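(* Let $d\ge 1$ and $c\ge 1$. There exists $\nu=\nu(c,d)>0$ such that for every probability measure $\mu_0$ on $[1/c,c]$, with $\mu=\mu_0^{\otimes(\mathbb Z^d)^*}$, the following hold. (i) For all $i,j\in\{1,\dots,d\}$ and all $N$ sufficiently large, $$\mu\Big(\big|D_N^{ij}(\xi)-\mathbb E_\mu D_N^{ij}(\xi)\big|>N^{-\nu}\Big)<e^{-N^{\nu}}.$$ (ii) $\displaystyle\lim_{N\to\infty}\mathbb E_\mu D_N(\xi)=D$ (convergence of $d\times d$ matrices).
   Context: $(\mathbb Z^d)^*$ is the set of nearest neighbour bonds of $\mathbb Z^d$; $e_1,\dots,e_d$ are the unit coordinate vectors. The environment space is $\Omega=[1/c,c]^{(\mathbb Z^d)^*}$, and for $\xi\in\Omega$ we write $\xi_i(x)$ for the value $\xi(b)$ at the bond $b=(x,x+e_i)$. The measure $\mu=\mu_0^{\otimes(\mathbb Z^d)^*}$ is the product measure on $\Omega$, and $\mathbb E_\mu$ its expectation. For fixed $\xi\in\Omega$, $X(t,\xi)$ is the continuous time nearest neighbour random walk on $\mathbb Z^d$ that jumps across each bond $b$ (in either direction) at rate $\xi(b)$, i.e. with generator $f\mapsto\sum_{i=1}^d\{\xi_i(x)[f(x+e_i)-f(x)]+\xi_i(x-e_i)[f(x-e_i)-f(x)]\}$. $\mathbb E_x^\xi$ is expectation for the walk started at $x$. The (infinite volume, annealed) effective diffusion matrix $D$ is the symmetric $d\times d$ matrix with $$(Dv,v)=\lim_{t\to\infty}\frac1t\,\mathbb E_\mu\mathbb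 E_0^\xi\big[(X(t,\xi),v)^2\big],\quad v\in\mathbb R^d.$$ It is well known that the limit exists and that $(Dv,v)=2\inf_{f\in L^2(\mu)}\sum_{i=1}^d\mathbb E_\mu\big[\xi_i(0)(v_i+f(\tau_{-e_i}\xi)-f(\xi))^2\big]$, where $(\tau_y\xi)_i(x)=\xi_i(x-y)$. For a positive integer $N$ let $T_N=\mathbb Z^d/2N\mathbb Z^d$, identified with $\{-N,\dots,N-1\}^d$, and let $\pi_N\xi$ be the periodized environment $(\pi_N\xi)_i(x)=\xi_i(\dot x)$, where $\dot x\in\{-N,\dots,N-1\}^d$ and $x-\dot x\in 2N\mathbb Z^d$. For every $\xi\in\Omega$ the finite volume effective diffusion matrix $D_N(\xi)=(D_N^{ij}(\xi))$ is the symmetric $d\times d$ matrix with $$(D_N(\xi)v,v)=\lim_{t\to\infty}\frac1t\,\mathbb E_0^{\pi_N\xi}\big[(X(t,\pi_N\xi),v)^2\big],\quad v\in\mathbb R^d.$$ The limit exists, and $(D_N(\xi)v,v)=2\inf_{f:T_N\to\mathbb R}\sum_{i=1}^d\frac1{|T_N|}\sum_{x\in T_N}(\pi_N\xi)_i(x)\,(v_i+f(x+e_i)-f(x))^2$, with addition on the torus. *)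

theory Defs
  imports "HOL-Probability.Probability"
begin

section \<open>Environments\<close>

text \<open>
  Sites of the lattice are vectors in \<open>int ^ 'd\<close>. The pair \<open>(x, i)\<close> stands for the unordered
  bond between \<open>x\<close> and \<open>x + unit_site i\<close>; every nearest neighbour bond has exactly one such name.
\<close>

type_synonym 'd site = "int ^ 'd"
type_synonym 'd env = "'d site \<times> 'd \<Rightarrow> real"

definition unit_site :: "'d::finite \<Rightarrow> 'd site" where
  "unit_site i = axis i 1"

text \<open>
  If \<open>sets \<mu>0 = sets (restrict_space borel {1/c..c})\<close>, then the space of this measure is
  the set of all environments with values in \<open>{1/c..c}\<close>.
\<close>

definition env_measure :: "real measure \<Rightarrow> 'd::finite env measure" where
  "env_measure \<mu>0 = (\<Pi>\<^sub>M b\<in>UNIV. \<mu>0)"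

text \<open>The representative of \<open>x\<close> modulo \<open>2N\<close> with coordinates in \<open>{-N..N-1}\<close> (for \<open>N > 0\<close>).\<close>

definition torus_rep :: "nat \<Rightarrow> 'd::finite site \<Rightarrow> 'd site" where
  "torus_rep N x = (\<chi> k. (x $ k + int N) mod (2 * int N) - int N)"

definition periodize :: "nat \<Rightarrow> 'd::finite env \<Rightarrow> 'd env" where
  "periodize N \<xi> = (\<lambda>(x, i). \<xi> (torus_rep N x, i))"

section \<open>The random walk in a fixed environment\<close>

text \<open>
  A direction \<open>(i, True)\<close> is \<open>+ unit_site i\<close> and \<open>(i, False)\<close> is \<open>- unit_site i\<close>.
\<close>

type_synonym 'd dir = "'d \<times> bool"

definition shift :: "'d::finite dir \<Rightarrow> 'd site" where
  "shift s = (if snd s then unit_site (fst s) else - unit_site (fst s))"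

definition rate :: "'d::finite env \<Rightarrow> 'd site \<Rightarrow> 'd dir \<Rightarrow> real" where
  "rate \<xi> x s = (if snd s then \<xi> (x, fst s) else \<xi> (x - unit_site (fst s), fst s))"

text \<open>
  The walk is constructed from independent standard exponential clocks, one for each step and each
  direction. At \<open>x\<close>, the clock \<open>w s\<close> of direction \<open>s\<close> rings after time \<open>w s / rate \<xi> x s\<close>,
  which is exponential with parameter \<open>rate \<xi> x s\<close>; the walk follows the first clock to ring and
  then starts afresh with the clocks of the next step. This is the continuous time Markov chain
  that crosses each adjacent bond \<open>b\<close> at rate \<open>\<xi> b\<close>. Ties have probability 0.
\<close>

type_synonym 'd clocks = "'d dir \<Rightarrow> real"

definition clocks_measure :: "'d::finite clocks measure" where
  "clocks_measure = (\<Pi>\<^sub>M s\<in>UNIV. density lborel (\<lambda>r. ennreal (exponential_density 1 r)))"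

definition walk_measure :: "'d::finite clocks stream measure" where
  "walk_measure = stream_space clocks_measure"

definition first_dir :: "'d::finite env \<Rightarrow> 'd site \<Rightarrow> 'd clocks \<Rightarrow> 'd dir" where
  "first_dir \<xi> x w = arg_min (\<lambda>s. w s / rate \<xi> x s) (\<lambda>_. True)"

definition holding_time :: "'d::finite env \<Rightarrow> 'd site \<Rightarrow> 'd clocks \<Rightarrow> real" where
  "holding_time \<xi> x w = Min (range (\<lambda>s. w s / rate \<xi> x s))"

text \<open>Position after the \<open>n\<close>-th jump and time of the \<open>n\<close>-th jump, for the walk started at \<open>x\<close>.\<close>

primrec jump_site :: "'d::finite env \<Rightarrow> nat \<Rightarrow> 'd site \<Rightarrow> 'd clocks stream \<Rightarrow> 'd site" where
  "jump_site \<xi> 0 x \<omega> = x"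
| "jump_site \<xi> (Suc n) x \<omega> = jump_site \<xi> n (x + shift (first_dir \<xi> x (shd \<omega>))) (stl \<omega>)"

primrec jump_time :: "'d::finite env \<Rightarrow> nat \<Rightarrow> 'd site \<Rightarrow> 'd clocks stream \<Rightarrow> real" where
  "jump_time \<xi> 0 x \<omega> = 0"
| "jump_time \<xi> (Suc n) x \<omega> = holding_time \<xi> x (shd \<omega>)
     + jump_time \<xi> n (x + shift (first_dir \<xi> x (shd \<omega>))) (stl \<omega>)"

text \<open>
  \<open>LEAST n. t < jump_time \<xi> (Suc n) x \<omega>\<close> is the number of jumps up to time \<open>t\<close>; it exists
  almost surely because the rates are bounded.
\<close>

definition walk :: "'d::finite env \<Rightarrow> 'd site \<Rightarrow> real \<Rightarrow> 'd clocks stream \<Rightarrow> 'd site" where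
  "walk \<xi> x t \<omega> = jump_site \<xi> (LEAST n. t < jump_time \<xi> (Suc n) x \<omega>) x \<omega>"

section \<open>Effective diffusion matrices\<close>

definition real_vec :: "'d::finite site \<Rightarrow> real ^ 'd" where
  "real_vec x = (\<chi> k. real_of_int (x $ k))"

definition mean_square :: "'d::finite env \<Rightarrow> real \<Rightarrow> real ^ 'd \<Rightarrow> real" where
  "mean_square \<xi> t v = (\<integral>\<omega>. (real_vec (walk \<xi> 0 t \<omega>) \<bullet> v)\<^sup>2 \<partial>walk_measure)"

text \<open>
  The symmetric matrix whose quadratic form is the limit of \<open>q t v / t\<close>. A symmetric matrix is
  determined by its quadratic form, so this is well defined whenever the limit exists for all \<open>v\<close>
  and is a quadratic form in \<open>v\<close>.
\<close>

definition diffusion_matrix :: "(real \<Rightarrow> real ^ 'd \<Rightarrow> real) \<Rightarrow> real ^ 'd ^ 'd::finite" where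
  "diffusion_matrix q = (THE A. transpose A = A \<and>
     (\<forall>v. ((\<lambda>t. 1 / t * q t v) \<longlongrightarrow> (A *v v) \<bullet> v) at_top))"

definition eff_diffusion :: "'d::finite env measure \<Rightarrow> real ^ 'd ^ 'd" where
  "eff_diffusion \<mu> = diffusion_matrix (\<lambda>t v. \<integral>\<xi>. mean_square \<xi> t v \<partial>\<mu>)"

definition eff_diffusion_fin :: "nat \<Rightarrow> 'd::finite env \<Rightarrow> real ^ 'd ^ 'd" where
  "eff_diffusion_fin N \<xi> = diffusion_matrix (mean_square (periodize N \<xi>))"

end

theory Submission
  imports Defs
begin

text \<open>
  Write \<open>\<phi>\<close> for the periodic corrector of \<open>\<xi>\<close> on the torus and \<open>w = v + \<nabla>\<phi>\<close>; the quadratic form of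
  \<open>D\<^sub>N(\<xi>)\<close> is twice the mean over the torus of \<open>\<xi> w\<^sup>2\<close>.

  Changing one conductance \<open>b\<close> changes this form by at most a constant times \<open>w(b)\<^sup>2 / |T\<^sub>N|\<close>. The sum
  over \<open>b\<close> of these oscillations is bounded, and the hole filling technique shows, uniformly in the
  environment, that each of them is at most of order \<open>N\<^sup>-\<^sup>\<alpha>\<close>. The Efron--Stein inequality, applied to
  exponentials and iterated, turns this into an exponential tail.

  The same bound on \<open>w\<close>, together with Efron--Stein for block averages of \<open>\<phi>\<close> and stationarity, shows
  that the mean square of \<open>\<phi>\<close> is \<open>o(N\<^sup>2)\<close>. Let \<open>b\<^sub>n\<close> be the annealed mean square displacement after \<open>n\<close>
  steps of the lazy chain \<open>1 + gen / l\<close>, by which the walk is uniformised. For \<open>N > n\<close> periodisation is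
  not seen in \<open>n\<close> steps, and reversibility gives \<open>E D\<^sub>N \<le> l b\<^sub>n / n\<close>. Conversely, cutting \<open>\<phi>\<close> off near
  the boundary of a box of side \<open>2 N\<close> and gluing independent copies gives a trial function on larger
  tori, so that \<open>l b\<^sub>n / n \<le> E D\<^sub>N + o(1)\<close> as first \<open>n\<close> and then \<open>N\<close> tend to infinity.
\<close>

section \<open>Variance and exponential tails of functions of independent variables\<close>

section \<open>The Efron--Stein inequality\<close>

text \<open>The existence of both limits has to be shown as well: \<open>diffusion_matrix\<close> is
  a definite description, known only once its limit has been found and recognised as a quadratic
  form. Every variational object lives on a finite torus, so no infinite volume corrector, ergodic
  theorem or invariance principle is invoked. The rate \<open>l\<close> is at least 4 d c, twice
  what makes the lazy chain stochastic: its operator is then positive semidefinite, drift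
  autocorrelations are nonnegative, and dropping them bounds mean squares by the energy of a trial
  function at every finite time. The corrector is the Neumann series \<open>green\<close>, which
  makes measurability, linearity and shift covariance immediate. In the tail bound the largest
  oscillation is of order \<open>N powr (- \<alpha>)\<close> while the sum of oscillations stays
  bounded, so exponential moments of order \<open>N powr (\<alpha> / 2)\<close> are controlled; with
  \<nu> = \<alpha> / 8 the deviation \<open>N powr (- \<nu>)\<close> has an exponent of order
  \<open>N powr (3 * \<nu>)\<close>, which beats the target.\<close>

locale iid = prob_space M for M :: "'a measure"
begin

abbreviation PM :: "('i \<Rightarrow> 'a) measure" where "PM \<equiv> \<Pi>\<^sub>M i\<in>UNIV. M"

lemma prob_space_PM: "prob_space PM"
  by (intro prob_space_PiM prob_space_axioms)

lemma upd_measurable: "(\<lambda>p. (fst p)(b := snd p)) \<in> measurable (PM \<Otimes>\<^sub>M M) PM" for b :: 'i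
  using measurable_add_dim[of b UNIV "\<lambda>_. M"] by (simp add: case_prod_beta)

lemma upd_space: "w \<in> space PM \<Longrightarrow> t \<in> space M \<Longrightarrow> w(b := t) \<in> space PM" for b :: 'i
  by (auto simp: space_PiM PiE_def Pi_def)

text \<open>Independent resampling of one coordinate preserves the product measure; all properties
  of \<open>avg\<close> rest on this. The index set is all of \<open>UNIV\<close>, so inserting
  \<open>b\<close> into it changes nothing.\<close>

lemma distr_upd: "distr (PM \<Otimes>\<^sub>M M) PM (\<lambda>p. (fst p)(b := snd p)) = PM" for b :: 'i
proof -
  interpret P: prob_space "PM :: ('i \<Rightarrow> 'a) measure" by (rule prob_space_PM)
  interpret pair_sigma_finite "PM :: ('i \<Rightarrow> 'a) measure" M
    by (simp add: pair_sigma_finite_def P.sigma_finite_measure_axioms sigma_finite_measure_axioms)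
  have "distr (M \<Otimes>\<^sub>M PM) PM (\<lambda>(x, X). X(b := x)) = PM"
    using distr_pair_PiM_eq_PiM[of UNIV "\<lambda>_. M" b] prob_space_axioms by simp
  moreover have "distr (M \<Otimes>\<^sub>M PM) PM (\<lambda>(x, X). X(b := x)) = distr (PM \<Otimes>\<^sub>M M) PM (\<lambda>p. (fst p)(b := snd p))"
  proof -
    have m: "(\<lambda>(x, X). X(b := x)) \<in> measurable (M \<Otimes>\<^sub>M PM) PM"
      using measurable_compose[OF measurable_pair_swap' upd_measurable[of b]] by (simp add: case_prod_beta)
    show ?thesis
      by (subst distr_pair_swap) (simp add: distr_distr[OF upd_measurable measurable_pair_swap'] comp_def case_prod_beta, simp add: case_prod_unfold)
  qed
  ultimately show ?thesis by simp
qed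

text \<open>Boundedness is asked for on the space only, where conductances are elliptic. The class
  is closed under algebra, continuous functions and averaging, so that integrability below reduces
  to membership.\<close>

definition bdd :: "(('i \<Rightarrow> 'a) \<Rightarrow> real) \<Rightarrow> bool" where
  "bdd f \<longleftrightarrow> f \<in> borel_measurable PM \<and> (\<exists>B. \<forall>w\<in>space PM. \<bar>f w\<bar> \<le> B)"

lemma bddD [measurable_dest]: "bdd f \<Longrightarrow> f \<in> borel_measurable PM"
  by (simp add: bdd_def)

lemma bdd_integrable: assumes "bdd f" shows "integrable PM f"
proof -
  interpret P: prob_space "PM :: ('b \<Rightarrow> 'a) measure" by (rule prob_space_PM)
  obtain B where B: "\<forall>w\<in>space PM. \<bar>f w\<bar> \<le> B" using assms by (auto simp: bdd_def)
  show ?thesis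
    by (rule P.integrable_const_bound[of _ B]) (use B assms in \<open>auto simp: bdd_def\<close>)
qed

lemma bdd_add: assumes "bdd f" "bdd g" shows "bdd (\<lambda>w. f w + g w)"
proof -
  obtain A B where "\<forall>w\<in>space PM. \<bar>f w\<bar> \<le> A" "\<forall>w\<in>space PM. \<bar>g w\<bar> \<le> B" using assms by (auto simp: bdd_def)
  then have "\<forall>w\<in>space PM. \<bar>f w + g w\<bar> \<le> A + B" by (meson abs_triangle_ineq add_mono order_trans)
  then show ?thesis using assms by (auto simp: bdd_def)
qed

lemma bdd_const: "bdd (\<lambda>w. a)"
  by (auto simp: bdd_def)

lemma bdd_mult: assumes "bdd f" "bdd g" shows "bdd (\<lambda>w. f w * g w)"
proof -
  obtain A B where A: "\<forall>w\<in>space PM. \<bar>f w\<bar> \<le> A" and B: "\<forall>w\<in>space PM. \<bar>g w\<bar> \<le> B" using assms by (auto simp: bdd_def)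
  have "\<bar>f w * g w\<bar> \<le> A * B" if "w \<in> space PM" for w
    unfolding abs_mult using A B that by (intro mult_mono) (auto intro: order_trans[OF abs_ge_zero])
  then show ?thesis using assms by (auto simp: bdd_def)
qed

lemma bdd_diff: "bdd f \<Longrightarrow> bdd g \<Longrightarrow> bdd (\<lambda>w. f w - g w)"
  using bdd_add[of f "\<lambda>w. (-1) * g w"] bdd_mult[OF bdd_const[of "-1"], of g] by simp

lemma bdd_sum: "(\<And>i. i \<in> I \<Longrightarrow> bdd (f i)) \<Longrightarrow> bdd (\<lambda>w. \<Sum>i\<in>I. f i w)"
  by (induction I rule: infinite_finite_induct) (auto intro: bdd_const bdd_add)

lemma bdd_compose:
  assumes "bdd f" "continuous_on UNIV h" shows "bdd (\<lambda>w. h (f w) :: real)"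
proof -
  obtain B where B: "\<forall>w\<in>space PM. \<bar>f w\<bar> \<le> B" using assms by (auto simp: bdd_def)
  have "compact (h ` {-B..B})"
    using assms(2) by (intro compact_continuous_image) (auto intro: continuous_on_subset)
  then have "bounded (h ` {-B..B})" by (rule compact_imp_bounded)
  then obtain C where "\<forall>x\<in>{-B..B}. \<bar>h x\<bar> \<le> C" by (auto simp: bounded_iff)
  then have "\<forall>w\<in>space PM. \<bar>h (f w)\<bar> \<le> C" using B by (auto simp: abs_le_iff minus_le_iff)
  moreover have "(\<lambda>w. h (f w)) \<in> borel_measurable PM"
    using assms by (intro measurable_compose[OF bddD borel_measurable_continuous_onI])
  ultimately show ?thesis by (auto simp: bdd_def)
qed

lemma bdd_power: "bdd f \<Longrightarrow> bdd (\<lambda>w. f w ^ n)"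
  by (rule bdd_compose[where h = "\<lambda>x. x ^ n"]) (auto intro!: continuous_intros)

text \<open>The conditional expectation of \<open>f\<close> given all coordinates other than
  \<open>b\<close>.\<close>

definition avg :: "'i \<Rightarrow> (('i \<Rightarrow> 'a) \<Rightarrow> real) \<Rightarrow> ('i \<Rightarrow> 'a) \<Rightarrow> real" where
  "avg b f w = (\<integral>t. f (w(b := t)) \<partial>M)"

lemma pair_bounded_integrable:
  fixes h :: "('i \<Rightarrow> 'a) \<times> 'b \<Rightarrow> real"
  assumes "prob_space N" "h \<in> borel_measurable (PM \<Otimes>\<^sub>M N)" "\<And>w t. w \<in> space PM \<Longrightarrow> t \<in> space N \<Longrightarrow> \<bar>h (w, t)\<bar> \<le> B"
  shows "integrable (PM \<Otimes>\<^sub>M N) h"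
proof -
  interpret PP: prob_space "PM :: ('i \<Rightarrow> 'a) measure" by (rule prob_space_PM)
  interpret N: prob_space N by fact
  interpret Q: pair_prob_space "PM :: ('i \<Rightarrow> 'a) measure" N ..
  show ?thesis
    by (rule Q.P.integrable_const_bound[of _ B]) (use assms in \<open>auto simp: space_pair_measure\<close>)
qed

lemma avg_pair:
  assumes "bdd f"
  shows "integrable (PM \<Otimes>\<^sub>M M) (\<lambda>p. f ((fst p)(b := snd p)))"
proof -
  obtain B where B: "\<forall>w\<in>space PM. \<bar>f w\<bar> \<le> B" using assms by (auto simp: bdd_def)
  show ?thesis
    using B by (intro pair_bounded_integrable[of M _ B] prob_space_axioms measurable_compose[OF upd_measurable bddD[OF assms]])
      (auto intro: upd_space)
qed

lemma avg_bdd: assumes "bdd f" shows "bdd (avg b f)"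
proof -
  obtain B where B: "\<forall>w\<in>space PM. \<bar>f w\<bar> \<le> B" using assms by (auto simp: bdd_def)
  have "\<bar>avg b f w\<bar> \<le> B" if w: "w \<in> space PM" for w
  proof -
    have B0: "0 \<le> B" using B w by (meson abs_ge_zero order_trans)
    have "\<bar>avg b f w\<bar> \<le> (\<integral>t. \<bar>f (w(b := t))\<bar> \<partial>M)" unfolding avg_def by (rule integral_abs_bound)
    also have "\<dots> \<le> (\<integral>t. B \<partial>M)"
    proof (rule integral_mono_AE')
      show "AE t in M. \<bar>f (w(b := t))\<bar> \<le> B" using B upd_space[OF w] by (intro AE_I2) auto
    qed (use B0 B upd_space[OF w] in auto)
    also have "\<dots> = B" by (simp add: prob_space)
    finally show ?thesis .
  qed
  moreover have "avg b f \<in> borel_measurable PM"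
    unfolding avg_def[abs_def]
    using borel_measurable_lebesgue_integral[of "\<lambda>w t. f (w(b := t))" PM] measurable_compose[OF upd_measurable bddD[OF assms], of b]
    by (simp add: case_prod_beta)
  ultimately show ?thesis by (auto simp: bdd_def)
qed

lemma integral_avg:
  assumes "bdd f" shows "(\<integral>w. avg b f w \<partial>PM) = (\<integral>w. f w \<partial>PM)"
proof -
  interpret P: prob_space "PM :: ('b \<Rightarrow> 'a) measure" by (rule prob_space_PM)
  interpret pair_sigma_finite "PM :: ('b \<Rightarrow> 'a) measure" M
    by (simp add: pair_sigma_finite_def P.sigma_finite_measure_axioms sigma_finite_measure_axioms)
  have "(\<integral>w. f w \<partial>PM) = (\<integral>w. f w \<partial>distr (PM \<Otimes>\<^sub>M M) PM (\<lambda>p. (fst p)(b := snd p)))"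
    by (simp only: distr_upd)
  also have "\<dots> = (\<integral>p. f ((fst p)(b := snd p)) \<partial>(PM \<Otimes>\<^sub>M M))"
    by (rule integral_distr[OF upd_measurable bddD[OF assms]])
  also have "\<dots> = (\<integral>w. avg b f w \<partial>PM)"
    using integral_fst'[OF avg_pair[OF assms, of b]] by (simp add: avg_def)
  finally show ?thesis ..
qed

lemma fiber_integrable:
  assumes "bdd f" "w \<in> space PM" shows "integrable M (\<lambda>t. f (w(b := t)))"
proof -
  obtain B where B: "\<forall>w\<in>space PM. \<bar>f w\<bar> \<le> B" using assms by (auto simp: bdd_def)
  have "(\<lambda>t. (w, t)) \<in> measurable M (PM \<Otimes>\<^sub>M M)" using assms(2) by simp
  from measurable_compose[OF this measurable_compose[OF upd_measurable bddD[OF assms(1)]], of b]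
  have "(\<lambda>t. f (w(b := t))) \<in> borel_measurable M" by simp
  then show ?thesis using B upd_space[OF assms(2)] by (intro integrable_const_bound[of _ B]) auto
qed

text \<open>Twice the expected conditional variance given the coordinates other than
  \<open>b\<close>, written by means of an independent resample.\<close>

definition local_var :: "'i \<Rightarrow> (('i \<Rightarrow> 'a) \<Rightarrow> real) \<Rightarrow> real" where
  "local_var b f = (\<integral>w. (\<integral>t. (f w - f (w(b := t)))\<^sup>2 \<partial>M) \<partial>PM)"

lemma avg_square_diff:
  assumes "bdd f" "w \<in> space PM"
  shows "(\<integral>t. (f w - f (w(b := t)))\<^sup>2 \<partial>M) = (f w)\<^sup>2 - 2 * (f w * avg b f w) + avg b (\<lambda>w. (f w)\<^sup>2) w"
proof -
  have "(\<integral>t. (f w - f (w(b := t)))\<^sup>2 \<partial>M)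
    = (\<integral>t. (f w)\<^sup>2 - 2 * f w * f (w(b := t)) + (f (w(b := t)))\<^sup>2 \<partial>M)"
    by (intro Bochner_Integration.integral_cong refl) (simp add: power2_eq_square algebra_simps)
  also have "\<dots> = (\<integral>t. (f w)\<^sup>2 - 2 * f w * f (w(b := t)) \<partial>M) + (\<integral>t. (f (w(b := t)))\<^sup>2 \<partial>M)"
    using fiber_integrable[OF assms] fiber_integrable[OF bdd_power[OF assms(1), of 2] assms(2)]
    by (intro Bochner_Integration.integral_add) auto
  also have "(\<integral>t. (f w)\<^sup>2 - 2 * f w * f (w(b := t)) \<partial>M) = (f w)\<^sup>2 - 2 * (f w * avg b f w)"
    using fiber_integrable[OF assms] by (subst Bochner_Integration.integral_diff) (auto simp: avg_def prob_space)
  finally show ?thesis unfolding avg_def .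
qed

text \<open>\<open>avg b\<close> is an orthogonal projection: it commutes with multiplication by
  functions that do not see coordinate \<open>b\<close>, so the mean of \<open>f * avg b f\<close>
  is that of the square of \<open>avg b f\<close>.\<close>

lemma local_var_eq:
  assumes "bdd f"
  shows "local_var b f = 2 * ((\<integral>w. (f w)\<^sup>2 \<partial>PM) - (\<integral>w. (avg b f w)\<^sup>2 \<partial>PM))"
proof -
  have "local_var b f = (\<integral>w. (f w)\<^sup>2 - 2 * (f w * avg b f w) + avg b (\<lambda>w. (f w)\<^sup>2) w \<partial>PM)"
    unfolding local_var_def by (intro Bochner_Integration.integral_cong refl avg_square_diff assms)
  also have "\<dots> = (\<integral>w. (f w)\<^sup>2 \<partial>PM) - 2 * (\<integral>w. f w * avg b f w \<partial>PM) + (\<integral>w. avg b (\<lambda>w. (f w)\<^sup>2) w \<partial>PM)"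
    using bdd_integrable[OF bdd_power[OF assms, of 2]] bdd_integrable[OF bdd_mult[OF assms avg_bdd[OF assms, of b]]]
      bdd_integrable[OF avg_bdd[OF bdd_power[OF assms, of 2], of b]]
    by simp
  also have "(\<integral>w. avg b (\<lambda>w. (f w)\<^sup>2) w \<partial>PM) = (\<integral>w. (f w)\<^sup>2 \<partial>PM)"
    by (rule integral_avg[OF bdd_power[OF assms]])
  also have "(\<integral>w. f w * avg b f w \<partial>PM) = (\<integral>w. (avg b f w)\<^sup>2 \<partial>PM)"
    using integral_avg[OF bdd_mult[OF assms avg_bdd[OF assms, of b]], of b]
    by (simp add: avg_def power2_eq_square)
  finally show ?thesis by simp
qed

lemma jensen_square:
  fixes g :: "'a \<Rightarrow> real"
  assumes "integrable M g" "integrable M (\<lambda>t. (g t)\<^sup>2)"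
  shows "(\<integral>t. g t \<partial>M)\<^sup>2 \<le> (\<integral>t. (g t)\<^sup>2 \<partial>M)"
  using variance_eq[OF assms] variance_positive[of g] by simp

text \<open>Averaging over \<open>b\<close> and resampling \<open>b'\<close> commute for distinct
  coordinates. Jensen's inequality for the average over \<open>b\<close>, followed by Fubini, leaves
  \<open>avg b\<close> of the local variance, whose mean is unchanged.\<close>

lemma local_var_avg_le:
  fixes f :: "('i \<Rightarrow> 'a) \<Rightarrow> real"
  assumes "bdd f" "b \<noteq> b'"
  shows "local_var b' (avg b f) \<le> local_var b' f"
proof -
  interpret PP: prob_space "PM :: ('i \<Rightarrow> 'a) measure" by (rule prob_space_PM)
  interpret MM: pair_sigma_finite M M
    by (simp add: pair_sigma_finite_def sigma_finite_measure_axioms)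
  obtain B where B: "\<forall>w\<in>space PM. \<bar>f w\<bar> \<le> B" using assms by (auto simp: bdd_def)
  define h where "h w = (\<integral>s. (f w - f (w(b' := s)))\<^sup>2 \<partial>M)" for w
  have h_eq: "h w = (f w)\<^sup>2 - 2 * (f w * avg b' f w) + avg b' (\<lambda>w. (f w)\<^sup>2) w" if "w \<in> space PM" for w
    unfolding h_def by (rule avg_square_diff[OF assms(1) that])
  have "bdd (\<lambda>w. (f w)\<^sup>2 - 2 * (f w * avg b' f w) + avg b' (\<lambda>w. (f w)\<^sup>2) w)"
    by (intro bdd_add bdd_diff bdd_mult bdd_const avg_bdd bdd_power assms)
  then have h: "bdd h"
    unfolding bdd_def using h_eq by (subst measurable_cong[of PM h]) auto
  have "local_var b' (avg b f) \<le> (\<integral>w. avg b h w \<partial>PM)"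
    unfolding local_var_def
  proof (rule integral_mono_AE')
    show "integrable PM (avg b h)" by (intro bdd_integrable avg_bdd h)
    show "AE w in PM. (\<integral>s. (avg b f w - avg b f (w(b' := s)))\<^sup>2 \<partial>M) \<le> avg b h w"
    proof (rule AE_I2)
      fix w :: "'i \<Rightarrow> 'a" assume w: "w \<in> space PM"
      define k where "k s t = (f (w(b := t)) - f (w(b := t, b' := s)))\<^sup>2" for s t
      have kb: "\<bar>k s t\<bar> \<le> (2 * B)\<^sup>2" if "s \<in> space M" "t \<in> space M" for s t
      proof -
        have "\<bar>f (w(b := t)) - f (w(b := t, b' := s))\<bar> \<le> 2 * B"
          using B upd_space[OF w that(2), of b] upd_space[OF upd_space[OF w that(2), of b] that(1), of b']
          by (smt (verit) abs_triangle_ineq4)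
        then have "\<bar>f (w(b := t)) - f (w(b := t, b' := s))\<bar>\<^sup>2 \<le> (2 * B)\<^sup>2" by (intro power_mono) auto
        then show ?thesis by (simp add: k_def)
      qed
      have m1: "(\<lambda>p. f (w(b := snd p))) \<in> borel_measurable (M \<Otimes>\<^sub>M M)"
        using borel_measurable_integrable[OF fiber_integrable[OF assms(1) w, of b]] by simp
      have m2: "(\<lambda>p. f (w(b := snd p, b' := fst p))) \<in> borel_measurable (M \<Otimes>\<^sub>M M)"
      proof -
        have "(\<lambda>t. (w, t)) \<in> measurable M (PM \<Otimes>\<^sub>M M)" using w by simp
        from measurable_compose[OF this upd_measurable[of b]] have "(\<lambda>t. w(b := t)) \<in> measurable M PM" by simp
        from measurable_Pair[OF measurable_compose[OF measurable_snd this] measurable_fst]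
        have "(\<lambda>p. (w(b := snd p), fst p)) \<in> measurable (M \<Otimes>\<^sub>M M) (PM \<Otimes>\<^sub>M M)" .
        from measurable_compose[OF this measurable_compose[OF upd_measurable[of b'] bddD[OF assms(1)]]]
        show ?thesis by simp
      qed
      have km: "case_prod k \<in> borel_measurable (M \<Otimes>\<^sub>M M)"
        unfolding k_def case_prod_beta using m1 m2 by measurable
      have ki: "integrable (M \<Otimes>\<^sub>M M) (case_prod k)"
      proof -
        interpret MP: pair_prob_space M M ..
        show ?thesis
          by (rule MP.P.integrable_const_bound[of _ "(2 * B)\<^sup>2"]) (use kb km in \<open>auto simp: space_pair_measure\<close>)
      qed
      have diff: "avg b f w - avg b f (w(b' := s)) = (\<integral>t. f (w(b := t)) - f (w(b := t, b' := s)) \<partial>M)"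
        if "s \<in> space M" for s
      proof -
        have "(w(b' := s))(b := t) = w(b := t, b' := s)" for t by (rule fun_upd_twist) (use assms(2) in simp)
        then show ?thesis unfolding avg_def
          using fiber_integrable[OF assms(1) w, of b] fiber_integrable[OF assms(1) upd_space[OF w that, of b'], of b]
          by (subst Bochner_Integration.integral_diff) auto
      qed
      have "(\<integral>s. (avg b f w - avg b f (w(b' := s)))\<^sup>2 \<partial>M) \<le> (\<integral>s. (\<integral>t. k s t \<partial>M) \<partial>M)"
      proof (rule integral_mono_AE')
        show "integrable M (\<lambda>s. \<integral>t. k s t \<partial>M)" using MM.integrable_fst'[OF ki] by simp
        show "AE s in M. (avg b f w - avg b f (w(b' := s)))\<^sup>2 \<le> (\<integral>t. k s t \<partial>M)"
        proof (rule AE_I2)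
          fix s assume s: "s \<in> space M"
          have i1: "integrable M (\<lambda>t. f (w(b := t)) - f (w(b := t, b' := s)))"
          proof -
            have "(w(b' := s))(b := t) = w(b := t, b' := s)" for t by (rule fun_upd_twist) (use assms(2) in simp)
            then show ?thesis
              using fiber_integrable[OF assms(1) w, of b] fiber_integrable[OF assms(1) upd_space[OF w s, of b'], of b]
              by (intro Bochner_Integration.integrable_diff) auto
          qed
          have i2: "integrable M (\<lambda>t. (f (w(b := t)) - f (w(b := t, b' := s)))\<^sup>2)"
            using kb[OF s] i1 by (intro integrable_const_bound[of _ "(2 * B)\<^sup>2"])
              (auto simp: k_def intro!: borel_measurable_power borel_measurable_integrable)
          show "(avg b f w - avg b f (w(b' := s)))\<^sup>2 \<le> (\<integral>t. k s t \<partial>M)"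
            unfolding diff[OF s] k_def by (rule jensen_square[OF i1 i2])
        qed
        show "AE s in M. 0 \<le> (\<integral>t. k s t \<partial>M)" by (intro AE_I2 integral_nonneg_AE) (auto simp: k_def)
      qed
      also have "\<dots> = (\<integral>t. (\<integral>s. k s t \<partial>M) \<partial>M)" by (rule MM.Fubini_integral[OF ki, symmetric])
      also have "\<dots> = avg b h w" by (simp add: avg_def h_def k_def)
      finally show "(\<integral>s. (avg b f w - avg b f (w(b' := s)))\<^sup>2 \<partial>M) \<le> avg b h w" .
    qed
    show "AE w in PM. 0 \<le> avg b h w"
      by (intro AE_I2) (auto simp: avg_def h_def intro!: integral_nonneg_AE)
  qed
  also have "\<dots> = local_var b' f" by (simp only: integral_avg[OF h]) (simp add: local_var_def h_def)
  finally show ?thesis .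
qed

definition depends :: "'i set \<Rightarrow> (('i \<Rightarrow> 'a) \<Rightarrow> real) \<Rightarrow> bool" where
  "depends I f \<longleftrightarrow> (\<forall>w\<in>space PM. \<forall>w'\<in>space PM. (\<forall>i\<in>I. w i = w' i) \<longrightarrow> f w = f w')"

text \<open>Coordinates are integrated out one at a time. Passing from \<open>f\<close> to
  \<open>avg b f\<close> lowers the second moment by exactly half of \<open>local_var b f\<close>,
  and does not increase the local variances still to come. The product is infinite, but the
  induction runs over the finite set on which \<open>f\<close> depends.\<close>

theorem efron_stein:
  assumes "finite I" "bdd f" "depends I f"
  shows "(\<integral>w. (f w)\<^sup>2 \<partial>PM) - (\<integral>w. f w \<partial>PM)\<^sup>2 \<le> (\<Sum>b\<in>I. local_var b f) / 2"
  using assms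
proof (induction I arbitrary: f rule: finite_induct)
  case empty
  interpret P: prob_space "PM :: ('b \<Rightarrow> 'a) measure" by (rule prob_space_PM)
  obtain w0 where w0: "w0 \<in> space (PM :: ('b \<Rightarrow> 'a) measure)" using P.not_empty by blast
  have eq: "f w = f w0" if "w \<in> space PM" for w using empty(2)[unfolded depends_def, rule_format, OF that w0] by simp
  have "(\<integral>w. f w \<partial>PM) = (\<integral>w. f w0 \<partial>(PM :: ('b \<Rightarrow> 'a) measure))"
    by (rule Bochner_Integration.integral_cong[OF refl]) (rule eq)
  moreover have "(\<integral>w. (f w)\<^sup>2 \<partial>PM) = (\<integral>w. (f w0)\<^sup>2 \<partial>(PM :: ('b \<Rightarrow> 'a) measure))"
    by (rule Bochner_Integration.integral_cong[OF refl]) (simp only: eq)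
  ultimately show ?case by (simp add: P.prob_space)
next
  case (insert b I)
  have dep: "depends I (avg b f)"
    unfolding depends_def
  proof (intro ballI impI)
    fix w w' assume *: "w \<in> space PM" "w' \<in> space PM" "\<forall>i\<in>I. w i = w' i"
    have "f (w(b := t)) = f (w'(b := t))" if "t \<in> space M" for t
      using insert.prems(2) upd_space[OF *(1) that, of b] upd_space[OF *(2) that, of b] *(3)
      unfolding depends_def by (metis (no_types, lifting) fun_upd_apply insert_iff)
    then show "avg b f w = avg b f w'" unfolding avg_def by (intro Bochner_Integration.integral_cong) auto
  qed
  have "(\<integral>w. (avg b f w)\<^sup>2 \<partial>PM) - (\<integral>w. avg b f w \<partial>PM)\<^sup>2 \<le> (\<Sum>b'\<in>I. local_var b' (avg b f)) / 2"
    by (intro insert.IH avg_bdd insert.prems dep)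
  also have "(\<Sum>b'\<in>I. local_var b' (avg b f)) \<le> (\<Sum>b'\<in>I. local_var b' f)"
    using insert.hyps insert.prems by (intro sum_mono local_var_avg_le) auto
  finally show ?case
    using insert.hyps by (simp add: integral_avg[OF insert.prems(1)] local_var_eq[OF insert.prems(1), of b])
qed

text \<open>The sum over coordinates stays inside the expectation, so that it may be bounded
  configuration by configuration, where total energy estimates apply.\<close>

corollary efron_stein_le:
  fixes f B :: "('i \<Rightarrow> 'a) \<Rightarrow> real"
  assumes I: "finite I" and f: "bdd f" and dep: "depends I f" and B: "bdd B"
    and le: "\<And>w. w \<in> space PM \<Longrightarrow> (\<Sum>b\<in>I. \<integral>t. (f w - f (w(b := t)))\<^sup>2 \<partial>M) \<le> B w"
  shows "(\<integral>w. (f w)\<^sup>2 \<partial>PM) - (\<integral>w. f w \<partial>PM)\<^sup>2 \<le> (\<integral>w. B w \<partial>PM) / 2"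
proof -
  have int: "integrable PM (\<lambda>w. \<integral>t. (f w - f (w(b := t)))\<^sup>2 \<partial>M)" for b
  proof -
    have "bdd (\<lambda>w. (f w)\<^sup>2 - 2 * (f w * avg b f w) + avg b (\<lambda>w. (f w)\<^sup>2) w)"
      by (intro bdd_add bdd_diff bdd_mult bdd_const avg_bdd bdd_power f)
    from bdd_integrable[OF this] show ?thesis
      by (subst Bochner_Integration.integrable_cong[OF refl avg_square_diff[OF f]])
  qed
  have "(\<Sum>b\<in>I. local_var b f) = (\<integral>w. (\<Sum>b\<in>I. \<integral>t. (f w - f (w(b := t)))\<^sup>2 \<partial>M) \<partial>PM)"
    unfolding local_var_def by (rule Bochner_Integration.integral_sum[symmetric]) (rule int)
  also have "\<dots> \<le> (\<integral>w. B w \<partial>PM)"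
    by (intro integral_mono Bochner_Integration.integrable_sum int bdd_integrable B le)
  finally show ?thesis using efron_stein[OF I f dep] by linarith
qed

section \<open>Exponential concentration from the Efron--Stein inequality\<close>

lemma exp_diff_square_le: "(exp x - exp y)\<^sup>2 \<le> (x - y)\<^sup>2 * exp (2 * x + 2 * \<bar>x - y\<bar>)" for x y :: real
proof -
  have e: "\<bar>exp z - 1\<bar> \<le> \<bar>z\<bar> * exp \<bar>z\<bar>" for z :: real
  proof (cases "z \<ge> 0")
    case True
    have "1 - z \<le> exp (- z)" using exp_ge_add_one_self[of "- z"] by simp
    from mult_right_mono[OF this, of "exp z"] have "(1 - z) * exp z \<le> 1" by (simp flip: exp_add)
    then show ?thesis using True by (simp add: algebra_simps)
  next
    case False
    have "1 + z \<le> exp z" by (rule exp_ge_add_one_self)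
    then have "1 - exp z \<le> \<bar>z\<bar>" by linarith
    then have "\<bar>exp z - 1\<bar> \<le> \<bar>z\<bar>" using False by simp
    also have "\<dots> \<le> \<bar>z\<bar> * exp \<bar>z\<bar>" using mult_left_mono[of 1 "exp \<bar>z\<bar>" "\<bar>z\<bar>"] by simp
    finally show ?thesis .
  qed
  have "\<bar>exp x - exp y\<bar> = exp x * \<bar>exp (y - x) - 1\<bar>"
    by (simp add: abs_mult[symmetric, of "exp x", simplified] exp_diff right_diff_distrib abs_minus_commute)
  also have "\<dots> \<le> exp x * (\<bar>y - x\<bar> * exp \<bar>y - x\<bar>)" by (intro mult_left_mono e) auto
  finally have "\<bar>exp x - exp y\<bar>\<^sup>2 \<le> (exp x * (\<bar>y - x\<bar> * exp \<bar>y - x\<bar>))\<^sup>2" by (intro power_mono) auto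
  also have "\<dots> = (x - y)\<^sup>2 * ((exp x)\<^sup>2 * (exp \<bar>x - y\<bar>)\<^sup>2)"
    by (simp add: power_mult_distrib power2_commute abs_minus_commute)
  also have "(exp x)\<^sup>2 * (exp \<bar>x - y\<bar>)\<^sup>2 = exp (2 * x + 2 * \<bar>x - y\<bar>)"
    by (simp add: exp_add exp_double)
  finally show ?thesis by simp
qed

lemma exp_le_quadratic: "\<bar>y\<bar> \<le> 1 \<Longrightarrow> exp y \<le> 1 + y + y\<^sup>2" for y :: real
proof (cases "y \<ge> 0")
  case False
  assume "\<bar>y\<bar> \<le> 1"
  have "1 - y \<le> exp (- y)" using exp_ge_add_one_self[of "- y"] by simp
  then have "exp y * (1 - y) \<le> 1" using mult_left_mono[of "1 - y" "exp (- y)" "exp y"] by (simp flip: exp_add)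
  then have "exp y \<le> 1 / (1 - y)" using False by (simp add: pos_le_divide_eq)
  also have "\<dots> \<le> 1 + y + y\<^sup>2"
  proof -
    have "(1 + y + y\<^sup>2) * (1 - y) = 1 - y ^ 3" by (simp add: power2_eq_square power3_eq_cube algebra_simps)
    moreover have "y ^ 3 \<le> 0" using False by (simp add: power_le_zero_eq)
    ultimately show ?thesis using False by (simp add: pos_divide_le_eq)
  qed
  finally show ?thesis .
qed (use exp_bound in auto)

context
  fixes F :: "('i \<Rightarrow> 'a) \<Rightarrow> real" and m :: "'i \<Rightarrow> ('i \<Rightarrow> 'a) \<Rightarrow> real" and I :: "'i set" and Mx S :: real
  assumes I: "finite I" and F: "bdd F" "depends I F"
    and Mx: "Mx \<ge> 0" and osc: "\<And>b w t. b \<in> I \<Longrightarrow> w \<in> space PM \<Longrightarrow> t \<in> space M \<Longrightarrow> \<bar>F w - F (w(b := t))\<bar> \<le> m b w"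
    and m: "\<And>b w. b \<in> I \<Longrightarrow> w \<in> space PM \<Longrightarrow> m b w \<le> Mx" "\<And>w. w \<in> space PM \<Longrightarrow> (\<Sum>b\<in>I. m b w) \<le> S"
begin

lemma m_nonneg: "b \<in> I \<Longrightarrow> w \<in> space PM \<Longrightarrow> m b w \<ge> 0"
proof -
  assume *: "b \<in> I" "w \<in> space PM"
  obtain t where "t \<in> space M" using not_empty by blast
  then show "m b w \<ge> 0" using osc[OF *] abs_ge_zero order_trans by blast
qed

lemma S_nonneg: "S \<ge> 0"
proof -
  interpret P: prob_space "PM :: ('i \<Rightarrow> 'a) measure" by (rule prob_space_PM)
  obtain w where w: "w \<in> space (PM :: ('i \<Rightarrow> 'a) measure)" using P.not_empty by blast
  have "0 \<le> (\<Sum>b\<in>I. m b w)" by (intro sum_nonneg m_nonneg w)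
  then show ?thesis using m(2)[OF w] by linarith
qed

lemma bdd_exp: "bdd (\<lambda>w. exp (s * F w))"
  using F(1) by (rule bdd_compose[where h = "\<lambda>x. exp (s * x)"]) (auto intro!: continuous_intros)

text \<open>Efron-Stein for \<open>exp (s / 2 * F)\<close>, whose square is
  \<open>exp (s * F)\<close>. In a squared oscillation one factor \<open>m b w\<close> is replaced
  by its maximum \<open>Mx\<close> and the other is summed; hence the product \<open>Mx * S\<close>,
  which is small when no coordinate dominates.\<close>

lemma var_exp_le:
  assumes s: "\<bar>s\<bar> * Mx \<le> 1"
  shows "(\<integral>w. exp (s * F w) \<partial>PM) - (\<integral>w. exp (s / 2 * F w) \<partial>PM)\<^sup>2
    \<le> Mx * S * s\<^sup>2 * (\<integral>w. exp (s * F w) \<partial>PM)"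
proof -
  define f where "f w = exp (s / 2 * F w)" for w
  have f: "bdd f" unfolding f_def by (rule bdd_exp)
  have ff: "(f w)\<^sup>2 = exp (s * F w)" for w by (simp add: f_def power2_eq_square flip: exp_add)
  have "(\<integral>w. (f w)\<^sup>2 \<partial>PM) - (\<integral>w. f w \<partial>PM)\<^sup>2 \<le> (\<integral>w. (2 * Mx * S * s\<^sup>2) * exp (s * F w) \<partial>PM) / 2"
  proof (rule efron_stein_le[OF I f])
    show "depends I f" using F(2) unfolding f_def depends_def by metis
    show "bdd (\<lambda>w. (2 * Mx * S * s\<^sup>2) * exp (s * F w))"
      by (intro bdd_mult bdd_const bdd_exp)
    fix w :: "'i \<Rightarrow> 'a" assume w: "w \<in> space PM"
    have "(\<integral>t. (f w - f (w(b := t)))\<^sup>2 \<partial>M) \<le> m b w * (2 * Mx * s\<^sup>2 * exp (s * F w))" if b: "b \<in> I" for b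
    proof -
      have pt: "(f w - f (w(b := t)))\<^sup>2 \<le> m b w * (2 * Mx * s\<^sup>2 * exp (s * F w))" if t: "t \<in> space M" for t
      proof -
        define d where "d = s / 2 * F w - s / 2 * F (w(b := t))"
        have mb: "0 \<le> m b w" "m b w \<le> Mx" using m_nonneg[OF b w] m(1)[OF b w] by auto
        have "d = s / 2 * (F w - F (w(b := t)))" by (simp add: d_def right_diff_distrib)
        then have "\<bar>d\<bar> = \<bar>s\<bar> / 2 * \<bar>F w - F (w(b := t))\<bar>" by (simp only: abs_mult)
        also have "\<dots> \<le> \<bar>s\<bar> / 2 * m b w" by (intro mult_left_mono osc b w t) auto
        finally have d: "\<bar>d\<bar> \<le> \<bar>s\<bar> / 2 * m b w" .
        also have "\<dots> \<le> \<bar>s\<bar> / 2 * Mx" using mb by (intro mult_left_mono) auto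
        finally have d1: "2 * \<bar>d\<bar> \<le> 1" using s by simp
        have "\<bar>d\<bar>\<^sup>2 \<le> (\<bar>s\<bar> / 2 * m b w)\<^sup>2" by (intro power_mono d) auto
        moreover have "(\<bar>s\<bar> / 2 * m b w)\<^sup>2 = s\<^sup>2 / 4 * (m b w * m b w)"
          by (simp only: power_mult_distrib power_divide power2_abs) (simp add: power2_eq_square)
        ultimately have "d\<^sup>2 \<le> s\<^sup>2 / 4 * (m b w * m b w)" by simp
        also have "\<dots> \<le> s\<^sup>2 / 4 * (m b w * Mx)" using mb by (intro mult_left_mono) auto
        finally have d2: "d\<^sup>2 \<le> s\<^sup>2 / 4 * (m b w * Mx)" .
        have "(f w - f (w(b := t)))\<^sup>2 \<le> d\<^sup>2 * exp (2 * (s / 2 * F w) + 2 * \<bar>d\<bar>)"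
          unfolding f_def d_def by (rule exp_diff_square_le)
        also have "\<dots> \<le> (s\<^sup>2 / 4 * (m b w * Mx)) * (exp (s * F w) * 3)"
        proof (rule mult_mono[OF d2])
          have "exp (2 * \<bar>d\<bar>) \<le> exp 1" using d1 by simp
          also have "\<dots> \<le> 3" by (rule exp_le)
          finally show "exp (2 * (s / 2 * F w) + 2 * \<bar>d\<bar>) \<le> exp (s * F w) * 3"
            by (simp add: exp_add)
        qed (use mb in auto)
        \<comment> \<open>The 3 bounds \<open>exp 1\<close> and the 1/4 comes from
          \<open>s / 2\<close>; the factor 2 of the next line cancels the 1/2 in
          Efron-Stein.\<close>
        also have "\<dots> = (3 / 4) * (m b w * (Mx * s\<^sup>2 * exp (s * F w)))" by simp
        also have "\<dots> \<le> 2 * (m b w * (Mx * s\<^sup>2 * exp (s * F w)))" using mb by (intro mult_right_mono) auto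
        finally show ?thesis by (simp add: mult_ac)
      qed
      have "(\<integral>t. (f w - f (w(b := t)))\<^sup>2 \<partial>M) \<le> (\<integral>t. m b w * (2 * Mx * s\<^sup>2 * exp (s * F w)) \<partial>M)"
      proof (rule integral_mono_AE')
        show "AE t in M. 0 \<le> m b w * (2 * Mx * s\<^sup>2 * exp (s * F w))"
          using pt by (intro AE_I2) (meson order_trans zero_le_power2)
      qed (use pt in auto)
      then show ?thesis by (simp add: prob_space)
    qed
    then have "(\<Sum>b\<in>I. \<integral>t. (f w - f (w(b := t)))\<^sup>2 \<partial>M) \<le> (\<Sum>b\<in>I. m b w) * (2 * Mx * s\<^sup>2 * exp (s * F w))"
      unfolding sum_distrib_right by (intro sum_mono)
    also have "\<dots> \<le> S * (2 * Mx * s\<^sup>2 * exp (s * F w))"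
      using Mx by (intro mult_right_mono m(2) w) auto
    finally show "(\<Sum>b\<in>I. \<integral>t. (f w - f (w(b := t)))\<^sup>2 \<partial>M) \<le> (2 * Mx * S * s\<^sup>2) * exp (s * F w)"
      by (simp add: mult_ac)
  qed
  then show ?thesis by (simp add: ff) (simp add: f_def mult_ac)
qed

definition mgf :: "real \<Rightarrow> real" where
  "mgf s = (\<integral>w. exp (s * (F w - (\<integral>w. F w \<partial>PM))) \<partial>PM)"

lemma mgf_eq: "mgf s = exp (- s * (\<integral>w. F w \<partial>PM)) * (\<integral>w. exp (s * F w) \<partial>PM)"
proof -
  have "exp (s * (F w - (\<integral>w. F w \<partial>PM))) = exp (- s * (\<integral>w. F w \<partial>PM)) * exp (s * F w)" for w
    by (simp add: exp_add[symmetric] right_diff_distrib)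
  then show ?thesis by (simp add: mgf_def)
qed

lemma mgf_nonneg: "mgf s \<ge> 0"
  unfolding mgf_def by (intro integral_nonneg_AE AE_I2) auto

text \<open>The variance bound says \<open>(1 - x) * mgf s \<le> (mgf (s / 2))\<^sup>2\<close> for
  \<open>x = Mx * S * s\<^sup>2\<close>, and \<open>exp (- (2 * x)) \<le> 1 - x\<close> as long as
  \<open>x\<close> is at most 1/4.\<close>

lemma mgf_step:
  assumes "\<bar>s\<bar> * Mx \<le> 1" "Mx * S * s\<^sup>2 \<le> 1 / 4"
  shows "mgf s \<le> exp (2 * (Mx * S * s\<^sup>2)) * (mgf (s / 2))\<^sup>2"
proof -
  define x where "x = Mx * S * s\<^sup>2"
  have x: "0 \<le> x" "x \<le> 1 / 4" using Mx S_nonneg assms(2) by (auto simp: x_def)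
  have "exp (- (2 * x)) \<le> 1 + - (2 * x) + (- (2 * x))\<^sup>2" using x by (intro exp_le_quadratic) auto
  also have "\<dots> \<le> 1 - x" using x mult_left_mono[of x "1 / 4" x] by (simp add: power2_eq_square)
  finally have e: "exp (- (2 * x)) \<le> 1 - x" .
  have "(mgf (s / 2))\<^sup>2 = exp (- s * (\<integral>w. F w \<partial>PM)) * (\<integral>w. exp (s / 2 * F w) \<partial>PM)\<^sup>2"
    by (simp add: mgf_eq power_mult_distrib power2_eq_square exp_add[symmetric])
  moreover have "(1 - x) * (\<integral>w. exp (s * F w) \<partial>PM) \<le> (\<integral>w. exp (s / 2 * F w) \<partial>PM)\<^sup>2"
    using var_exp_le[OF assms(1)] by (simp add: x_def left_diff_distrib)
  ultimately have "(1 - x) * mgf s \<le> (mgf (s / 2))\<^sup>2"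
    using mult_left_mono[of "(1 - x) * (\<integral>w. exp (s * F w) \<partial>PM)" "(\<integral>w. exp (s / 2 * F w) \<partial>PM)\<^sup>2"
      "exp (- s * (\<integral>w. F w \<partial>PM))"] by (simp add: mgf_eq mult_ac)
  moreover have "exp (- (2 * x)) * mgf s \<le> (1 - x) * mgf s" by (intro mult_right_mono e mgf_nonneg)
  ultimately have "exp (- (2 * x)) * mgf s \<le> (mgf (s / 2))\<^sup>2" by linarith
  then have "exp (2 * x) * (exp (- (2 * x)) * mgf s) \<le> exp (2 * x) * (mgf (s / 2))\<^sup>2"
    by (intro mult_left_mono) auto
  moreover have "exp (2 * x) * (exp (- (2 * x)) * mgf s) = mgf s"
    by (simp only: mult.assoc[symmetric] exp_add[symmetric]) simp
  ultimately show ?thesis by (simp only: x_def)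
qed

text \<open>Halving \<open>s\<close> divides \<open>s\<^sup>2\<close> by four while squaring doubles
  the exponent, so the constant 4 reproduces itself: 4 = 2 + 2 * (4 / 4).\<close>

lemma mgf_iterate:
  assumes "\<bar>s\<bar> * Mx \<le> 1" "Mx * S * s\<^sup>2 \<le> 1 / 4"
  shows "mgf s \<le> exp (4 * (Mx * S * s\<^sup>2)) * mgf (s / 2 ^ n) ^ (2 ^ n)"
  using assms
proof (induction n arbitrary: s)
  case 0
  have "0 \<le> Mx * S * s\<^sup>2" using Mx S_nonneg by simp
  then have "1 \<le> exp (4 * (Mx * S * s\<^sup>2))" by simp
  then show ?case using mult_right_mono[OF _ mgf_nonneg[of s], of 1 "exp (4 * (Mx * S * s\<^sup>2))"] by simp
next
  case (Suc n)
  have MS: "0 \<le> Mx * S" using Mx S_nonneg by simp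
  have sq: "(s / 2)\<^sup>2 = s\<^sup>2 / 4" by (simp add: power_divide)
  have 1: "\<bar>s / 2\<bar> * Mx \<le> 1" using Suc.prems(1) Mx by (simp add: abs_mult)
  have "Mx * S * (s / 2)\<^sup>2 \<le> Mx * S * s\<^sup>2" unfolding sq using MS by (intro mult_left_mono) auto
  then have 2: "Mx * S * (s / 2)\<^sup>2 \<le> 1 / 4" using Suc.prems(2) by linarith
  have "mgf s \<le> exp (2 * (Mx * S * s\<^sup>2)) * (mgf (s / 2))\<^sup>2" by (rule mgf_step[OF Suc.prems])
  also have "\<dots> \<le> exp (2 * (Mx * S * s\<^sup>2)) * (exp (4 * (Mx * S * (s / 2)\<^sup>2)) * mgf (s / 2 / 2 ^ n) ^ (2 ^ n))\<^sup>2"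
    by (intro mult_left_mono power_mono Suc.IH[OF 1 2] mgf_nonneg) auto
  also have "\<dots> = exp (2 * (Mx * S * s\<^sup>2)) * exp (2 * (Mx * S * s\<^sup>2)) * mgf (s / 2 ^ Suc n) ^ (2 ^ Suc n)"
    by (simp add: power_mult_distrib sq exp_double[symmetric] power_mult[symmetric] mult_ac)
  also have "\<dots> = exp (4 * (Mx * S * s\<^sup>2)) * mgf (s / 2 ^ Suc n) ^ (2 ^ Suc n)"
    by (simp add: exp_add[symmetric])
  finally show ?case .
qed

text \<open>After many halvings the remaining factor \<open>mgf (s / 2 ^ n) ^ (2 ^ n)\<close> is
  close to at most 1, because centring removes the linear term of the exponential: the exponent left
  over is of order \<open>2 ^ n\<close> times \<open>(s / 2 ^ n)\<^sup>2\<close>.\<close>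

lemma mgf_le:
  assumes "\<bar>s\<bar> * Mx \<le> 1" "Mx * S * s\<^sup>2 \<le> 1 / 4"
  shows "mgf s \<le> exp (4 * (Mx * S * s\<^sup>2))"
proof -
  interpret P: prob_space "PM :: ('i \<Rightarrow> 'a) measure" by (rule prob_space_PM)
  let ?E = "\<integral>w. F w \<partial>PM"
  have "bdd (\<lambda>w. F w - ?E)" by (intro bdd_diff F(1) bdd_const)
  then obtain D0 where D0: "\<forall>w\<in>space PM. \<bar>F w - ?E\<bar> \<le> D0" by (auto simp: bdd_def)
  define D where "D = max 1 D0"
  have D: "D \<ge> 1" "\<And>w. w \<in> space PM \<Longrightarrow> \<bar>F w - ?E\<bar> \<le> D" using D0 by (auto simp: D_def intro: max.coboundedI2)
  have small: "mgf q \<le> exp (q\<^sup>2 * D\<^sup>2)" if q: "\<bar>q\<bar> * D \<le> 1" for q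
  proof -
    have b1: "bdd (\<lambda>w. 1 + q * (F w - ?E) + (q * (F w - ?E))\<^sup>2)"
      by (intro bdd_add bdd_mult bdd_const bdd_diff bdd_power F(1))
    have ab: "\<bar>q * (F w - ?E)\<bar> \<le> \<bar>q\<bar> * D" if "w \<in> space PM" for w
      unfolding abs_mult using D(2)[OF that] by (intro mult_left_mono) auto
    have "mgf q \<le> (\<integral>w. 1 + q * (F w - ?E) + q\<^sup>2 * D\<^sup>2 \<partial>PM)"
      unfolding mgf_def
    proof (rule integral_mono)
      show "integrable PM (\<lambda>w. exp (q * (F w - ?E)))"
        by (intro bdd_integrable bdd_compose[where h = "\<lambda>x. exp (q * (x - ?E))", OF F(1)]) (auto intro!: continuous_intros)
      show "integrable PM (\<lambda>w. 1 + q * (F w - ?E) + q\<^sup>2 * D\<^sup>2)"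
        by (intro bdd_integrable bdd_add bdd_mult bdd_const bdd_diff F(1))
      fix w :: "'i \<Rightarrow> 'a" assume w: "w \<in> space PM"
      have "exp (q * (F w - ?E)) \<le> 1 + q * (F w - ?E) + (q * (F w - ?E))\<^sup>2"
        using ab[OF w] q by (intro exp_le_quadratic) linarith
      also have "(q * (F w - ?E))\<^sup>2 \<le> (\<bar>q\<bar> * D)\<^sup>2"
        using power_mono[OF ab[OF w], of 2] by simp
      finally show "exp (q * (F w - ?E)) \<le> 1 + q * (F w - ?E) + q\<^sup>2 * D\<^sup>2" by (simp add: power_mult_distrib)
    qed
    also have "\<dots> = 1 + q\<^sup>2 * D\<^sup>2" using bdd_integrable[OF F(1)] by (simp add: P.prob_space)
    also have "\<dots> \<le> exp (q\<^sup>2 * D\<^sup>2)" using exp_ge_add_one_self[of "q\<^sup>2 * D\<^sup>2"] by simp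
    finally show ?thesis .
  qed
  have ev: "\<forall>\<^sub>F n in sequentially. mgf s \<le> exp (4 * (Mx * S * s\<^sup>2)) * exp (s\<^sup>2 * D\<^sup>2 / 2 ^ n)"
  proof -
    obtain k :: nat where k: "\<bar>s\<bar> * D < 2 ^ k" using real_arch_pow[of 2 "\<bar>s\<bar> * D"] by auto
    show ?thesis
    proof (rule eventually_sequentiallyI[of k])
      fix n assume "k \<le> n"
      then have "(2 :: real) ^ k \<le> 2 ^ n" by (intro power_increasing) auto
      then have "\<bar>s\<bar> * D \<le> 2 ^ n" using k by linarith
      then have "\<bar>s / 2 ^ n\<bar> * D \<le> 1" by (simp add: abs_mult divide_le_eq)
      from small[OF this] have "mgf (s / 2 ^ n) ^ (2 ^ n) \<le> exp ((s / 2 ^ n)\<^sup>2 * D\<^sup>2) ^ (2 ^ n)"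
        by (intro power_mono mgf_nonneg)
      also have "\<dots> = exp (real (2 ^ n) * ((s / 2 ^ n)\<^sup>2 * D\<^sup>2))" by (rule exp_of_nat_mult[symmetric])
      also have "real (2 ^ n) * ((s / 2 ^ n)\<^sup>2 * D\<^sup>2) = s\<^sup>2 * D\<^sup>2 / 2 ^ n"
        by (simp add: power_divide power2_eq_square)
      finally have "mgf (s / 2 ^ n) ^ (2 ^ n) \<le> exp (s\<^sup>2 * D\<^sup>2 / 2 ^ n)" .
      then show "mgf s \<le> exp (4 * (Mx * S * s\<^sup>2)) * exp (s\<^sup>2 * D\<^sup>2 / 2 ^ n)"
        using mgf_iterate[OF assms, of n] by (meson mult_left_mono exp_ge_zero order_trans)
    qed
  qed
  have "(\<lambda>n. exp (4 * (Mx * S * s\<^sup>2)) * exp (s\<^sup>2 * D\<^sup>2 / 2 ^ n)) \<longlonglongrightarrow> exp (4 * (Mx * S * s\<^sup>2)) * exp 0"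
  proof (intro tendsto_intros)
    have "(\<lambda>n. s\<^sup>2 * D\<^sup>2 * (1 / 2) ^ n) \<longlonglongrightarrow> s\<^sup>2 * D\<^sup>2 * 0"
      by (intro tendsto_intros LIMSEQ_realpow_zero) auto
    then show "(\<lambda>n. s\<^sup>2 * D\<^sup>2 / 2 ^ n) \<longlonglongrightarrow> 0" by (simp add: power_divide)
  qed
  from tendsto_lowerbound[OF this ev] show ?thesis by simp
qed

text \<open>Chernoff's bound at \<open>s\<close> and at \<open>- s\<close>; the condition on
  \<open>Mx * S * s\<^sup>2\<close> keeps both moment generating functions below
  \<open>exp 1\<close>.\<close>

theorem concentration:
  assumes s: "s > 0" "s * Mx \<le> 1" "Mx * S * s\<^sup>2 \<le> 1 / 4"
  shows "measure PM {w \<in> space PM. \<bar>F w - (\<integral>w. F w \<partial>PM)\<bar> > t} \<le> 2 * exp (1 - s * t)"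
proof -
  interpret P: prob_space "PM :: ('i \<Rightarrow> 'a) measure" by (rule prob_space_PM)
  let ?E = "\<integral>w. F w \<partial>PM"
  have tail: "measure PM {w \<in> space PM. exp (q * (F w - ?E)) \<ge> exp (s * t)} \<le> exp (1 - s * t)" if q: "\<bar>q\<bar> = s" for q
  proof -
    have "q\<^sup>2 = s\<^sup>2" using q by (metis power2_abs)
    then have q2: "\<bar>q\<bar> * Mx \<le> 1" "Mx * S * q\<^sup>2 \<le> 1 / 4" using s q by auto
    have "measure PM {w \<in> space PM. exp (q * (F w - ?E)) \<ge> exp (s * t)} \<le> (\<integral>w. exp (q * (F w - ?E)) \<partial>PM) / exp (s * t)"
    proof (rule integral_Markov_inequality_measure[where A = "space PM"])
      show "integrable PM (\<lambda>w. exp (q * (F w - ?E)))"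
        by (intro bdd_integrable bdd_compose[where h = "\<lambda>x. exp (q * (x - ?E))", OF F(1)]) (auto intro!: continuous_intros)
    qed auto
    also have "\<dots> = mgf q / exp (s * t)" by (simp add: mgf_def)
    also have "\<dots> \<le> exp 1 / exp (s * t)"
      using mgf_le[OF q2] q2(2) by (intro divide_right_mono) (auto intro: order_trans)
    finally show ?thesis by (simp add: exp_diff)
  qed
  have [measurable]: "F \<in> borel_measurable PM" using F(1) by (rule bddD)
  have "measure PM {w \<in> space PM. \<bar>F w - ?E\<bar> > t}
    \<le> measure PM ({w \<in> space PM. exp (s * (F w - ?E)) \<ge> exp (s * t)} \<union> {w \<in> space PM. exp (- s * (F w - ?E)) \<ge> exp (s * t)})"
  proof (rule P.finite_measure_mono)
    have "s * t \<le> s * (F w - ?E) \<or> s * t \<le> - s * (F w - ?E)" if "\<bar>F w - ?E\<bar> > t" for w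
    proof (cases "F w - ?E \<ge> 0")
      case True
      then have "t \<le> F w - ?E" using that by linarith
      then show ?thesis using s(1) by (intro disjI1 mult_left_mono) auto
    next
      case False
      then have "t \<le> - (F w - ?E)" using that by linarith
      from mult_left_mono[OF this, of s] show ?thesis using s(1) by (intro disjI2) (simp add: algebra_simps)
    qed
    then show "{w \<in> space PM. \<bar>F w - ?E\<bar> > t} \<subseteq> {w \<in> space PM. exp (s * (F w - ?E)) \<ge> exp (s * t)} \<union> {w \<in> space PM. exp (- s * (F w - ?E)) \<ge> exp (s * t)}"
      by (auto simp del: mult_minus_left)
  qed measurable
  also have "\<dots> \<le> measure PM {w \<in> space PM. exp (s * (F w - ?E)) \<ge> exp (s * t)} + measure PM {w \<in> space PM. exp (- s * (F w - ?E)) \<ge> exp (s * t)}"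
    by (intro measure_Un_le) measurable
  also have "\<dots> \<le> exp (1 - s * t) + exp (1 - s * t)" using s(1) by (intro add_mono tail) auto
  finally show ?thesis by simp
qed

end

end

section \<open>Discrete calculus on the torus and the lazy chain\<close>

section \<open>Periodic functions on the lattice\<close>

definition sbox :: "'d::finite site \<Rightarrow> 'd site \<Rightarrow> 'd site set" where
  "sbox a b = {x. \<forall>k. a $ k \<le> x $ k \<and> x $ k \<le> b $ k}"

lemma sbox_eq_image:
  "sbox a b = vec_lambda ` (\<Pi>\<^sub>E k\<in>UNIV. {a $ k..b $ k})" for a b :: "'d::finite site"
proof (intro set_eqI iffI)
  fix x assume "x \<in> sbox a b"
  then show "x \<in> vec_lambda ` (\<Pi>\<^sub>E k\<in>UNIV. {a $ k..b $ k})"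
    by (intro image_eqI[of _ _ "vec_nth x"]) (auto simp: sbox_def)
qed (auto simp: sbox_def PiE_def Pi_def)

lemma finite_sbox [simp]: "finite (sbox a b)"
  unfolding sbox_eq_image by (intro finite_imageI finite_PiE) auto

lemma card_sbox: "card (sbox a b) = (\<Prod>k\<in>UNIV. nat (b $ k - a $ k + 1))" for a b :: "'d::finite site"
proof -
  have "card (sbox a b) = card (\<Pi>\<^sub>E k\<in>UNIV. {a $ k..b $ k})"
    unfolding sbox_eq_image by (intro card_image inj_onI) (auto simp: vec_lambda_inject)
  then show ?thesis by (simp add: card_PiE add.commute)
qed

definition torus :: "nat \<Rightarrow> 'd::finite site set" where
  "torus N = {x. \<forall>k. - int N \<le> x $ k \<and> x $ k < int N}"

lemma torus_eq_sbox: "torus N = sbox (\<chi> k. - int N) (\<chi> k. int N - 1)"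
  by (auto simp: torus_def sbox_def)

lemma finite_torus [simp]: "finite (torus N)"
  by (simp add: torus_eq_sbox)

lemma card_torus: "card (torus N :: 'd::finite site set) = (2 * N) ^ CARD('d)"
  by (simp add: torus_eq_sbox card_sbox nat_mult_distrib flip: mult_2)

lemma card_torus_pos: "N > 0 \<Longrightarrow> card (torus N :: 'd::finite site set) > 0"
  by (simp add: card_torus)

lemma torus_rep_in [simp]: "N > 0 \<Longrightarrow> torus_rep N x \<in> torus N"
  by (auto simp: torus_rep_def torus_def intro: order_less_le_trans[OF pos_mod_bound])

lemma torus_rep_id: "x \<in> torus N \<Longrightarrow> torus_rep N x = x"
proof -
  assume "x \<in> torus N"
  then have "(x $ k + int N) mod (2 * int N) = x $ k + int N" for k
    by (intro mod_pos_pos_trivial) (auto simp: torus_def add.commute dest!: spec[of _ k])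
  then show ?thesis by (simp add: torus_rep_def vec_eq_iff)
qed

lemma torus_rep_add: "torus_rep N (torus_rep N x + y) = torus_rep N (x + y)"
proof -
  have "((x $ k + int N) mod (2 * int N) - int N + y $ k + int N) mod (2 * int N)
      = (x $ k + y $ k + int N) mod (2 * int N)" for k
  proof -
    have "((x $ k + int N) mod (2 * int N) + y $ k) mod (2 * int N) = (x $ k + int N + y $ k) mod (2 * int N)"
      by (rule mod_add_left_eq)
    then show ?thesis by (simp add: algebra_simps)
  qed
  then show ?thesis by (simp add: torus_rep_def vec_eq_iff)
qed

lemma torus_rep_diff: "torus_rep N (torus_rep N x - y) = torus_rep N (x - y)"
  using torus_rep_add[of N x "-y"] by simp

lemma torus_rep_rep [simp]: "torus_rep N (torus_rep N x) = torus_rep N x"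
  using torus_rep_add[of N x 0] by simp

text \<open>Functions on the torus are represented by periodic functions on the lattice. Sums run
  over one period, while shifts and gradients are those of the lattice and involve no
  wrap-around.\<close>

definition periodic :: "nat \<Rightarrow> ('d::finite site \<Rightarrow> 'a) \<Rightarrow> bool" where
  "periodic N f \<longleftrightarrow> (\<forall>x. f (torus_rep N x) = f x)"

lemma periodicD: "periodic N f \<Longrightarrow> f (torus_rep N x) = f x"
  by (simp add: periodic_def)

lemma periodic_shift:
  assumes "periodic N f" shows "periodic N (\<lambda>x. f (x + y))" "periodic N (\<lambda>x. f (x - y))"
  using assms unfolding periodic_def by (metis torus_rep_add torus_rep_diff)+

lemma periodic_const [simp]: "periodic N (\<lambda>x. a)"
  by (simp add: periodic_def)

lemma periodic_sum: "(\<And>i. i \<in> I \<Longrightarrow> periodic N (f i)) \<Longrightarrow> periodic N (\<lambda>x. \<Sum>i\<in>I. f i x)"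
  by (simp add: periodic_def)

lemma periodic_add: "periodic N f \<Longrightarrow> periodic N g \<Longrightarrow> periodic N (\<lambda>x. f x + g x :: real)"
  and periodic_diff: "periodic N f \<Longrightarrow> periodic N g \<Longrightarrow> periodic N (\<lambda>x. f x - g x :: real)"
  and periodic_mult: "periodic N f \<Longrightarrow> periodic N g \<Longrightarrow> periodic N (\<lambda>x. f x * g x :: real)"
  and periodic_divide: "periodic N f \<Longrightarrow> periodic N (\<lambda>x. f x / r :: real)"
  and periodic_power: "periodic N f \<Longrightarrow> periodic N (\<lambda>x. f x ^ n :: real)"
  and periodic_uminus: "periodic N f \<Longrightarrow> periodic N (\<lambda>x. - f x :: real)"
  by (simp_all add: periodic_def)

lemmas periodic_intros = periodic_add periodic_diff periodic_mult periodic_divide periodic_power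
  periodic_uminus periodic_sum periodic_shift

lemma bij_torus_shift:
  assumes "N > 0" shows "bij_betw (\<lambda>x. torus_rep N (x + y)) (torus N) (torus N)"
proof (rule bij_betwI[where g = "\<lambda>x. torus_rep N (x - y)"])
  fix x :: "'a site" assume "x \<in> torus N"
  then show "torus_rep N (torus_rep N (x + y) - y) = x" "torus_rep N (torus_rep N (x - y) + y) = x"
    by (simp_all add: torus_rep_diff torus_rep_add torus_rep_id)
qed (use assms in auto)

lemma torus_sum_shift:
  assumes "N > 0" "periodic N f"
  shows "(\<Sum>x\<in>torus N. f (x + y)) = (\<Sum>x\<in>torus N. f x)"
  using sum.reindex_bij_betw[OF bij_torus_shift[OF assms(1)], of f y] assms(2)
  by (simp add: periodic_def)

lemma torus_sum_shift_diff:
  assumes "N > 0" "periodic N f"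
  shows "(\<Sum>x\<in>torus N. f (x - y)) = (\<Sum>x\<in>torus N. f x)"
  using torus_sum_shift[OF assms, of "-y"] by simp

lemma periodic_ext:
  assumes "N > 0" "periodic N f" "\<And>x. x \<in> torus N \<Longrightarrow> P (f x)"
  shows "P (f x)"
  using assms by (metis periodicD torus_rep_in)

definition nab :: "('d::finite site \<Rightarrow> real) \<Rightarrow> 'd \<Rightarrow> 'd site \<Rightarrow> real" where
  "nab f i x = f (x + unit_site i) - f x"

text \<open>Discrete divergence; the backward difference makes it minus the adjoint of
  \<open>nab\<close>.\<close>

definition dv :: "('d::finite \<Rightarrow> 'd site \<Rightarrow> real) \<Rightarrow> 'd site \<Rightarrow> real" where
  "dv j x = (\<Sum>i\<in>UNIV. j i x - j i (x - unit_site i))"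

lemma periodic_nab: "periodic N f \<Longrightarrow> periodic N (nab f i)"
  unfolding nab_def[abs_def] by (intro periodic_intros)

lemma periodic_dv: "(\<And>i. periodic N (j i)) \<Longrightarrow> periodic N (dv j)"
  unfolding dv_def[abs_def] by (intro periodic_intros)

lemma torus_sum_by_parts:
  assumes "N > 0" "periodic N f" "\<And>i. periodic N (j i)"
  shows "(\<Sum>x\<in>torus N. f x * dv j x) = - (\<Sum>x\<in>torus N. \<Sum>i\<in>UNIV. j i x * nab f i x)"
proof -
  have *: "(\<Sum>x\<in>torus N. f x * j i (x - unit_site i)) = (\<Sum>x\<in>torus N. f (x + unit_site i) * j i x)" for i
    using torus_sum_shift[OF assms(1), of "\<lambda>x. f x * j i (x - unit_site i)" "unit_site i"]
    by (simp add: periodic_mult periodic_shift assms)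
  have "(\<Sum>x\<in>torus N. f x * dv j x) = (\<Sum>i\<in>UNIV. \<Sum>x\<in>torus N. f x * j i x - f x * j i (x - unit_site i))"
    unfolding dv_def by (simp add: sum_distrib_left right_diff_distrib) (rule sum.swap)
  also have "\<dots> = (\<Sum>i\<in>UNIV. \<Sum>x\<in>torus N. f x * j i x - f (x + unit_site i) * j i x)"
    by (simp only: sum_subtractf *)
  also have "\<dots> = (\<Sum>i\<in>UNIV. \<Sum>x\<in>torus N. - (j i x * nab f i x))"
    by (simp add: nab_def algebra_simps)
  also have "\<dots> = (\<Sum>x\<in>torus N. \<Sum>i\<in>UNIV. - (j i x * nab f i x))"
    by (rule sum.swap)
  finally show ?thesis by (simp add: sum_negf)
qed

section \<open>The Poincare inequality on the torus\<close>

definition grad_energy :: "nat \<Rightarrow> ('d::finite site \<Rightarrow> real) \<Rightarrow> real" where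
  "grad_energy N f = (\<Sum>x\<in>torus N. \<Sum>i\<in>UNIV. (nab f i x)\<^sup>2)"

lemma grad_energy_nonneg: "grad_energy N f \<ge> 0"
  unfolding grad_energy_def by (intro sum_nonneg) auto

text \<open>By translation invariance the L2 norm of \<open>f (x + y) - f x\<close> over the torus
  is subadditive and even in \<open>y\<close>. A unit step costs at most the root of the energy, so
  the norm grows at most with the l1 length of \<open>y\<close>.\<close>

lemma shift_diff_le:
  fixes f :: "'d::finite site \<Rightarrow> real"
  assumes "N > 0" "periodic N f"
  shows "(\<Sum>x\<in>torus N. (f (x + y) - f x)\<^sup>2) \<le> (real_of_int (\<Sum>k\<in>UNIV. \<bar>y $ k\<bar>))\<^sup>2 * grad_energy N f"
proof -
  define D where "D y = L2_set (\<lambda>x. f (x + y) - f x) (torus N)" for y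
  define s where "s = sqrt (grad_energy N f)"
  have D0: "D 0 = 0" by (simp add: D_def L2_set_def)
  have sq: "(D y)\<^sup>2 = (\<Sum>x\<in>torus N. (f (x + y) - f x)\<^sup>2)" for y
    by (simp add: D_def L2_set_def sum_nonneg)
  have add: "D (y + z) \<le> D y + D z" for y z
  proof -
    have "D (y + z) = L2_set (\<lambda>x. (f (x + z + y) - f (x + z)) + (f (x + z) - f x)) (torus N)"
      unfolding D_def by (intro L2_set_cong) (auto simp: add_ac)
    also have "\<dots> \<le> L2_set (\<lambda>x. f (x + z + y) - f (x + z)) (torus N) + D z"
      unfolding D_def by (rule L2_set_triangle_ineq)
    also have "L2_set (\<lambda>x. f (x + z + y) - f (x + z)) (torus N) = D y"
      unfolding D_def L2_set_def
      using torus_sum_shift[OF assms(1), of "\<lambda>x. (f (x + y) - f x)\<^sup>2" z]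
      by (simp add: periodic_intros assms(2))
    finally show ?thesis .
  qed
  have neg: "D (- y) = D y" for y
    unfolding D_def L2_set_def
    using torus_sum_shift[OF assms(1), of "\<lambda>x. (f (x - y) - f x)\<^sup>2" y]
    by (simp add: periodic_intros assms(2) power2_commute)
  have unit: "D (unit_site k) \<le> s" for k
  proof -
    have "(D (unit_site k))\<^sup>2 \<le> grad_energy N f"
      unfolding sq grad_energy_def nab_def
      by (intro sum_mono member_le_sum) auto
    then show ?thesis unfolding s_def by (rule real_le_rsqrt)
  qed
  have nat_mult: "D (int n *s unit_site k) \<le> real n * s" for n k
  proof (induction n)
    case (Suc n)
    have "D (int (Suc n) *s unit_site k) = D (unit_site k + int n *s unit_site k)"
      by (simp add: vector_sadd_rdistrib)
    also have "\<dots> \<le> D (unit_site k) + D (int n *s unit_site k)" by (rule add)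
    finally show ?case using Suc unit[of k] by (simp add: algebra_simps)
  qed (simp add: D0)
  have int_mult: "D (m *s unit_site k) \<le> \<bar>real_of_int m\<bar> * s" for m k
  proof (cases "m \<ge> 0")
    case True
    then show ?thesis using nat_mult[of "nat m" k] by simp
  next
    case False
    then have "m *s unit_site k = - (int (nat (-m)) *s unit_site k)" by (simp add: vec_eq_iff)
    then have "D (m *s unit_site k) = D (int (nat (-m)) *s unit_site k)" by (simp only: neg)
    then show ?thesis using nat_mult[of "nat (-m)" k] False by simp
  qed
  have "D (\<Sum>k\<in>J. (y $ k) *s unit_site k) \<le> (\<Sum>k\<in>J. \<bar>real_of_int (y $ k)\<bar> * s)" if "finite J" for J
    using that
  proof induction
    case (insert k J)
    then show ?case using add[of "y $ k *s unit_site k" "\<Sum>k\<in>J. (y $ k) *s unit_site k"] int_mult[of "y $ k" k]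
      by simp
  qed (simp add: D0)
  from this[of UNIV] have "D y \<le> real_of_int (\<Sum>k\<in>UNIV. \<bar>y $ k\<bar>) * s"
    by (simp add: unit_site_def basis_expansion sum_distrib_right)
  moreover have "D y \<ge> 0" by (simp add: D_def L2_set_nonneg)
  ultimately have "(D y)\<^sup>2 \<le> (real_of_int (\<Sum>k\<in>UNIV. \<bar>y $ k\<bar>) * s)\<^sup>2" by (intro power_mono)
  then show ?thesis by (simp add: sq power_mult_distrib s_def grad_energy_nonneg)
qed

text \<open>\<open>shift_diff_le\<close> is summed over all \<open>y\<close> of the torus: cross
  terms vanish because the mean of \<open>f\<close> is zero, and every \<open>y\<close> has l1
  length at most d N.\<close>

lemma poincare_torus:
  fixes f :: "'d::finite site \<Rightarrow> real"
  assumes "N > 0" "periodic N f" "(\<Sum>x\<in>torus N. f x) = 0"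
  shows "(\<Sum>x\<in>torus N. (f x)\<^sup>2) \<le> (real CARD('d) * real N)\<^sup>2 * grad_energy N f"
proof -
  let ?T = "torus N :: 'd site set"
  let ?c = "(real CARD('d) * real N)\<^sup>2"
  have le: "(\<Sum>x\<in>?T. (f (x + y) - f x)\<^sup>2) \<le> ?c * grad_energy N f" if "y \<in> ?T" for y
  proof -
    have "(\<Sum>k\<in>UNIV. \<bar>y $ k\<bar>) \<le> (\<Sum>k\<in>(UNIV :: 'd set). int N)"
      using that by (intro sum_mono) (auto simp: torus_def abs_le_iff less_imp_le minus_le_iff)
    then have "real_of_int (\<Sum>k\<in>UNIV. \<bar>y $ k\<bar>) \<le> real CARD('d) * real N"
      unfolding sum_constant by (simp only: of_int_le_iff[symmetric, where 'a=real] of_int_mult of_int_of_nat_eq)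
    then have "(real_of_int (\<Sum>k\<in>UNIV. \<bar>y $ k\<bar>))\<^sup>2 \<le> ?c"
      by (intro power_mono) (auto intro!: sum_nonneg)
    then show ?thesis
      using shift_diff_le[OF assms(1,2), of y] grad_energy_nonneg[of N f]
      by (meson mult_right_mono order_trans)
  qed
  have s1: "(\<Sum>y\<in>?T. \<Sum>x\<in>?T. (f (x + y))\<^sup>2) = (\<Sum>y\<in>?T. \<Sum>x\<in>?T. (f x)\<^sup>2)"
    by (intro sum.cong refl torus_sum_shift[OF assms(1), of "\<lambda>x. (f x)\<^sup>2"] periodic_intros assms)
  have s2: "(\<Sum>y\<in>?T. \<Sum>x\<in>?T. f (x + y) * f x) = 0"
  proof -
    have "(\<Sum>y\<in>?T. \<Sum>x\<in>?T. f (x + y) * f x) = (\<Sum>x\<in>?T. (\<Sum>y\<in>?T. f (y + x)) * f x)"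
      by (subst sum.swap) (simp add: sum_distrib_right add.commute)
    also have "\<dots> = 0" using torus_sum_shift[OF assms(1,2)] assms(3) by simp
    finally show ?thesis .
  qed
  have "2 * real (card ?T) * (\<Sum>x\<in>?T. (f x)\<^sup>2) = (\<Sum>y\<in>?T. \<Sum>x\<in>?T. (f (x + y) - f x)\<^sup>2)"
    using s1 s2 by (simp add: power2_diff sum.distrib sum_subtractf sum_distrib_left[symmetric] mult.assoc)
  also have "\<dots> \<le> (\<Sum>y\<in>?T. ?c * grad_energy N f)" by (intro sum_mono le)
  finally have "real (card ?T) * (2 * (\<Sum>x\<in>?T. (f x)\<^sup>2)) \<le> real (card ?T) * (?c * grad_energy N f)"
    by simp
  then have "2 * (\<Sum>x\<in>?T. (f x)\<^sup>2) \<le> ?c * grad_energy N f"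
    using card_torus_pos[OF assms(1), where 'd='d] by (simp only: mult_le_cancel_left_pos of_nat_0_less_iff)
  moreover have "(\<Sum>x\<in>?T. (f x)\<^sup>2) \<ge> 0" by (intro sum_nonneg) auto
  ultimately show ?thesis by linarith
qed

section \<open>The generator and its lazy discretisation\<close>

definition gen :: "'d::finite env \<Rightarrow> ('d site \<Rightarrow> real) \<Rightarrow> 'd site \<Rightarrow> real" where
  "gen \<xi> f = dv (\<lambda>i y. \<xi> (y, i) * nab f i y)"

definition lazy :: "real \<Rightarrow> 'd::finite env \<Rightarrow> ('d site \<Rightarrow> real) \<Rightarrow> 'd site \<Rightarrow> real" where
  "lazy l \<xi> f x = f x + gen \<xi> f x / l"

definition elliptic :: "real \<Rightarrow> 'd::finite env \<Rightarrow> bool" where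
  "elliptic c \<xi> \<longleftrightarrow> (\<forall>b. 1 / c \<le> \<xi> b \<and> \<xi> b \<le> c)"

definition total_rate :: "'d::finite env \<Rightarrow> 'd site \<Rightarrow> real" where
  "total_rate \<xi> x = (\<Sum>s\<in>UNIV. rate \<xi> x s)"

lemma gen_eq_sum:
  "gen \<xi> f x = (\<Sum>i\<in>UNIV. \<xi> (x, i) * (f (x + unit_site i) - f x)
     + \<xi> (x - unit_site i, i) * (f (x - unit_site i) - f x))"
  by (simp add: gen_def dv_def nab_def algebra_simps)

lemma sum_dir:
  fixes g :: "'d::finite dir \<Rightarrow> 'a::comm_monoid_add"
  shows "(\<Sum>s\<in>UNIV. g s) = (\<Sum>i\<in>UNIV. g (i, True) + g (i, False))"
proof -
  have "(\<Sum>s\<in>UNIV. g s) = (\<Sum>i\<in>UNIV. \<Sum>b\<in>UNIV. g (i, b))"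
    unfolding sum.cartesian_product by (simp only: UNIV_Times_UNIV case_prod_eta)
  then show ?thesis by (simp add: UNIV_bool add.commute)
qed

lemma gen_eq_rate: "gen \<xi> f x = (\<Sum>s\<in>UNIV. rate \<xi> x s * (f (x + shift s) - f x))"
  by (simp add: gen_eq_sum sum_dir rate_def shift_def)

lemma lazy_eq_rate:
  "lazy l \<xi> f x = (1 - total_rate \<xi> x / l) * f x + (\<Sum>s\<in>UNIV. rate \<xi> x s / l * f (x + shift s))"
  unfolding lazy_def gen_eq_rate total_rate_def
  by (simp add: algebra_simps sum_subtractf sum_distrib_left diff_divide_distrib sum_divide_distrib)

lemma lazy_add: "lazy l \<xi> (\<lambda>x. f x + g x) x = lazy l \<xi> f x + lazy l \<xi> g x"
  by (simp add: lazy_eq_rate algebra_simps sum.distrib add_divide_distrib)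

lemma lazy_cmult: "lazy l \<xi> (\<lambda>x. a * f x) x = a * lazy l \<xi> f x"
  by (simp add: lazy_eq_rate algebra_simps sum_distrib_left)

lemma lazy_const [simp]: "lazy l \<xi> (\<lambda>x. a) x = a"
  by (simp add: lazy_def gen_eq_rate)

abbreviation "lazyn l \<xi> n \<equiv> lazy l \<xi> ^^ n"

lemma lazyn_add: "lazyn l \<xi> n (\<lambda>x. f x + g x) = (\<lambda>x. lazyn l \<xi> n f x + lazyn l \<xi> n g x)"
  by (induction n) (auto simp: lazy_add)

lemma lazyn_cmult: "lazyn l \<xi> n (\<lambda>x. a * f x) = (\<lambda>x. a * lazyn l \<xi> n f x)"
  by (induction n) (auto simp: lazy_cmult)

lemma lazyn_const [simp]: "lazyn l \<xi> n (\<lambda>x. a) = (\<lambda>x. a)"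
  by (induction n) auto

lemma lazyn_diff: "lazyn l \<xi> n (\<lambda>x. f x - g x) = (\<lambda>x. lazyn l \<xi> n f x - lazyn l \<xi> n g x)"
  using lazyn_add[of n l \<xi> f "\<lambda>x. -1 * g x"] lazyn_cmult[of n l \<xi> "-1" g] by simp

lemma lazyn_sum: "finite I \<Longrightarrow> lazyn l \<xi> n (\<lambda>x. \<Sum>i\<in>I. f i x) = (\<lambda>x. \<Sum>i\<in>I. lazyn l \<xi> n (f i) x)"
  by (induction I rule: finite_induct) (auto simp: lazyn_add)

lemma lazyn_Suc': "lazyn l \<xi> (Suc n) f = lazyn l \<xi> n (lazy l \<xi> f)"
  by (simp add: funpow_swap1)

lemma gen_add: "gen \<xi> (\<lambda>x. f x + g x) x = gen \<xi> f x + gen \<xi> g x"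
  by (simp add: gen_eq_rate algebra_simps sum.distrib sum_subtractf)

lemma gen_cmult: "gen \<xi> (\<lambda>x. a * f x) x = a * gen \<xi> f x"
  by (simp add: gen_eq_rate algebra_simps sum_distrib_left)

lemma gen_const [simp]: "gen \<xi> (\<lambda>x. a) x = 0"
  by (simp add: gen_eq_rate)

lemma lazyn_fix: "l \<noteq> 0 \<Longrightarrow> (\<And>x. gen \<xi> f x = 0) \<Longrightarrow> lazyn l \<xi> n f = f"
  by (induction n) (auto simp: lazy_def)

lemma ellipticD: "elliptic c \<xi> \<Longrightarrow> 1 / c \<le> \<xi> b" "elliptic c \<xi> \<Longrightarrow> \<xi> b \<le> c"
  by (simp_all add: elliptic_def del: split_paired_All)

lemma rate_bounds:
  assumes "elliptic c \<xi>" "c \<ge> 1"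
  shows "0 < rate \<xi> x s" "rate \<xi> x s \<le> c"
proof -
  have "0 < 1 / c" using assms(2) by simp
  then have "0 < \<xi> b" for b using ellipticD(1)[OF assms(1), of b] by linarith
  then show "0 < rate \<xi> x s" "rate \<xi> x s \<le> c"
    using ellipticD(2)[OF assms(1)] by (simp_all add: rate_def)
qed

lemma elliptic_pos: "elliptic c \<xi> \<Longrightarrow> c \<ge> 1 \<Longrightarrow> \<xi> b > 0"
  using ellipticD(1)[of c \<xi> b] by (smt (verit) divide_pos_pos)

lemma card_dir: "card (UNIV :: 'd::finite dir set) = 2 * CARD('d)"
  by simp

lemma total_rate_bounds:
  fixes \<xi> :: "'d::finite env"
  assumes "elliptic c \<xi>" "c \<ge> 1"
  shows "0 < total_rate \<xi> x" "total_rate \<xi> x \<le> 2 * real CARD('d) * c"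
proof -
  show "0 < total_rate \<xi> x" unfolding total_rate_def
    by (intro sum_pos) (auto simp: rate_bounds[OF assms])
  have "total_rate \<xi> x \<le> (\<Sum>s\<in>(UNIV :: 'd dir set). c)" unfolding total_rate_def
    by (intro sum_mono rate_bounds[OF assms])
  then show "total_rate \<xi> x \<le> 2 * real CARD('d) * c" by (simp add: card_dir)
qed

lemma lazy_mono:
  fixes \<xi> :: "'d::finite env"
  assumes "elliptic c \<xi>" "c \<ge> 1" "2 * real CARD('d) * c \<le> l" "\<And>x. f x \<le> g x"
  shows "lazy l \<xi> f x \<le> lazy l \<xi> g x"
proof -
  have "0 < 2 * real CARD('d) * c" using assms(2) by simp
  then have "l > 0" using assms(3) by linarith
  then have "total_rate \<xi> x / l \<le> 1" using total_rate_bounds(2)[OF assms(1,2), of x] assms(3) by simp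
  then show ?thesis
    unfolding lazy_eq_rate using assms(4) \<open>l > 0\<close> rate_bounds(1)[OF assms(1,2)]
    by (intro add_mono mult_left_mono sum_mono) (auto intro!: divide_nonneg_pos simp: less_imp_le)
qed

lemma lazyn_mono:
  fixes \<xi> :: "'d::finite env"
  assumes "elliptic c \<xi>" "c \<ge> 1" "2 * real CARD('d) * c \<le> l" "\<And>x. f x \<le> g x"
  shows "lazyn l \<xi> n f x \<le> lazyn l \<xi> n g x"
  by (induction n arbitrary: x) (auto simp: assms(4) intro!: lazy_mono[OF assms(1-3)])

text \<open>Finite speed of propagation: a step reads only bonds named by sites at distance at most
  1 from the current site, and moves by at most 1.\<close>

lemma lazyn_local:
  assumes "\<And>y i. (\<And>k. \<bar>y $ k - x $ k\<bar> \<le> int n) \<Longrightarrow> \<xi> (y, i) = \<xi>' (y, i)"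
  shows "lazyn l \<xi> n f x = lazyn l \<xi>' n f x"
  using assms
proof (induction n arbitrary: x)
  case (Suc n)
  have u: "\<bar>unit_site i $ k\<bar> \<le> 1" for i k :: 'a by (simp add: unit_site_def axis_def)
  have near: "lazyn l \<xi> n f z = lazyn l \<xi>' n f z" if "\<And>k. \<bar>z $ k - x $ k\<bar> \<le> 1" for z
  proof (rule Suc.IH)
    fix y i assume y: "\<And>k. \<bar>y $ k - z $ k\<bar> \<le> int n"
    have "\<bar>y $ k - x $ k\<bar> \<le> int (Suc n)" for k using y[of k] that[of k] by simp
    then show "\<xi> (y, i) = \<xi>' (y, i)" by (rule Suc.prems)
  qed
  have r: "rate \<xi> x s = rate \<xi>' x s" for s
    unfolding rate_def using u by (auto intro!: Suc.prems order_trans[OF u])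
  have sh: "\<bar>(x + shift s) $ k - x $ k\<bar> \<le> 1" for s k by (simp add: shift_def u)
  show ?case
    by (simp only: funpow.simps o_apply lazy_eq_rate[of l _ "(_ ^^ _) _"] total_rate_def r near[OF sh] near[of x] diff_self abs_zero)
qed simp

definition env_shift :: "'d::finite site \<Rightarrow> 'd env \<Rightarrow> 'd env" where
  "env_shift z \<xi> = (\<lambda>(x, i). \<xi> (x + z, i))"

lemma gen_env_shift: "gen (env_shift z \<xi>) (\<lambda>x. f (x + z)) x = gen \<xi> f (x + z)"
  by (simp add: gen_eq_sum env_shift_def algebra_simps)

lemma lazyn_env_shift: "lazyn l (env_shift z \<xi>) n (\<lambda>x. f (x + z)) = (\<lambda>x. lazyn l \<xi> n f (x + z))"
  by (induction n) (auto simp: lazy_def gen_env_shift)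

lemma elliptic_env_shift: "elliptic c \<xi> \<Longrightarrow> elliptic c (env_shift z \<xi>)"
  by (auto simp: elliptic_def env_shift_def)

lemma elliptic_periodize: "elliptic c \<xi> \<Longrightarrow> elliptic c (periodize N \<xi>)"
  by (auto simp: elliptic_def periodize_def)

lemma periodic_periodize: "periodic N (\<lambda>x. periodize N \<xi> (x, i))"
  by (simp add: periodic_def periodize_def)

section \<open>Reversibility and mean square displacements in a periodic environment\<close>

section \<open>Periodic environments\<close>

text \<open>With \<open>l\<close> at least 2 d c the operator \<open>K\<close> is stochastic; the
  factor 4 makes it also positive semidefinite on periodic functions, see
  \<open>K_psd\<close>.\<close>

locale torus_env =
  fixes N :: nat and c l :: real and \<xi> :: "'d::finite env"
  assumes N: "N > 0" and c: "c \<ge> 1" and ell: "elliptic c \<xi>"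
    and per: "\<And>i. periodic N (\<lambda>x. \<xi> (x, i))" and l: "4 * real CARD('d) * c \<le> l"
begin

abbreviation "T \<equiv> torus N :: 'd site set"
abbreviation "K \<equiv> lazy l \<xi>"

lemma l2: "2 * real CARD('d) * c \<le> l"
proof -
  have "2 * real CARD('d) * c \<le> 4 * real CARD('d) * c" using c by (intro mult_right_mono) auto
  then show ?thesis using l by linarith
qed

lemma l_pos: "l > 0"
proof -
  have "0 < 4 * real CARD('d) * c" using c by simp
  then show ?thesis using l by linarith
qed

lemma pos: "\<xi> b > 0" using elliptic_pos[OF ell c] .

lemma periodic_gen: "(\<And>i. periodic N (nab f i)) \<Longrightarrow> periodic N (gen \<xi> f)"
  unfolding gen_def by (intro periodic_dv periodic_intros per)

lemma periodic_K: "periodic N f \<Longrightarrow> periodic N (K f)"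
  unfolding lazy_def[abs_def] by (intro periodic_intros periodic_gen periodic_nab)

lemma periodic_Kn: "periodic N f \<Longrightarrow> periodic N ((K ^^ n) f)"
  by (induction n) (auto intro: periodic_K)

definition dform :: "('d site \<Rightarrow> real) \<Rightarrow> ('d site \<Rightarrow> real) \<Rightarrow> real" where
  "dform f g = (\<Sum>x\<in>T. \<Sum>i\<in>UNIV. \<xi> (x, i) * nab f i x * nab g i x)"

lemma dform_commute: "dform f g = dform g f"
  by (simp add: dform_def mult_ac)

lemma dform_nonneg: "dform f f \<ge> 0"
  unfolding dform_def by (intro sum_nonneg) (auto simp: mult.assoc less_imp_le[OF pos])

lemma sum_gen:
  assumes "periodic N f" "\<And>i. periodic N (nab g i)"
  shows "(\<Sum>x\<in>T. f x * gen \<xi> g x) = - dform f g"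
  unfolding gen_def dform_def
  by (subst torus_sum_by_parts[OF N assms(1)]) (auto intro!: periodic_intros per assms simp: mult_ac)

lemma sum_gen_zero: "(\<And>i. periodic N (nab g i)) \<Longrightarrow> (\<Sum>x\<in>T. gen \<xi> g x) = 0"
  using sum_gen[of "\<lambda>x. 1" g] by (simp add: dform_def nab_def)

lemma K_sym:
  assumes "periodic N f" "periodic N g"
  shows "(\<Sum>x\<in>T. f x * K g x) = (\<Sum>x\<in>T. K f x * g x)"
  using sum_gen[OF assms(1), of g] sum_gen[OF assms(2), of f] dform_commute[of f g] assms
  by (simp add: lazy_def distrib_left distrib_right sum.distrib periodic_nab
      sum_divide_distrib[symmetric] mult.commute[of "gen _ _ _"])

lemma Kn_sym:
  assumes "periodic N f" "periodic N g"
  shows "(\<Sum>x\<in>T. f x * (K ^^ n) g x) = (\<Sum>x\<in>T. (K ^^ n) f x * g x)"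
  using assms
proof (induction n arbitrary: f)
  case (Suc n)
  have "(\<Sum>x\<in>T. f x * (K ^^ Suc n) g x) = (\<Sum>x\<in>T. K f x * (K ^^ n) g x)"
    by (simp add: K_sym Suc.prems periodic_Kn)
  also have "\<dots> = (\<Sum>x\<in>T. (K ^^ n) (K f) x * g x)"
    by (intro Suc periodic_K)
  finally show ?case by (simp only: lazyn_Suc')
qed simp

lemma sum_Kn: "periodic N f \<Longrightarrow> (\<Sum>x\<in>T. (K ^^ n) f x) = (\<Sum>x\<in>T. f x)"
  using Kn_sym[of "\<lambda>x. 1" f n] by simp

subsection \<open>Commutators with a function of periodic gradient\<close>

text \<open>Commutator of \<open>K ^^ n\<close> with multiplication by \<open>g\<close>. It is
  introduced for functions such as linear ones, of which only the gradient is periodic: the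
  commutator applied to a periodic \<open>f\<close> is again periodic, although \<open>g * f\<close>
  is not.\<close>

definition comm :: "nat \<Rightarrow> ('d site \<Rightarrow> real) \<Rightarrow> ('d site \<Rightarrow> real) \<Rightarrow> 'd site \<Rightarrow> real" where
  "comm n g f x = (K ^^ n) (\<lambda>y. g y * f y) x - g x * (K ^^ n) f x"

lemma comm_1: "comm 1 g f = (\<lambda>x. (\<Sum>i\<in>UNIV. \<xi> (x, i) * nab g i x * f (x + unit_site i)
    - \<xi> (x - unit_site i, i) * nab g i (x - unit_site i) * f (x - unit_site i)) / l)"
proof
  fix x
  have "comm 1 g f x = (gen \<xi> (\<lambda>y. g y * f y) x - g x * gen \<xi> f x) / l"
    by (simp add: comm_def lazy_def distrib_left diff_divide_distrib)
  also have "gen \<xi> (\<lambda>y. g y * f y) x - g x * gen \<xi> f x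
    = (\<Sum>i\<in>UNIV. \<xi> (x, i) * nab g i x * f (x + unit_site i)
    - \<xi> (x - unit_site i, i) * nab g i (x - unit_site i) * f (x - unit_site i))"
    unfolding gen_eq_sum sum_distrib_left sum_subtractf[symmetric]
    by (intro sum.cong refl) (simp add: nab_def algebra_simps)
  finally show "comm 1 g f x = (\<Sum>i\<in>UNIV. \<xi> (x, i) * nab g i x * f (x + unit_site i)
    - \<xi> (x - unit_site i, i) * nab g i (x - unit_site i) * f (x - unit_site i)) / l" .
qed

lemma comm_Suc: "comm (Suc n) g f x = K (comm n g f) x + comm 1 g ((K ^^ n) f) x"
proof -
  have "comm n g f = (\<lambda>x. (K ^^ n) (\<lambda>y. g y * f y) x - g x * (K ^^ n) f x)"
    by (auto simp: comm_def)
  then have "K (comm n g f) x = K ((K ^^ n) (\<lambda>y. g y * f y)) x - K (\<lambda>y. g y * (K ^^ n) f y) x"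
    using lazyn_diff[of 1 l \<xi> "(K ^^ n) (\<lambda>y. g y * f y)" "\<lambda>y. g y * (K ^^ n) f y"] by simp
  then show ?thesis by (simp add: comm_def)
qed

lemma comm_Suc': "comm (Suc n) g f x = comm n g (K f) x + (K ^^ n) (comm 1 g f) x"
proof -
  have "comm 1 g f = (\<lambda>x. K (\<lambda>y. g y * f y) x - g x * K f x)" by (auto simp: comm_def)
  then have "(K ^^ n) (comm 1 g f) x = (K ^^ n) (K (\<lambda>y. g y * f y)) x - (K ^^ n) (\<lambda>y. g y * K f y) x"
    by (simp add: lazyn_diff)
  then show ?thesis by (simp add: comm_def lazyn_Suc' del: funpow.simps)
qed

lemma periodic_comm_1:
  assumes "\<And>i. periodic N (nab g i)" "periodic N f"
  shows "periodic N (comm 1 g f)"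
proof -
  have "periodic N (\<lambda>x. \<xi> (x - unit_site i, i))" for i
    using periodic_shift(2)[OF per] .
  then show ?thesis unfolding comm_1 by (intro periodic_intros assms per)
qed

lemma periodic_comm:
  assumes "\<And>i. periodic N (nab g i)" "periodic N f"
  shows "periodic N (comm n g f)"
proof (induction n)
  case 0
  then show ?case by (simp add: comm_def[abs_def])
next
  case (Suc n)
  then show ?case unfolding comm_Suc[abs_def]
    by (intro periodic_intros periodic_K periodic_comm_1 periodic_Kn assms)
qed

text \<open>A symmetric operator has antisymmetric commutators, but this cannot be read off
  \<open>K_sym\<close> because \<open>g * f\<close> is not periodic. The one-step commutator
  involves only the gradient of \<open>g\<close>, which changes sign when a bond is traversed
  backwards.\<close>

lemma comm_1_antisym:
  assumes "\<And>i. periodic N (nab g i)" "periodic N f" "periodic N h"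
  shows "(\<Sum>x\<in>T. h x * comm 1 g f x) = - (\<Sum>x\<in>T. f x * comm 1 g h x)"
proof -
  have per': "periodic N (\<lambda>x. \<xi> (x - unit_site i, i))" for i
    using periodic_shift(2)[OF per] .
  have *: "(\<Sum>x\<in>T. h x * comm 1 g f x) =
    (\<Sum>i\<in>UNIV. \<Sum>x\<in>T. \<xi> (x, i) * nab g i x * (h x * f (x + unit_site i) - h (x + unit_site i) * f x)) / l"
    if "periodic N f" "periodic N h" for f h
  proof -
    have "(\<Sum>x\<in>T. h x * comm 1 g f x) = (\<Sum>x\<in>T. \<Sum>i\<in>UNIV. h x * (\<xi> (x, i) * nab g i x * f (x + unit_site i))
       - h x * (\<xi> (x - unit_site i, i) * nab g i (x - unit_site i) * f (x - unit_site i))) / l"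
      unfolding comm_1 by (simp add: sum_distrib_left sum_divide_distrib right_diff_distrib)
    also have "(\<Sum>x\<in>T. \<Sum>i\<in>UNIV. h x * (\<xi> (x, i) * nab g i x * f (x + unit_site i))
       - h x * (\<xi> (x - unit_site i, i) * nab g i (x - unit_site i) * f (x - unit_site i)))
      = (\<Sum>i\<in>UNIV. (\<Sum>x\<in>T. h x * (\<xi> (x, i) * nab g i x * f (x + unit_site i)))
       - (\<Sum>x\<in>T. h x * (\<xi> (x - unit_site i, i) * nab g i (x - unit_site i) * f (x - unit_site i))))"
      by (subst sum.swap) (simp add: sum_subtractf)
    also have "\<dots> = (\<Sum>i\<in>UNIV. (\<Sum>x\<in>T. h x * (\<xi> (x, i) * nab g i x * f (x + unit_site i)))
       - (\<Sum>x\<in>T. h (x + unit_site i) * (\<xi> (x, i) * nab g i x * f x)))"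
    proof -
      have "(\<Sum>x\<in>T. h x * (\<xi> (x - unit_site i, i) * nab g i (x - unit_site i) * f (x - unit_site i)))
        = (\<Sum>x\<in>T. h (x + unit_site i) * (\<xi> (x, i) * nab g i x * f x))" for i
        using torus_sum_shift[OF N, of "\<lambda>x. h x * (\<xi> (x - unit_site i, i) * nab g i (x - unit_site i) * f (x - unit_site i))" "unit_site i"]
        by (simp add: periodic_intros assms(1) that per')
      then show ?thesis by simp
    qed
    finally show ?thesis by (simp add: algebra_simps sum_subtractf)
  qed
  show ?thesis unfolding *[OF assms(2,3)] *[OF assms(3,2)]
    unfolding minus_divide_left sum_negf[symmetric] by (simp add: algebra_simps)
qed

text \<open>\<open>comm_Suc\<close> and \<open>comm_Suc'\<close> split the power at opposite ends,
  and the symmetry of \<open>K\<close> carries one decomposition into the other.\<close>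

lemma comm_antisym:
  assumes "\<And>i. periodic N (nab g i)" "periodic N f" "periodic N h"
  shows "(\<Sum>x\<in>T. h x * comm n g f x) = - (\<Sum>x\<in>T. f x * comm n g h x)"
  using assms(2,3)
proof (induction n arbitrary: f h)
  case 0
  then show ?case by (simp add: comm_def)
next
  case (Suc n)
  have "(\<Sum>x\<in>T. h x * comm (Suc n) g f x)
    = (\<Sum>x\<in>T. h x * K (comm n g f) x) + (\<Sum>x\<in>T. h x * comm 1 g ((K ^^ n) f) x)"
    by (simp only: comm_Suc distrib_left sum.distrib)
  also have "(\<Sum>x\<in>T. h x * K (comm n g f) x) = - (\<Sum>x\<in>T. f x * comm n g (K h) x)"
    using Suc by (subst K_sym) (auto intro!: periodic_comm assms periodic_K)
  also have "(\<Sum>x\<in>T. h x * comm 1 g ((K ^^ n) f) x) = - (\<Sum>x\<in>T. (K ^^ n) f x * comm 1 g h x)"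
    using Suc.prems by (intro comm_1_antisym assms periodic_Kn)
  also have "(\<Sum>x\<in>T. (K ^^ n) f x * comm 1 g h x) = (\<Sum>x\<in>T. f x * (K ^^ n) (comm 1 g h) x)"
    using Suc.prems by (intro Kn_sym[symmetric] periodic_comm_1 assms)
  finally show ?case by (simp add: comm_Suc' distrib_left sum.distrib)
qed

lemma sum_comm:
  assumes "\<And>i. periodic N (nab g i)" "periodic N f"
  shows "(\<Sum>x\<in>T. comm n g f x) = - (\<Sum>x\<in>T. f x * ((K ^^ n) g x - g x))"
  using comm_antisym[OF assms(1,2), where h = "\<lambda>x. 1" and n = n] by (simp add: comm_def)

subsection \<open>Mean squares averaged over the starting point\<close>

text \<open>Mean square increment of \<open>W\<close> over \<open>n\<close> steps of the chain
  started at \<open>x\<close>; for \<open>W = lin v\<close> this is the mean square displacement in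
  direction \<open>v\<close>.\<close>

definition msq :: "nat \<Rightarrow> ('d site \<Rightarrow> real) \<Rightarrow> 'd site \<Rightarrow> real" where
  "msq n W x = (K ^^ n) (\<lambda>y. (W y - W x)\<^sup>2) x"

lemma gen_square:
  "gen \<xi> (\<lambda>y. (W y - a)\<^sup>2) x = gen \<xi> (\<lambda>y. (W y - W x)\<^sup>2) x + 2 * (W x - a) * gen \<xi> W x"
  unfolding gen_eq_rate sum_distrib_left sum.distrib[symmetric]
  by (intro sum.cong refl) (simp add: power2_eq_square algebra_simps)

lemma sum_gen_square:
  assumes "\<And>i. periodic N (nab W i)"
  shows "(\<Sum>x\<in>T. gen \<xi> (\<lambda>y. (W y - W x)\<^sup>2) x) = 2 * dform W W"
proof -
  have "(\<Sum>x\<in>T. gen \<xi> (\<lambda>y. (W y - W x)\<^sup>2) x)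
    = (\<Sum>i\<in>UNIV. (\<Sum>x\<in>T. \<xi> (x, i) * (nab W i x)\<^sup>2) + (\<Sum>x\<in>T. \<xi> (x - unit_site i, i) * (nab W i (x - unit_site i))\<^sup>2))"
    unfolding gen_eq_sum by (subst sum.swap) (simp add: sum.distrib nab_def power2_commute)
  also have "\<dots> = (\<Sum>i\<in>UNIV. 2 * (\<Sum>x\<in>T. \<xi> (x, i) * (nab W i x)\<^sup>2))"
    using torus_sum_shift_diff[OF N, of "\<lambda>x. \<xi> (x, _) * (nab W _ x)\<^sup>2"]
    by (simp add: periodic_intros per assms)
  also have "\<dots> = 2 * (\<Sum>x\<in>T. \<Sum>i\<in>UNIV. \<xi> (x, i) * (nab W i x)\<^sup>2)"
    by (subst sum.swap) (simp add: sum_distrib_left)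
  finally show ?thesis by (simp add: dform_def power2_eq_square mult.assoc)
qed

lemma periodic_gen_square:
  assumes "\<And>i. periodic N (nab W i)"
  shows "periodic N (\<lambda>x. gen \<xi> (\<lambda>y. (W y - W x)\<^sup>2) x)"
proof -
  have "periodic N (\<lambda>x. \<xi> (x - unit_site i, i))" for i
    using periodic_shift(2)[OF per] .
  moreover have "gen \<xi> (\<lambda>y. (W y - W x)\<^sup>2) x = (\<Sum>i\<in>UNIV. \<xi> (x, i) * (nab W i x)\<^sup>2
     + \<xi> (x - unit_site i, i) * (nab W i (x - unit_site i))\<^sup>2)" for x
    unfolding gen_eq_sum by (simp add: nab_def power2_commute)
  ultimately show ?thesis by (simp add: periodic_intros per assms)
qed

text \<open>One more step adds the local energy at the current point and twice the increment so far
  times the drift; the expectation of that product is a commutator.\<close>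

lemma msq_Suc: "msq (Suc n) W x = msq n W x + (K ^^ n) (\<lambda>x. gen \<xi> (\<lambda>y. (W y - W x)\<^sup>2) x) x / l
    + 2 / l * comm n W (gen \<xi> W) x"
proof -
  let ?g = "\<lambda>x. gen \<xi> (\<lambda>y. (W y - W x)\<^sup>2) x"
  have "K (\<lambda>y. (W y - W x)\<^sup>2) z = ((W z - W x)\<^sup>2 + (1 / l) * ?g z)
      + (2 / l) * (W z * gen \<xi> W z - W x * gen \<xi> W z)" for z
    unfolding lazy_def gen_square[where a = "W x"] using l_pos by (simp add: field_simps)
  then have "K (\<lambda>y. (W y - W x)\<^sup>2) = (\<lambda>z. ((W z - W x)\<^sup>2 + (1 / l) * ?g z)
      + (2 / l) * (W z * gen \<xi> W z - W x * gen \<xi> W z))" by (rule ext)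
  then have "msq (Suc n) W x = (K ^^ n) (\<lambda>z. ((W z - W x)\<^sup>2 + (1 / l) * ?g z)
      + (2 / l) * (W z * gen \<xi> W z - W x * gen \<xi> W z)) x"
    by (simp only: msq_def lazyn_Suc')
  then show ?thesis
    unfolding lazyn_add lazyn_cmult lazyn_diff by (simp add: msq_def comm_def lazyn_cmult)
qed

lemma Kn_diff: "(K ^^ n) g x - g x = (\<Sum>k<n. (K ^^ k) (gen \<xi> g) x) / l"
proof (induction n)
  case (Suc n)
  have "K g = (\<lambda>x. g x + (1 / l) * gen \<xi> g x)" by (auto simp: lazy_def)
  then have "(K ^^ Suc n) g x = (K ^^ n) g x + (1 / l) * (K ^^ n) (gen \<xi> g) x"
    by (simp only: lazyn_Suc' lazyn_add lazyn_cmult)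
  then show ?case using Suc by (simp add: add_divide_distrib)
qed simp

text \<open>Averaged over the starting point, one step contributes twice the energy minus
  autocorrelations of the drift \<open>gen \<xi> W\<close>, up to powers of \<open>l\<close>. The
  autocorrelations appear when \<open>sum_comm\<close> and \<open>Kn_diff\<close> evaluate the
  commutator of \<open>msq_Suc\<close>.\<close>

lemma sum_msq_Suc:
  assumes "\<And>i. periodic N (nab W i)"
  shows "(\<Sum>x\<in>T. msq (Suc n) W x) = (\<Sum>x\<in>T. msq n W x) + 2 * dform W W / l
    - 2 / l\<^sup>2 * (\<Sum>k<n. \<Sum>x\<in>T. gen \<xi> W x * (K ^^ k) (gen \<xi> W) x)"
proof -
  have "(\<Sum>x\<in>T. comm n W (gen \<xi> W) x) = - (\<Sum>x\<in>T. gen \<xi> W x * ((\<Sum>k<n. (K ^^ k) (gen \<xi> W) x) / l))"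
    using assms by (subst sum_comm) (simp_all add: periodic_gen Kn_diff)
  also have "\<dots> = - (\<Sum>k<n. \<Sum>x\<in>T. gen \<xi> W x * (K ^^ k) (gen \<xi> W) x) / l"
    by (subst sum.swap) (simp add: sum_distrib_left sum_divide_distrib)
  finally show ?thesis
    using sum_Kn[OF periodic_gen_square[OF assms], of n] sum_gen_square[OF assms]
    by (simp add: msq_Suc sum.distrib sum_divide_distrib[symmetric] sum_distrib_left[symmetric] power2_eq_square)
qed

lemma dform_le:
  assumes "periodic N h"
  shows "dform h h \<le> l * (\<Sum>x\<in>T. (h x)\<^sup>2)"
proof -
  have "dform h h \<le> (\<Sum>x\<in>T. \<Sum>i\<in>UNIV. 2 * c * (h (x + unit_site i))\<^sup>2 + 2 * c * (h x)\<^sup>2)"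
    unfolding dform_def
  proof (intro sum_mono)
    fix x i
    have "\<xi> (x, i) * nab h i x * nab h i x \<le> c * (nab h i x)\<^sup>2"
      using ellipticD(2)[OF ell] by (simp add: power2_eq_square mult.assoc mult_right_mono)
    also have "\<dots> \<le> c * (2 * (h (x + unit_site i))\<^sup>2 + 2 * (h x)\<^sup>2)"
      using c sum_squares_ge_zero[of "h (x + unit_site i) + h x" 0]
      by (intro mult_left_mono) (auto simp: nab_def power2_eq_square algebra_simps)
    finally show "\<xi> (x, i) * nab h i x * nab h i x \<le> 2 * c * (h (x + unit_site i))\<^sup>2 + 2 * c * (h x)\<^sup>2"
      by (simp add: algebra_simps)
  qed
  also have "\<dots> = (\<Sum>i\<in>(UNIV :: 'd set). 2 * c * (\<Sum>x\<in>T. (h (x + unit_site i))\<^sup>2) + 2 * c * (\<Sum>x\<in>T. (h x)\<^sup>2))"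
    by (subst sum.swap) (simp add: sum.distrib sum_distrib_left)
  also have "\<dots> = 4 * real CARD('d) * c * (\<Sum>x\<in>T. (h x)\<^sup>2)"
    using torus_sum_shift[OF N, of "\<lambda>x. (h x)\<^sup>2"] assms by (simp add: periodic_power)
  also have "\<dots> \<le> l * (\<Sum>x\<in>T. (h x)\<^sup>2)"
    by (intro mult_right_mono l sum_nonneg) auto
  finally show ?thesis .
qed

text \<open>\<open>dform_le\<close> bounds the negative generator from above by \<open>l\<close> as
  a quadratic form, so \<open>1 + gen / l\<close> has no negative eigenvalue.\<close>

lemma K_psd:
  assumes "periodic N h" shows "(\<Sum>x\<in>T. h x * K h x) \<ge> 0"
proof -
  have "(\<Sum>x\<in>T. h x * K h x) = (\<Sum>x\<in>T. (h x)\<^sup>2) - dform h h / l"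
    using sum_gen[OF assms, of h] assms
    by (simp add: lazy_def distrib_left sum.distrib sum_divide_distrib[symmetric] power2_eq_square periodic_nab)
  moreover have "dform h h / l \<le> (\<Sum>x\<in>T. (h x)\<^sup>2)"
    using dform_le[OF assms] l_pos by (simp add: pos_divide_le_eq mult.commute)
  ultimately show ?thesis by linarith
qed

text \<open>Symmetry moves half of the power to the other side: an even power leaves a square, an
  odd one leaves \<open>K\<close> between equal factors.\<close>

lemma Kn_psd:
  assumes "periodic N h" shows "(\<Sum>x\<in>T. h x * (K ^^ n) h x) \<ge> 0"
proof -
  have "(\<Sum>x\<in>T. h x * (K ^^ (m + k)) h x) = (\<Sum>x\<in>T. (K ^^ m) h x * (K ^^ k) h x)" for m k
    using Kn_sym[OF assms periodic_Kn[OF assms, of k], of m] by (simp add: funpow_add)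
  note * = this
  show ?thesis
  proof (cases "even n")
    case True
    then obtain m where "n = m + m" by (auto elim!: evenE simp: mult_2)
    then show ?thesis using *[of m m] by (simp add: sum_nonneg)
  next
    case False
    then obtain m where "n = m + Suc m" by (auto elim!: oddE simp: mult_2)
    then show ?thesis using *[of m "Suc m"] K_psd[OF periodic_Kn[OF assms, of m]] by simp
  qed
qed

text \<open>The autocorrelations of the drift enter with a minus sign and are nonnegative by
  \<open>Kn_psd\<close>; dropping them bounds the mean square by the energy of
  \<open>W\<close>.\<close>

lemma sum_msq_le:
  assumes "\<And>i. periodic N (nab W i)"
  shows "(\<Sum>x\<in>T. msq n W x) \<le> real n * (2 * dform W W / l)"
proof (induction n)
  case (Suc n)
  have "0 \<le> 2 / l\<^sup>2 * (\<Sum>k<n. \<Sum>x\<in>T. gen \<xi> W x * (K ^^ k) (gen \<xi> W) x)"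
    using l_pos by (intro mult_nonneg_nonneg sum_nonneg[of "{..<n}"] Kn_psd periodic_gen assms) auto
  then have "(\<Sum>x\<in>T. msq (Suc n) W x) \<le> real n * (2 * dform W W / l) + 2 * dform W W / l"
    using Suc sum_msq_Suc[OF assms, of n] by linarith
  then show ?case by (simp only: of_nat_Suc distrib_right mult_1 add.commute)
qed (simp add: msq_def)

lemma sum_msq_harmonic:
  assumes "\<And>i. periodic N (nab W i)" "\<And>x. gen \<xi> W x = 0"
  shows "(\<Sum>x\<in>T. msq n W x) = real n * (2 * dform W W / l)"
  using assms(2) by (induction n) (auto simp: sum_msq_Suc[OF assms(1)] msq_def[of 0] algebra_simps add_divide_distrib)

lemma msq_nonneg: "msq n W x \<ge> 0"
  using lazyn_mono[OF ell c l2, of "\<lambda>x. 0" "\<lambda>y. (W y - W x)\<^sup>2" n x] by (simp add: msq_def)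

text \<open>Along the chain a harmonic \<open>U\<close> is a martingale. By reversibility its
  increments are, on average over the starting point, orthogonal to those of a periodic
  \<open>f\<close>: the cross term is \<open>comm n U f\<close>, which sums to zero. Subtracting
  \<open>f\<close> can therefore only increase the mean square.\<close>

lemma sum_msq_ge:
  assumes U: "\<And>i. periodic N (nab U i)" "\<And>x. gen \<xi> U x = 0" and f: "periodic N f"
  shows "real n * (2 * dform U U / l) \<le> (\<Sum>x\<in>T. msq n (\<lambda>x. U x - f x) x)"
proof -
  have "msq n (\<lambda>x. U x - f x) x = msq n U x - 2 * (comm n U f x - f x * ((K ^^ n) U x - U x)) + msq n f x" for x
  proof -
    have "(\<lambda>y. (U y - f y - (U x - f x))\<^sup>2) = (\<lambda>y. ((U y - U x)\<^sup>2
        - 2 * ((U y * f y - U x * f y) - f x * (U y - U x))) + (f y - f x)\<^sup>2)"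
      by (auto simp: power2_eq_square algebra_simps)
    then show ?thesis
      unfolding msq_def comm_def by (simp add: lazyn_add lazyn_diff lazyn_cmult)
  qed
  then have "msq n (\<lambda>x. U x - f x) x = msq n U x - 2 * comm n U f x + msq n f x" for x
    using lazyn_fix[of l \<xi> U n] U(2) l_pos by simp
  then have "(\<Sum>x\<in>T. msq n (\<lambda>x. U x - f x) x)
      = (\<Sum>x\<in>T. msq n U x) - 2 * (\<Sum>x\<in>T. comm n U f x) + (\<Sum>x\<in>T. msq n f x)"
    by (simp add: sum.distrib sum_subtractf sum_distrib_left)
  also have "(\<Sum>x\<in>T. comm n U f x) = 0"
    using lazyn_fix[of l \<xi> U n] U(2) l_pos by (simp add: sum_comm[OF U(1) f])
  finally show ?thesis
    using sum_nonneg[of T "msq n f"] msq_nonneg by (simp add: sum_msq_harmonic[OF U])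
qed

lemma sum_msq_periodic_le:
  assumes "periodic N f"
  shows "(\<Sum>x\<in>T. msq n f x) \<le> 4 * (\<Sum>x\<in>T. (f x)\<^sup>2)"
proof -
  have "msq n f x \<le> 2 * (K ^^ n) (\<lambda>y. (f y)\<^sup>2) x + 2 * (f x)\<^sup>2" for x
  proof -
    have "(f y - f x)\<^sup>2 \<le> 2 * (f y)\<^sup>2 + 2 * (f x)\<^sup>2" for y
      using sum_squares_ge_zero[of "f y + f x" 0] by (simp add: power2_eq_square algebra_simps)
    from lazyn_mono[OF ell c l2 this, where n = n and x = x] show ?thesis
      by (simp add: msq_def lazyn_add lazyn_cmult)
  qed
  then have "(\<Sum>x\<in>T. msq n f x) \<le> (\<Sum>x\<in>T. 2 * (K ^^ n) (\<lambda>y. (f y)\<^sup>2) x + 2 * (f x)\<^sup>2)"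
    by (intro sum_mono)
  also have "\<dots> = 4 * (\<Sum>x\<in>T. (f x)\<^sup>2)"
    using sum_Kn[OF periodic_power[OF assms, of 2], of n]
    by (simp add: sum.distrib sum_distrib_left[symmetric])
  finally show ?thesis .
qed

lemma msq_split:
  assumes "\<epsilon> > 0"
  shows "msq n (\<lambda>x. W x - f x) x \<le> (1 + \<epsilon>) * msq n W x + (1 + 1 / \<epsilon>) * msq n f x"
proof -
  have "((W y - f y) - (W x - f x))\<^sup>2 \<le> (1 + \<epsilon>) * (W y - W x)\<^sup>2 + (1 + 1 / \<epsilon>) * (f y - f x)\<^sup>2" for y
  proof -
    define a b where "a = W y - W x" and "b = f y - f x"
    have "0 \<le> (\<epsilon> * a + b)\<^sup>2 / \<epsilon>" using assms by simp
    then have "- (2 * a * b) \<le> \<epsilon> * a\<^sup>2 + b\<^sup>2 / \<epsilon>"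
      using assms by (simp add: power2_eq_square field_simps)
    then have "(a - b)\<^sup>2 \<le> (1 + \<epsilon>) * a\<^sup>2 + (1 + 1 / \<epsilon>) * b\<^sup>2"
      by (simp add: power2_eq_square algebra_simps)
    then show ?thesis by (simp add: a_def b_def algebra_simps)
  qed
  from lazyn_mono[OF ell c l2 this, where n = n and x = x] show ?thesis
    by (simp add: msq_def lazyn_add lazyn_cmult)
qed

end

section \<open>The law of the walk, from exponential clocks to the semigroup\<close>

section \<open>The first jump\<close>

abbreviation "expm \<equiv> density lborel (\<lambda>r. ennreal (exponential_density 1 r))"

lemma prob_space_expm: "prob_space expm"
  using prob_space_exponential_density[of 1] by simp

lemma space_clocks_measure [simp]: "space (clocks_measure :: 'd::finite clocks measure) = UNIV"
  by (simp add: clocks_measure_def space_PiM)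

lemma prob_space_clocks_measure: "prob_space (clocks_measure :: 'd::finite clocks measure)"
  unfolding clocks_measure_def by (intro prob_space_PiM prob_space_expm)

lemma clock_measurable: "(\<lambda>w. w s) \<in> borel_measurable (clocks_measure :: 'd::finite clocks measure)"
  unfolding clocks_measure_def by measurable

lemma holding_time_measurable [measurable]: "holding_time \<xi> x \<in> borel_measurable (clocks_measure :: 'd::finite clocks measure)"
proof -
  note clock_measurable [measurable]
  show ?thesis unfolding holding_time_def[abs_def] by measurable
qed

lemma clock_compare_measurable:
  "{w \<in> space (clocks_measure :: 'd::finite clocks measure). w s / a \<le> w t / b} \<in> sets clocks_measure"
  "{w \<in> space (clocks_measure :: 'd::finite clocks measure). w s / a < w t / b} \<in> sets clocks_measure"
  by (intro borel_measurable_le borel_measurable_less borel_measurable_divide clock_measurable borel_measurable_const)+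

text \<open>\<open>arg_min\<close> chooses among the minimisers, so the set of all minimisers is
  shown to be measurable as a map into a finite discrete space; the choice is then an arbitrary
  function on that space.\<close>

lemma first_dir_measurable [measurable]:
  "first_dir \<xi> x \<in> measurable (clocks_measure :: 'd::finite clocks measure) (count_space UNIV)"
proof -
  define M where "M w = {s. \<forall>t. w s / rate \<xi> x s \<le> w t / rate \<xi> x t}" for w :: "'d clocks"
  have "M \<in> measurable clocks_measure (count_space UNIV)"
    unfolding measurable_count_space_eq2[OF finite[of "UNIV :: 'd dir set set"]]
  proof (intro conjI ballI)
    fix S :: "'d dir set"
    define C where "C s = {w \<in> space clocks_measure. \<forall>t\<in>UNIV. w s / rate \<xi> x s \<le> w t / rate \<xi> x t}" for s
    have C: "C s \<in> sets clocks_measure" for s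
      unfolding C_def by (intro sets.sets_Collect_finite_All clock_compare_measurable finite)
    have mem: "s \<in> M w \<longleftrightarrow> w \<in> C s" for s w
      unfolding C_def M_def by simp
    have "M -` {S} \<inter> space clocks_measure = (\<Inter>s\<in>UNIV. if s \<in> S then C s else space clocks_measure - C s)"
    proof (rule set_eqI)
      fix w :: "'d clocks"
      have "w \<in> (if s \<in> S then C s else space clocks_measure - C s) \<longleftrightarrow> (w \<in> C s \<longleftrightarrow> s \<in> S)" for s
        by (cases "s \<in> S") simp_all
      then have "w \<in> (\<Inter>s\<in>UNIV. if s \<in> S then C s else space clocks_measure - C s) \<longleftrightarrow> (\<forall>s. w \<in> C s \<longleftrightarrow> s \<in> S)"
        by blast
      moreover have "M w = S \<longleftrightarrow> (\<forall>s. w \<in> C s \<longleftrightarrow> s \<in> S)"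
        unfolding set_eq_iff mem ..
      ultimately show "w \<in> M -` {S} \<inter> space clocks_measure
          \<longleftrightarrow> w \<in> (\<Inter>s\<in>UNIV. if s \<in> S then C s else space clocks_measure - C s)"
        by simp
    qed
    also have "\<dots> \<in> sets clocks_measure"
      using C sets.compl_sets[OF C] by (intro sets.finite_INT) (auto simp del: split_paired_All)
    finally show "M -` {S} \<inter> space clocks_measure \<in> sets clocks_measure" .
  qed auto
  then have "(\<lambda>w. SOME s. s \<in> M w) \<in> measurable clocks_measure (count_space UNIV)"
    by (rule measurable_compose) simp
  also have "(\<lambda>w. SOME s. s \<in> M w) = first_dir \<xi> x"
    by (auto simp: first_dir_def arg_min_def is_arg_min_linorder M_def)
  finally show ?thesis .
qed

lemma expm_tail:
  assumes "a \<ge> 0" shows "emeasure expm {a<..} = ennreal (exp (- a))"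
proof -
  interpret prob_space expm by (rule prob_space_expm)
  have "distributed expm lborel (\<lambda>x. x) (exponential_density 1)"
    by (auto simp: distributed_def distr_id2)
  from exponential_distributedD_gt[OF this assms] have "prob {x \<in> space expm. a < x} = exp (- a)" by simp
  then show ?thesis by (simp add: emeasure_eq_measure greaterThan_def)
qed

lemma expm_nonneg: "AE r in expm. r \<ge> 0"
  by (subst AE_density) (auto simp: exponential_density_def)

locale rates =
  fixes \<xi> :: "'d::finite env" and c :: real
  assumes c: "c \<ge> 1" and ell: "elliptic c \<xi>"
begin

abbreviation "lam \<equiv> total_rate \<xi>"
abbreviation "r \<equiv> rate \<xi>"

lemma r_pos: "r x s > 0" using rate_bounds(1)[OF ell c] .

lemma lam_pos: "lam x > 0" using total_rate_bounds(1)[OF ell c] .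

text \<open>Strict inequalities make these events disjoint for different \<open>s\<close>;
  \<open>AE_first_is\<close> shows that they exhaust the space up to a null set.\<close>

definition first_is :: "'d site \<Rightarrow> 'd dir \<Rightarrow> 'd clocks set" where
  "first_is x s = {w. \<forall>t. t \<noteq> s \<longrightarrow> w s / r x s < w t / r x t}"

lemma first_is_measurable [measurable]: "first_is x s \<in> sets clocks_measure"
proof -
  have "first_is x s = {w \<in> space clocks_measure. \<forall>t\<in>UNIV - {s}. w s / r x s < w t / r x t}"
    by (simp add: first_is_def Ball_def del: split_paired_All)
  also have "\<dots> \<in> sets clocks_measure"
    by (intro sets.sets_Collect_finite_All clock_compare_measurable finite)
  finally show ?thesis .
qed

lemma first_isD:
  assumes "w \<in> first_is x s"
  shows "first_dir \<xi> x w = s" "holding_time \<xi> x w = w s / r x s"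
proof -
  have *: "w s / r x s < w t / r x t" if "t \<noteq> s" for t using assms that by (simp add: first_is_def del: split_paired_All)
  have le: "w s / r x s \<le> w t / r x t" for t using *[of t] by (cases "t = s") (simp_all add: less_imp_le)
  show "first_dir \<xi> x w = s"
    unfolding first_dir_def arg_min_def
  proof (rule some_equality)
    show "is_arg_min (\<lambda>s. w s / r x s) (\<lambda>_. True) s" unfolding is_arg_min_linorder using le by blast
    fix t assume "is_arg_min (\<lambda>s. w s / r x s) (\<lambda>_. True) t"
    then have "w t / r x t \<le> w s / r x s" unfolding is_arg_min_linorder by blast
    then show "t = s" using *[of t] by (cases "t = s") simp_all
  qed
  show "holding_time \<xi> x w = w s / r x s"
    unfolding holding_time_def
  proof (rule Min_eqI)
    show "w s / r x s \<le> y" if "y \<in> range (\<lambda>s. w s / r x s)" for y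
      using that le by blast
  qed simp_all
qed

text \<open>Competing clocks: given that \<open>s\<close> rings at time \<tau>, independence makes
  all others ring later with probability \<open>exp (- (lam x - r x s) * \<tau>)\<close>. Rescaling
  time by \<open>r x s\<close> turns the standard exponential into the density of the ringing
  time.\<close>

lemma nn_integral_first_is:
  assumes [measurable]: "g \<in> borel_measurable borel"
  shows "(\<integral>\<^sup>+w. g (w s / r x s) * indicator (first_is x s) w \<partial>clocks_measure)
    = (\<integral>\<^sup>+\<tau>. ennreal (r x s * exp (- lam x * \<tau>)) * g \<tau> * indicator {0..} \<tau> \<partial>lborel)"
proof -
  note clock_measurable [measurable]
  interpret P: product_prob_space "\<lambda>_ :: 'd dir. expm" "UNIV"
    by (simp add: product_prob_space_def product_prob_space_axioms_def product_sigma_finite_def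
        prob_space_expm prob_space_imp_sigma_finite)
  let ?I = "UNIV - {s}"
  have I: "finite ?I" "s \<notin> ?I" "insert s ?I = UNIV" by auto
  have [measurable]: "(\<lambda>w. g (w s / r x s) * indicator (first_is x s) w) \<in> borel_measurable (PiM UNIV (\<lambda>_. expm))"
    unfolding clocks_measure_def[symmetric] by measurable
  have "(\<integral>\<^sup>+w. g (w s / r x s) * indicator (first_is x s) w \<partial>clocks_measure)
    = (\<integral>\<^sup>+y. (\<integral>\<^sup>+w. g ((w(s := y)) s / r x s) * indicator (first_is x s) (w(s := y)) \<partial>PiM ?I (\<lambda>_. expm)) \<partial>expm)"
    using P.product_nn_integral_insert_rev[OF I(1,2), of "\<lambda>w. g (w s / r x s) * indicator (first_is x s) w"]
    by (simp add: clocks_measure_def I(3))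
  also have "\<dots> = (\<integral>\<^sup>+y. g (y / r x s) * ennreal (exp (- (lam x * (y / r x s) - y))) \<partial>expm)"
  proof (rule nn_integral_cong_AE)
    show "AE y in expm. (\<integral>\<^sup>+w. g ((w(s := y)) s / r x s) * indicator (first_is x s) (w(s := y)) \<partial>PiM ?I (\<lambda>_. expm))
      = g (y / r x s) * ennreal (exp (- (lam x * (y / r x s) - y)))"
      using expm_nonneg
    proof eventually_elim
      fix y :: real assume y: "y \<ge> 0"
      let ?E = "\<Pi>\<^sub>E t\<in>?I. {r x t * (y / r x s)<..}"
      have [measurable]: "?E \<in> sets (PiM ?I (\<lambda>_. expm))" by (intro sets_PiM_I_finite) auto
      have "(\<integral>\<^sup>+w. g ((w(s := y)) s / r x s) * indicator (first_is x s) (w(s := y)) \<partial>PiM ?I (\<lambda>_. expm))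
        = (\<integral>\<^sup>+w. g (y / r x s) * indicator ?E w \<partial>PiM ?I (\<lambda>_. expm))"
      proof (rule nn_integral_cong)
        fix w assume "w \<in> space (PiM ?I (\<lambda>_. expm))"
        then have "w \<in> extensional ?I" by (simp add: space_PiM PiE_def)
        moreover have "y / r x s < w t / r x t \<longleftrightarrow> r x t * (y / r x s) < w t" for t
          using r_pos[of x t] by (simp add: pos_less_divide_eq mult.commute)
        ultimately have "w(s := y) \<in> first_is x s \<longleftrightarrow> w \<in> ?E"
          by (auto simp: first_is_def PiE_def Pi_def)
        then show "g ((w(s := y)) s / r x s) * indicator (first_is x s) (w(s := y)) = g (y / r x s) * indicator ?E w"
          by (auto simp: indicator_def)
      qed
      also have "\<dots> = g (y / r x s) * emeasure (PiM ?I (\<lambda>_. expm)) ?E"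
        by (rule nn_integral_cmult_indicator) simp
      also have "emeasure (PiM ?I (\<lambda>_. expm)) ?E = (\<Prod>t\<in>?I. emeasure expm {r x t * (y / r x s)<..})"
        by (subst P.emeasure_PiM) auto
      also have "\<dots> = (\<Prod>t\<in>?I. ennreal (exp (- (r x t * (y / r x s)))))"
        using y r_pos by (intro prod.cong refl expm_tail) (simp add: less_imp_le)
      also have "\<dots> = ennreal (exp (- (\<Sum>t\<in>?I. r x t * (y / r x s))))"
        by (simp add: prod_ennreal exp_sum sum_negf flip: exp_sum)
      also have "(\<Sum>t\<in>?I. r x t * (y / r x s)) = lam x * (y / r x s) - y"
        using r_pos[of x s] by (simp add: total_rate_def sum_distrib_right sum_diff1 sum_divide_distrib)
      finally show "(\<integral>\<^sup>+w. g ((w(s := y)) s / r x s) * indicator (first_is x s) (w(s := y)) \<partial>PiM ?I (\<lambda>_. expm))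
        = g (y / r x s) * ennreal (exp (- (lam x * (y / r x s) - y)))" .
    qed
  qed
  also have "\<dots> = (\<integral>\<^sup>+y. ennreal (exponential_density 1 y) * (g (y / r x s) * ennreal (exp (- (lam x * (y / r x s) - y)))) \<partial>lborel)"
    by (subst nn_integral_density) auto
  also have "\<dots> = (\<integral>\<^sup>+y. ennreal (exp (- lam x * (y / r x s))) * g (y / r x s) * indicator {0..} (y / r x s) \<partial>lborel)"
  proof (rule nn_integral_cong)
    fix y :: real
    show "ennreal (exponential_density 1 y) * (g (y / r x s) * ennreal (exp (- (lam x * (y / r x s) - y))))
      = ennreal (exp (- lam x * (y / r x s))) * g (y / r x s) * indicator {0..} (y / r x s)"
    proof (cases "y \<ge> 0")
      case True
      have "ennreal (exp (- y)) * ennreal (exp (- (lam x * (y / r x s) - y))) = ennreal (exp (- lam x * (y / r x s)))"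
        by (simp add: ennreal_mult[symmetric] exp_add[symmetric])
      then have "ennreal (exp (- y)) * (G * ennreal (exp (- (lam x * (y / r x s) - y)))) = ennreal (exp (- lam x * (y / r x s))) * G" for G
        by (metis mult.commute mult.left_commute)
      from this[of "g (y / r x s)"] show ?thesis using True r_pos[of x s] by (simp add: exponential_density_def)
    next
      case False
      then have "y / r x s < 0" using r_pos[of x s] by (simp add: divide_less_0_iff)
      then show ?thesis using False by (simp add: exponential_density_def)
    qed
  qed
  also have "\<dots> = ennreal (r x s) * (\<integral>\<^sup>+\<tau>. ennreal (exp (- lam x * \<tau>)) * g \<tau> * indicator {0..} \<tau> \<partial>lborel)"
    using nn_integral_real_affine[of "\<lambda>y. ennreal (exp (- lam x * (y / r x s))) * g (y / r x s) * indicator {0..} (y / r x s)" "r x s" 0]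
      r_pos[of x s] by (simp add: less_imp_le)
  also have "\<dots> = (\<integral>\<^sup>+\<tau>. ennreal (r x s * exp (- lam x * \<tau>)) * g \<tau> * indicator {0..} \<tau> \<partial>lborel)"
    using r_pos[of x s] by (subst nn_integral_cmult[symmetric]) (auto simp: ennreal_mult less_imp_le mult_ac)
  finally show ?thesis .
qed

lemma nn_integral_exp: "(\<integral>\<^sup>+\<tau>. ennreal (r x s * exp (- lam x * \<tau>)) * 1 * indicator {0..} \<tau> \<partial>lborel) = ennreal (r x s / lam x)"
proof -
  have "(\<integral>\<^sup>+\<tau>. ennreal (r x s * exp (- lam x * \<tau>)) * indicator {0..} \<tau> \<partial>lborel)
    = ennreal (0 - (- (r x s / lam x) * exp (- lam x * 0)))"
  proof (rule nn_integral_FTC_atLeast[where F = "\<lambda>\<tau>. - (r x s / lam x) * exp (- lam x * \<tau>)"])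
    show "((\<lambda>\<tau>. - (r x s / lam x) * exp (- lam x * \<tau>)) \<longlongrightarrow> 0) at_top"
    proof -
      have "((\<lambda>\<tau>. exp (- lam x * \<tau>)) \<longlongrightarrow> 0) at_top"
        by (rule filterlim_compose[OF exp_at_bot filterlim_tendsto_neg_mult_at_bot[OF tendsto_const _ filterlim_ident]])
          (use lam_pos[of x] in simp)
      from tendsto_mult_left[OF this, of "- (r x s / lam x)"] show ?thesis by simp
    qed
    show "DERIV (\<lambda>\<tau>. - (r x s / lam x) * exp (- lam x * \<tau>)) \<tau> :> r x s * exp (- lam x * \<tau>)" for \<tau>
      using lam_pos[of x] by (auto intro!: derivative_eq_intros)
  qed (auto simp: r_pos less_imp_le)
  then show ?thesis by simp
qed

lemma first_is_disjoint: "w \<in> first_is x s \<Longrightarrow> w \<in> first_is x t \<Longrightarrow> s = t"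
  using first_isD(1) by metis

lemma sum_indicator_first_is: "(\<Sum>s\<in>UNIV. indicator (first_is x s) w) = (indicator (\<Union>s. first_is x s) w :: ennreal)"
proof (cases "\<exists>s. w \<in> first_is x s")
  case True
  then obtain s where s: "w \<in> first_is x s" by blast
  have "w \<in> first_is x t \<longleftrightarrow> t = s" for t using s first_is_disjoint by metis
  then have "(\<Sum>t\<in>UNIV. indicator (first_is x t) w) = (1 :: ennreal)" by (simp add: indicator_def)
  moreover have "w \<in> (\<Union>s. first_is x s)" using s by blast
  ultimately show ?thesis by (simp only: indicator_simps)
next
  case False
  then have "w \<notin> first_is x t" for t by blast
  then show ?thesis by (simp add: indicator_def)
qed

text \<open>Ties are excluded by counting mass: the disjoint events \<open>first_is x s\<close> have
  probabilities \<open>r x s / lam x\<close>, which add up to 1.\<close>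

lemma AE_first_is: "AE w in clocks_measure. \<exists>s. w \<in> first_is x s"
proof -
  interpret prob_space "clocks_measure :: 'd clocks measure" by (rule prob_space_clocks_measure)
  have "emeasure clocks_measure (\<Union>s. first_is x s) = (\<integral>\<^sup>+w. (\<Sum>s\<in>UNIV. 1 * indicator (first_is x s) w) \<partial>clocks_measure)"
    unfolding mult_1 sum_indicator_first_is by (subst nn_integral_indicator) auto
  also have "\<dots> = (\<Sum>s\<in>UNIV. \<integral>\<^sup>+w. 1 * indicator (first_is x s) w \<partial>clocks_measure)"
    by (rule nn_integral_sum) auto
  also have "\<dots> = (\<Sum>s\<in>UNIV. ennreal (r x s / lam x))"
    using nn_integral_first_is[of "\<lambda>_. 1" s x for s] nn_integral_exp by simp
  also have "\<dots> = ennreal (\<Sum>s\<in>UNIV. r x s / lam x)"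
    using r_pos lam_pos by (intro sum_ennreal) (auto simp: less_imp_le)
  also have "(\<Sum>s\<in>UNIV. r x s / lam x) = 1"
    using lam_pos[of x] by (simp add: sum_divide_distrib[symmetric] total_rate_def)
  finally have "prob (\<Union>s. first_is x s) = 1" by (simp add: emeasure_eq_measure)
  then have "AE w in clocks_measure. w \<in> (\<Union>s. first_is x s)"
    by (intro prob_eq_1[THEN iffD1]) auto
  then show ?thesis by simp
qed

lemma nn_integral_first_jump:
  assumes [measurable]: "\<And>s. g s \<in> borel_measurable borel"
  shows "(\<integral>\<^sup>+w. g (first_dir \<xi> x w) (holding_time \<xi> x w) \<partial>clocks_measure)
    = (\<Sum>s\<in>UNIV. \<integral>\<^sup>+\<tau>. ennreal (r x s * exp (- lam x * \<tau>)) * g s \<tau> * indicator {0..} \<tau> \<partial>lborel)"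
proof -
  note clock_measurable [measurable]
  have "(\<integral>\<^sup>+w. g (first_dir \<xi> x w) (holding_time \<xi> x w) \<partial>clocks_measure)
    = (\<integral>\<^sup>+w. (\<Sum>s\<in>UNIV. g s (w s / r x s) * indicator (first_is x s) w) \<partial>clocks_measure)"
  proof (rule nn_integral_cong_AE)
    show "AE w in clocks_measure. g (first_dir \<xi> x w) (holding_time \<xi> x w)
      = (\<Sum>s\<in>UNIV. g s (w s / r x s) * indicator (first_is x s) w)"
      using AE_first_is[of x]
    proof eventually_elim
      fix w :: "'d clocks" assume "\<exists>s. w \<in> first_is x s"
      then obtain s where s: "w \<in> first_is x s" by blast
      have "w \<in> first_is x t \<longleftrightarrow> t = s" for t using s first_is_disjoint by metis
      then have "(\<Sum>t\<in>UNIV. g t (w t / r x t) * indicator (first_is x t) w) = (\<Sum>t\<in>UNIV. if t = s then g s (w s / r x s) else 0)"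
        by (intro sum.cong refl) (simp add: indicator_def)
      then show "g (first_dir \<xi> x w) (holding_time \<xi> x w)
        = (\<Sum>s\<in>UNIV. g s (w s / r x s) * indicator (first_is x s) w)"
        using first_isD[OF s] by simp
    qed
  qed
  also have "\<dots> = (\<Sum>s\<in>UNIV. \<integral>\<^sup>+w. g s (w s / r x s) * indicator (first_is x s) w \<partial>clocks_measure)"
    by (rule nn_integral_sum) measurable
  finally show ?thesis by (simp add: nn_integral_first_is)
qed

end

section \<open>The renewal equation\<close>

lemma sets_walk_measure [measurable_cong]: "sets (walk_measure :: 'd::finite clocks stream measure) = sets (stream_space clocks_measure)"
  by (simp add: walk_measure_def)

lemma prob_space_walk_measure: "prob_space (walk_measure :: 'd::finite clocks stream measure)"
  unfolding walk_measure_def by (intro prob_space.prob_space_stream_space prob_space_clocks_measure)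

lemma space_walk_measure [simp]: "space (walk_measure :: 'd::finite clocks stream measure) = UNIV"
  by (simp add: walk_measure_def space_stream_space)

lemma jump_site_measurable [measurable]:
  "(\<lambda>\<omega>. jump_site \<xi> n x \<omega>) \<in> measurable (walk_measure :: 'd::finite clocks stream measure) (count_space UNIV)"
proof (induction n arbitrary: x)
  case (Suc n)
  have "(\<lambda>\<omega>. jump_site \<xi> n y (stl \<omega>)) \<in> measurable (walk_measure :: 'd clocks stream measure) (count_space UNIV)" for y
    by (rule measurable_compose[OF _ Suc[of y]]) (simp add: walk_measure_def)
  moreover have "(\<lambda>\<omega>. x + shift (first_dir \<xi> x (shd \<omega>))) \<in> measurable (walk_measure :: 'd clocks stream measure) (count_space UNIV)"
    by measurable
  ultimately show ?case unfolding jump_site.simps by (rule measurable_compose_countable)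
next
  case 0
  have "jump_site \<xi> 0 x = (\<lambda>\<omega>. x)" by (rule ext) simp
  then show ?case by simp
qed

lemma jump_time_measurable [measurable]:
  "(\<lambda>\<omega>. jump_time \<xi> n x \<omega>) \<in> borel_measurable (walk_measure :: 'd::finite clocks stream measure)"
proof (induction n arbitrary: x)
  case (Suc n)
  have "(\<lambda>\<omega>. jump_time \<xi> n y (stl \<omega>)) \<in> borel_measurable (walk_measure :: 'd clocks stream measure)" for y
    by (rule measurable_compose[OF _ Suc[of y]]) (simp add: walk_measure_def)
  moreover have "(\<lambda>\<omega>. x + shift (first_dir \<xi> x (shd \<omega>))) \<in> measurable (walk_measure :: 'd clocks stream measure) (count_space UNIV)"
    by measurable
  ultimately have [measurable]: "(\<lambda>\<omega>. jump_time \<xi> n (x + shift (first_dir \<xi> x (shd \<omega>))) (stl \<omega>)) \<in> borel_measurable (walk_measure :: 'd clocks stream measure)"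
    by (rule measurable_compose_countable)
  show ?case unfolding jump_time.simps by measurable
next
  case 0
  have "jump_time \<xi> 0 x = (\<lambda>\<omega>. 0)" by (rule ext) simp
  then show ?case by simp
qed

lemma first_passage_measurable:
  fixes g :: "nat \<Rightarrow> 'a \<Rightarrow> real"
  assumes [measurable]: "\<And>n. g n \<in> borel_measurable M"
  shows "(\<lambda>p. LEAST n. fst p < g n (snd p)) \<in> measurable (borel \<Otimes>\<^sub>M M) (count_space UNIV)"
    and "Measurable.pred (borel \<Otimes>\<^sub>M M) (\<lambda>p. \<exists>k<n. fst p < g k (snd p))"
    and "Measurable.pred M (\<lambda>\<omega>. \<exists>k<n. t < g k \<omega>)"
  by measurable

lemma walk_measurable_pair [measurable]:
  "(\<lambda>p. walk \<xi> x (fst p) (snd p)) \<in> measurable (borel \<Otimes>\<^sub>M (walk_measure :: 'd::finite clocks stream measure)) (count_space UNIV)"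
  unfolding walk_def
  by (rule measurable_compose_countable[where g = "\<lambda>p. LEAST n. fst p < jump_time \<xi> (Suc n) x (snd p)"
        and f = "\<lambda>n p. jump_site \<xi> n x (snd p)", OF _ first_passage_measurable(1)[OF jump_time_measurable]])
    (rule measurable_compose[OF measurable_snd jump_site_measurable])

lemma walk_measurable [measurable]:
  "walk \<xi> x t \<in> measurable (walk_measure :: 'd::finite clocks stream measure) (count_space UNIV)"
proof -
  have "(\<lambda>\<omega>. (t, \<omega>)) \<in> measurable walk_measure (borel \<Otimes>\<^sub>M (walk_measure :: 'd clocks stream measure))" by simp
  from measurable_compose[OF this walk_measurable_pair[of \<xi> x]] show ?thesis by simp
qed

text \<open>One of the first \<open>n\<close> jump times exceeds \<open>t\<close>. On this event the
  \<open>LEAST\<close> in \<open>walk\<close> is attained; restricting to it permits induction on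
  \<open>n\<close> before non-explosion is known.\<close>

definition reached :: "'d::finite env \<Rightarrow> nat \<Rightarrow> real \<Rightarrow> 'd site \<Rightarrow> 'd clocks stream \<Rightarrow> bool" where
  "reached \<xi> n t x \<omega> \<longleftrightarrow> (\<exists>k<n. t < jump_time \<xi> (Suc k) x \<omega>)"

definition trunc_exp :: "'d::finite env \<Rightarrow> ('d site \<Rightarrow> ennreal) \<Rightarrow> nat \<Rightarrow> real \<Rightarrow> 'd site \<Rightarrow> ennreal" where
  "trunc_exp \<xi> f n t x = (\<integral>\<^sup>+\<omega>. (if reached \<xi> n t x \<omega> then f (walk \<xi> x t \<omega>) else 0) \<partial>walk_measure)"

lemma reached_measurable_pair [measurable]:
  "Measurable.pred (borel \<Otimes>\<^sub>M (walk_measure :: 'd::finite clocks stream measure)) (\<lambda>p. reached \<xi> n (fst p) x (snd p))"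
  unfolding reached_def by (rule first_passage_measurable(2)[OF jump_time_measurable])

lemma reached_measurable [measurable]:
  "Measurable.pred (walk_measure :: 'd::finite clocks stream measure) (reached \<xi> n t x)"
  unfolding reached_def by (rule first_passage_measurable(3)[OF jump_time_measurable])

lemma trunc_exp_measurable [measurable]:
  "(\<lambda>t. trunc_exp \<xi> f n t x) \<in> borel_measurable (borel :: real measure)" for \<xi> :: "'d::finite env"
proof -
  interpret prob_space "walk_measure :: 'd clocks stream measure" by (rule prob_space_walk_measure)
  have [measurable]: "f \<in> borel_measurable (count_space UNIV)" by simp
  have "(\<lambda>p. if reached \<xi> n (fst p) x (snd p) then f (walk \<xi> x (fst p) (snd p)) else 0)
      \<in> borel_measurable (borel \<Otimes>\<^sub>M (walk_measure :: 'd clocks stream measure))" by measurable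
  from borel_measurable_nn_integral_fst[OF this] show ?thesis by (simp add: trunc_exp_def)
qed

lemma trunc_exp_0 [simp]: "trunc_exp \<xi> f 0 t x = 0"
  by (simp add: trunc_exp_def reached_def)

text \<open>The head of the stream is consumed by the first jump. The third claim assumes
  \<open>reached\<close> because the index chosen by \<open>LEAST\<close> can be shifted by one only
  where it is attained.\<close>

lemma walk_Stream:
  fixes \<xi> :: "'d::finite env" and x :: "'d site"
  defines "y \<equiv> \<lambda>w. x + shift (first_dir \<xi> x w)" and "h \<equiv> holding_time \<xi> x"
  shows "reached \<xi> (Suc n) t x (w ## \<omega>) \<longleftrightarrow> t < h w \<or> reached \<xi> n (t - h w) (y w) \<omega>"
    and "t < h w \<Longrightarrow> walk \<xi> x t (w ## \<omega>) = x"
    and "\<not> t < h w \<Longrightarrow> reached \<xi> n (t - h w) (y w) \<omega> \<Longrightarrow> walk \<xi> x t (w ## \<omega>) = walk \<xi> (y w) (t - h w) \<omega>"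
proof -
  have 0: "t < jump_time \<xi> (Suc 0) x (w ## \<omega>) \<longleftrightarrow> t < h w" by (simp add: h_def)
  have S: "t < jump_time \<xi> (Suc (Suc k)) x (w ## \<omega>) \<longleftrightarrow> t - h w < jump_time \<xi> (Suc k) (y w) \<omega>" for k
    unfolding jump_time.simps(2)[of \<xi> "Suc k" x] h_def y_def by (simp del: jump_time.simps, linarith)
  show "reached \<xi> (Suc n) t x (w ## \<omega>) \<longleftrightarrow> t < h w \<or> reached \<xi> n (t - h w) (y w) \<omega>"
    unfolding reached_def Ex_less_Suc2 0 S ..
  show "t < h w \<Longrightarrow> walk \<xi> x t (w ## \<omega>) = x"
    using Least_equality[of "\<lambda>n. t < jump_time \<xi> (Suc n) x (w ## \<omega>)" 0] 0 by (simp add: walk_def del: jump_time.simps)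
  assume not: "\<not> t < h w" and "reached \<xi> n (t - h w) (y w) \<omega>"
  then obtain k where "t - h w < jump_time \<xi> (Suc k) (y w) \<omega>" by (auto simp: reached_def)
  then have "t < jump_time \<xi> (Suc (Suc k)) x (w ## \<omega>)" by (simp only: S)
  then have "(LEAST n. t < jump_time \<xi> (Suc n) x (w ## \<omega>)) = Suc (LEAST m. t < jump_time \<xi> (Suc (Suc m)) x (w ## \<omega>))"
    by (rule Least_Suc) (simp only: 0 not not_False_eq_True)
  also have "\<dots> = Suc (LEAST m. t - h w < jump_time \<xi> (Suc m) (y w) \<omega>)" by (simp only: S)
  finally show "walk \<xi> x t (w ## \<omega>) = walk \<xi> (y w) (t - h w) \<omega>"
    unfolding walk_def by (simp add: y_def del: jump_time.simps)
qed

context rates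
begin

text \<open>Markov property at the first jump: the tail of the stream is independent of its head and
  has the same law, so the walk restarts at the new site with time \<open>t - \<tau>\<close> left
  and one jump fewer.\<close>

lemma trunc_exp_Suc:
  "trunc_exp \<xi> f (Suc n) t x = (\<Sum>s\<in>UNIV. \<integral>\<^sup>+\<tau>. ennreal (r x s * exp (- lam x * \<tau>)) *
     (if t < \<tau> then f x else trunc_exp \<xi> f n (t - \<tau>) (x + shift s)) * indicator {0..} \<tau> \<partial>lborel)"
proof -
  interpret prob_space "clocks_measure :: 'd clocks measure" by (rule prob_space_clocks_measure)
  interpret W: prob_space "walk_measure :: 'd clocks stream measure" by (rule prob_space_walk_measure)
  let ?y = "\<lambda>w. x + shift (first_dir \<xi> x w)" and ?h = "holding_time \<xi> x"
  have [measurable]: "f \<in> borel_measurable (count_space UNIV)" by simp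
  have "trunc_exp \<xi> f (Suc n) t x = (\<integral>\<^sup>+w. \<integral>\<^sup>+\<omega>. (if reached \<xi> (Suc n) t x (w ## \<omega>) then f (walk \<xi> x t (w ## \<omega>)) else 0) \<partial>walk_measure \<partial>clocks_measure)"
    unfolding trunc_exp_def walk_measure_def
    by (rule nn_integral_stream_space) (unfold walk_measure_def[symmetric], measurable)
  also have "\<dots> = (\<integral>\<^sup>+w. (if t < ?h w then f x else trunc_exp \<xi> f n (t - ?h w) (?y w)) \<partial>clocks_measure)"
  proof (rule nn_integral_cong)
    fix w :: "'d clocks"
    show "(\<integral>\<^sup>+\<omega>. (if reached \<xi> (Suc n) t x (w ## \<omega>) then f (walk \<xi> x t (w ## \<omega>)) else 0) \<partial>walk_measure)
      = (if t < ?h w then f x else trunc_exp \<xi> f n (t - ?h w) (?y w))"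
    proof (cases "t < ?h w")
      case True
      then show ?thesis using W.emeasure_space_1 by (simp add: walk_Stream(1,2))
    next
      case False
      then have "(if reached \<xi> (Suc n) t x (w ## \<omega>) then f (walk \<xi> x t (w ## \<omega>)) else 0)
        = (if reached \<xi> n (t - ?h w) (?y w) \<omega> then f (walk \<xi> (?y w) (t - ?h w) \<omega>) else 0)" for \<omega>
        by (simp add: walk_Stream(1,3))
      then show ?thesis using False by (simp add: trunc_exp_def)
    qed
  qed
  also have "\<dots> = (\<Sum>s\<in>UNIV. \<integral>\<^sup>+\<tau>. ennreal (r x s * exp (- lam x * \<tau>)) *
     (if t < \<tau> then f x else trunc_exp \<xi> f n (t - \<tau>) (x + shift s)) * indicator {0..} \<tau> \<partial>lborel)"
    by (rule nn_integral_first_jump[where g = "\<lambda>s \<tau>. if t < \<tau> then f x else trunc_exp \<xi> f n (t - \<tau>) (x + shift s)"]) measurable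
  finally show ?thesis .
qed

end

section \<open>The law of the walk at a fixed time\<close>

text \<open>
  Uniformisation: at time \<open>t\<close> the walk has made a Poisson number, with mean \<open>l t\<close>, of steps of the
  lazy chain.
\<close>

definition semi :: "real \<Rightarrow> 'd::finite env \<Rightarrow> ('d site \<Rightarrow> real) \<Rightarrow> real \<Rightarrow> 'd site \<Rightarrow> real" where
  "semi l \<xi> f t x = exp (- (l * t)) * (\<Sum>k. (l * t) ^ k / fact k * lazyn l \<xi> k f x)"

text \<open>Exponential in the l1 norm, so that one step multiplies it by at most
  \<open>exp 1\<close>. A function dominated by it, such as the square of a linear one, grows at
  most like \<open>exp 1 ^ n\<close> over \<open>n\<close> steps, and the factorials in
  \<open>semi\<close> absorb this.\<close>

definition weight :: "'d::finite site \<Rightarrow> real" where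
  "weight x = exp (\<Sum>k\<in>UNIV. \<bar>real_of_int (x $ k)\<bar>)"

lemma weight_shift: "weight (x + shift s) \<le> exp 1 * weight x" for x :: "'d::finite site"
proof -
  have "(\<Sum>k\<in>UNIV. \<bar>real_of_int ((x + shift s) $ k)\<bar>)
    \<le> (\<Sum>k\<in>UNIV. \<bar>real_of_int (x $ k)\<bar> + (if k = fst s then 1 else 0))"
    by (intro sum_mono) (auto simp: shift_def unit_site_def axis_def)
  then have "(\<Sum>k\<in>UNIV. \<bar>real_of_int ((x + shift s) $ k)\<bar>) \<le> (\<Sum>k\<in>UNIV. \<bar>real_of_int (x $ k)\<bar>) + 1"
    by (simp add: sum.distrib)
  then show ?thesis by (simp add: weight_def exp_add[symmetric] add.commute)
qed

lemma weight_pos: "weight x > 0" and weight_ge_1: "weight x \<ge> 1"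
  by (auto simp: weight_def intro!: sum_nonneg)

locale growth = rates \<xi> c for \<xi> :: "'d::finite env" and c +
  fixes l :: real and f :: "'d site \<Rightarrow> real" and C :: real
  assumes l: "2 * real CARD('d) * c \<le> l"
    and f: "\<And>x. 0 \<le> f x" "\<And>x. f x \<le> C * weight x"
begin

lemma l_pos: "l > 0"
proof -
  have "0 < 2 * real CARD('d) * c" using c by simp
  then show ?thesis using l by linarith
qed

lemma C_nonneg: "C \<ge> 0"
proof -
  have "0 \<le> C * weight (0 :: 'd site)" using f[of 0] by linarith
  then show ?thesis using weight_pos[of "0 :: 'd site"] by (simp add: zero_le_mult_iff)
qed

lemma Kn_nonneg: "lazyn l \<xi> n f x \<ge> 0"
  using lazyn_mono[OF ell c l, of "\<lambda>x. 0" f n x] f(1) by simp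

lemma lazy_weight: "lazy l \<xi> weight x \<le> exp 1 * weight x"
proof -
  have tl: "lam x / l \<le> 1" using total_rate_bounds(2)[OF ell c, of x] l l_pos by simp
  have "lazy l \<xi> weight x \<le> (1 - lam x / l) * (exp 1 * weight x) + (\<Sum>s\<in>UNIV. r x s / l * (exp 1 * weight x))"
    unfolding lazy_eq_rate
  proof (intro add_mono mult_left_mono sum_mono)
    show "weight x \<le> exp 1 * weight x" using weight_pos[of x] by simp
  qed (use tl l_pos r_pos weight_shift in \<open>auto simp: less_imp_le\<close>)
  also have "(\<Sum>s\<in>UNIV. r x s / l * (exp 1 * weight x)) = lam x / l * (exp 1 * weight x)"
    by (simp add: total_rate_def sum_distrib_right sum_divide_distrib)
  also have "(1 - lam x / l) * (exp 1 * weight x) + lam x / l * (exp 1 * weight x) = exp 1 * weight x"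
    by (simp add: left_diff_distrib)
  finally show ?thesis .
qed

lemma Kn_le: "lazyn l \<xi> n f x \<le> C * exp 1 ^ n * weight x"
proof (induction n arbitrary: x)
  case (Suc n)
  have "lazyn l \<xi> (Suc n) f x \<le> lazy l \<xi> (\<lambda>x. (C * exp 1 ^ n) * weight x) x"
    using lazy_mono[OF ell c l Suc] by simp
  also have "\<dots> \<le> (C * exp 1 ^ n) * (exp 1 * weight x)"
    unfolding lazy_cmult using C_nonneg by (intro mult_left_mono lazy_weight) auto
  finally show ?case by (simp add: mult_ac)
qed (simp add: f)

lemma term_bound: "norm ((l * t) ^ k / fact k * lazyn l \<xi> k f x) \<le> C * weight x * (\<bar>l * t * exp 1\<bar> ^ k / fact k)"
proof -
  have "norm ((l * t) ^ k / fact k * lazyn l \<xi> k f x) = \<bar>l * t\<bar> ^ k / fact k * lazyn l \<xi> k f x"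
    using Kn_nonneg[of k x] by (simp add: abs_mult power_abs)
  also have "\<dots> \<le> \<bar>l * t\<bar> ^ k / fact k * (C * exp 1 ^ k * weight x)"
    by (intro mult_left_mono Kn_le) auto
  also have "\<dots> = C * weight x * (\<bar>l * t * exp 1\<bar> ^ k / fact k)"
    by (simp add: abs_mult power_mult_distrib)
  finally show ?thesis .
qed

lemma summable_terms: "summable (\<lambda>k. (l * t) ^ k / fact k * lazyn l \<xi> k f x)"
proof (rule summable_comparison_test')
  show "summable (\<lambda>k. C * weight x * (\<bar>l * t * exp 1\<bar> ^ k / fact k))"
    using summable_exp[of "\<bar>l * t * exp 1\<bar>"] by (intro summable_mult) (simp add: divide_inverse mult.commute)
qed (use term_bound in auto)

abbreviation "u \<equiv> semi l \<xi> f"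

lemma u_nonneg: "t \<ge> 0 \<Longrightarrow> u t x \<ge> 0"
  unfolding semi_def using l_pos Kn_nonneg
  by (intro mult_nonneg_nonneg suminf_nonneg summable_terms) auto

lemma u_0: "u 0 x = f x"
proof -
  have "(\<Sum>k. (l * 0) ^ k / fact k * lazyn l \<xi> k f x) = (\<Sum>k\<in>{0}. (l * 0) ^ k / fact k * lazyn l \<xi> k f x)"
    by (rule suminf_finite) auto
  then show ?thesis by (simp add: semi_def)
qed

lemma u_le:
  assumes "t \<ge> 0" shows "u t x \<le> C * weight x * exp (l * (exp 1 - 1) * t)"
proof -
  have s: "(\<lambda>k. (l * t * exp 1) ^ k / fact k) sums exp (l * t * exp 1)"
    using exp_converges[of "l * t * exp 1"] by (simp add: divide_inverse mult.commute)
  have "(\<Sum>k. (l * t) ^ k / fact k * lazyn l \<xi> k f x) \<le> (\<Sum>k. C * weight x * ((l * t * exp 1) ^ k / fact k))"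
  proof (rule suminf_le[OF _ summable_terms])
    show "(l * t) ^ k / fact k * lazyn l \<xi> k f x \<le> C * weight x * ((l * t * exp 1) ^ k / fact k)" for k
    proof -
      have "(l * t) ^ k / fact k * lazyn l \<xi> k f x \<le> norm ((l * t) ^ k / fact k * lazyn l \<xi> k f x)"
        unfolding real_norm_def by (rule abs_ge_self)
      also note term_bound
      finally show ?thesis using assms l_pos by simp
    qed
    show "summable (\<lambda>k. C * weight x * ((l * t * exp 1) ^ k / fact k))"
      using s by (intro summable_mult) (auto simp: sums_iff)
  qed
  also have "\<dots> = C * weight x * exp (l * t * exp 1)"
    using s by (subst suminf_mult) (auto simp: sums_iff)
  finally have "u t x \<le> exp (- (l * t)) * (C * weight x * exp (l * t * exp 1))"
    unfolding semi_def by (intro mult_left_mono) auto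
  also have "\<dots> = C * weight x * exp (l * (exp 1 - 1) * t)"
    by (simp add: exp_add[symmetric] algebra_simps)
  finally show ?thesis .
qed

text \<open>The backward Kolmogorov equation, by termwise differentiation of a power series in
  \<open>t\<close>; the prefactor \<open>exp (- (l * t))\<close> turns \<open>l * K\<close> into the
  generator.\<close>

lemma u_deriv: "((\<lambda>t. u t x) has_real_derivative (\<Sum>s\<in>UNIV. r x s * (u t (x + shift s) - u t x))) (at t)"
proof -
  define P where "P t y = (\<Sum>k. (l * t) ^ k / fact k * lazyn l \<xi> k f y)" for t y
  define a where "a k = l ^ k / fact k * lazyn l \<xi> k f x" for k
  have a: "a k * s ^ k = (l * s) ^ k / fact k * lazyn l \<xi> k f x" for k s
    by (simp add: a_def power_mult_distrib)
  have "((\<lambda>s. \<Sum>k. a k * s ^ k) has_field_derivative (\<Sum>k. diffs a k * t ^ k)) (at t)"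
    by (rule termdiffs_strong_converges_everywhere) (simp only: a summable_terms)
  then have P': "((\<lambda>s. P s x) has_field_derivative (\<Sum>k. diffs a k * t ^ k)) (at t)"
    by (simp only: a P_def)
  have dk: "diffs a k * t ^ k = l * ((l * t) ^ k / fact k * lazy l \<xi> (lazyn l \<xi> k f) x)" for k
  proof -
    have "real (Suc k) / fact (Suc k) = 1 / fact k" by (simp add: divide_simps)
    moreover have "diffs a k * t ^ k = real (Suc k) / fact (Suc k) * (l ^ Suc k * lazyn l \<xi> (Suc k) f x * t ^ k)"
      by (simp add: diffs_def a_def del: fact_Suc of_nat_Suc)
    ultimately show ?thesis by (simp add: power_mult_distrib)
  qed
  have S2: "(\<lambda>k. (l * t) ^ k / fact k * lazy l \<xi> (lazyn l \<xi> k f) x) sums lazy l \<xi> (P t) x"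
  proof -
    have S: "(\<lambda>k. (l * t) ^ k / fact k * lazyn l \<xi> k f y) sums P t y" for y
      unfolding P_def by (rule summable_sums[OF summable_terms])
    have "(\<lambda>k. (1 - lam x / l) * ((l * t) ^ k / fact k * lazyn l \<xi> k f x)
       + (\<Sum>s\<in>UNIV. r x s / l * ((l * t) ^ k / fact k * lazyn l \<xi> k f (x + shift s)))) sums lazy l \<xi> (P t) x"
      unfolding lazy_eq_rate[of l \<xi> "P t"] by (intro sums_add sums_mult sums_sum S)
    then show ?thesis
      by (simp add: lazy_eq_rate[of l \<xi> "lazyn l \<xi> _ f"] distrib_left sum_distrib_left mult_ac)
  qed
  have "(\<lambda>k. diffs a k * t ^ k) sums (l * lazy l \<xi> (P t) x)"
    unfolding dk by (rule sums_mult[OF S2])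
  then have d: "(\<Sum>k. diffs a k * t ^ k) = l * P t x + gen \<xi> (P t) x"
    using l_pos by (simp add: sums_iff lazy_def distrib_left)
  have "((\<lambda>t. exp (- (l * t)) * P t x) has_real_derivative
     exp (- (l * t)) * (l * P t x + gen \<xi> (P t) x) + (- l * exp (- (l * t))) * P t x) (at t)"
  proof -
    have "((\<lambda>t. exp (- (l * t))) has_real_derivative - l * exp (- (l * t))) (at t)"
      by (auto intro!: derivative_eq_intros)
    from DERIV_mult[OF this P'] show ?thesis unfolding d by (rule DERIV_cong) (simp add: algebra_simps)
  qed
  moreover have "exp (- (l * t)) * (l * P t x + gen \<xi> (P t) x) + (- l * exp (- (l * t))) * P t x
      = gen \<xi> (\<lambda>y. exp (- (l * t)) * P t y) x"
    unfolding gen_cmult by (simp add: algebra_simps)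
  ultimately show ?thesis
    unfolding semi_def P_def[symmetric] gen_eq_rate by simp
qed

lemma u_cont: "continuous_on UNIV (\<lambda>t. u t x)"
  using u_deriv by (meson DERIV_isCont continuous_at_imp_continuous_on)

lemma u_measurable [measurable]: "(\<lambda>t. u t x) \<in> borel_measurable borel"
  by (intro borel_measurable_continuous_onI u_cont)

text \<open>Right-hand side of the first-jump equation. The truncated expectations are its iterates
  from 0 (\<open>J_Suc\<close>), and \<open>u\<close> is a fixed point
  (\<open>u_renew\<close>).\<close>

definition renew :: "(real \<Rightarrow> 'd site \<Rightarrow> ennreal) \<Rightarrow> real \<Rightarrow> 'd site \<Rightarrow> ennreal" where
  "renew h t x = (\<Sum>s\<in>UNIV. \<integral>\<^sup>+\<tau>. ennreal (r x s * exp (- lam x * \<tau>)) *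
     (if t < \<tau> then ennreal (f x) else h (t - \<tau>) (x + shift s)) * indicator {0..} \<tau> \<partial>lborel)"

text \<open>By the backward equation the integrand, summed over directions, is the \<tau>-derivative
  of \<open>- exp (- lam x * \<tau>) * u (t - \<tau>) x\<close>. The boundary term at \<tau> = t
  cancels the contribution of paths without a jump before \<open>t\<close>.\<close>

lemma u_renew:
  assumes t: "t \<ge> 0"
  shows "renew (\<lambda>t x. ennreal (u t x)) t x = ennreal (u t x)"
proof -
  have split: "(\<integral>\<^sup>+\<tau>. ennreal (r x s * exp (- lam x * \<tau>)) * (if t < \<tau> then ennreal (f x) else ennreal (u (t - \<tau>) (x + shift s))) * indicator {0..} \<tau> \<partial>lborel)
    = (\<integral>\<^sup>+\<tau>. ennreal (r x s * exp (- lam x * \<tau>) * f x) * indicator {t..} \<tau> \<partial>lborel)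
     + (\<integral>\<^sup>+\<tau>. ennreal (r x s * exp (- lam x * \<tau>) * u (t - \<tau>) (x + shift s)) * indicator {0..t} \<tau> \<partial>lborel)" for s
  proof -
    have [measurable]: "(\<lambda>\<tau>. u (t - \<tau>) (x + shift s)) \<in> borel_measurable borel"
      by (rule measurable_compose[OF _ u_measurable]) simp
    have "(\<integral>\<^sup>+\<tau>. ennreal (r x s * exp (- lam x * \<tau>)) * (if t < \<tau> then ennreal (f x) else ennreal (u (t - \<tau>) (x + shift s))) * indicator {0..} \<tau> \<partial>lborel)
      = (\<integral>\<^sup>+\<tau>. ennreal (r x s * exp (- lam x * \<tau>) * f x) * indicator {t..} \<tau>
         + ennreal (r x s * exp (- lam x * \<tau>) * u (t - \<tau>) (x + shift s)) * indicator {0..t} \<tau> \<partial>lborel)"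
    proof (rule nn_integral_cong_AE)
      show "AE \<tau> in lborel. ennreal (r x s * exp (- lam x * \<tau>)) * (if t < \<tau> then ennreal (f x) else ennreal (u (t - \<tau>) (x + shift s))) * indicator {0..} \<tau>
        = ennreal (r x s * exp (- lam x * \<tau>) * f x) * indicator {t..} \<tau>
         + ennreal (r x s * exp (- lam x * \<tau>) * u (t - \<tau>) (x + shift s)) * indicator {0..t} \<tau>"
        \<comment> \<open>At \<tau> = t both indicators on the right equal 1; this single point is a
          null set.\<close>
        using AE_lborel_singleton[of t]
        by eventually_elim (use t r_pos[of x s] in \<open>auto simp: indicator_def ennreal_mult' less_imp_le\<close>)
    qed
    also have "\<dots> = (\<integral>\<^sup>+\<tau>. ennreal (r x s * exp (- lam x * \<tau>) * f x) * indicator {t..} \<tau> \<partial>lborel)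
     + (\<integral>\<^sup>+\<tau>. ennreal (r x s * exp (- lam x * \<tau>) * u (t - \<tau>) (x + shift s)) * indicator {0..t} \<tau> \<partial>lborel)"
    proof (rule nn_integral_add)
      define a b y where "a = r x s" and "b = lam x" and "y = f x"
      define g where "g \<tau> = u (t - \<tau>) (x + shift s)" for \<tau>
      have [measurable]: "g \<in> borel_measurable borel"
        unfolding g_def by (rule measurable_compose[OF _ u_measurable]) simp
      show "(\<lambda>\<tau>. ennreal (r x s * exp (- lam x * \<tau>) * f x) * indicator {t..} \<tau>) \<in> borel_measurable lborel"
        unfolding a_def[symmetric] b_def[symmetric] y_def[symmetric] by measurable
      show "(\<lambda>\<tau>. ennreal (r x s * exp (- lam x * \<tau>) * u (t - \<tau>) (x + shift s)) * indicator {0..t} \<tau>) \<in> borel_measurable lborel"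
        unfolding a_def[symmetric] b_def[symmetric] g_def[symmetric] by measurable
    qed
    finally show ?thesis .
  qed
  have tail: "(\<integral>\<^sup>+\<tau>. ennreal (r x s * exp (- lam x * \<tau>) * f x) * indicator {t..} \<tau> \<partial>lborel)
     = ennreal (r x s / lam x * exp (- lam x * t) * f x)" for s
  proof -
    have "(\<integral>\<^sup>+\<tau>. ennreal (r x s * exp (- lam x * \<tau>) * f x) * indicator {t..} \<tau> \<partial>lborel)
      = ennreal (0 - (- (r x s / lam x * f x) * exp (- lam x * t)))"
    proof (rule nn_integral_FTC_atLeast[where F = "\<lambda>\<tau>. - (r x s / lam x * f x) * exp (- lam x * \<tau>)"])
      show "((\<lambda>\<tau>. - (r x s / lam x * f x) * exp (- lam x * \<tau>)) \<longlongrightarrow> 0) at_top"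
      proof -
        have "((\<lambda>\<tau>. exp (- lam x * \<tau>)) \<longlongrightarrow> 0) at_top"
          by (rule filterlim_compose[OF exp_at_bot filterlim_tendsto_neg_mult_at_bot[OF tendsto_const _ filterlim_ident]])
            (use lam_pos[of x] in simp)
        from tendsto_mult_left[OF this, of "- (r x s / lam x * f x)"] show ?thesis by simp
      qed
      show "DERIV (\<lambda>\<tau>. - (r x s / lam x * f x) * exp (- lam x * \<tau>)) \<tau> :> r x s * exp (- lam x * \<tau>) * f x" for \<tau>
        using lam_pos[of x] by (auto intro!: derivative_eq_intros)
    qed (auto simp: r_pos less_imp_le f(1))
    then show ?thesis by (simp add: mult_ac)
  qed
  have "(\<Sum>s\<in>UNIV. \<integral>\<^sup>+\<tau>. ennreal (r x s * exp (- lam x * \<tau>) * u (t - \<tau>) (x + shift s)) * indicator {0..t} \<tau> \<partial>lborel)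
    = (\<integral>\<^sup>+\<tau>. (\<Sum>s\<in>UNIV. ennreal (r x s * exp (- lam x * \<tau>) * u (t - \<tau>) (x + shift s)) * indicator {0..t} \<tau>) \<partial>lborel)"
  proof (rule nn_integral_sum[symmetric])
    fix s
    have [measurable]: "(\<lambda>\<tau>. u (t - \<tau>) (x + shift s)) \<in> borel_measurable borel"
      by (rule measurable_compose[OF _ u_measurable]) simp
    show "(\<lambda>\<tau>. ennreal (r x s * exp (- lam x * \<tau>) * u (t - \<tau>) (x + shift s)) * indicator {0..t} \<tau>) \<in> borel_measurable lborel"
      by measurable
  qed
  also have "\<dots> = (\<integral>\<^sup>+\<tau>. ennreal (\<Sum>s\<in>UNIV. r x s * exp (- lam x * \<tau>) * u (t - \<tau>) (x + shift s)) * indicator {0..t} \<tau> \<partial>lborel)"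
  proof (rule nn_integral_cong)
    fix \<tau> :: real
    show "(\<Sum>s\<in>UNIV. ennreal (r x s * exp (- lam x * \<tau>) * u (t - \<tau>) (x + shift s)) * indicator {0..t} \<tau>)
      = ennreal (\<Sum>s\<in>UNIV. r x s * exp (- lam x * \<tau>) * u (t - \<tau>) (x + shift s)) * indicator {0..t} \<tau>"
    proof (cases "\<tau> \<in> {0..t}")
      case True
      then have "0 \<le> r x s * exp (- lam x * \<tau>) * u (t - \<tau>) (x + shift s)" for s
        using r_pos[of x s] by (intro mult_nonneg_nonneg u_nonneg) (auto simp: less_imp_le)
      then show ?thesis using True by (simp add: sum_ennreal)
    qed simp
  qed
  also have "\<dots> = ennreal (- exp (- lam x * t) * u (t - t) x - (- exp (- lam x * 0) * u (t - 0) x))"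
  proof (rule nn_integral_FTC_Icc[where F = "\<lambda>\<tau>. - exp (- lam x * \<tau>) * u (t - \<tau>) x"])
    fix \<tau> assume \<tau>: "\<tau> \<in> {0..t}"
    have "((\<lambda>\<tau>. u (t - \<tau>) x) has_real_derivative (\<Sum>s\<in>UNIV. r x s * (u (t - \<tau>) (x + shift s) - u (t - \<tau>) x)) * - 1) (at \<tau>)"
      by (rule DERIV_chain2[OF u_deriv]) (auto intro!: derivative_eq_intros)
    moreover have "((\<lambda>\<tau>. - exp (- lam x * \<tau>)) has_real_derivative lam x * exp (- lam x * \<tau>)) (at \<tau>)"
      by (auto intro!: derivative_eq_intros)
    ultimately have "((\<lambda>\<tau>. - exp (- lam x * \<tau>) * u (t - \<tau>) x) has_real_derivative
       lam x * exp (- lam x * \<tau>) * u (t - \<tau>) x + exp (- lam x * \<tau>) * (\<Sum>s\<in>UNIV. r x s * (u (t - \<tau>) (x + shift s) - u (t - \<tau>) x))) (at \<tau>)"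
      by - (rule DERIV_cong[OF DERIV_mult], assumption+, simp add: algebra_simps)
    also have "lam x * exp (- lam x * \<tau>) * u (t - \<tau>) x + exp (- lam x * \<tau>) * (\<Sum>s\<in>UNIV. r x s * (u (t - \<tau>) (x + shift s) - u (t - \<tau>) x))
      = (\<Sum>s\<in>UNIV. r x s * exp (- lam x * \<tau>) * u (t - \<tau>) (x + shift s))"
      by (simp add: total_rate_def sum_distrib_left sum_distrib_right right_diff_distrib sum_subtractf mult_ac)
    finally show "((\<lambda>\<tau>. - exp (- lam x * \<tau>) * u (t - \<tau>) x) has_real_derivative
      (\<Sum>s\<in>UNIV. r x s * exp (- lam x * \<tau>) * u (t - \<tau>) (x + shift s))) (at \<tau>)" .
    show "0 \<le> (\<Sum>s\<in>UNIV. r x s * exp (- lam x * \<tau>) * u (t - \<tau>) (x + shift s))"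
      using \<tau> r_pos by (intro sum_nonneg mult_nonneg_nonneg u_nonneg) (auto simp: less_imp_le)
  next
    have [measurable]: "(\<lambda>\<tau>. u (t - \<tau>) (x + shift s)) \<in> borel_measurable borel" for s
      by (rule measurable_compose[OF _ u_measurable]) simp
    show "(\<lambda>\<tau>. \<Sum>s\<in>UNIV. r x s * exp (- lam x * \<tau>) * u (t - \<tau>) (x + shift s)) \<in> borel_measurable borel" by measurable
  qed (rule t)
  also have "\<dots> = ennreal (u t x - exp (- lam x * t) * f x)" by (simp add: u_0)
  finally have body: "(\<Sum>s\<in>UNIV. \<integral>\<^sup>+\<tau>. ennreal (r x s * exp (- lam x * \<tau>) * u (t - \<tau>) (x + shift s)) * indicator {0..t} \<tau> \<partial>lborel)
    = ennreal (u t x - exp (- lam x * t) * f x)" .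
  have tails: "(\<Sum>s\<in>UNIV. ennreal (r x s / lam x * exp (- lam x * t) * f x)) = ennreal (exp (- lam x * t) * f x)"
  proof -
    have "(\<Sum>s\<in>UNIV. ennreal (r x s / lam x * exp (- lam x * t) * f x)) = ennreal (\<Sum>s\<in>UNIV. r x s / lam x * exp (- lam x * t) * f x)"
      using r_pos lam_pos f(1) by (intro sum_ennreal mult_nonneg_nonneg divide_nonneg_nonneg) (auto simp: less_imp_le)
    also have "(\<Sum>s\<in>UNIV. r x s / lam x * exp (- lam x * t) * f x) = exp (- lam x * t) * f x"
      using lam_pos[of x] by (simp add: sum_distrib_right[symmetric] sum_divide_distrib[symmetric] total_rate_def)
    finally show ?thesis .
  qed
  \<comment> \<open>Ensures that the difference inside \<open>ennreal\<close> is nonnegative, so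
    that the two parts really add up to \<open>u t x\<close>.\<close>
  have ge: "exp (- lam x * t) * f x \<le> u t x"
  proof -
    define F where "F \<tau> = - exp (- lam x * \<tau>) * u (t - \<tau>) x" for \<tau>
    have "F 0 \<le> F t"
    proof (rule DERIV_nonneg_imp_nondecreasing[OF t])
      fix \<tau> assume \<tau>: "0 \<le> \<tau>" "\<tau> \<le> t"
      have "((\<lambda>\<tau>. u (t - \<tau>) x) has_real_derivative (\<Sum>s\<in>UNIV. r x s * (u (t - \<tau>) (x + shift s) - u (t - \<tau>) x)) * - 1) (at \<tau>)"
        by (rule DERIV_chain2[OF u_deriv]) (auto intro!: derivative_eq_intros)
      moreover have "((\<lambda>\<tau>. - exp (- lam x * \<tau>)) has_real_derivative lam x * exp (- lam x * \<tau>)) (at \<tau>)"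
        by (auto intro!: derivative_eq_intros)
      ultimately have "(F has_real_derivative
         lam x * exp (- lam x * \<tau>) * u (t - \<tau>) x + exp (- lam x * \<tau>) * (\<Sum>s\<in>UNIV. r x s * (u (t - \<tau>) (x + shift s) - u (t - \<tau>) x))) (at \<tau>)"
        unfolding F_def[abs_def] by - (rule DERIV_cong[OF DERIV_mult], assumption+, simp add: algebra_simps)
      moreover have "lam x * exp (- lam x * \<tau>) * u (t - \<tau>) x + exp (- lam x * \<tau>) * (\<Sum>s\<in>UNIV. r x s * (u (t - \<tau>) (x + shift s) - u (t - \<tau>) x))
        = (\<Sum>s\<in>UNIV. r x s * exp (- lam x * \<tau>) * u (t - \<tau>) (x + shift s))"
        by (simp add: total_rate_def sum_distrib_left sum_distrib_right right_diff_distrib sum_subtractf mult_ac)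
      moreover have "0 \<le> (\<Sum>s\<in>UNIV. r x s * exp (- lam x * \<tau>) * u (t - \<tau>) (x + shift s))"
        using \<tau> r_pos by (intro sum_nonneg mult_nonneg_nonneg u_nonneg) (auto simp: less_imp_le)
      ultimately show "\<exists>y. (F has_real_derivative y) (at \<tau>) \<and> 0 \<le> y" by metis
    qed
    then show ?thesis by (simp add: F_def u_0)
  qed
  have "renew (\<lambda>t x. ennreal (u t x)) t x
    = ennreal (exp (- lam x * t) * f x) + ennreal (u t x - exp (- lam x * t) * f x)"
    unfolding renew_def split tail sum.distrib tails body ..
  also have "\<dots> = ennreal (u t x)"
    using ge f(1)[of x] by (subst ennreal_plus[symmetric]) auto
  finally show ?thesis .
qed

abbreviation "J \<equiv> trunc_exp \<xi> (\<lambda>x. ennreal (f x))"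

lemma J_Suc: "J (Suc n) t x = renew (J n) t x"
  by (simp add: trunc_exp_Suc renew_def)

lemma J_le: "t \<ge> 0 \<Longrightarrow> J n t x \<le> ennreal (u t x)"
proof (induction n arbitrary: t x)
  case (Suc n)
  have "renew (J n) t x \<le> renew (\<lambda>t x. ennreal (u t x)) t x"
    unfolding renew_def
    by (intro sum_mono nn_integral_mono mult_right_mono mult_left_mono) (auto intro: Suc.IH)
  then show ?case using Suc.prems by (simp add: J_Suc u_renew)
qed simp

text \<open>Bounds what paths with at least \<open>n\<close> jumps before \<open>t\<close> can
  contribute to \<open>u\<close>: the a priori growth of \<open>u\<close>, a factor 2 d c
  \<open>exp 1\<close> for each jump, and the volume \<open>t ^ n / fact n\<close> of ordered jump
  times.\<close>

definition err :: "nat \<Rightarrow> real \<Rightarrow> 'd site \<Rightarrow> real" where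
  "err n t x = C * weight x * exp (l * (exp 1 - 1) * t) * ((2 * real CARD('d) * c * exp 1) ^ n * (t ^ n / fact n))"

lemma err_Suc:
  assumes t: "t \<ge> 0"
  shows "(\<Sum>s\<in>UNIV. \<integral>\<^sup>+\<tau>. ennreal (r x s * exp (- lam x * \<tau>)) * ennreal (err n (t - \<tau>) (x + shift s)) * indicator {0..t} \<tau> \<partial>lborel)
    \<le> ennreal (err (Suc n) t x)"
proof -
  define a b where "a = 2 * real CARD('d) * c * exp 1" and "b = l * (exp 1 - 1)"
  have a: "a \<ge> 0" using c by (simp add: a_def)
  have b: "b \<ge> 0" using l_pos by (simp add: b_def)
  define B where "B = C * exp 1 * weight x * exp (b * t) * a ^ n"
  have B: "B \<ge> 0" using C_nonneg weight_pos[of x] a by (simp add: B_def)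
  have pt: "r x s * exp (- lam x * \<tau>) * err n (t - \<tau>) (x + shift s) \<le> r x s * B * ((t - \<tau>) ^ n / fact n)"
    if \<tau>: "\<tau> \<in> {0..t}" for s \<tau>
  proof -
    have "err n (t - \<tau>) (x + shift s) \<le> C * (exp 1 * weight x) * exp (b * t) * (a ^ n * ((t - \<tau>) ^ n / fact n))"
      unfolding err_def a_def[symmetric] b_def[symmetric]
      using \<tau> a b C_nonneg weight_shift[of x s] weight_pos[of x] weight_pos[of "x + shift s"]
      by (intro mult_mono mult_left_mono) (auto simp: less_imp_le intro!: mult_left_mono mult_nonneg_nonneg)
    also have "\<dots> = B * ((t - \<tau>) ^ n / fact n)" by (simp add: B_def mult_ac)
    finally have "err n (t - \<tau>) (x + shift s) \<le> B * ((t - \<tau>) ^ n / fact n)" .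
    moreover have "0 \<le> B * ((t - \<tau>) ^ n / fact n)" using B \<tau> by simp
    ultimately have "exp (- lam x * \<tau>) * err n (t - \<tau>) (x + shift s) \<le> 1 * (B * ((t - \<tau>) ^ n / fact n))"
      using \<tau> lam_pos[of x] C_nonneg a weight_pos[of "x + shift s"]
      by (intro mult_mono) (auto simp: err_def a_def[symmetric] less_imp_le intro!: mult_nonneg_nonneg)
    from mult_left_mono[OF this less_imp_le[OF r_pos[of x s]]] show ?thesis by (simp add: mult_ac)
  qed
  have "(\<integral>\<^sup>+\<tau>. ennreal (r x s * exp (- lam x * \<tau>)) * ennreal (err n (t - \<tau>) (x + shift s)) * indicator {0..t} \<tau> \<partial>lborel)
      \<le> ennreal (r x s * B * (t ^ Suc n / fact (Suc n)))" for s
  proof -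
    have "(\<integral>\<^sup>+\<tau>. ennreal (r x s * exp (- lam x * \<tau>)) * ennreal (err n (t - \<tau>) (x + shift s)) * indicator {0..t} \<tau> \<partial>lborel)
      \<le> (\<integral>\<^sup>+\<tau>. ennreal (r x s * B * ((t - \<tau>) ^ n / fact n)) * indicator {0..t} \<tau> \<partial>lborel)"
    proof (rule nn_integral_mono)
      fix \<tau> :: real
      show "ennreal (r x s * exp (- lam x * \<tau>)) * ennreal (err n (t - \<tau>) (x + shift s)) * indicator {0..t} \<tau>
        \<le> ennreal (r x s * B * ((t - \<tau>) ^ n / fact n)) * indicator {0..t} \<tau>"
      proof (cases "\<tau> \<in> {0..t}")
        case True
        have "ennreal (r x s * exp (- lam x * \<tau>)) * ennreal (err n (t - \<tau>) (x + shift s))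
          = ennreal (r x s * exp (- lam x * \<tau>) * err n (t - \<tau>) (x + shift s))"
          using r_pos[of x s] by (intro ennreal_mult'[symmetric]) (simp add: less_imp_le)
        then show ?thesis using ennreal_leI[OF pt[OF True, of s]] True by simp
      qed simp
    qed
    also have "\<dots> = ennreal (r x s * B * (- ((t - t) ^ Suc n / fact (Suc n))) - r x s * B * (- ((t - 0) ^ Suc n / fact (Suc n))))"
    proof (rule nn_integral_FTC_Icc[where F = "\<lambda>\<tau>. r x s * B * (- ((t - \<tau>) ^ Suc n / fact (Suc n)))"])
      fix \<tau> assume \<tau>: "\<tau> \<in> {0..t}"
      have "((\<lambda>\<tau>. (t - \<tau>) ^ Suc n) has_real_derivative - (real (Suc n) * (t - \<tau>) ^ n)) (at \<tau>)"
        by (auto intro!: derivative_eq_intros simp del: power_Suc)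
      from DERIV_cmult[OF DERIV_minus[OF DERIV_cdivide[OF this, of "fact (Suc n)"]], of "r x s * B"]
      show "((\<lambda>\<tau>. r x s * B * (- ((t - \<tau>) ^ Suc n / fact (Suc n)))) has_real_derivative r x s * B * ((t - \<tau>) ^ n / fact n)) (at \<tau>)"
        by (simp add: fact_Suc del: power_Suc of_nat_Suc)
      show "0 \<le> r x s * B * ((t - \<tau>) ^ n / fact n)" using \<tau> B r_pos[of x s] by (simp add: less_imp_le)
    qed (auto simp: t)
    finally show ?thesis by (simp add: power_0_left)
  qed
  then have "(\<Sum>s\<in>UNIV. \<integral>\<^sup>+\<tau>. ennreal (r x s * exp (- lam x * \<tau>)) * ennreal (err n (t - \<tau>) (x + shift s)) * indicator {0..t} \<tau> \<partial>lborel)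
    \<le> (\<Sum>s\<in>UNIV. ennreal (r x s * B * (t ^ Suc n / fact (Suc n))))" by (intro sum_mono)
  also have "\<dots> = ennreal (\<Sum>s\<in>UNIV. r x s * B * (t ^ Suc n / fact (Suc n)))"
    using B t r_pos by (intro sum_ennreal mult_nonneg_nonneg) (auto simp: less_imp_le simp del: fact_Suc)
  also have "(\<Sum>s\<in>UNIV. r x s * B * (t ^ Suc n / fact (Suc n))) = lam x * (B * (t ^ Suc n / fact (Suc n)))"
    by (simp only: total_rate_def sum_distrib_right mult.assoc)
  also have "ennreal \<dots> \<le> ennreal (2 * real CARD('d) * c * (B * (t ^ Suc n / fact (Suc n))))"
    using B t by (intro ennreal_leI mult_right_mono total_rate_bounds(2)[OF ell c]) (auto simp del: fact_Suc)
  also have "2 * real CARD('d) * c * (B * (t ^ Suc n / fact (Suc n))) = err (Suc n) t x"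
    by (simp add: err_def B_def b_def[symmetric] a_def[symmetric] del: fact_Suc) (simp add: a_def)
  finally show ?thesis .
qed

text \<open>Iterating the renewal equation from 0 misses \<open>u\<close> by at most
  \<open>err\<close>, which tends to 0. Together with \<open>J_le\<close> this identifies the limit
  without a uniqueness theorem for unbounded solutions.\<close>

lemma u_le_J: "t \<ge> 0 \<Longrightarrow> ennreal (u t x) \<le> J n t x + ennreal (err n t x)"
proof (induction n arbitrary: t x)
  case 0
  then show ?case using u_le[of t x] by (auto simp: err_def intro!: ennreal_leI)
next
  case (Suc n)
  have [measurable]: "(\<lambda>\<tau>. err n (t - \<tau>) y) \<in> borel_measurable borel" for y unfolding err_def by measurable
  have "ennreal (u t x) = renew (\<lambda>t x. ennreal (u t x)) t x" using u_renew[OF Suc.prems] by simp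
  also have "\<dots> \<le> (\<Sum>s\<in>UNIV. \<integral>\<^sup>+\<tau>. ennreal (r x s * exp (- lam x * \<tau>)) *
      (if t < \<tau> then ennreal (f x) else J n (t - \<tau>) (x + shift s)) * indicator {0..} \<tau>
      + ennreal (r x s * exp (- lam x * \<tau>)) * ennreal (err n (t - \<tau>) (x + shift s)) * indicator {0..t} \<tau> \<partial>lborel)"
    unfolding renew_def
  proof (intro sum_mono nn_integral_mono)
    fix s and \<tau> :: real
    show "ennreal (r x s * exp (- lam x * \<tau>)) * (if t < \<tau> then ennreal (f x) else ennreal (u (t - \<tau>) (x + shift s))) * indicator {0..} \<tau>
      \<le> ennreal (r x s * exp (- lam x * \<tau>)) * (if t < \<tau> then ennreal (f x) else J n (t - \<tau>) (x + shift s)) * indicator {0..} \<tau>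
      + ennreal (r x s * exp (- lam x * \<tau>)) * ennreal (err n (t - \<tau>) (x + shift s)) * indicator {0..t} \<tau>"
    proof (cases "0 \<le> \<tau> \<and> \<tau> \<le> t")
      case True
      then have "ennreal (u (t - \<tau>) (x + shift s)) \<le> J n (t - \<tau>) (x + shift s) + ennreal (err n (t - \<tau>) (x + shift s))"
        by (intro Suc.IH) simp
      from mult_left_mono[OF this, of "ennreal (r x s * exp (- lam x * \<tau>))"] show ?thesis
        using True by (simp add: distrib_left)
    qed (auto simp: indicator_def)
  qed
  also have "\<dots> = renew (J n) t x + (\<Sum>s\<in>UNIV. \<integral>\<^sup>+\<tau>. ennreal (r x s * exp (- lam x * \<tau>)) * ennreal (err n (t - \<tau>) (x + shift s)) * indicator {0..t} \<tau> \<partial>lborel)"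
    unfolding renew_def sum.distrib[symmetric]
  proof (intro sum.cong refl nn_integral_add)
    fix s
    define a b y where "a = r x s" and "b = lam x" and "y = f x"
    define g h where "g \<tau> = J n (t - \<tau>) (x + shift s)" and "h \<tau> = err n (t - \<tau>) (x + shift s)" for \<tau>
    have [measurable]: "g \<in> borel_measurable borel" "h \<in> borel_measurable borel"
      unfolding g_def h_def by (rule measurable_compose[OF _ trunc_exp_measurable], simp) measurable
    show "(\<lambda>\<tau>. ennreal (r x s * exp (- lam x * \<tau>)) * (if t < \<tau> then ennreal (f x) else J n (t - \<tau>) (x + shift s)) * indicator {0..} \<tau>) \<in> borel_measurable lborel"
      unfolding a_def[symmetric] b_def[symmetric] y_def[symmetric] g_def[symmetric] by measurable
    show "(\<lambda>\<tau>. ennreal (r x s * exp (- lam x * \<tau>)) * ennreal (err n (t - \<tau>) (x + shift s)) * indicator {0..t} \<tau>) \<in> borel_measurable lborel"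
      unfolding a_def[symmetric] b_def[symmetric] h_def[symmetric] by measurable
  qed
  also have "\<dots> \<le> J (Suc n) t x + ennreal (err (Suc n) t x)"
    unfolding J_Suc by (intro add_left_mono err_Suc Suc.prems)
  finally show ?case .
qed

lemma err_tendsto: "(\<lambda>n. err n t x) \<longlonglongrightarrow> 0"
proof -
  have "(\<lambda>n. (2 * real CARD('d) * c * exp 1 * t) ^ n / fact n) \<longlonglongrightarrow> 0"
    using summable_LIMSEQ_zero[OF summable_exp[of "2 * real CARD('d) * c * exp 1 * t"]]
    by (simp add: divide_inverse mult.commute)
  from tendsto_mult_left[OF this, of "C * weight x * exp (l * (exp 1 - 1) * t)"]
  show ?thesis by (simp add: err_def power_mult_distrib)
qed

lemma reached_limit:
  assumes t: "t \<ge> 0"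
  shows "(\<integral>\<^sup>+\<omega>. (if \<exists>n. reached \<xi> n t x \<omega> then ennreal (f (walk \<xi> x t \<omega>)) else 0) \<partial>walk_measure) = ennreal (u t x)"
proof -
  have [measurable]: "(\<lambda>y. ennreal (f y)) \<in> borel_measurable (count_space UNIV)" by simp
  have mono: "reached \<xi> m t x \<omega> \<Longrightarrow> m \<le> n \<Longrightarrow> reached \<xi> n t x \<omega>" for m n \<omega>
    unfolding reached_def by (meson less_le_trans)
  have "(\<integral>\<^sup>+\<omega>. (if \<exists>n. reached \<xi> n t x \<omega> then ennreal (f (walk \<xi> x t \<omega>)) else 0) \<partial>walk_measure)
    = (\<integral>\<^sup>+\<omega>. (SUP n. if reached \<xi> n t x \<omega> then ennreal (f (walk \<xi> x t \<omega>)) else 0) \<partial>walk_measure)"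
  proof (rule nn_integral_cong)
    fix \<omega> :: "'d clocks stream"
    let ?g = "\<lambda>n. if reached \<xi> n t x \<omega> then ennreal (f (walk \<xi> x t \<omega>)) else 0"
    show "(if \<exists>n. reached \<xi> n t x \<omega> then ennreal (f (walk \<xi> x t \<omega>)) else 0) = (SUP n. ?g n)"
    proof (cases "\<exists>n. reached \<xi> n t x \<omega>")
      case True
      then obtain n where n: "reached \<xi> n t x \<omega>" by blast
      have "(SUP n. ?g n) = ennreal (f (walk \<xi> x t \<omega>))"
      proof (rule antisym)
        show "(SUP n. ?g n) \<le> ennreal (f (walk \<xi> x t \<omega>))" by (intro SUP_least) auto
        show "ennreal (f (walk \<xi> x t \<omega>)) \<le> (SUP n. ?g n)" using n by (intro SUP_upper2[of n]) auto
      qed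
      then show ?thesis using True by simp
    qed simp
  qed
  also have "\<dots> = (SUP n. J n t x)"
    unfolding trunc_exp_def
  proof (rule nn_integral_monotone_convergence_SUP)
    show "incseq (\<lambda>n \<omega>. if reached \<xi> n t x \<omega> then ennreal (f (walk \<xi> x t \<omega>)) else 0)"
      by (auto simp: incseq_def le_fun_def dest: mono)
  qed measurable
  also have "\<dots> = ennreal (u t x)"
  proof (rule antisym)
    show "(SUP n. J n t x) \<le> ennreal (u t x)" by (intro SUP_least J_le t)
    have "(\<lambda>n. (SUP n. J n t x) + ennreal (err n t x)) \<longlonglongrightarrow> (SUP n. J n t x) + ennreal 0"
      by (intro tendsto_add tendsto_const tendsto_ennrealI err_tendsto)
    moreover have "ennreal (u t x) \<le> (SUP n. J n t x) + ennreal (err n t x)" for n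
      by (rule order_trans[OF u_le_J[OF t, of x n]]) (intro add_right_mono SUP_upper, auto)
    ultimately show "ennreal (u t x) \<le> (SUP n. J n t x)"
      by (intro LIMSEQ_le_const[of "\<lambda>n. (SUP n. J n t x) + ennreal (err n t x)"]) auto
  qed
  finally show ?thesis .
qed

end

text \<open>Non-explosion: for \<open>f = 1\<close> the semigroup equals 1, so by
  \<open>reached_limit\<close> the event that some jump time exceeds \<open>t\<close> has full
  measure.\<close>

lemma (in rates) AE_reached:
  assumes t: "t \<ge> 0" shows "AE \<omega> in walk_measure. \<exists>n. reached \<xi> n t x \<omega>"
proof -
  interpret W: prob_space "walk_measure :: 'd clocks stream measure" by (rule prob_space_walk_measure)
  let ?l = "2 * real CARD('d) * c"
  interpret growth \<xi> c ?l "\<lambda>x. 1" 1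
    by unfold_locales (use weight_ge_1 in auto)
  have "semi ?l \<xi> (\<lambda>x. 1) t x = exp (- (?l * t)) * exp (?l * t)"
    using exp_converges[of "?l * t"] by (simp add: semi_def sums_iff divide_inverse mult.commute)
  then have "semi ?l \<xi> (\<lambda>x. 1) t x = 1" by (simp flip: exp_add)
  then have "(\<integral>\<^sup>+\<omega>. indicator {\<omega>. \<exists>n. reached \<xi> n t x \<omega>} \<omega> \<partial>walk_measure) = 1"
    using reached_limit[OF t, of x] unfolding ennreal_1 by (simp add: indicator_def of_bool_def)
  moreover have sets: "{\<omega>. \<exists>n. reached \<xi> n t x \<omega>} \<in> sets (walk_measure :: 'd clocks stream measure)"
  proof -
    have "{\<omega> \<in> space walk_measure. \<exists>n. reached \<xi> n t x \<omega>} \<in> sets (walk_measure :: 'd clocks stream measure)"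
      by measurable
    then show ?thesis by simp
  qed
  ultimately have "W.prob {\<omega>. \<exists>n. reached \<xi> n t x \<omega>} = 1"
    by (simp add: W.emeasure_eq_measure)
  then show ?thesis using W.prob_eq_1[OF sets] by simp
qed

lemma (in growth) walk_expectation:
  assumes t: "t \<ge> 0" shows "(\<integral>\<omega>. f (walk \<xi> x t \<omega>) \<partial>walk_measure) = semi l \<xi> f t x"
proof -
  have [measurable]: "f \<in> borel_measurable (count_space UNIV)" by simp
  have "(\<integral>\<^sup>+\<omega>. ennreal (f (walk \<xi> x t \<omega>)) \<partial>walk_measure)
    = (\<integral>\<^sup>+\<omega>. (if \<exists>n. reached \<xi> n t x \<omega> then ennreal (f (walk \<xi> x t \<omega>)) else 0) \<partial>walk_measure)"
    using AE_reached[OF t, of x] by (intro nn_integral_cong_AE) (auto elim!: eventually_mono)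
  then have "(\<integral>\<^sup>+\<omega>. ennreal (f (walk \<xi> x t \<omega>)) \<partial>walk_measure) = ennreal (u t x)"
    by (simp add: reached_limit[OF t])
  then show ?thesis
    by (subst integral_eq_nn_integral) (auto simp: f(1) u_nonneg[OF t])
qed

lemma square_growth: "(real_vec x \<bullet> v)\<^sup>2 \<le> 2 * (norm v)\<^sup>2 * weight x" for v :: "real ^ 'd::finite"
proof -
  define m where "m = (\<Sum>k\<in>UNIV. \<bar>real_of_int (x $ k)\<bar>)"
  have m: "m \<ge> 0" by (simp add: m_def sum_nonneg)
  have "norm (real_vec x) \<le> m"
    using norm_le_l1_cart[of "real_vec x"] by (simp add: m_def real_vec_def)
  then have "\<bar>real_vec x \<bullet> v\<bar> \<le> m * norm v"
    using Cauchy_Schwarz_ineq2[of "real_vec x" v] by (meson mult_right_mono norm_ge_zero order_trans)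
  then have "\<bar>real_vec x \<bullet> v\<bar>\<^sup>2 \<le> (m * norm v)\<^sup>2" by (intro power_mono) auto
  also have "m\<^sup>2 \<le> 2 * weight x"
    using exp_lower_Taylor_quadratic[OF m] m unfolding weight_def m_def[symmetric] by linarith
  then have "(m * norm v)\<^sup>2 \<le> 2 * (norm v)\<^sup>2 * weight x"
    using mult_right_mono[of "m\<^sup>2" "2 * weight x" "(norm v)\<^sup>2"] by (simp add: power_mult_distrib mult_ac)
  finally show ?thesis by simp
qed

lemma mean_square_eq_semi:
  fixes \<xi> :: "'d::finite env"
  assumes "elliptic c \<xi>" "c \<ge> 1" "2 * real CARD('d) * c \<le> l" "t \<ge> 0"
  shows "mean_square \<xi> t v = semi l \<xi> (\<lambda>x. (real_vec x \<bullet> v)\<^sup>2) t 0"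
proof -
  interpret growth \<xi> c l "\<lambda>x. (real_vec x \<bullet> v)\<^sup>2" "2 * (norm v)\<^sup>2"
    by unfold_locales (use assms square_growth in auto)
  show ?thesis unfolding mean_square_def by (rule walk_expectation[OF assms(4)])
qed

section \<open>Correctors and their response to a single conductance\<close>

section \<open>The Poisson equation and the corrector on the torus\<close>

text \<open>On mean zero periodic functions this inverts the negative generator, as the Neumann
  series of \<open>K = 1 + gen / l\<close>. It involves no choice, hence is measurable in the
  environment and commutes with shifts.\<close>

definition green :: "real \<Rightarrow> 'd::finite env \<Rightarrow> ('d site \<Rightarrow> real) \<Rightarrow> 'd site \<Rightarrow> real" where
  "green l \<xi> h x = (\<Sum>k. lazyn l \<xi> k h x) / l"

definition lin :: "real ^ 'd \<Rightarrow> 'd::finite site \<Rightarrow> real" where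
  "lin v x = real_vec x \<bullet> v"

definition corr :: "real \<Rightarrow> 'd::finite env \<Rightarrow> real ^ 'd \<Rightarrow> 'd site \<Rightarrow> real" where
  "corr l \<xi> v = green l \<xi> (gen \<xi> (lin v))"

definition wfield :: "real \<Rightarrow> 'd::finite env \<Rightarrow> real ^ 'd \<Rightarrow> 'd \<Rightarrow> 'd site \<Rightarrow> real" where
  "wfield l \<xi> v i x = v $ i + nab (corr l \<xi> v) i x"

definition Fq :: "nat \<Rightarrow> real \<Rightarrow> 'd::finite env \<Rightarrow> real ^ 'd \<Rightarrow> real" where
  "Fq N l \<xi> v = 2 / real (card (torus N :: 'd site set))
     * (\<Sum>x\<in>torus N. \<Sum>i\<in>UNIV. \<xi> (x, i) * (wfield l \<xi> v i x)\<^sup>2)"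

lemma lin_add: "lin v (x + y) = lin v x + lin v y"
  by (simp add: lin_def real_vec_def inner_vec_def distrib_right sum.distrib)

lemma lin_unit: "lin v (unit_site i) = v $ i"
proof -
  have "lin v (unit_site i) = (\<Sum>k\<in>UNIV. if k = i then v $ k else 0)"
    unfolding lin_def real_vec_def inner_vec_def unit_site_def axis_def
    by (intro sum.cong) auto
  then show ?thesis by simp
qed

lemma lin_zero [simp]: "lin v 0 = 0"
  by (simp add: lin_def real_vec_def inner_vec_def)

lemma nab_lin [simp]: "nab (lin v) i = (\<lambda>x. v $ i)"
  by (auto simp: nab_def lin_add lin_unit)

lemma lin_add_vec: "lin (u + v) = (\<lambda>x. lin u x + lin v x)"
  by (auto simp: lin_def inner_add_right)

lemma lin_scale_vec: "lin (a *\<^sub>R v) = (\<lambda>x. a * lin v x)"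
  by (auto simp: lin_def)

lemma gen_lin_env_shift: "gen (env_shift z \<xi>) (lin v) = (\<lambda>x. gen \<xi> (lin v) (x + z))"
proof
  fix x
  have "gen (env_shift z \<xi>) (\<lambda>x. lin v (x + z)) x = gen (env_shift z \<xi>) (lin v) x"
    by (simp add: lin_add gen_add)
  then show "gen (env_shift z \<xi>) (lin v) x = gen \<xi> (lin v) (x + z)"
    using gen_env_shift[of z \<xi> "lin v" x] by simp
qed

lemma corr_env_shift: "corr l (env_shift z \<xi>) v x = corr l \<xi> v (x + z)"
  unfolding corr_def green_def gen_lin_env_shift lazyn_env_shift ..

context torus_env
begin

lemma grad_energy_le: "grad_energy N f \<le> c * dform f f"
proof -
  have "(nab f i x)\<^sup>2 \<le> c * (\<xi> (x, i) * nab f i x * nab f i x)" for i x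
  proof -
    have "1 \<le> c * \<xi> (x, i)" using ellipticD(1)[OF ell, of "(x, i)"] c by (simp add: field_simps)
    from mult_right_mono[OF this, of "(nab f i x)\<^sup>2"] show ?thesis
      by (simp add: power2_eq_square mult_ac)
  qed
  then show ?thesis unfolding grad_energy_def dform_def
    by (simp add: sum_distrib_left sum_mono)
qed

lemma l_ge_1: "l \<ge> 1"
proof -
  have "1 \<le> real CARD('d)" by (simp add: Suc_le_eq)
  then have "1 * 1 \<le> (4 * real CARD('d)) * c" using c by (intro mult_mono) linarith+
  then show ?thesis using l by simp
qed

text \<open>A lower bound for the spectral gap of \<open>K\<close> on mean zero functions, from the
  Poincare constant, ellipticity and the rate \<open>l\<close>.\<close>

definition gap :: real where "gap = 1 / (l * (c * (real CARD('d) * real N)\<^sup>2))"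

lemma gap: "gap > 0" "gap \<le> 1"
proof -
  have "1 \<le> real CARD('d) * real N" using N by (simp add: Suc_le_eq flip: of_nat_mult)
  then have "1 \<le> (real CARD('d) * real N)\<^sup>2" by simp
  then have "1 * 1 \<le> c * (real CARD('d) * real N)\<^sup>2" using c by (intro mult_mono) auto
  then have "1 * 1 \<le> l * (c * (real CARD('d) * real N)\<^sup>2)" using l_ge_1 by (intro mult_mono) linarith+
  then show "gap > 0" "gap \<le> 1" by (simp_all add: gap_def)
qed

text \<open>Cauchy-Schwarz over the directions, weighted by the rates, bounds the squared drift by
  the total rate times the local energy.\<close>

lemma gen_square_le: "(\<Sum>x\<in>T. (gen \<xi> h x)\<^sup>2) \<le> l * dform h h" if "periodic N h"
proof -
  have "(gen \<xi> h x)\<^sup>2 \<le> 2 * real CARD('d) * c * gen \<xi> (\<lambda>y. (h y - h x)\<^sup>2) x" for x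
  proof -
    have "(gen \<xi> h x)\<^sup>2 = (\<Sum>s\<in>UNIV. sqrt (rate \<xi> x s) * (sqrt (rate \<xi> x s) * (h (x + shift s) - h x)))\<^sup>2"
      unfolding gen_eq_rate using rate_bounds(1)[OF ell c] by (simp add: mult.assoc[symmetric] less_imp_le)
    also have "\<dots> \<le> (\<Sum>s\<in>UNIV. (sqrt (rate \<xi> x s))\<^sup>2) * (\<Sum>s\<in>UNIV. (sqrt (rate \<xi> x s) * (h (x + shift s) - h x))\<^sup>2)"
      by (rule Cauchy_Schwarz_ineq_sum)
    also have "\<dots> = total_rate \<xi> x * gen \<xi> (\<lambda>y. (h y - h x)\<^sup>2) x"
      using rate_bounds(1)[OF ell c]
      by (simp add: total_rate_def gen_eq_rate power_mult_distrib less_imp_le)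
    also have "\<dots> \<le> 2 * real CARD('d) * c * gen \<xi> (\<lambda>y. (h y - h x)\<^sup>2) x"
      using total_rate_bounds(2)[OF ell c, of x] rate_bounds(1)[OF ell c]
      by (intro mult_right_mono) (auto simp: gen_eq_rate less_imp_le intro!: sum_nonneg)
    finally show ?thesis .
  qed
  then have "(\<Sum>x\<in>T. (gen \<xi> h x)\<^sup>2) \<le> (\<Sum>x\<in>T. 2 * real CARD('d) * c * gen \<xi> (\<lambda>y. (h y - h x)\<^sup>2) x)"
    by (intro sum_mono)
  also have "\<dots> = 4 * real CARD('d) * c * dform h h"
    using that by (simp add: sum_distrib_left[symmetric] sum_gen_square periodic_nab)
  also have "\<dots> \<le> l * dform h h" by (intro mult_right_mono l dform_nonneg)
  finally show ?thesis .
qed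

text \<open>In the square of \<open>h + gen \<xi> h / l\<close> the cross term contributes -2 times
  \<open>dform h h / l\<close> and the last square at most +1 times; Poincare converts what remains
  into the gap.\<close>

lemma K_contract:
  assumes "periodic N h" "(\<Sum>x\<in>T. h x) = 0"
  shows "(\<Sum>x\<in>T. (K h x)\<^sup>2) \<le> (1 - gap) * (\<Sum>x\<in>T. (h x)\<^sup>2)"
proof -
  have *: "(K h x)\<^sup>2 = (h x)\<^sup>2 + 2 / l * (h x * gen \<xi> h x) + (gen \<xi> h x)\<^sup>2 / l\<^sup>2" for x
    using l_pos by (simp add: lazy_def power2_sum power_divide)
  have "(\<Sum>x\<in>T. (K h x)\<^sup>2) = (\<Sum>x\<in>T. (h x)\<^sup>2) + 2 / l * (- dform h h) + (\<Sum>x\<in>T. (gen \<xi> h x)\<^sup>2) / l\<^sup>2"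
    unfolding * sum.distrib sum_distrib_left[symmetric] sum_divide_distrib[symmetric]
    using assms(1) by (simp add: sum_gen periodic_nab)
  also have "(\<Sum>x\<in>T. (gen \<xi> h x)\<^sup>2) / l\<^sup>2 \<le> dform h h / l"
    using divide_right_mono[OF gen_square_le[OF assms(1)], of "l\<^sup>2"] l_pos by (simp add: power2_eq_square)
  also have "2 / l * (- dform h h) = - 2 * (dform h h / l)" by simp
  finally have "(\<Sum>x\<in>T. (K h x)\<^sup>2) \<le> (\<Sum>x\<in>T. (h x)\<^sup>2) - dform h h / l" by simp
  moreover have "gap * (\<Sum>x\<in>T. (h x)\<^sup>2) \<le> dform h h / l"
  proof -
    have "0 < (real CARD('d) * real N)\<^sup>2" using N by simp
    moreover have "(\<Sum>x\<in>T. (h x)\<^sup>2) \<le> (real CARD('d) * real N)\<^sup>2 * (c * dform h h)"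
      using poincare_torus[OF N assms] grad_energy_le[of h]
      by (meson mult_left_mono order_trans zero_le_power2)
    ultimately show ?thesis using l_pos c unfolding gap_def by (simp add: divide_simps mult_ac)
  qed
  ultimately show ?thesis by (simp add: algebra_simps)
qed

lemma Kn_contract:
  assumes "periodic N h" "(\<Sum>x\<in>T. h x) = 0"
  shows "(\<Sum>x\<in>T. ((K ^^ n) h x)\<^sup>2) \<le> (1 - gap) ^ n * (\<Sum>x\<in>T. (h x)\<^sup>2)"
proof (induction n)
  case (Suc n)
  have "(\<Sum>x\<in>T. ((K ^^ Suc n) h x)\<^sup>2) \<le> (1 - gap) * (\<Sum>x\<in>T. ((K ^^ n) h x)\<^sup>2)"
    using K_contract[OF periodic_Kn[OF assms(1)]] sum_Kn[OF assms(1)] assms(2) by simp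
  also have "\<dots> \<le> (1 - gap) * ((1 - gap) ^ n * (\<Sum>x\<in>T. (h x)\<^sup>2))"
    using Suc gap by (intro mult_left_mono) auto
  finally show ?case by (simp add: mult.assoc)
qed simp

lemma Kn_le:
  assumes "periodic N h" "(\<Sum>x\<in>T. h x) = 0"
  shows "\<bar>(K ^^ n) h x\<bar> \<le> sqrt (1 - gap) ^ n * sqrt (\<Sum>x\<in>T. (h x)\<^sup>2)"
proof -
  have "((K ^^ n) h y)\<^sup>2 \<le> (1 - gap) ^ n * (\<Sum>x\<in>T. (h x)\<^sup>2)" if "y \<in> T" for y
    using member_le_sum[of y T "\<lambda>x. ((K ^^ n) h x)\<^sup>2"] that Kn_contract[OF assms, of n] by simp
  then have "((K ^^ n) h x)\<^sup>2 \<le> (1 - gap) ^ n * (\<Sum>x\<in>T. (h x)\<^sup>2)"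
    by (rule periodic_ext[OF N periodic_Kn[OF assms(1)], where P = "\<lambda>t. t\<^sup>2 \<le> _"])
  from real_sqrt_le_mono[OF this] show ?thesis by (simp add: real_sqrt_mult real_sqrt_power[of "1 - gap"])
qed

lemma summable_Kn:
  assumes "periodic N h" "(\<Sum>x\<in>T. h x) = 0"
  shows "summable (\<lambda>k. (K ^^ k) h x)"
proof (rule summable_comparison_test')
  have "norm (sqrt (1 - gap)) < 1" using gap by simp
  then show "summable (\<lambda>k. sqrt (1 - gap) ^ k * sqrt (\<Sum>x\<in>T. (h x)\<^sup>2))"
    by (intro summable_mult2 summable_geometric)
qed (use Kn_le[OF assms] in auto)

lemma green_LIMSEQ:
  assumes "periodic N h" "(\<Sum>x\<in>T. h x) = 0"
  shows "(\<lambda>n. (\<Sum>k<n. (K ^^ k) h x) / l) \<longlonglongrightarrow> green l \<xi> h x"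
  unfolding green_def using l_pos by (intro tendsto_divide summable_LIMSEQ summable_Kn assms) auto

text \<open>Under \<open>K - 1\<close> the partial sums telescope, and the limit passes through
  \<open>K\<close> because each of its values is a finite combination of values.\<close>

lemma gen_green:
  assumes "periodic N h" "(\<Sum>x\<in>T. h x) = 0"
  shows "gen \<xi> (green l \<xi> h) x = - h x"
proof -
  define S where "S n x = (\<Sum>k<n. (K ^^ k) h x) / l" for n x
  have S: "(\<lambda>n. S n x) \<longlonglongrightarrow> green l \<xi> h x" for x
    unfolding S_def by (rule green_LIMSEQ[OF assms])
  have "K (S n) x = S (Suc n) x - h x / l" for n
  proof -
    have "S n = (\<lambda>x. (1 / l) * (\<Sum>k<n. (K ^^ k) h x))" by (auto simp: S_def)
    then have "K (S n) x = (1 / l) * K (\<lambda>x. \<Sum>k<n. (K ^^ k) h x) x" by (simp only: lazy_cmult)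
    also have "K (\<lambda>x. \<Sum>k<n. (K ^^ k) h x) x = (\<Sum>k<n. K ((K ^^ k) h) x)"
      using lazyn_sum[of "{..<n}" 1 l \<xi> "\<lambda>k. (K ^^ k) h"] by (simp add: fun_eq_iff)
    also have "(\<Sum>k<n. K ((K ^^ k) h) x) = (\<Sum>k<Suc n. (K ^^ k) h x) - h x"
      by (simp only: sum.lessThan_Suc_shift) simp
    finally show ?thesis by (simp only: S_def[of "Suc n" x]) (simp add: diff_divide_distrib)
  qed
  moreover have "(\<lambda>n. K (S n) x) \<longlonglongrightarrow> K (green l \<xi> h) x"
    unfolding lazy_eq_rate by (intro tendsto_intros S)
  moreover have "(\<lambda>n. S (Suc n) x - h x / l) \<longlonglongrightarrow> green l \<xi> h x - h x / l"
    by (intro tendsto_intros LIMSEQ_Suc[OF S])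
  ultimately have "K (green l \<xi> h) x = green l \<xi> h x - h x / l"
    using LIMSEQ_unique by simp
  then have "gen \<xi> (green l \<xi> h) x / l = (- h x) / l" by (simp add: lazy_def)
  then show ?thesis using l_pos by (simp only: divide_cancel_right) simp
qed

lemma periodic_green: "periodic N h \<Longrightarrow> periodic N (green l \<xi> h)"
  using periodic_Kn by (simp add: periodic_def green_def)

lemma sum_green:
  assumes "periodic N h" "(\<Sum>x\<in>T. h x) = 0"
  shows "(\<Sum>x\<in>T. green l \<xi> h x) = 0"
proof -
  have "(\<lambda>n. \<Sum>x\<in>T. (\<Sum>k<n. (K ^^ k) h x) / l) \<longlonglongrightarrow> (\<Sum>x\<in>T. green l \<xi> h x)"
    by (intro tendsto_sum green_LIMSEQ assms)
  moreover have "(\<Sum>x\<in>T. (\<Sum>k<n. (K ^^ k) h x) / l) = 0" for n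
    unfolding sum_divide_distrib[symmetric] by (subst sum.swap) (simp add: sum_Kn assms)
  ultimately show ?thesis using LIMSEQ_unique[OF tendsto_const] by fastforce
qed

lemma green_add:
  assumes "periodic N h" "(\<Sum>x\<in>T. h x) = 0" "periodic N h'" "(\<Sum>x\<in>T. h' x) = 0"
  shows "green l \<xi> (\<lambda>x. h x + h' x) x = green l \<xi> h x + green l \<xi> h' x"
  unfolding green_def lazyn_add
  by (subst suminf_add[symmetric]) (auto intro!: summable_Kn assms simp: add_divide_distrib)

lemma green_cmult:
  assumes "periodic N h" "(\<Sum>x\<in>T. h x) = 0"
  shows "green l \<xi> (\<lambda>x. a * h x) x = a * green l \<xi> h x"
  unfolding green_def lazyn_cmult
  by (subst suminf_mult) (auto intro!: summable_Kn assms)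

lemma green_energy:
  assumes "periodic N q" "(\<Sum>x\<in>T. q x) = 0" "periodic N f"
  shows "dform f (green l \<xi> q) = (\<Sum>x\<in>T. q x * f x)"
  using sum_gen[OF assms(3) periodic_nab[OF periodic_green[OF assms(1)]]] gen_green[OF assms(1,2)]
  by (simp add: sum_negf mult.commute)

text \<open>Young's inequality between \<open>q\<close> and its potential is balanced by the
  Poincare constant \<open>m\<close>, so that half of the energy is absorbed on the left.\<close>

lemma green_grad_energy:
  assumes "periodic N q" "(\<Sum>x\<in>T. q x) = 0"
  shows "grad_energy N (green l \<xi> q) \<le> (c * real CARD('d) * real N)\<^sup>2 * (\<Sum>x\<in>T. (q x)\<^sup>2)"
proof -
  define \<psi> where "\<psi> = green l \<xi> q"
  define m where "m = (real CARD('d) * real N)\<^sup>2"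
  have m: "m > 0" using N by (simp add: m_def)
  have "c * (q x * \<psi> x) \<le> (c\<^sup>2 * m * (q x)\<^sup>2 + (\<psi> x)\<^sup>2 / m) / 2" for x
  proof -
    have "0 \<le> (c * m * q x - \<psi> x)\<^sup>2 / m" using m by simp
    then show ?thesis using m by (simp add: power2_eq_square field_simps)
  qed
  then have "(\<Sum>x\<in>T. c * (q x * \<psi> x)) \<le> (\<Sum>x\<in>T. (c\<^sup>2 * m * (q x)\<^sup>2 + (\<psi> x)\<^sup>2 / m) / 2)"
    by (intro sum_mono)
  then have "c * (\<Sum>x\<in>T. q x * \<psi> x) \<le> (c\<^sup>2 * m * (\<Sum>x\<in>T. (q x)\<^sup>2) + (\<Sum>x\<in>T. (\<psi> x)\<^sup>2) / m) / 2"
    by (simp add: sum_distrib_left sum.distrib sum_divide_distrib add_divide_distrib)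
  moreover have "(\<Sum>x\<in>T. (\<psi> x)\<^sup>2) / m \<le> grad_energy N \<psi>"
    using poincare_torus[OF N periodic_green[OF assms(1)] sum_green[OF assms]] m
    unfolding \<psi>_def m_def by (simp add: pos_divide_le_eq mult.commute)
  moreover have "grad_energy N \<psi> \<le> c * (\<Sum>x\<in>T. q x * \<psi> x)"
    using grad_energy_le[of \<psi>] green_energy[OF assms periodic_green[OF assms(1)]] by (simp add: \<psi>_def)
  ultimately have "grad_energy N \<psi> \<le> c\<^sup>2 * m * (\<Sum>x\<in>T. (q x)\<^sup>2)" by argo
  then show ?thesis by (simp add: \<psi>_def m_def power_mult_distrib mult.assoc)
qed

subsection \<open>The corrector\<close>

abbreviation "V v \<equiv> gen \<xi> (lin v)"

lemma V: "periodic N (V v)" "(\<Sum>x\<in>T. V v x) = 0"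
  by (auto intro!: periodic_gen sum_gen_zero)

lemma periodic_corr: "periodic N (corr l \<xi> v)"
  unfolding corr_def by (intro periodic_green V)

lemma sum_corr: "(\<Sum>x\<in>T. corr l \<xi> v x) = 0"
  unfolding corr_def by (intro sum_green V)

abbreviation "U v \<equiv> \<lambda>x. lin v x + corr l \<xi> v x"

lemma gen_U: "gen \<xi> (U v) x = 0"
  unfolding gen_add corr_def by (simp add: gen_green[OF V])

lemma nab_U: "nab (U v) i = wfield l \<xi> v i"
  by (auto simp: nab_def wfield_def lin_add lin_unit)

lemma periodic_wfield: "periodic N (wfield l \<xi> v i)"
  unfolding wfield_def[abs_def] by (rule periodic_add[OF periodic_const periodic_nab[OF periodic_corr]])

lemma periodic_nab_U: "periodic N (nab (U v) i)"
  by (simp only: nab_U periodic_wfield)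

lemma dv_wfield: "dv (\<lambda>i x. \<xi> (x, i) * wfield l \<xi> v i x) x = 0"
  using gen_U[of v x] by (simp only: gen_def nab_U)

lemma wfield_orth:
  assumes "periodic N f"
  shows "(\<Sum>x\<in>T. \<Sum>i\<in>UNIV. \<xi> (x, i) * wfield l \<xi> v i x * nab f i x) = 0"
  using sum_gen[OF assms periodic_nab_U[of v]]
  by (simp only: gen_U) (simp add: dform_def nab_U mult_ac)

lemma wfield_energy:
  "(\<Sum>x\<in>T. \<Sum>i\<in>UNIV. \<xi> (x, i) * (wfield l \<xi> v i x)\<^sup>2) = (\<Sum>x\<in>T. \<Sum>i\<in>UNIV. \<xi> (x, i) * wfield l \<xi> v i x * v $ i)"
proof -
  have "\<xi> (x, i) * (wfield l \<xi> v i x)\<^sup>2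
    = \<xi> (x, i) * wfield l \<xi> v i x * v $ i + \<xi> (x, i) * wfield l \<xi> v i x * nab (corr l \<xi> v) i x" for x i
    by (simp add: wfield_def power2_eq_square algebra_simps)
  then show ?thesis using wfield_orth[OF periodic_corr, of v v] by (simp add: sum.distrib)
qed

lemma wfield_energy_le:
  "(\<Sum>x\<in>T. \<Sum>i\<in>UNIV. \<xi> (x, i) * (wfield l \<xi> v i x)\<^sup>2) \<le> c * real (card T) * (v \<bullet> v)"
proof -
  let ?E = "\<Sum>x\<in>T. \<Sum>i\<in>UNIV. \<xi> (x, i) * (wfield l \<xi> v i x)\<^sup>2"
  have "?E \<le> (\<Sum>x\<in>T. \<Sum>i\<in>UNIV. (\<xi> (x, i) * (wfield l \<xi> v i x)\<^sup>2 + c * (v $ i)\<^sup>2) / 2)"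
    unfolding wfield_energy
  proof (intro sum_mono)
    fix x i
    have "wfield l \<xi> v i x * v $ i \<le> ((wfield l \<xi> v i x)\<^sup>2 + (v $ i)\<^sup>2) / 2"
      using zero_le_power2[of "wfield l \<xi> v i x - v $ i"] by (simp add: power2_eq_square algebra_simps)
    from mult_left_mono[OF this less_imp_le[OF pos[of "(x, i)"]]]
    have "\<xi> (x, i) * wfield l \<xi> v i x * v $ i \<le> (\<xi> (x, i) * (wfield l \<xi> v i x)\<^sup>2 + \<xi> (x, i) * (v $ i)\<^sup>2) / 2"
      by (simp add: algebra_simps)
    also have "\<xi> (x, i) * (v $ i)\<^sup>2 \<le> c * (v $ i)\<^sup>2"
      using ellipticD(2)[OF ell] by (intro mult_right_mono) auto
    finally show "\<xi> (x, i) * wfield l \<xi> v i x * v $ i \<le> (\<xi> (x, i) * (wfield l \<xi> v i x)\<^sup>2 + c * (v $ i)\<^sup>2) / 2"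
      by simp
  qed
  also have "\<dots> = (?E + c * real (card T) * (v \<bullet> v)) / 2"
    by (simp add: inner_vec_def sum.distrib sum_divide_distrib[symmetric] sum_distrib_left[symmetric] power2_eq_square)
  finally show ?thesis by argo
qed

lemma sum_wfield_le:
  "(\<Sum>x\<in>T. \<Sum>i\<in>UNIV. (wfield l \<xi> v i x)\<^sup>2) \<le> c\<^sup>2 * real (card T) * (v \<bullet> v)"
proof -
  have "(wfield l \<xi> v i x)\<^sup>2 \<le> c * (\<xi> (x, i) * (wfield l \<xi> v i x)\<^sup>2)" for i x
  proof -
    have "1 \<le> c * \<xi> (x, i)" using ellipticD(1)[OF ell, of "(x, i)"] c by (simp add: field_simps)
    from mult_right_mono[OF this, of "(wfield l \<xi> v i x)\<^sup>2"] show ?thesis by (simp add: mult_ac)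
  qed
  then have "(\<Sum>x\<in>T. \<Sum>i\<in>UNIV. (wfield l \<xi> v i x)\<^sup>2)
      \<le> c * (\<Sum>x\<in>T. \<Sum>i\<in>UNIV. \<xi> (x, i) * (wfield l \<xi> v i x)\<^sup>2)"
    by (simp add: sum_distrib_left sum_mono)
  also have "\<dots> \<le> c * (c * real (card T) * (v \<bullet> v))"
    using c by (intro mult_left_mono wfield_energy_le) auto
  finally show ?thesis by (simp add: power2_eq_square mult.assoc)
qed

lemma grad_energy_corr: "grad_energy N (corr l \<xi> v) \<le> 4 * c\<^sup>2 * real (card T) * (v \<bullet> v)"
proof -
  have "(nab (corr l \<xi> v) i x)\<^sup>2 \<le> 2 * (wfield l \<xi> v i x)\<^sup>2 + 2 * (v $ i)\<^sup>2" for i x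
    using zero_le_power2[of "nab (corr l \<xi> v) i x + 2 * v $ i"]
    by (simp add: wfield_def power2_eq_square algebra_simps)
  then have "grad_energy N (corr l \<xi> v) \<le> (\<Sum>x\<in>T. \<Sum>i\<in>UNIV. 2 * (wfield l \<xi> v i x)\<^sup>2 + 2 * (v $ i)\<^sup>2)"
    unfolding grad_energy_def by (intro sum_mono)
  also have "\<dots> = 2 * (\<Sum>x\<in>T. \<Sum>i\<in>UNIV. (wfield l \<xi> v i x)\<^sup>2) + 2 * real (card T) * (v \<bullet> v)"
    by (simp add: inner_vec_def sum.distrib sum_distrib_left power2_eq_square mult_ac)
  also have "\<dots> \<le> 2 * (c\<^sup>2 * real (card T) * (v \<bullet> v)) + 2 * (c\<^sup>2 * real (card T) * (v \<bullet> v))"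
  proof -
    have "1 * (real (card T) * (v \<bullet> v)) \<le> c\<^sup>2 * (real (card T) * (v \<bullet> v))"
      using c by (intro mult_right_mono) auto
    then show ?thesis using sum_wfield_le[of v] unfolding mult.assoc mult_1 by linarith
  qed
  finally show ?thesis by (simp add: mult_ac)
qed

lemma Fq_dform: "Fq N l \<xi> v = 2 / real (card T) * dform (U v) (U v)"
  by (simp add: Fq_def dform_def nab_U power2_eq_square mult.assoc)

lemma Fq_bounds: "0 \<le> Fq N l \<xi> v" "Fq N l \<xi> v \<le> 2 * c * (v \<bullet> v)"
proof -
  show "0 \<le> Fq N l \<xi> v" unfolding Fq_dform using dform_nonneg by simp
  have "Fq N l \<xi> v \<le> 2 / real (card T) * (c * real (card T) * (v \<bullet> v))"
    unfolding Fq_def by (intro mult_left_mono wfield_energy_le) auto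
  moreover have "T \<noteq> {}" using card_torus_pos[OF N, where 'd='d] by force
  ultimately show "Fq N l \<xi> v \<le> 2 * c * (v \<bullet> v)" by simp
qed

lemma corr_add: "corr l \<xi> (u + v) x = corr l \<xi> u x + corr l \<xi> v x"
proof -
  have "V (u + v) = (\<lambda>x. V u x + V v x)" by (auto simp: lin_add_vec gen_add)
  then show ?thesis unfolding corr_def by (simp add: green_add V)
qed

lemma corr_scale: "corr l \<xi> (a *\<^sub>R v) x = a * corr l \<xi> v x"
proof -
  have "V (a *\<^sub>R v) = (\<lambda>x. a * V v x)" by (auto simp: lin_scale_vec gen_cmult)
  then show ?thesis unfolding corr_def by (simp add: green_cmult V)
qed

lemma wfield_add: "wfield l \<xi> (u + v) i x = wfield l \<xi> u i x + wfield l \<xi> v i x"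
  by (simp add: wfield_def nab_def corr_add)

lemma wfield_scale: "wfield l \<xi> (a *\<^sub>R v) i x = a * wfield l \<xi> v i x"
  by (simp add: wfield_def nab_def corr_scale algebra_simps)

lemma periodic_bounded:
  fixes f :: "'d site \<Rightarrow> real"
  assumes "periodic N f" obtains B where "B \<ge> 0" "\<And>x. \<bar>f x\<bar> \<le> B"
proof
  have "\<bar>f x\<bar> \<le> (\<Sum>x\<in>T. \<bar>f x\<bar>)" if "x \<in> T" for x
    using that by (intro member_le_sum) auto
  then show "\<bar>f x\<bar> \<le> (\<Sum>x\<in>T. \<bar>f x\<bar>)" for x
    by (rule periodic_ext[OF N assms, where P = "\<lambda>t. \<bar>t\<bar> \<le> _"])
qed (intro sum_nonneg, auto)

text \<open>
  The function \<open>(lin v)\<^sup>2\<close> is comparable to \<open>U\<^sup>2 + \<psi>\<close> with \<open>\<psi>\<close> periodic, and \<open>\<psi>\<close> can be chosen such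
  that the generator maps \<open>U\<^sup>2 + \<psi>\<close> to the constant \<open>Fq\<close>.
\<close>

lemma Kn_square:
  assumes "\<epsilon> > 0"
  obtains C where "\<And>n. \<bar>(K ^^ n) (\<lambda>y. (lin v y)\<^sup>2) 0 - real n * (Fq N l \<xi> v / l)\<bar> \<le> \<epsilon> * real n + C"
proof -
  define F where "F = Fq N l \<xi> v"
  define \<Gamma> where "\<Gamma> x = gen \<xi> (\<lambda>y. (U v y - U v x)\<^sup>2) x" for x
  define h where "h x = \<Gamma> x - F" for x
  define \<psi> where "\<psi> = green l \<xi> h"
  define p where "p x = (U v x)\<^sup>2 + \<psi> x" for x
  have F: "F \<ge> 0" using Fq_bounds by (simp add: F_def)
  have h: "periodic N h"
    unfolding h_def[abs_def] \<Gamma>_def[abs_def]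
    by (rule periodic_diff[OF periodic_gen_square[OF periodic_nab_U] periodic_const])
  have "(\<Sum>x\<in>T. \<Gamma> x) = 2 * dform (U v) (U v)"
    unfolding \<Gamma>_def by (rule sum_gen_square[OF periodic_nab_U])
  then have h0: "(\<Sum>x\<in>T. h x) = 0"
    using card_torus_pos[OF N, where 'd='d] by (auto simp: h_def sum_subtractf F_def Fq_dform)
  have genp: "gen \<xi> p x = F" for x
  proof -
    have "gen \<xi> p x = gen \<xi> (\<lambda>y. (U v y - 0)\<^sup>2) x + gen \<xi> \<psi> x"
      unfolding p_def[abs_def] by (simp add: gen_add)
    also have "\<dots> = \<Gamma> x - h x"
      unfolding gen_square[where a = 0] gen_U \<psi>_def gen_green[OF h h0] by (simp add: \<Gamma>_def)
    finally show ?thesis by (simp add: h_def)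
  qed
  have Kp: "(K ^^ n) p = (\<lambda>x. p x + real n * (F / l))" for n
  proof (induction n)
    case (Suc n)
    have "K (\<lambda>x. p x + real n * (F / l)) x = p x + F / l + real n * (F / l)" for x
      by (simp only: lazy_add lazy_const) (simp add: lazy_def genp)
    then show ?case using Suc by (auto simp: algebra_simps add_divide_distrib)
  qed simp
  obtain B1 where B1: "B1 \<ge> 0" "\<And>x. \<bar>corr l \<xi> v x\<bar> \<le> B1" using periodic_bounded[OF periodic_corr[of v]] by blast
  obtain B2 where B2: "B2 \<ge> 0" "\<And>x. \<bar>\<psi> x\<bar> \<le> B2"
    using periodic_bounded[OF periodic_green[OF h]] unfolding \<psi>_def by blast
  \<comment> \<open>A relative error \<delta> in \<open>p\<close>, which grows by
    \<open>F / l\<close> per step, then costs at most \<epsilon> per step; the summand 1 keeps the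
    denominator positive.\<close>
  define \<delta> where "\<delta> = \<epsilon> / (F / l + 1)"
  have Fl: "F / l \<ge> 0" using F l_pos by simp
  have "\<delta> > 0" using Fl assms by (simp add: \<delta>_def)
  moreover have "\<delta> * (F / l + 1) = \<epsilon>" using Fl by (simp add: \<delta>_def)
  ultimately have \<delta>: "\<delta> > 0" "\<delta> * (F / l) \<le> \<epsilon>" by (simp_all add: distrib_left)
  define C where "C = (1 + \<delta>) * B2 + (1 + 1 / \<delta>) * B1\<^sup>2"
  have near: "\<bar>(lin v y)\<^sup>2 - p y\<bar> \<le> \<delta> * p y + C" for y
  proof -
    define a b where "a = U v y" and "b = corr l \<xi> v y"
    have b: "b\<^sup>2 \<le> B1\<^sup>2" using B1(2)[of y] power_mono[of "\<bar>b\<bar>" B1 2] by (simp add: b_def)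
    have p: "p y = a\<^sup>2 + \<psi> y" by (simp add: p_def a_def)
    have "(lin v y)\<^sup>2 - a\<^sup>2 = b\<^sup>2 - 2 * a * b" by (simp add: a_def b_def power2_eq_square algebra_simps)
    moreover have "\<bar>2 * a * b\<bar> \<le> \<delta> * a\<^sup>2 + (1 / \<delta>) * b\<^sup>2"
    proof -
      have "0 \<le> (\<delta> * a + b)\<^sup>2 / \<delta>" "0 \<le> (\<delta> * a - b)\<^sup>2 / \<delta>" using \<delta> by simp_all
      then have "- (2 * a * b) \<le> \<delta> * a\<^sup>2 + (1 / \<delta>) * b\<^sup>2" "2 * a * b \<le> \<delta> * a\<^sup>2 + (1 / \<delta>) * b\<^sup>2"
        using \<delta> by (simp_all add: power2_eq_square field_simps)
      then show ?thesis by linarith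
    qed
    ultimately have "\<bar>(lin v y)\<^sup>2 - a\<^sup>2\<bar> \<le> \<delta> * a\<^sup>2 + (1 + 1 / \<delta>) * b\<^sup>2"
      using zero_le_power2[of b] unfolding distrib_right mult_1 by linarith
    moreover have "(1 + 1 / \<delta>) * b\<^sup>2 \<le> (1 + 1 / \<delta>) * B1\<^sup>2"
      using b \<delta> by (intro mult_left_mono) auto
    moreover have "\<bar>\<psi> y\<bar> \<le> B2" by (rule B2)
    moreover have "- (\<delta> * \<psi> y) \<le> \<delta> * B2"
      using mult_left_mono[of "- \<psi> y" B2 \<delta>] B2(2)[of y] \<delta> by simp
    ultimately show ?thesis unfolding p C_def by (simp add: algebra_simps)
  qed
  have "\<bar>(K ^^ n) (\<lambda>y. (lin v y)\<^sup>2) 0 - (K ^^ n) p 0\<bar> \<le> \<delta> * (K ^^ n) p 0 + C" for n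
  proof -
    have "(lin v y)\<^sup>2 \<le> (1 + \<delta>) * p y + C" "(1 - \<delta>) * p y - C \<le> (lin v y)\<^sup>2" for y
      using near[of y] by (simp_all add: algebra_simps abs_le_iff)
    then show ?thesis
      using lazyn_mono[OF ell c l2, of "\<lambda>y. (lin v y)\<^sup>2" "\<lambda>y. (1 + \<delta>) * p y + C" n 0]
        lazyn_mono[OF ell c l2, of "\<lambda>y. (1 - \<delta>) * p y - C" "\<lambda>y. (lin v y)\<^sup>2" n 0]
      by (simp only: lazyn_add lazyn_diff lazyn_cmult lazyn_const) (simp add: algebra_simps abs_le_iff)
  qed
  then have "\<bar>(K ^^ n) (\<lambda>y. (lin v y)\<^sup>2) 0 - real n * (F / l)\<bar>
      \<le> \<epsilon> * real n + (\<delta> * \<bar>p 0\<bar> + C + \<bar>p 0\<bar>)" for n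
  proof -
    have "\<delta> * (real n * (F / l)) \<le> \<epsilon> * real n"
      using mult_right_mono[OF \<delta>(2), of "real n"] by (simp add: mult_ac)
    moreover have "\<delta> * p 0 \<le> \<delta> * \<bar>p 0\<bar>" using \<delta> by (intro mult_left_mono) auto
    moreover have "\<bar>(K ^^ n) (\<lambda>y. (lin v y)\<^sup>2) 0 - (p 0 + real n * (F / l))\<bar> \<le> \<delta> * (p 0 + real n * (F / l)) + C"
      using \<open>\<And>n. \<bar>(K ^^ n) (\<lambda>y. (lin v y)\<^sup>2) 0 - (K ^^ n) p 0\<bar> \<le> _\<close>[of n] by (simp add: Kp)
    ultimately show ?thesis by (simp add: distrib_left)
  qed
  then show ?thesis using that unfolding F_def by blast
qed

end

subsection \<open>Changing a single conductance\<close>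

locale torus_env_pair = torus_env N c l \<xi> + E': torus_env N c l \<xi>'
  for N c l and \<xi> \<xi>' :: "'d::finite env" +
  fixes z :: "'d site" and k :: 'd
  assumes z: "z \<in> torus N" and agree: "\<And>x i. x \<in> torus N \<Longrightarrow> (x, i) \<noteq> (z, k) \<Longrightarrow> \<xi>' (x, i) = \<xi> (x, i)"
begin

lemma sum_diff_bond:
  "(\<Sum>x\<in>T. \<Sum>i\<in>UNIV. \<xi>' (x, i) * g i x) = (\<Sum>x\<in>T. \<Sum>i\<in>UNIV. \<xi> (x, i) * g i x) + (\<xi>' (z, k) - \<xi> (z, k)) * g k z"
proof -
  have "(\<Sum>x\<in>T. \<Sum>i\<in>UNIV. \<xi>' (x, i) * g i x) - (\<Sum>x\<in>T. \<Sum>i\<in>UNIV. \<xi> (x, i) * g i x)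
     = (\<Sum>x\<in>T. \<Sum>i\<in>UNIV. (\<xi>' (x, i) - \<xi> (x, i)) * g i x)"
    by (simp add: left_diff_distrib sum_subtractf)
  also have "\<dots> = (\<Sum>b\<in>T \<times> UNIV. (\<xi>' b - \<xi> b) * g (snd b) (fst b))"
    by (simp add: sum.cartesian_product case_prod_beta)
  also have "\<dots> = (\<Sum>b\<in>{(z, k)}. (\<xi>' b - \<xi> b) * g (snd b) (fst b))"
    using z agree by (intro sum.mono_neutral_right) auto
  finally show ?thesis by simp
qed

text \<open>In each environment the energy is also the pairing of its own field with any field
  differing from it by a periodic gradient. Pairing with the field of the other environment leaves
  the same product on both sides, and only the changed bond survives: the formula is exact.\<close>

lemma Fq_diff:
  "Fq N l \<xi>' v - Fq N l \<xi> v = 2 / real (card T) * ((\<xi>' (z, k) - \<xi> (z, k)) * (wfield l \<xi> v k z * wfield l \<xi>' v k z))"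
proof -
  let ?w = "wfield l \<xi> v" and ?w' = "wfield l \<xi>' v"
  have cross: "(\<Sum>x\<in>T. \<Sum>i\<in>UNIV. \<zeta> (x, i) * (wfield l \<zeta> v i x)\<^sup>2) = (\<Sum>x\<in>T. \<Sum>i\<in>UNIV. \<zeta> (x, i) * (wfield l \<zeta> v i x * (v $ i + nab f i x)))"
    if "torus_env N c l \<zeta>" "periodic N f" for \<zeta> :: "'d env" and f
  proof -
    interpret Z: torus_env N c l \<zeta> by fact
    show ?thesis using Z.wfield_energy[of v] Z.wfield_orth[OF that(2), of v]
      by (simp add: distrib_left sum.distrib mult.assoc)
  qed
  have "(\<Sum>x\<in>T. \<Sum>i\<in>UNIV. \<xi>' (x, i) * (?w' i x)\<^sup>2) = (\<Sum>x\<in>T. \<Sum>i\<in>UNIV. \<xi>' (x, i) * (?w i x * ?w' i x))"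
    using cross[OF E'.torus_env_axioms periodic_corr[of v]] by (simp add: wfield_def mult_ac)
  moreover have "(\<Sum>x\<in>T. \<Sum>i\<in>UNIV. \<xi> (x, i) * (?w i x)\<^sup>2) = (\<Sum>x\<in>T. \<Sum>i\<in>UNIV. \<xi> (x, i) * (?w i x * ?w' i x))"
    using cross[OF torus_env_axioms E'.periodic_corr[of v]] by (simp add: wfield_def mult_ac)
  moreover have "(\<Sum>x\<in>T. \<Sum>i\<in>UNIV. \<xi>' (x, i) * (?w i x * ?w' i x))
     = (\<Sum>x\<in>T. \<Sum>i\<in>UNIV. \<xi> (x, i) * (?w i x * ?w' i x)) + (\<xi>' (z, k) - \<xi> (z, k)) * (?w k z * ?w' k z)"
    by (rule sum_diff_bond)
  ultimately show ?thesis unfolding Fq_def by (simp add: distrib_left add_divide_distrib)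
qed

lemma corr_diff:
  assumes "periodic N f"
  shows "(\<Sum>x\<in>T. \<Sum>i\<in>UNIV. \<xi>' (x, i) * ((wfield l \<xi>' v i x - wfield l \<xi> v i x) * nab f i x))
    = - ((\<xi>' (z, k) - \<xi> (z, k)) * (wfield l \<xi> v k z * nab f k z))"
  using E'.wfield_orth[OF assms, of v] wfield_orth[OF assms, of v]
    sum_diff_bond[of "\<lambda>i x. wfield l \<xi> v i x * nab f i x"]
  by (simp add: left_diff_distrib right_diff_distrib sum_subtractf mult.assoc)

lemma abs_bond_diff: "\<bar>\<xi>' (z, k) - \<xi> (z, k)\<bar> \<le> c"
  using pos[of "(z, k)"] E'.pos[of "(z, k)"] ellipticD(2)[OF ell, of "(z, k)"] ellipticD(2)[OF E'.ell, of "(z, k)"]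
  by linarith

text \<open>The difference of the fields is a periodic gradient whose energy is driven by the
  changed bond alone. Keeping only this bond on the left, the old field there controls the
  difference and hence the new field.\<close>

lemma wfield_compare: "\<bar>wfield l \<xi>' v k z\<bar> \<le> (1 + c\<^sup>2) * \<bar>wfield l \<xi> v k z\<bar>"
proof -
  define g where "g i x = wfield l \<xi>' v i x - wfield l \<xi> v i x" for i x
  define f where "f x = corr l \<xi>' v x - corr l \<xi> v x" for x
  have f: "periodic N f" unfolding f_def[abs_def] by (rule periodic_diff[OF E'.periodic_corr periodic_corr])
  have g: "nab f i x = g i x" for i x by (simp add: f_def g_def nab_def wfield_def)
  have *: "(\<Sum>x\<in>T. \<Sum>i\<in>UNIV. \<xi>' (x, i) * (g i x)\<^sup>2) = - ((\<xi>' (z, k) - \<xi> (z, k)) * (wfield l \<xi> v k z * g k z))"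
    using corr_diff[OF f, of v] by (simp add: g power2_eq_square) (simp add: g_def)
  have "\<xi>' (z, k) * (g k z)\<^sup>2 \<le> (\<Sum>i\<in>UNIV. \<xi>' (z, i) * (g i z)\<^sup>2)"
    by (intro member_le_sum) (auto intro!: mult_nonneg_nonneg simp: less_imp_le[OF E'.pos])
  also have "\<dots> \<le> (\<Sum>x\<in>T. \<Sum>i\<in>UNIV. \<xi>' (x, i) * (g i x)\<^sup>2)"
    using z by (intro member_le_sum[where f = "\<lambda>x. \<Sum>i\<in>UNIV. \<xi>' (x, i) * (g i x)\<^sup>2"])
      (auto intro!: sum_nonneg mult_nonneg_nonneg simp: less_imp_le[OF E'.pos])
  also have "\<dots> \<le> \<bar>\<xi>' (z, k) - \<xi> (z, k)\<bar> * (\<bar>wfield l \<xi> v k z\<bar> * \<bar>g k z\<bar>)"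
    unfolding * by (simp flip: abs_mult)
  also have "\<dots> \<le> c * (\<bar>wfield l \<xi> v k z\<bar> * \<bar>g k z\<bar>)"
    by (intro mult_right_mono abs_bond_diff) auto
  finally have "\<xi>' (z, k) * \<bar>g k z\<bar>\<^sup>2 \<le> c * (\<bar>wfield l \<xi> v k z\<bar> * \<bar>g k z\<bar>)" by simp
  moreover have "(1 / c) * \<bar>g k z\<bar>\<^sup>2 \<le> \<xi>' (z, k) * \<bar>g k z\<bar>\<^sup>2"
    by (intro mult_right_mono ellipticD(1)[OF E'.ell]) auto
  ultimately have "(1 / c) * \<bar>g k z\<bar>\<^sup>2 \<le> c * (\<bar>wfield l \<xi> v k z\<bar> * \<bar>g k z\<bar>)" by linarith
  then have "\<bar>g k z\<bar> * \<bar>g k z\<bar> \<le> (c\<^sup>2 * \<bar>wfield l \<xi> v k z\<bar>) * \<bar>g k z\<bar>"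
    using c by (simp add: power2_eq_square field_simps)
  from mult_right_le_imp_le[OF this] have "\<bar>g k z\<bar> \<le> c\<^sup>2 * \<bar>wfield l \<xi> v k z\<bar>"
    by (cases "g k z = 0") auto
  moreover have "\<bar>wfield l \<xi>' v k z\<bar> \<le> \<bar>g k z\<bar> + \<bar>wfield l \<xi> v k z\<bar>" unfolding g_def by linarith
  ultimately show ?thesis by (simp add: distrib_right)
qed

lemma Fq_diff_le:
  "\<bar>Fq N l \<xi>' v - Fq N l \<xi> v\<bar> \<le> 2 * c * (1 + c\<^sup>2) / real (card T) * (wfield l \<xi> v k z)\<^sup>2"
proof -
  have "\<bar>Fq N l \<xi>' v - Fq N l \<xi> v\<bar> = 2 / real (card T) * (\<bar>\<xi>' (z, k) - \<xi> (z, k)\<bar> * (\<bar>wfield l \<xi> v k z\<bar> * \<bar>wfield l \<xi>' v k z\<bar>))"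
    unfolding Fq_diff by (simp add: abs_mult)
  also have "\<dots> \<le> 2 / real (card T) * (c * (\<bar>wfield l \<xi> v k z\<bar> * ((1 + c\<^sup>2) * \<bar>wfield l \<xi> v k z\<bar>)))"
    using c by (intro mult_left_mono mult_mono abs_bond_diff wfield_compare) auto
  also have "\<bar>wfield l \<xi> v k z\<bar> * ((1 + c\<^sup>2) * \<bar>wfield l \<xi> v k z\<bar>) = (1 + c\<^sup>2) * (wfield l \<xi> v k z)\<^sup>2"
    by (simp add: power2_eq_square mult_ac)
  finally show ?thesis by (simp add: algebra_simps add_divide_distrib)
qed

text \<open>Adjoint method: testing the equation for the change of the corrector with the potential
  of \<open>q\<close> evaluates the functional at one bond. The potential is taken in the new
  environment and the field in the old one, which makes the identity exact.\<close>

lemma corr_functional_diff: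
  assumes "periodic N q" "(\<Sum>x\<in>T. q x) = 0"
  shows "(\<Sum>x\<in>T. q x * (corr l \<xi>' v x - corr l \<xi> v x))
    = - ((\<xi>' (z, k) - \<xi> (z, k)) * (wfield l \<xi> v k z * nab (green l \<xi>' q) k z))"
proof -
  define f where "f x = corr l \<xi>' v x - corr l \<xi> v x" for x
  have f: "periodic N f" unfolding f_def[abs_def] by (rule periodic_diff[OF E'.periodic_corr periodic_corr])
  have g: "nab f i x = wfield l \<xi>' v i x - wfield l \<xi> v i x" for i x by (simp add: f_def nab_def wfield_def)
  show ?thesis
    using E'.green_energy[OF assms f] corr_diff[OF E'.periodic_green[OF assms(1)], of v]
    unfolding E'.dform_def g by (simp add: f_def mult_ac)
qed

end

section \<open>Elliptic regularity and the decay of the field\<close>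

section \<open>Poincare inequalities on boxes and annuli\<close>

definition cube :: "int \<Rightarrow> 'd::finite site set" where
  "cube r = {x. \<forall>k. \<bar>x $ k\<bar> \<le> r}"

text \<open>Only bonds with both ends in \<open>S\<close> are counted, so that the energies of
  disjoint parts add up to at most the energy of the whole.\<close>

definition edge_energy :: "'d::finite site set \<Rightarrow> ('d site \<Rightarrow> real) \<Rightarrow> real" where
  "edge_energy S u = (\<Sum>x\<in>S. \<Sum>i\<in>UNIV. if x + unit_site i \<in> S then (nab u i x)\<^sup>2 else 0)"

text \<open>A sum over pairs in place of deviations from a mean: such sums can be chained through
  overlapping sets without comparing different averages.\<close>

definition pair_sum :: "('d::finite site \<Rightarrow> real) \<Rightarrow> 'd site set \<Rightarrow> 'd site set \<Rightarrow> real" where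
  "pair_sum u A B = (\<Sum>x\<in>A. \<Sum>y\<in>B. (u x - u y)\<^sup>2)"

lemma cube_eq_sbox: "cube r = sbox (\<chi> k. - r) (\<chi> k. r)"
  by (auto simp: cube_def sbox_def abs_le_iff minus_le_iff)

lemma finite_cube [simp]: "finite (cube r)"
  by (simp add: cube_eq_sbox)

lemma edge_energy_nonneg: "edge_energy S u \<ge> 0"
  unfolding edge_energy_def by (intro sum_nonneg) auto

lemma edge_energy_mono:
  assumes "finite B" "A \<subseteq> B" shows "edge_energy A u \<le> edge_energy B u"
proof -
  have "edge_energy A u \<le> (\<Sum>x\<in>A. \<Sum>i\<in>UNIV. if x + unit_site i \<in> B then (nab u i x)\<^sup>2 else 0)"
    unfolding edge_energy_def using assms by (intro sum_mono) auto
  also have "\<dots> \<le> edge_energy B u"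
    unfolding edge_energy_def using assms by (intro sum_mono2) (auto intro!: sum_nonneg)
  finally show ?thesis .
qed

lemma edge_energy_disjoint:
  assumes "finite B" "A \<subseteq> B" "A' \<subseteq> B" "A \<inter> A' = {}"
  shows "edge_energy A u + edge_energy A' u \<le> edge_energy B u"
proof -
  have fin: "finite A" "finite A'" using assms by (auto intro: finite_subset)
  let ?g = "\<lambda>x. \<Sum>i\<in>UNIV. if x + unit_site i \<in> B then (nab u i x)\<^sup>2 else 0"
  have "edge_energy A u + edge_energy A' u \<le> sum ?g A + sum ?g A'"
    unfolding edge_energy_def using assms by (intro add_mono sum_mono) auto
  also have "\<dots> = sum ?g (A \<union> A')" using assms fin by (intro sum.union_disjoint[symmetric]) auto
  also have "\<dots> \<le> edge_energy B u"
    unfolding edge_energy_def using assms by (intro sum_mono2) (auto intro!: sum_nonneg)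
  finally show ?thesis .
qed

lemma pair_sum_nonneg: "pair_sum u A B \<ge> 0"
  unfolding pair_sum_def by (intro sum_nonneg) auto

lemma pair_sum_commute: "pair_sum u A B = pair_sum u B A"
  unfolding pair_sum_def by (subst sum.swap) (simp add: power2_commute)

lemma pair_sum_mono:
  assumes "finite A'" "finite B'" "A \<subseteq> A'" "B \<subseteq> B'"
  shows "pair_sum u A B \<le> pair_sum u A' B'"
proof -
  have "pair_sum u A B \<le> (\<Sum>x\<in>A. \<Sum>y\<in>B'. (u x - u y)\<^sup>2)"
    unfolding pair_sum_def using assms by (intro sum_mono sum_mono2) auto
  also have "\<dots> \<le> pair_sum u A' B'"
    unfolding pair_sum_def using assms by (intro sum_mono2) (auto intro!: sum_nonneg)
  finally show ?thesis .
qed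

text \<open>Averaging over an intermediate point \<open>z\<close> is the step by which estimates on
  overlapping boxes are chained.\<close>

lemma pair_sum_via:
  "real (card Z) * pair_sum u A B \<le> 2 * real (card B) * pair_sum u A Z + 2 * real (card A) * pair_sum u Z B"
proof -
  have le: "(u x - u y)\<^sup>2 \<le> 2 * (u x - u z)\<^sup>2 + 2 * (u z - u y)\<^sup>2" for x y z
  proof -
    have "0 \<le> ((u x - u z) - (u z - u y))\<^sup>2" by simp
    then show ?thesis by (simp add: power2_eq_square algebra_simps)
  qed
  have "real (card Z) * pair_sum u A B = (\<Sum>x\<in>A. \<Sum>y\<in>B. \<Sum>z\<in>Z. (u x - u y)\<^sup>2)"
    by (simp add: pair_sum_def sum_distrib_left)
  also have "\<dots> \<le> (\<Sum>x\<in>A. \<Sum>y\<in>B. \<Sum>z\<in>Z. 2 * (u x - u z)\<^sup>2 + 2 * (u z - u y)\<^sup>2)"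
    by (intro sum_mono le)
  also have "\<dots> = (\<Sum>x\<in>A. \<Sum>y\<in>B. \<Sum>z\<in>Z. 2 * (u x - u z)\<^sup>2) + (\<Sum>x\<in>A. \<Sum>y\<in>B. \<Sum>z\<in>Z. 2 * (u z - u y)\<^sup>2)"
    by (simp add: sum.distrib)
  also have "(\<Sum>x\<in>A. \<Sum>y\<in>B. \<Sum>z\<in>Z. 2 * (u z - u y)\<^sup>2) = 2 * real (card A) * pair_sum u Z B"
    unfolding pair_sum_def by (subst (2) sum.swap) (simp add: sum_distrib_left mult_ac)
  finally show ?thesis by (simp add: pair_sum_def sum_distrib_left mult_ac)
qed

lemma sum_UN_le:
  fixes f :: "'a \<Rightarrow> real"
  assumes "finite I" "\<And>i. i \<in> I \<Longrightarrow> finite (S i)" "\<And>x. f x \<ge> 0"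
  shows "sum f (\<Union>i\<in>I. S i) \<le> (\<Sum>i\<in>I. sum f (S i))"
  using assms(1,2)
proof (induction I rule: finite_induct)
  case (insert i I)
  have "sum f (\<Union>i\<in>insert i I. S i) = sum f (S i) + sum f (\<Union>i\<in>I. S i) - sum f (S i \<inter> (\<Union>i\<in>I. S i))"
    using insert by (simp add: sum_Un)
  moreover have "sum f (S i \<inter> (\<Union>i\<in>I. S i)) \<ge> 0" by (intro sum_nonneg assms)
  ultimately show ?case using insert by simp
qed simp

lemma abs_diff_le_sum_int:
  fixes g :: "int \<Rightarrow> real"
  assumes "s \<in> {a..b}" "t \<in> {a..b}"
  shows "\<bar>g s - g t\<bar> \<le> (\<Sum>r\<in>{a..<b}. \<bar>g (r + 1) - g r\<bar>)"
proof -
  have *: "\<bar>g t - g s\<bar> \<le> (\<Sum>r\<in>{s..<t}. \<bar>g (r + 1) - g r\<bar>)" if "s \<le> t" for s t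
    using that
  proof (induction t rule: int_ge_induct)
    case (step t)
    then have "{s..<t + 1} = insert t {s..<t}" by auto
    then show ?case using step by simp
  qed simp
  have **: "\<bar>g t - g s\<bar> \<le> (\<Sum>r\<in>{a..<b}. \<bar>g (r + 1) - g r\<bar>)" if "s \<le> t" "a \<le> s" "t \<le> b" for s t
    using *[OF that(1)] sum_mono2[of "{a..<b}" "{s..<t}" "\<lambda>r. \<bar>g (r + 1) - g r\<bar>"] that by force
  show ?thesis using **[of s t] **[of t s] assms by (cases "s \<le> t") (auto simp: abs_minus_commute)
qed

definition upd :: "'d::finite site \<Rightarrow> 'd \<Rightarrow> int \<Rightarrow> 'd site" where
  "upd x k t = (\<chi> j. if j = k then t else x $ j)"

lemma upd_self [simp]: "upd x k (x $ k) = x"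
  by (simp add: upd_def vec_eq_iff)

lemma upd_step: "upd x k (t + 1) = upd x k t + unit_site k"
  by (auto simp: upd_def unit_site_def axis_def vec_eq_iff)

lemma line_poincare:
  fixes a b :: "'d::finite site"
  assumes L: "\<And>k. real_of_int (b $ k - a $ k + 1) \<le> L"
  shows "(\<Sum>x\<in>sbox a b. \<Sum>y\<in>sbox a b. (u x - u (upd x k (y $ k)))\<^sup>2)
    \<le> L\<^sup>2 * real (card (sbox a b)) * edge_energy (sbox a b) u"
proof (cases "sbox a b = {}")
  case False
  let ?S = "sbox a b" and ?g = "\<lambda>z. (nab u k z)\<^sup>2"
  obtain x where "x \<in> ?S" using False by auto
  then have ab: "a $ k \<le> b $ k" using order_trans[of "a $ k" "x $ k" "b $ k"] by (auto simp: sbox_def)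
  have "real_of_int (b $ k - a $ k + 1) \<ge> 1" using ab by simp
  then have L1: "L \<ge> 1" using L[of k] by linarith
  have pt: "(u x - u (upd x k t))\<^sup>2 \<le> L * (\<Sum>s\<in>{a $ k..<b $ k}. ?g (upd x k s))"
    if "x \<in> ?S" "a $ k \<le> t" "t \<le> b $ k" for x t
  proof -
    have "\<bar>u (upd x k (x $ k)) - u (upd x k t)\<bar> \<le> (\<Sum>r\<in>{a $ k..<b $ k}. \<bar>u (upd x k (r + 1)) - u (upd x k r)\<bar>)"
      using that by (intro abs_diff_le_sum_int) (auto simp: sbox_def)
    then have "\<bar>u x - u (upd x k t)\<bar> \<le> (\<Sum>r\<in>{a $ k..<b $ k}. \<bar>nab u k (upd x k r)\<bar>)"
      by (simp add: upd_step nab_def)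
    then have "\<bar>u x - u (upd x k t)\<bar>\<^sup>2 \<le> (\<Sum>r\<in>{a $ k..<b $ k}. 1 * \<bar>nab u k (upd x k r)\<bar>)\<^sup>2"
      by (intro power_mono) auto
    also have "\<dots> \<le> (\<Sum>r\<in>{a $ k..<b $ k}. 1\<^sup>2) * (\<Sum>r\<in>{a $ k..<b $ k}. \<bar>nab u k (upd x k r)\<bar>\<^sup>2)"
      by (rule Cauchy_Schwarz_ineq_sum)
    also have "\<dots> \<le> L * (\<Sum>r\<in>{a $ k..<b $ k}. ?g (upd x k r))"
      using L[of k] ab by (auto intro!: mult_mono sum_nonneg)
    finally show ?thesis by simp
  qed
  \<comment> \<open>The pair records the lower end of a bond and the coordinate of the starting
    point, from which both \<open>x\<close> and \<open>s\<close> are recovered. So each bond is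
    counted at most once per starting point on its line.\<close>
  have inj: "inj_on (\<lambda>(x, s). (upd x k s, x $ k)) (?S \<times> {a $ k..<b $ k})"
    by (auto simp: inj_on_def upd_def vec_eq_iff)
  have "(\<Sum>x\<in>?S. \<Sum>s\<in>{a $ k..<b $ k}. ?g (upd x k s))
    = (\<Sum>p\<in>(\<lambda>(x, s). (upd x k s, x $ k)) ` (?S \<times> {a $ k..<b $ k}). ?g (fst p))"
    by (subst sum.reindex[OF inj]) (simp add: sum.cartesian_product case_prod_beta)
  also have "\<dots> \<le> (\<Sum>p\<in>{z \<in> ?S. z $ k < b $ k} \<times> {a $ k..b $ k}. ?g (fst p))"
  proof (intro sum_mono2)
    show "finite ({z \<in> ?S. z $ k < b $ k} \<times> {a $ k..b $ k})" by simp
  qed (auto simp: sbox_def upd_def)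
  also have "\<dots> = (\<Sum>z\<in>{z \<in> ?S. z $ k < b $ k}. \<Sum>r\<in>{a $ k..b $ k}. ?g z)"
    unfolding sum.cartesian_product by (rule sum.cong[OF refl]) auto
  also have "\<dots> = real_of_int (b $ k - a $ k + 1) * (\<Sum>z\<in>{z \<in> ?S. z $ k < b $ k}. ?g z)"
    using ab by (simp add: sum_distrib_left algebra_simps)
  also have "\<dots> \<le> L * edge_energy ?S u"
  proof (intro mult_mono L)
    have "(\<Sum>z\<in>{z \<in> ?S. z $ k < b $ k}. ?g z)
      \<le> (\<Sum>z\<in>{z \<in> ?S. z $ k < b $ k}. \<Sum>i\<in>UNIV. if z + unit_site i \<in> ?S then (nab u i z)\<^sup>2 else 0)"
    proof (intro sum_mono)
      fix z assume z: "z \<in> {z \<in> ?S. z $ k < b $ k}"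
      then have "z + unit_site k \<in> ?S"
        by (auto simp: sbox_def unit_site_def axis_def add_increasing2)
      then have "?g z = (if z + unit_site k \<in> ?S then (nab u k z)\<^sup>2 else 0)" by simp
      also have "\<dots> \<le> (\<Sum>i\<in>UNIV. if z + unit_site i \<in> ?S then (nab u i z)\<^sup>2 else 0)"
        by (intro member_le_sum) auto
      finally show "?g z \<le> (\<Sum>i\<in>UNIV. if z + unit_site i \<in> ?S then (nab u i z)\<^sup>2 else 0)" .
    qed
    also have "\<dots> \<le> edge_energy ?S u" unfolding edge_energy_def
      by (intro sum_mono2) (auto intro!: sum_nonneg)
    finally show "(\<Sum>z\<in>{z \<in> ?S. z $ k < b $ k}. ?g z) \<le> edge_energy ?S u" .
  qed (use L1 in \<open>auto intro!: sum_nonneg\<close>)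
  finally have lines: "(\<Sum>x\<in>?S. \<Sum>s\<in>{a $ k..<b $ k}. ?g (upd x k s)) \<le> L * edge_energy ?S u" .
  have "(\<Sum>x\<in>?S. \<Sum>y\<in>?S. (u x - u (upd x k (y $ k)))\<^sup>2)
    \<le> (\<Sum>x\<in>?S. \<Sum>y\<in>?S. L * (\<Sum>s\<in>{a $ k..<b $ k}. ?g (upd x k s)))"
    by (intro sum_mono pt) (auto simp: sbox_def)
  also have "\<dots> = L * real (card ?S) * (\<Sum>x\<in>?S. \<Sum>s\<in>{a $ k..<b $ k}. ?g (upd x k s))"
    by (simp add: sum_distrib_left mult_ac)
  also have "\<dots> \<le> L * real (card ?S) * (L * edge_energy ?S u)"
    using L1 by (intro mult_left_mono lines) auto
  finally show ?thesis by (simp add: power2_eq_square mult_ac)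
qed simp

definition mix :: "'d set \<Rightarrow> 'd::finite site \<Rightarrow> 'd site \<Rightarrow> 'd site" where
  "mix J x y = (\<chi> k. if k \<in> J then y $ k else x $ k)"

lemma bij_mix: "bij_betw (\<lambda>(x, y). (mix J x y, mix J y x)) (sbox a b \<times> sbox a b) (sbox a b \<times> sbox a b)"
  by (rule bij_betwI[where g = "\<lambda>(x, y). (mix J x y, mix J y x)"]) (auto simp: mix_def sbox_def vec_eq_iff)

lemma L2_set_reindex: "bij_betw m A B \<Longrightarrow> L2_set (\<lambda>p. h (m p)) A = L2_set h B"
  unfolding L2_set_def by (simp add: sum.reindex_bij_betw[of m A B "\<lambda>p. (h p)\<^sup>2"])

text \<open>The coordinates of \<open>x\<close> are replaced by those of \<open>y\<close> one at a
  time. Exchanging coordinates permutes the pairs of points of the box (\<open>bij_mix\<close>), so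
  each replacement costs one line estimate, and the triangle inequality in L2 adds the
  costs.\<close>

lemma box_poincare:
  fixes a b :: "'d::finite site"
  assumes L: "\<And>k. real_of_int (b $ k - a $ k + 1) \<le> L"
  shows "pair_sum u (sbox a b) (sbox a b)
    \<le> (real CARD('d))\<^sup>2 * (L\<^sup>2 * real (card (sbox a b)) * edge_energy (sbox a b) u)"
proof -
  let ?S = "sbox a b"
  define B where "B = L\<^sup>2 * real (card ?S) * edge_energy ?S u"
  have B: "B \<ge> 0" by (simp add: B_def edge_energy_nonneg)
  have "L2_set (\<lambda>(x, y). u x - u (mix J x y)) (?S \<times> ?S) \<le> real (card J) * sqrt B" for J :: "'d set"
  proof (induction J rule: finite_induct[OF finite])
    case 1
    show ?case by (simp add: mix_def L2_set_def)
  next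
    case (2 k J)
    have "L2_set (\<lambda>(x, y). u x - u (mix (insert k J) x y)) (?S \<times> ?S)
      = L2_set (\<lambda>p. (case p of (x, y) \<Rightarrow> u x - u (mix J x y)) + (case p of (x, y) \<Rightarrow> u (mix J x y) - u (mix (insert k J) x y))) (?S \<times> ?S)"
      by (intro L2_set_cong) auto
    also have "\<dots> \<le> L2_set (\<lambda>(x, y). u x - u (mix J x y)) (?S \<times> ?S)
        + L2_set (\<lambda>(x, y). u (mix J x y) - u (mix (insert k J) x y)) (?S \<times> ?S)"
      by (rule L2_set_triangle_ineq)
    also have "L2_set (\<lambda>(x, y). u (mix J x y) - u (mix (insert k J) x y)) (?S \<times> ?S)
      = L2_set (\<lambda>(x, y). u x - u (upd x k (y $ k))) (?S \<times> ?S)"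
    proof -
      have "mix (insert k J) x y = upd (mix J x y) k (mix J y x $ k)" for x y :: "'d site"
        using 2 by (auto simp: mix_def upd_def vec_eq_iff)
      then have "(\<lambda>(x, y). u (mix J x y) - u (mix (insert k J) x y))
        = (\<lambda>p. (\<lambda>(x, y). u x - u (upd x k (y $ k))) ((\<lambda>(x, y). (mix J x y, mix J y x)) p))"
        by auto
      then show ?thesis by (simp only: L2_set_reindex[OF bij_mix])
    qed
    also have "\<dots> \<le> sqrt B"
    proof -
      have "(\<Sum>p\<in>?S \<times> ?S. ((\<lambda>(x, y). u x - u (upd x k (y $ k))) p)\<^sup>2) \<le> B"
        using line_poincare[OF L, of u k] by (simp add: sum.cartesian_product case_prod_beta B_def)
      then show ?thesis unfolding L2_set_def by (rule real_sqrt_le_mono)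
    qed
    finally show ?case using 2 by (simp add: distrib_right)
  qed
  from this[of UNIV] have "L2_set (\<lambda>(x, y). u x - u y) (?S \<times> ?S) \<le> real CARD('d) * sqrt B"
    by (simp add: mix_def)
  then have "(L2_set (\<lambda>(x, y). u x - u y) (?S \<times> ?S))\<^sup>2 \<le> (real CARD('d) * sqrt B)\<^sup>2"
    by (intro power_mono) (auto simp: L2_set_nonneg)
  moreover have "(L2_set (\<lambda>(x, y). u x - u y) (?S \<times> ?S))\<^sup>2 = pair_sum u ?S ?S"
    by (simp add: L2_set_def pair_sum_def sum_nonneg sum.cartesian_product case_prod_beta)
  ultimately show ?thesis using B by (simp add: power_mult_distrib B_def)
qed

definition annulus :: "int \<Rightarrow> 'd::finite site set" where
  "annulus r = cube (3 * r) - cube r"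

definition slab_lo :: "int \<Rightarrow> ('d \<times> bool) set \<Rightarrow> 'd::finite site" where
  "slab_lo r D = (\<chi> k. if (k, True) \<in> D then r + 1 else - 3 * r)"

definition slab_hi :: "int \<Rightarrow> ('d \<times> bool) set \<Rightarrow> 'd::finite site" where
  "slab_hi r D = (\<chi> k. if (k, False) \<in> D then - r - 1 else 3 * r)"

text \<open>Each member of \<open>D\<close> pushes one coordinate beyond \<open>r\<close> on the
  indicated side. For positive \<open>r\<close> the slabs of single members cover the annulus, and
  the slab of two members is the intersection of their slabs.\<close>

definition slab :: "int \<Rightarrow> ('d::finite \<times> bool) set \<Rightarrow> 'd site set" where
  "slab r D = sbox (slab_lo r D) (slab_hi r D)"

lemma slab_iff: "x \<in> slab r D \<longleftrightarrow> (\<forall>k. (if (k, True) \<in> D then r + 1 else - 3 * r) \<le> x $ k \<and>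
    x $ k \<le> (if (k, False) \<in> D then - r - 1 else 3 * r))"
  by (simp add: slab_def sbox_def slab_lo_def slab_hi_def)

lemma finite_slab [simp]: "finite (slab r D)"
  by (simp add: slab_def)

lemma slab_anti: "r \<ge> 0 \<Longrightarrow> D \<subseteq> D' \<Longrightarrow> slab r D' \<subseteq> slab r D"
  unfolding slab_iff subset_iff by (smt (verit, ccfv_threshold))

lemma annulus_eq:
  assumes "r \<ge> 1" shows "annulus r = (\<Union>s\<in>UNIV. slab r {s})"
proof (intro set_eqI iffI)
  fix x :: "'a site" assume "x \<in> annulus r"
  then obtain k where k: "\<bar>x $ k\<bar> > r" and x: "\<And>j. \<bar>x $ j\<bar> \<le> 3 * r"
    by (auto simp: annulus_def cube_def not_le)
  show "x \<in> (\<Union>s\<in>UNIV. slab r {s})"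
  proof (cases "x $ k > 0")
    case True
    then have "x \<in> slab r {(k, True)}" using k x assms unfolding slab_iff by (auto simp: abs_le_iff minus_le_iff)
    then show ?thesis by blast
  next
    case False
    then have "x \<in> slab r {(k, False)}" using k x assms unfolding slab_iff by (auto simp: abs_le_iff minus_le_iff)
    then show ?thesis by blast
  qed
next
  fix x :: "'a site" assume "x \<in> (\<Union>s\<in>UNIV. slab r {s})"
  then obtain k b where s: "x \<in> slab r {(k, b)}" by auto
  then have "\<bar>x $ j\<bar> \<le> 3 * r" for j
    using assms unfolding slab_iff by (auto simp: abs_le_iff dest!: spec[of _ j] split: if_splits)
  moreover have "\<bar>x $ k\<bar> > r"
    using s assms unfolding slab_iff by (cases b) (auto dest!: spec[of _ k])
  ultimately show "x \<in> annulus r" by (auto simp: annulus_def cube_def not_le)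
qed

lemma slab_in_annulus: "r \<ge> 1 \<Longrightarrow> slab r {s} \<subseteq> annulus r"
  by (auto simp: annulus_eq)

lemma card_slab_le:
  assumes "r \<ge> 1" shows "real (card (slab r D :: 'd::finite site set)) \<le> (7 * real_of_int r) ^ CARD('d)"
proof -
  have "real (card (slab r D :: 'd site set)) = (\<Prod>k\<in>UNIV. real (nat (slab_hi r D $ k - slab_lo r D $ k + 1)))"
    by (simp add: slab_def card_sbox)
  also have "\<dots> \<le> (\<Prod>k\<in>(UNIV :: 'd set). 7 * real_of_int r)"
    using assms by (intro prod_mono) (auto simp: slab_lo_def slab_hi_def)
  finally show ?thesis by simp
qed

lemma card_slab_ge:
  assumes "r \<ge> 1" "\<And>k. \<not> ((k, True) \<in> D \<and> (k, False) \<in> D)"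
  shows "(2 * real_of_int r) ^ CARD('d) \<le> real (card (slab r D :: 'd::finite site set))"
proof -
  have "(\<Prod>k\<in>(UNIV :: 'd set). 2 * real_of_int r) \<le> (\<Prod>k\<in>UNIV. real (nat (slab_hi r D $ k - slab_lo r D $ k + 1)))"
    using assms by (intro prod_mono) (auto simp: slab_lo_def slab_hi_def)
  then show ?thesis by (simp add: slab_def card_sbox)
qed

text \<open>The annulus is covered by 2 d slabs, boxes with sides of order \<open>r\<close>. Slabs
  along different axes overlap in a box of comparable size; opposite slabs are disjoint and are
  joined through a slab along another axis, which exists in dimension at least 2.\<close>

lemma annulus_poincare:
  assumes d: "CARD('d::finite) \<ge> 2"
  shows "\<exists>C>0. \<forall>r\<ge>1. \<forall>u :: 'd site \<Rightarrow> real. \<exists>k.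
    (\<Sum>x\<in>annulus r. (u x - k)\<^sup>2) \<le> C * (real_of_int r)\<^sup>2 * edge_energy (annulus r) u"
proof -
  define n where "n = CARD('d)"
  define q where "q = (7 / 2 :: real) ^ n"
  have q1: "q \<ge> 1" by (simp add: q_def)
  \<comment> \<open>The number of pairs of slabs, then \<open>4 * q\<close> for each of at most two
    passages through an intermediate set, then \<open>box_poincare\<close> with sides at most 7 r.
    Here \<open>q\<close> compares the largest slab volume with the smallest, and the final 1/2 is
    due to counting pairs instead of deviations from the mean.\<close>
  define C where "C = (2 * real n)\<^sup>2 * (16 * q\<^sup>2 * ((real n)\<^sup>2 * 49 * q)) / 2"
  have n: "n > 0" by (simp add: n_def)
  have C: "C > 0" using n q1 by (simp add: C_def)
  show ?thesis
  proof (rule exI[of _ C], intro conjI C allI impI)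
    fix r :: int and u :: "'d site \<Rightarrow> real" assume r: "r \<ge> 1"
    define R where "R = real_of_int r"
    have R: "R \<ge> 1" using r by (simp add: R_def)
    let ?A = "annulus r :: 'd site set"
    have finA: "finite ?A" by (simp add: annulus_def)
    define E where "E = edge_energy ?A u"
    have E: "E \<ge> 0" by (simp add: E_def edge_energy_nonneg)
    define P where "P = (real n)\<^sup>2 * ((7 * R)\<^sup>2 * (7 * R) ^ n * E)"
    have P: "P \<ge> 0" using E R by (simp add: P_def)
    have up: "real (card (slab r D :: 'd site set)) \<le> (7 * R) ^ n" for D
      using card_slab_le[OF r] by (simp add: R_def n_def)
    have lo: "(2 * R) ^ n \<le> real (card (slab r D :: 'd site set))" if "\<And>k. \<not> ((k, True) \<in> D \<and> (k, False) \<in> D)" for D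
      using card_slab_ge[OF r that] by (simp add: R_def n_def)
    have q: "(7 * R) ^ n = q * (2 * R) ^ n" by (simp only: q_def power_mult_distrib[symmetric]) simp
    have same: "pair_sum u (slab r {s}) (slab r {s}) \<le> P" for s
    proof -
      have side: "real_of_int (slab_hi r {s} $ k - slab_lo r {s} $ k + 1) \<le> 7 * R" for k
        using r by (auto simp: slab_lo_def slab_hi_def R_def)
      have "pair_sum u (slab r {s}) (slab r {s})
        \<le> (real n)\<^sup>2 * ((7 * R)\<^sup>2 * real (card (slab r {s})) * edge_energy (slab r {s}) u)"
        using box_poincare[OF side, of u] by (simp add: slab_def n_def)
      also have "\<dots> \<le> P" unfolding P_def E_def
        using slab_in_annulus[OF r, of s] finA up R
        by (intro mult_left_mono mult_mono edge_energy_mono) (auto simp: edge_energy_nonneg)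
      finally show ?thesis .
    qed
    have diff: "pair_sum u (slab r {s}) (slab r {t}) \<le> 4 * q * P" if "fst s \<noteq> fst t" for s t
    proof -
      let ?O = "slab r {s, t}"
      have sub: "?O \<subseteq> slab r {s}" "?O \<subseteq> slab r {t}" using slab_anti[of r "{s}" "{s, t}"] slab_anti[of r "{t}" "{s, t}"] r by auto
      have "(2 * R) ^ n * pair_sum u (slab r {s}) (slab r {t}) \<le> real (card ?O) * pair_sum u (slab r {s}) (slab r {t})"
        using that by (intro mult_right_mono lo pair_sum_nonneg) auto
      also have "\<dots> \<le> 2 * real (card (slab r {t})) * pair_sum u (slab r {s}) ?O + 2 * real (card (slab r {s})) * pair_sum u ?O (slab r {t})"
        by (rule pair_sum_via)
      also have "\<dots> \<le> 2 * (7 * R) ^ n * P + 2 * (7 * R) ^ n * P"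
      proof (intro add_mono mult_mono)
        show "pair_sum u (slab r {s}) ?O \<le> P"
          by (rule order_trans[OF pair_sum_mono same[of s]]) (use sub in auto)
        show "pair_sum u ?O (slab r {t}) \<le> P"
          by (rule order_trans[OF pair_sum_mono same[of t]]) (use sub in auto)
      qed (use up R P in \<open>auto simp: pair_sum_nonneg\<close>)
      also have "\<dots> = (2 * R) ^ n * (4 * q * P)"
      proof -
        have "2 * (q * X) * P + 2 * (q * X) * P = X * (4 * q * P)" for X by simp
        then show ?thesis by (simp only: q)
      qed
      finally show ?thesis by (rule mult_left_le_imp_le) (use R in simp)
    qed
    have all: "pair_sum u (slab r {s}) (slab r {t}) \<le> 16 * q\<^sup>2 * P" for s t
    proof (cases "fst s = fst t")
      case False
      have "4 * q * P \<le> 16 * q\<^sup>2 * P"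
        using q1 P by (intro mult_right_mono) (auto simp: power2_eq_square)
      then show ?thesis using diff[OF False] by linarith
    next
      case True
      obtain j where j: "j \<noteq> fst s"
      proof -
        have "UNIV \<noteq> {fst s}" using d by (metis One_nat_def card.empty card.insert empty_iff finite.emptyI not_less_eq_eq numeral_2_eq_2 order_refl)
        then show ?thesis using that by auto
      qed
      let ?Z = "slab r {(j, True)}"
      have "(2 * R) ^ n * pair_sum u (slab r {s}) (slab r {t}) \<le> real (card ?Z) * pair_sum u (slab r {s}) (slab r {t})"
        by (intro mult_right_mono lo pair_sum_nonneg) auto
      also have "\<dots> \<le> 2 * real (card (slab r {t})) * pair_sum u (slab r {s}) ?Z + 2 * real (card (slab r {s})) * pair_sum u ?Z (slab r {t})"
        by (rule pair_sum_via)
      also have "\<dots> \<le> 2 * (7 * R) ^ n * (4 * q * P) + 2 * (7 * R) ^ n * (4 * q * P)"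
      proof (intro add_mono mult_mono)
        show "pair_sum u (slab r {s}) ?Z \<le> 4 * q * P" using j by (intro diff) auto
        show "pair_sum u ?Z (slab r {t}) \<le> 4 * q * P" using j True by (intro diff) auto
      qed (use up R P q1 in \<open>auto simp: pair_sum_nonneg\<close>)
      also have "\<dots> = (2 * R) ^ n * (16 * q\<^sup>2 * P)"
      proof -
        have "2 * (q * X) * (4 * q * P) + 2 * (q * X) * (4 * q * P) = X * (16 * q\<^sup>2 * P)" for X
          by (simp add: power2_eq_square)
        then show ?thesis by (simp only: q)
      qed
      finally show ?thesis by (rule mult_left_le_imp_le) (use R in simp)
    qed
    have total: "pair_sum u ?A ?A \<le> (2 * real n)\<^sup>2 * (16 * q\<^sup>2 * P)"
    proof -
      have "pair_sum u ?A ?A \<le> (\<Sum>s\<in>UNIV. pair_sum u (slab r {s}) ?A)"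
        unfolding pair_sum_def by (subst (1) annulus_eq[OF r], rule sum_UN_le) (auto intro!: sum_nonneg)
      also have "\<dots> \<le> (\<Sum>s\<in>UNIV. \<Sum>t\<in>UNIV. pair_sum u (slab r {s}) (slab r {t}))"
      proof (intro sum_mono)
        fix s :: "'d \<times> bool"
        have "pair_sum u ?A (slab r {s}) \<le> (\<Sum>t\<in>UNIV. pair_sum u (slab r {t}) (slab r {s}))"
          unfolding pair_sum_def by (subst (1) annulus_eq[OF r], rule sum_UN_le) (auto intro!: sum_nonneg)
        then show "pair_sum u (slab r {s}) ?A \<le> (\<Sum>t\<in>UNIV. pair_sum u (slab r {s}) (slab r {t}))"
          by (simp add: pair_sum_commute[of u "slab r {s}"])
      qed
      also have "\<dots> \<le> (\<Sum>s\<in>(UNIV :: ('d \<times> bool) set). \<Sum>t\<in>(UNIV :: ('d \<times> bool) set). 16 * q\<^sup>2 * P)"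
        by (intro sum_mono all)
      also have "\<dots> = (2 * real n)\<^sup>2 * (16 * q\<^sup>2 * P)"
        by (simp add: n_def power2_eq_square)
      finally show ?thesis .
    qed
    define k where "k = (\<Sum>x\<in>?A. u x) / real (card ?A)"
    have cardA: "(2 * R) ^ n \<le> real (card ?A)"
    proof -
      obtain i :: 'd where True by simp
      have "(2 * R) ^ n \<le> real (card (slab r {(i, True)}))" by (rule lo) auto
      also have "\<dots> \<le> real (card ?A)" using card_mono[OF finA slab_in_annulus[OF r]] by simp
      finally show ?thesis .
    qed
    have cpos: "real (card ?A) > 0" using cardA R by (smt (verit) zero_less_power)
    have "pair_sum u ?A ?A = 2 * real (card ?A) * (\<Sum>x\<in>?A. (u x - k)\<^sup>2)"
    proof -
      define g where "g x = u x - k" for x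
      have "(\<Sum>x\<in>?A. g x) = 0" using cpos by (simp add: g_def sum_subtractf k_def)
      then have s: "(\<Sum>x\<in>?A. \<Sum>y\<in>?A. g x * g y) = 0" by (simp add: sum_product[symmetric])
      have "pair_sum u ?A ?A = (\<Sum>x\<in>?A. \<Sum>y\<in>?A. (g x)\<^sup>2 + (g y)\<^sup>2 - 2 * (g x * g y))"
        unfolding pair_sum_def g_def by (intro sum.cong refl) (simp add: power2_eq_square algebra_simps)
      also have "\<dots> = 2 * real (card ?A) * (\<Sum>x\<in>?A. (g x)\<^sup>2)"
        using s by (simp add: sum.distrib sum_subtractf sum_distrib_left[symmetric])
      finally show ?thesis by (simp only: g_def)
    qed
    then have "2 * real (card ?A) * (\<Sum>x\<in>?A. (u x - k)\<^sup>2) \<le> (2 * real n)\<^sup>2 * (16 * q\<^sup>2 * P)" using total by simp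
    also have "\<dots> = 2 * (2 * R) ^ n * (C * R\<^sup>2 * E)"
    proof -
      have "(2 * real n)\<^sup>2 * (16 * q\<^sup>2 * ((real n)\<^sup>2 * ((7 * R)\<^sup>2 * (q * X) * E))) = 2 * X * (C * R\<^sup>2 * E)" for X
        by (simp add: C_def power_mult_distrib power2_eq_square)
      then show ?thesis by (simp only: P_def q)
    qed
    also have "\<dots> \<le> 2 * real (card ?A) * (C * R\<^sup>2 * E)"
      using cardA C E by (intro mult_right_mono) auto
    finally have "(\<Sum>x\<in>?A. (u x - k)\<^sup>2) \<le> C * R\<^sup>2 * E" using cpos by simp
    then show "\<exists>k. (\<Sum>x\<in>?A. (u x - k)\<^sup>2) \<le> C * (real_of_int r)\<^sup>2 * edge_energy ?A u"
      by (auto simp: R_def E_def)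
  qed
qed

section \<open>Hole filling\<close>

definition snorm :: "'d::finite site \<Rightarrow> int" where
  "snorm x = Max (range (\<lambda>k. \<bar>x $ k\<bar>))"

lemma snorm_le_iff: "snorm x \<le> r \<longleftrightarrow> x \<in> cube r"
  by (auto simp: snorm_def cube_def)

lemma le_snorm: "\<bar>x $ k\<bar> \<le> snorm x"
  by (simp add: snorm_def)

lemma snorm_step: "\<bar>snorm (x + unit_site i) - snorm x\<bar> \<le> 1"
proof -
  have e: "\<bar>unit_site i $ k\<bar> \<le> 1" for k by (simp add: unit_site_def axis_def)
  have "\<bar>(x + unit_site i) $ k\<bar> \<le> snorm x + 1" for k
    using le_snorm[of x k] e[of k] by simp
  then have "snorm (x + unit_site i) \<le> snorm x + 1" by (simp add: snorm_le_iff cube_def)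
  moreover have "\<bar>x $ k\<bar> \<le> snorm (x + unit_site i) + 1" for k
    using le_snorm[of "x + unit_site i" k] e[of k] by simp
  then have "snorm x \<le> snorm (x + unit_site i) + 1" by (simp add: snorm_le_iff cube_def)
  ultimately show ?thesis by linarith
qed

lemma cube_mono: "r \<le> s \<Longrightarrow> cube r \<subseteq> cube s"
  by (auto simp: cube_def intro: order_trans)

lemma annulus_iff: "x \<in> annulus r \<longleftrightarrow> r < snorm x \<and> snorm x \<le> 3 * r"
  by (auto simp: annulus_def snorm_le_iff[symmetric])

lemma finite_annulus [simp]: "finite (annulus r)"
  by (simp add: annulus_def)

text \<open>\<open>f\<close> vanishes on the outermost layer and beyond, so there are no boundary
  terms and bonds leaving the cube carry no gradient of \<open>f\<close>.\<close>

lemma cube_sum_by_parts: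
  assumes f: "\<And>x. x \<notin> cube (m - 1) \<Longrightarrow> f x = 0"
  shows "(\<Sum>x\<in>cube m. f x * dv j x) = - (\<Sum>x\<in>cube m. \<Sum>i\<in>UNIV. j i x * nab f i x)"
proof -
  have *: "(\<Sum>x\<in>cube m. f x * j i (x - unit_site i)) = (\<Sum>x\<in>cube m. f (x + unit_site i) * j i x)" for i
  proof -
    let ?I = "(\<lambda>x. x - unit_site i) ` cube (m - 1)"
    have sub: "?I \<subseteq> cube m"
    proof
      fix y assume "y \<in> ?I"
      then obtain x where x: "y = x - unit_site i" "x \<in> cube (m - 1)" by auto
      then show "y \<in> cube m" using snorm_step[of y i] by (simp add: snorm_le_iff[symmetric])
    qed
    have "(\<Sum>x\<in>cube m. f x * j i (x - unit_site i)) = (\<Sum>x\<in>cube (m - 1). f x * j i (x - unit_site i))"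
      using f cube_mono[of "m - 1" m] by (intro sum.mono_neutral_right) auto
    also have "\<dots> = (\<Sum>y\<in>?I. f (y + unit_site i) * j i y)"
      by (subst sum.reindex) (auto simp: inj_on_def)
    also have "\<dots> = (\<Sum>x\<in>cube m. f (x + unit_site i) * j i x)"
    proof (rule sum.mono_neutral_left[OF finite_cube sub], rule ballI)
      fix y assume "y \<in> cube m - ?I"
      then have "y + unit_site i \<notin> cube (m - 1)" by (auto simp: image_iff)
      then show "f (y + unit_site i) * j i y = 0" by (simp add: f)
    qed
    finally show ?thesis .
  qed
  have "(\<Sum>x\<in>cube m. f x * dv j x) = (\<Sum>i\<in>UNIV. (\<Sum>x\<in>cube m. f x * j i x) - (\<Sum>x\<in>cube m. f x * j i (x - unit_site i)))"
    unfolding dv_def sum_distrib_left by (subst sum.swap) (simp add: right_diff_distrib sum_subtractf)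
  also have "\<dots> = (\<Sum>i\<in>UNIV. \<Sum>x\<in>cube m. - (j i x * nab f i x))"
    unfolding * sum_subtractf[symmetric] by (simp add: nab_def algebra_simps)
  also have "\<dots> = (\<Sum>x\<in>cube m. \<Sum>i\<in>UNIV. - (j i x * nab f i x))" by (rule sum.swap)
  finally show ?thesis by (simp add: sum_negf)
qed

text \<open>Equal to 1 up to radius r + 1, not just r, and to 0 from radius 3 r: a bond on which it
  changes then has both ends in \<open>annulus r\<close>. The slope \<open>1 / (2 * r - 1)\<close>
  is at most \<open>1 / r\<close>.\<close>

definition cutoff :: "int \<Rightarrow> 'd::finite site \<Rightarrow> real" where
  "cutoff r x = min 1 (max 0 (real_of_int (3 * r - snorm x) / real_of_int (2 * r - 1)))"

lemma cutoff_one: "r \<ge> 1 \<Longrightarrow> snorm x \<le> r + 1 \<Longrightarrow> cutoff r x = 1"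
  by (simp add: cutoff_def divide_simps)

lemma cutoff_zero: "r \<ge> 1 \<Longrightarrow> snorm x \<ge> 3 * r \<Longrightarrow> cutoff r x = 0"
  by (simp add: cutoff_def divide_simps)

lemma clamp: "\<bar>min 1 (max 0 a) - min 1 (max 0 b)\<bar> \<le> \<bar>a - b :: real\<bar>"
  by (auto simp: min_def max_def abs_if)

lemma cutoff_step:
  assumes "r \<ge> 1"
  shows "(cutoff r (x + unit_site i) - cutoff r x)\<^sup>2 \<le> 1 / (real_of_int r)\<^sup>2"
    and "cutoff r (x + unit_site i) \<noteq> cutoff r x \<Longrightarrow> x \<in> annulus r \<and> x + unit_site i \<in> annulus r"
proof -
  define s t where "s = snorm x" and "t = snorm (x + unit_site i)"
  have st: "\<bar>t - s\<bar> \<le> 1" using snorm_step[of x i] by (simp add: s_def t_def)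
  define m where "m = real_of_int (2 * r - 1)"
  have m: "m \<ge> real_of_int r" using assms by (simp add: m_def)
  have r: "real_of_int r \<ge> 1" using assms by simp
  have "\<bar>cutoff r (x + unit_site i) - cutoff r x\<bar> \<le> \<bar>real_of_int (3 * r - t) / m - real_of_int (3 * r - s) / m\<bar>"
    unfolding cutoff_def s_def[symmetric] t_def[symmetric] m_def[symmetric] by (rule clamp)
  also have "\<dots> = \<bar>real_of_int (t - s)\<bar> / m"
    using m r by (simp add: diff_divide_distrib[symmetric] abs_divide abs_minus_commute)
  also have "\<dots> \<le> 1 / real_of_int r"
  proof (rule frac_le)
    show "\<bar>real_of_int (t - s)\<bar> \<le> 1" using st by linarith
  qed (use m r in auto)
  finally have "\<bar>cutoff r (x + unit_site i) - cutoff r x\<bar>\<^sup>2 \<le> (1 / real_of_int r)\<^sup>2"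
    by (intro power_mono) auto
  then show "(cutoff r (x + unit_site i) - cutoff r x)\<^sup>2 \<le> 1 / (real_of_int r)\<^sup>2"
    by (simp add: power_divide)
  assume ne: "cutoff r (x + unit_site i) \<noteq> cutoff r x"
  have "\<not> (s \<le> r + 1 \<and> t \<le> r + 1)"
    using cutoff_one[OF assms, of x] cutoff_one[OF assms, of "x + unit_site i"] ne by (auto simp: s_def t_def)
  moreover have "\<not> (3 * r \<le> s \<and> 3 * r \<le> t)"
    using cutoff_zero[OF assms, of x] cutoff_zero[OF assms, of "x + unit_site i"] ne by (auto simp: s_def t_def)
  ultimately show "x \<in> annulus r \<and> x + unit_site i \<in> annulus r"
    unfolding annulus_iff s_def[symmetric] t_def[symmetric] using st by linarith
qed

text \<open>Discrete substitute for the product rule; in terms of sums and differences of both pairs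
  the defect is a sum of squares.\<close>

lemma caccioppoli_pointwise:
  fixes a b U V :: real
  shows "(V - U)\<^sup>2 * (a\<^sup>2 + b\<^sup>2) / 4 - (b - a)\<^sup>2 * (U\<^sup>2 + V\<^sup>2) \<le> (V - U) * (b\<^sup>2 * V - a\<^sup>2 * U)"
proof -
  define w p s q where "w = V - U" and "p = U + V" and "s = a + b" and "q = b - a"
  have "8 * ((V - U) * (b\<^sup>2 * V - a\<^sup>2 * U)) - 2 * ((V - U)\<^sup>2 * (a\<^sup>2 + b\<^sup>2)) + 8 * ((b - a)\<^sup>2 * (U\<^sup>2 + V\<^sup>2))
    = (w * s + 2 * q * p)\<^sup>2 + (w * q)\<^sup>2 + 4 * (q * w)\<^sup>2"
    unfolding w_def p_def s_def q_def by (simp add: power2_eq_square algebra_simps)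
  moreover have "0 \<le> (w * s + 2 * q * p)\<^sup>2 + (w * q)\<^sup>2 + 4 * (q * w)\<^sup>2" by simp
  ultimately show ?thesis by linarith
qed

text \<open>The equation is tested with the squared cutoff times u - k. The square lets the gradient
  of the cutoff be separated from that of \<open>u\<close>, and every constant \<open>k\<close> is
  admissible because the equation sees only gradients.\<close>

lemma caccioppoli:
  fixes u :: "'d::finite site \<Rightarrow> real"
  assumes c: "c \<ge> 1" and ell: "\<And>b. 1 / c \<le> \<xi> b \<and> \<xi> b \<le> c"
    and harm: "\<And>x. dv (\<lambda>i x. \<xi> (x, i) * nab u i x) x = 0" and r: "r \<ge> 1"
  shows "edge_energy (cube r) u \<le> 4 * c\<^sup>2 * real CARD('d) / (real_of_int r)\<^sup>2 * (\<Sum>x\<in>annulus r. (u x - k)\<^sup>2)"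
proof -
  let ?Q = "cube (3 * r) :: 'd site set" and ?A = "annulus r :: 'd site set"
  define a where "a = (cutoff r :: 'd site \<Rightarrow> real)"
  define g where "g x = u x - k" for x
  define f where "f x = (a x)\<^sup>2 * g x" for x
  define R where "R = (real_of_int r)\<^sup>2"
  have R: "R > 0" using r by (simp add: R_def)
  have xi: "\<xi> b > 0" for b using ell[of b] c by (smt (verit) divide_pos_pos)
  have "f x = 0" if "x \<notin> cube (3 * r - 1)" for x
    using cutoff_zero[OF r, of x] that by (simp add: f_def a_def snorm_le_iff[symmetric])
  from cube_sum_by_parts[where m = "3 * r" and f = f and j = "\<lambda>i x. \<xi> (x, i) * nab u i x", OF this]
  have zero: "(\<Sum>x\<in>?Q. \<Sum>i\<in>UNIV. \<xi> (x, i) * nab u i x * nab f i x) = 0"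
    by (simp add: harm)
  have pt: "\<xi> (x, i) * ((nab u i x)\<^sup>2 * ((a x)\<^sup>2 + (a (x + unit_site i))\<^sup>2) / 4)
      \<le> \<xi> (x, i) * nab u i x * nab f i x + \<xi> (x, i) * ((a (x + unit_site i) - a x)\<^sup>2 * ((g x)\<^sup>2 + (g (x + unit_site i))\<^sup>2))" for x i
  proof -
    have "nab u i x = g (x + unit_site i) - g x" by (simp add: nab_def g_def)
    from mult_left_mono[OF caccioppoli_pointwise less_imp_le[OF xi[of "(x, i)"]], of "g (x + unit_site i)" "g x" "a x" "a (x + unit_site i)", folded this]
    show ?thesis by (simp add: nab_def[of f] f_def algebra_simps)
  qed
  have "edge_energy (cube r) u / (2 * c) = (\<Sum>x\<in>cube r. \<Sum>i\<in>UNIV. if x + unit_site i \<in> cube r then (nab u i x)\<^sup>2 / (2 * c) else 0)"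
    unfolding edge_energy_def sum_divide_distrib by (intro sum.cong refl) auto
  also have "\<dots> \<le> (\<Sum>x\<in>cube r. \<Sum>i\<in>UNIV. \<xi> (x, i) * ((nab u i x)\<^sup>2 * ((a x)\<^sup>2 + (a (x + unit_site i))\<^sup>2) / 4))"
  proof (intro sum_mono)
    fix x :: "'d site" and i :: 'd assume x: "x \<in> cube r"
    show "(if x + unit_site i \<in> cube r then (nab u i x)\<^sup>2 / (2 * c) else 0)
      \<le> \<xi> (x, i) * ((nab u i x)\<^sup>2 * ((a x)\<^sup>2 + (a (x + unit_site i))\<^sup>2) / 4)"
    proof (cases "x + unit_site i \<in> cube r")
      case True
      have "a x = 1" "a (x + unit_site i) = 1"
        using x True r by (auto simp: a_def snorm_le_iff[symmetric] intro!: cutoff_one)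
      moreover have "(1 / c) * ((nab u i x)\<^sup>2 / 2) \<le> \<xi> (x, i) * ((nab u i x)\<^sup>2 / 2)"
        using ell by (intro mult_right_mono) auto
      ultimately show ?thesis using True by simp
    qed (auto intro!: mult_nonneg_nonneg simp: less_imp_le[OF xi])
  qed
  also have "\<dots> \<le> (\<Sum>x\<in>?Q. \<Sum>i\<in>UNIV. \<xi> (x, i) * ((nab u i x)\<^sup>2 * ((a x)\<^sup>2 + (a (x + unit_site i))\<^sup>2) / 4))"
    using cube_mono[of r "3 * r"] r
    by (intro sum_mono2) (auto intro!: sum_nonneg mult_nonneg_nonneg simp: less_imp_le[OF xi])
  also have "\<dots> \<le> (\<Sum>x\<in>?Q. \<Sum>i\<in>UNIV. \<xi> (x, i) * nab u i x * nab f i x + \<xi> (x, i) * ((a (x + unit_site i) - a x)\<^sup>2 * ((g x)\<^sup>2 + (g (x + unit_site i))\<^sup>2)))"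
    by (intro sum_mono pt)
  also have "\<dots> = (\<Sum>x\<in>?Q. \<Sum>i\<in>UNIV. \<xi> (x, i) * ((a (x + unit_site i) - a x)\<^sup>2 * ((g x)\<^sup>2 + (g (x + unit_site i))\<^sup>2)))"
    by (simp add: sum.distrib zero)
  also have "\<dots> \<le> (\<Sum>x\<in>?Q. \<Sum>i\<in>UNIV. c / R * ((if x \<in> ?A then (g x)\<^sup>2 else 0) + (if x + unit_site i \<in> ?A then (g (x + unit_site i))\<^sup>2 else 0)))"
  proof (intro sum_mono)
    fix x :: "'d site" and i :: 'd
    show "\<xi> (x, i) * ((a (x + unit_site i) - a x)\<^sup>2 * ((g x)\<^sup>2 + (g (x + unit_site i))\<^sup>2))
      \<le> c / R * ((if x \<in> ?A then (g x)\<^sup>2 else 0) + (if x + unit_site i \<in> ?A then (g (x + unit_site i))\<^sup>2 else 0))"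
    proof (cases "a (x + unit_site i) = a x")
      case True
      then show ?thesis using c R by simp
    next
      case False
      then have "x \<in> ?A" "x + unit_site i \<in> ?A" using cutoff_step(2)[OF r, of x i] by (auto simp: a_def)
      moreover have "\<xi> (x, i) * ((a (x + unit_site i) - a x)\<^sup>2 * ((g x)\<^sup>2 + (g (x + unit_site i))\<^sup>2))
        \<le> c * (1 / R * ((g x)\<^sup>2 + (g (x + unit_site i))\<^sup>2))"
        unfolding a_def R_def using ell c cutoff_step(1)[OF r] by (intro mult_mono) auto
      ultimately show ?thesis by simp
    qed
  qed
  also have "\<dots> = c / R * ((\<Sum>x\<in>?Q. \<Sum>i\<in>(UNIV :: 'd set). if x \<in> ?A then (g x)\<^sup>2 else 0)
      + (\<Sum>x\<in>?Q. \<Sum>i\<in>UNIV. if x + unit_site i \<in> ?A then (g (x + unit_site i))\<^sup>2 else 0))"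
    by (simp only: sum_distrib_left[symmetric] sum.distrib)
  also have "\<dots> \<le> c / R * (real CARD('d) * (\<Sum>x\<in>?A. (g x)\<^sup>2) + real CARD('d) * (\<Sum>x\<in>?A. (g x)\<^sup>2))"
  proof (intro mult_left_mono add_mono)
    have "(\<Sum>x\<in>?Q. if x \<in> ?A then (g x)\<^sup>2 else 0) = (\<Sum>x\<in>?Q \<inter> ?A. (g x)\<^sup>2)"
      by (simp add: sum.inter_restrict)
    also have "?Q \<inter> ?A = ?A" by (auto simp: annulus_def)
    finally have "(\<Sum>x\<in>?Q. if x \<in> ?A then (g x)\<^sup>2 else 0) = (\<Sum>x\<in>?A. (g x)\<^sup>2)" .
    then show "(\<Sum>x\<in>?Q. \<Sum>i\<in>(UNIV :: 'd set). if x \<in> ?A then (g x)\<^sup>2 else 0) \<le> real CARD('d) * (\<Sum>x\<in>?A. (g x)\<^sup>2)"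
      by (simp add: sum_distrib_left[symmetric])
    have "(\<Sum>x\<in>?Q. if x + unit_site i \<in> ?A then (g (x + unit_site i))\<^sup>2 else 0) \<le> (\<Sum>x\<in>?A. (g x)\<^sup>2)" for i
    proof -
      have "(\<Sum>x\<in>?Q. if x + unit_site i \<in> ?A then (g (x + unit_site i))\<^sup>2 else 0)
        = (\<Sum>x\<in>{x \<in> ?Q. x + unit_site i \<in> ?A}. (g (x + unit_site i))\<^sup>2)"
        by (simp add: sum.inter_filter)
      also have "\<dots> = (\<Sum>y\<in>(\<lambda>x. x + unit_site i) ` {x \<in> ?Q. x + unit_site i \<in> ?A}. (g y)\<^sup>2)"
        by (subst sum.reindex) (auto simp: inj_on_def)
      also have "\<dots> \<le> (\<Sum>x\<in>?A. (g x)\<^sup>2)" by (intro sum_mono2) auto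
      finally show ?thesis .
    qed
    then have "(\<Sum>i\<in>(UNIV :: 'd set). \<Sum>x\<in>?Q. if x + unit_site i \<in> ?A then (g (x + unit_site i))\<^sup>2 else 0)
      \<le> (\<Sum>i\<in>(UNIV :: 'd set). \<Sum>x\<in>?A. (g x)\<^sup>2)" by (intro sum_mono)
    then show "(\<Sum>x\<in>?Q. \<Sum>i\<in>UNIV. if x + unit_site i \<in> ?A then (g (x + unit_site i))\<^sup>2 else 0) \<le> real CARD('d) * (\<Sum>x\<in>?A. (g x)\<^sup>2)"
      by (subst sum.swap) simp
  qed (use c R in simp)
  finally have "edge_energy (cube r) u / (2 * c) \<le> c / R * (2 * real CARD('d) * (\<Sum>x\<in>?A. (g x)\<^sup>2))" by simp
  then have "edge_energy (cube r) u \<le> 4 * c\<^sup>2 * real CARD('d) / R * (\<Sum>x\<in>?A. (g x)\<^sup>2)"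
    using c R by (simp add: field_simps power2_eq_square)
  then show ?thesis by (simp only: R_def g_def)
qed

text \<open>The inner energy is at most \<open>M\<close> times the energy of the annulus; adding
  \<open>M\<close> times the inner energy to both sides fills the hole and gives the factor
  \<open>M / (1 + M)\<close>, which depends only on \<open>c\<close> and the dimension.\<close>

lemma hole_filling:
  fixes c :: real
  assumes d: "CARD('d::finite) \<ge> 2" and c: "c \<ge> 1"
  shows "\<exists>\<theta>. 0 < \<theta> \<and> \<theta> < 1 \<and> (\<forall>(\<xi> :: 'd env) u r. (\<forall>b. 1 / c \<le> \<xi> b \<and> \<xi> b \<le> c) \<longrightarrow>
    (\<forall>x. dv (\<lambda>i x. \<xi> (x, i) * nab u i x) x = 0) \<longrightarrow> r \<ge> 1 \<longrightarrow>
    edge_energy (cube r) u \<le> \<theta> * edge_energy (cube (3 * r)) u)"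
proof -
  obtain C where C: "C > 0" and P: "\<And>r (u :: 'd site \<Rightarrow> real). r \<ge> 1 \<Longrightarrow> \<exists>k.
    (\<Sum>x\<in>annulus r. (u x - k)\<^sup>2) \<le> C * (real_of_int r)\<^sup>2 * edge_energy (annulus r) u"
    using annulus_poincare[OF d] by blast
  define M where "M = 4 * c\<^sup>2 * real CARD('d) * C"
  have M: "M > 0" using c C by (simp add: M_def)
  show ?thesis
  proof (intro exI[of _ "M / (1 + M)"] conjI allI impI)
    fix \<xi> :: "'d env" and u and r :: int
    assume ell: "\<forall>b. 1 / c \<le> \<xi> b \<and> \<xi> b \<le> c" and harm: "\<forall>x. dv (\<lambda>i x. \<xi> (x, i) * nab u i x) x = 0" and r: "r \<ge> 1"
    obtain k where k: "(\<Sum>x\<in>annulus r. (u x - k)\<^sup>2) \<le> C * (real_of_int r)\<^sup>2 * edge_energy (annulus r) u"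
      using P[OF r] by blast
    have "edge_energy (cube r) u \<le> 4 * c\<^sup>2 * real CARD('d) / (real_of_int r)\<^sup>2 * (\<Sum>x\<in>annulus r. (u x - k)\<^sup>2)"
      by (rule caccioppoli[OF c _ _ r, where \<xi> = \<xi>]) (use ell harm in blast)+
    also have "\<dots> \<le> 4 * c\<^sup>2 * real CARD('d) / (real_of_int r)\<^sup>2 * (C * (real_of_int r)\<^sup>2 * edge_energy (annulus r) u)"
      by (intro mult_left_mono k) auto
    also have "\<dots> = M * edge_energy (annulus r) u" using r by (simp add: M_def)
    finally have "edge_energy (cube r) u \<le> M * edge_energy (annulus r) u" .
    moreover have "edge_energy (cube r) u + edge_energy (annulus r) u \<le> edge_energy (cube (3 * r)) u"
      using r cube_mono[of r "3 * r"] by (intro edge_energy_disjoint) (auto simp: annulus_def)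
    then have "M * edge_energy (annulus r) u \<le> M * (edge_energy (cube (3 * r)) u - edge_energy (cube r) u)"
      using M by (intro mult_left_mono) auto
    ultimately show "edge_energy (cube r) u \<le> M / (1 + M) * edge_energy (cube (3 * r)) u"
      using M by (simp add: field_simps)
  qed (use M in auto)
qed

lemma hole_filling_iterate:
  assumes "\<And>r. r \<ge> 1 \<Longrightarrow> edge_energy (cube r) u \<le> \<theta> * edge_energy (cube (3 * r)) u" "\<theta> > 0"
  shows "edge_energy (cube 1) u \<le> \<theta> ^ k * edge_energy (cube (3 ^ k)) u"
proof (induction k)
  case (Suc k)
  have "\<theta> ^ k * edge_energy (cube (3 ^ k)) u \<le> \<theta> ^ k * (\<theta> * edge_energy (cube (3 * 3 ^ k)) u)"
    using assms by (intro mult_left_mono assms(1)) auto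
  then show ?case using Suc by (simp add: mult_ac)
qed simp

section \<open>No bond carries a positive fraction of the energy\<close>

lemma site_eq_smult:
  fixes x :: "'d::finite site"
  assumes "CARD('d) = 1"
  shows "x = x $ k *s unit_site k"
proof -
  obtain a :: 'd where a: "UNIV = {a}" using assms by (rule card_1_singletonE)
  have "i = k" for i using a by (metis UNIV_I singletonD)
  then show ?thesis by (metis (mono_tags, lifting) axis_nth mult.right_neutral unit_site_def vec_eq_iff vector_smult_component)
qed

lemma constant_if_unit_invariant:
  fixes g :: "'d::finite site \<Rightarrow> real"
  assumes "CARD('d) = 1" "\<And>x. g (x + unit_site k) = g x"
  shows "g x = g 0"
proof -
  have n: "g (int n *s unit_site k) = g 0" for n
  proof (induction n)
    case (Suc n)
    have "int (Suc n) *s unit_site k = int n *s unit_site k + unit_site k"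
      by (simp add: vector_sadd_rdistrib add.commute)
    then show ?case using assms(2) Suc by (simp only:)
  qed simp
  have m: "g (- (int n *s unit_site k)) = g 0" for n
  proof (induction n)
    case (Suc n)
    have "- (int (Suc n) *s unit_site k) + unit_site k = - (int n *s unit_site k)"
      by (simp add: vector_sadd_rdistrib)
    then show ?case using assms(2)[of "- (int (Suc n) *s unit_site k)"] Suc by simp
  qed simp
  have "g (t *s unit_site k) = g 0" for t
  proof (cases "t \<ge> 0")
    case True
    then show ?thesis using n[of "nat t"] by simp
  next
    case False
    then have "t *s unit_site k = - (int (nat (- t)) *s unit_site k)" by (simp add: vec_eq_iff)
    then show ?thesis using m[of "nat (- t)"] by simp
  qed
  then show ?thesis using site_eq_smult[OF assms(1), of x k] by metis
qed

context torus_env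
begin

text \<open>In one dimension a divergence free current is constant. By ellipticity the squares of
  the field at any two sites then agree up to \<open>c ^ 4\<close>, and averaging over the torus
  bounds each of them by the mean energy.\<close>

lemma wfield_bound_1d:
  assumes d: "CARD('d) = 1"
  shows "(wfield l \<xi> v i x)\<^sup>2 \<le> c ^ 6 * (v \<bullet> v)"
proof -
  obtain a :: 'd where a: "UNIV = {a}" using d by (rule card_1_singletonE)
  have i: "k = i" for k using a by (metis UNIV_I singletonD)
  then have U1: "UNIV = {i}" by blast
  define j where "j y = \<xi> (y, i) * wfield l \<xi> v i y" for y
  have "j (y + unit_site i) = j y" for y
    using dv_wfield[of v "y + unit_site i"] by (simp add: dv_def U1 j_def)
  then have j: "j y = j 0" for y using constant_if_unit_invariant[OF d] by blast
  have xi: "1 / c \<le> \<xi> b" "\<xi> b \<le> c" for b using ell by (auto simp: elliptic_def simp del: split_paired_All)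
  have le: "(wfield l \<xi> v i y)\<^sup>2 \<le> c\<^sup>2 * (j 0)\<^sup>2" for y
  proof -
    have "1 \<le> c * \<xi> (y, i)" using xi(1)[of "(y, i)"] c by (simp add: field_simps)
    then have "1 \<le> (c * \<xi> (y, i))\<^sup>2" by (simp add: one_le_power)
    from mult_right_mono[OF this, of "(wfield l \<xi> v i y)\<^sup>2"]
    have "(wfield l \<xi> v i y)\<^sup>2 \<le> c\<^sup>2 * (j y)\<^sup>2" by (simp add: j_def power_mult_distrib)
    then show ?thesis by (simp only: j[of y])
  qed
  have ge: "(j 0)\<^sup>2 \<le> c\<^sup>2 * (wfield l \<xi> v i y)\<^sup>2" for y
  proof -
    have "(\<xi> (y, i))\<^sup>2 \<le> c\<^sup>2" using xi(2)[of "(y, i)"] pos[of "(y, i)"] by (intro power_mono) (auto simp: less_imp_le)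
    from mult_right_mono[OF this, of "(wfield l \<xi> v i y)\<^sup>2"]
    have "(j y)\<^sup>2 \<le> c\<^sup>2 * (wfield l \<xi> v i y)\<^sup>2" by (simp add: j_def power_mult_distrib)
    then show ?thesis by (simp only: j[of y])
  qed
  have "real (card T) * (j 0)\<^sup>2 = (\<Sum>y\<in>T. (j 0)\<^sup>2)" by simp
  also have "\<dots> \<le> (\<Sum>y\<in>T. c\<^sup>2 * (wfield l \<xi> v i y)\<^sup>2)" by (intro sum_mono ge)
  also have "\<dots> = c\<^sup>2 * (\<Sum>y\<in>T. \<Sum>k\<in>UNIV. (wfield l \<xi> v k y)\<^sup>2)" by (simp add: U1 sum_distrib_left)
  also have "\<dots> \<le> c\<^sup>2 * (c\<^sup>2 * real (card T) * (v \<bullet> v))" by (intro mult_left_mono sum_wfield_le) auto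
  finally have "real (card T) * (j 0)\<^sup>2 \<le> real (card T) * (c ^ 4 * (v \<bullet> v))" by (simp add: mult_ac eval_nat_numeral)
  then have "(j 0)\<^sup>2 \<le> c ^ 4 * (v \<bullet> v)"
    using card_torus_pos[OF N, where 'd='d] by (simp only: mult_le_cancel_left_pos of_nat_0_less_iff)
  then have "c\<^sup>2 * (j 0)\<^sup>2 \<le> c\<^sup>2 * (c ^ 4 * (v \<bullet> v))" by (intro mult_left_mono) auto
  then show ?thesis using le[of x] by (simp add: mult.assoc[symmetric] flip: power_add)
qed

text \<open>Hole filling on cubes around \<open>z\<close>, from radius 1 to radius
  \<open>3 ^ k\<close>; the largest still fits into one period, whose total energy is bounded. For
  \<open>k = 0\<close> the total energy is used directly, which covers \<open>N = 1\<close>, where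
  the cube of radius 1 is larger than a period.\<close>

lemma wfield_bound_hole:
  assumes \<theta>: "0 < \<theta>" and hole: "\<And>(\<xi> :: 'd env) u r. \<lbrakk>\<forall>b. 1 / c \<le> \<xi> b \<and> \<xi> b \<le> c;
    \<forall>x. dv (\<lambda>i x. \<xi> (x, i) * nab u i x) x = 0; r \<ge> 1\<rbrakk> \<Longrightarrow>
    edge_energy (cube r) u \<le> \<theta> * edge_energy (cube (3 * r)) u"
    and k: "k = 0 \<or> 3 ^ k < N"
  shows "(wfield l \<xi> v i z)\<^sup>2 \<le> \<theta> ^ k * (c\<^sup>2 * real (card T) * (v \<bullet> v))"
proof (cases "k = 0")
  case True
  have "(wfield l \<xi> v i y)\<^sup>2 \<le> (\<Sum>x\<in>T. \<Sum>i\<in>UNIV. (wfield l \<xi> v i x)\<^sup>2)" if "y \<in> T" for y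
  proof -
    have "(wfield l \<xi> v i y)\<^sup>2 \<le> (\<Sum>i\<in>UNIV. (wfield l \<xi> v i y)\<^sup>2)" by (intro member_le_sum) auto
    also have "\<dots> \<le> (\<Sum>x\<in>T. \<Sum>i\<in>UNIV. (wfield l \<xi> v i x)\<^sup>2)"
      using that by (intro member_le_sum[where f = "\<lambda>x. \<Sum>i\<in>UNIV. (wfield l \<xi> v i x)\<^sup>2"]) (auto intro!: sum_nonneg)
    finally show ?thesis .
  qed
  then have "(wfield l \<xi> v i z)\<^sup>2 \<le> (\<Sum>x\<in>T. \<Sum>i\<in>UNIV. (wfield l \<xi> v i x)\<^sup>2)"
    by (rule periodic_ext[OF N periodic_wfield, where P = "\<lambda>t. t\<^sup>2 \<le> _"])
  then show ?thesis using sum_wfield_le[of v] True by simp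
next
  case False
  then have k: "3 ^ k < N" using k by simp
  define u where "u x = lin v (x + z) + corr l \<xi> v (x + z)" for x
  have nab_u: "nab u i = (\<lambda>x. wfield l \<xi> v i (x + z))" for i
    by (auto simp: u_def nab_def wfield_def lin_add lin_unit add_ac)
  have "dv (\<lambda>i x. env_shift z \<xi> (x, i) * nab u i x) x = 0" for x
    using dv_wfield[of v "x + z"] by (simp add: nab_u env_shift_def dv_def algebra_simps)
  moreover have "1 / c \<le> env_shift z \<xi> b \<and> env_shift z \<xi> b \<le> c" for b
    using elliptic_env_shift[OF ell, of z] by (simp add: elliptic_def del: split_paired_All)
  ultimately have h: "r \<ge> 1 \<Longrightarrow> edge_energy (cube r) u \<le> \<theta> * edge_energy (cube (3 * r)) u" for r
    using hole[of "env_shift z \<xi>" u r] by blast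
  have e: "unit_site i \<in> cube 1" "0 \<in> cube 1" by (auto simp: cube_def unit_site_def axis_def)
  have "(wfield l \<xi> v i z)\<^sup>2 = (if 0 + unit_site i \<in> cube 1 then (nab u i 0)\<^sup>2 else 0)" using e by (simp add: nab_u)
  also have "\<dots> \<le> (\<Sum>i\<in>UNIV. if 0 + unit_site i \<in> cube 1 then (nab u i 0)\<^sup>2 else 0)"
    by (rule member_le_sum) auto
  also have "\<dots> \<le> edge_energy (cube 1) u"
    unfolding edge_energy_def
    using e by (intro member_le_sum[where f = "\<lambda>x. \<Sum>i\<in>UNIV. if x + unit_site i \<in> cube 1 then (nab u i x)\<^sup>2 else 0"])
      (auto intro!: sum_nonneg)
  also have "\<dots> \<le> \<theta> ^ k * edge_energy (cube (3 ^ k)) u" by (rule hole_filling_iterate[OF h \<theta>])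
  also have "edge_energy (cube (3 ^ k)) u \<le> (\<Sum>x\<in>T. \<Sum>i\<in>UNIV. (nab u i x)\<^sup>2)"
  proof -
    have sub: "cube (3 ^ k) \<subseteq> T"
    proof
      fix x :: "'d site" assume x: "x \<in> cube (3 ^ k)"
      have "int (3 ^ k) < int N" using k by (simp only: of_nat_less_iff)
      then have K: "(3 :: int) ^ k < int N" by simp
      have "- int N \<le> x $ j \<and> x $ j < int N" for j
      proof -
        have "\<bar>x $ j\<bar> \<le> 3 ^ k" using x by (simp add: cube_def)
        then show ?thesis using K by linarith
      qed
      then show "x \<in> T" by (simp add: torus_def)
    qed
    have "edge_energy (cube (3 ^ k)) u \<le> (\<Sum>x\<in>cube (3 ^ k). \<Sum>i\<in>UNIV. (nab u i x)\<^sup>2)"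
      unfolding edge_energy_def by (intro sum_mono) auto
    also have "\<dots> \<le> (\<Sum>x\<in>T. \<Sum>i\<in>UNIV. (nab u i x)\<^sup>2)"
      using sub by (intro sum_mono2) (auto intro!: sum_nonneg)
    finally show ?thesis .
  qed
  also have "(\<Sum>x\<in>T. \<Sum>i\<in>UNIV. (nab u i x)\<^sup>2) = (\<Sum>x\<in>T. \<Sum>i\<in>UNIV. (wfield l \<xi> v i x)\<^sup>2)"
    using torus_sum_shift[OF N, of "\<lambda>x. \<Sum>i\<in>UNIV. (wfield l \<xi> v i x)\<^sup>2" z]
    by (simp add: nab_u periodic_sum periodic_power periodic_wfield)
  also have "\<dots> \<le> c\<^sup>2 * real (card T) * (v \<bullet> v)" by (rule sum_wfield_le)
  finally show ?thesis using \<theta> by (simp add: mult_left_mono)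
qed

end

text \<open>
  The only property of the exponent \<open>\<alpha>\<close> that matters is that it depends on nothing but \<open>c\<close> and the
  dimension. In dimension one, hole filling fails (the annulus is disconnected), but the current is
  constant.
\<close>

theorem wfield_decay:
  fixes c :: real
  assumes c: "c \<ge> 1"
  shows "\<exists>\<alpha> C. 0 < \<alpha> \<and> \<alpha> \<le> 1 \<and> 0 < C \<and> (\<forall>N l (\<xi> :: 'd::finite env) v i x. torus_env N c l \<xi> \<longrightarrow>
    (wfield l \<xi> v i x)\<^sup>2 \<le> C * real N powr (- \<alpha>) * (real (card (torus N :: 'd site set)) * (v \<bullet> v)))"
proof (cases "CARD('d) = 1")
  case True
  show ?thesis
  proof (rule exI[of _ 1], rule exI[of _ "c ^ 6"], intro conjI allI impI)
    fix N l and \<xi> :: "'d env" and v :: "real ^ 'd" and i x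
    assume "torus_env N c l \<xi>"
    then interpret torus_env N c l \<xi> .
    have "1 \<le> real N powr (- 1) * real (card (torus N :: 'd site set))"
      using N True by (simp add: card_torus powr_minus_divide)
    from mult_left_mono[OF this, of "c ^ 6 * (v \<bullet> v)"] c
    have "c ^ 6 * (v \<bullet> v) \<le> c ^ 6 * (v \<bullet> v) * (real N powr (- 1) * real (card (torus N :: 'd site set)))" by simp
    then show "(wfield l \<xi> v i x)\<^sup>2 \<le> c ^ 6 * real N powr (- 1) * (real (card (torus N :: 'd site set)) * (v \<bullet> v))"
      using wfield_bound_1d[OF True, of v i x] by (simp add: mult_ac)
  qed (use c in auto)
next
  case False
  then have d: "CARD('d) \<ge> 2" by (metis One_nat_def Suc_1 Suc_leI le_neq_implies_less zero_less_card_finite)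
  obtain \<theta> where \<theta>: "0 < \<theta>" "\<theta> < 1" and hole: "\<And>(\<xi> :: 'd env) u r. \<lbrakk>\<forall>b. 1 / c \<le> \<xi> b \<and> \<xi> b \<le> c;
    \<forall>x. dv (\<lambda>i x. \<xi> (x, i) * nab u i x) x = 0; r \<ge> 1\<rbrakk> \<Longrightarrow>
    edge_energy (cube r) u \<le> \<theta> * edge_energy (cube (3 * r)) u"
    using hole_filling[OF d c] by blast
  \<comment> \<open>Each tripling of the radius gains a factor \<theta>, and about
    \<open>log 3 N\<close> triplings fit into the torus: together the power
    \<open>log 3 \<theta>\<close> of \<open>N\<close>.\<close>
  define \<alpha> where "\<alpha> = min 1 (- log 3 \<theta>)"
  have "log 3 \<theta> < 0" using \<theta> by simp
  then have \<alpha>: "0 < \<alpha>" "\<alpha> \<le> 1" "\<alpha> \<le> - log 3 \<theta>" by (auto simp: \<alpha>_def)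
  show ?thesis
  proof (rule exI[of _ \<alpha>], rule exI[of _ "3 powr \<alpha> * c\<^sup>2"], intro conjI allI impI)
    fix N l and \<xi> :: "'d env" and v :: "real ^ 'd" and i x
    assume "torus_env N c l \<xi>"
    then interpret torus_env N c l \<xi> .
    have "\<exists>k. (k = 0 \<or> 3 ^ k < N) \<and> N \<le> 3 ^ Suc k"
    proof -
      \<comment> \<open>The last scale below \<open>N\<close>. For \<open>N\<close> at most 3 this
        is \<open>k = 0\<close>; otherwise minimality gives \<open>3 ^ k < N\<close>.\<close>
      define k where "k = (LEAST k. N \<le> 3 ^ Suc k)"
      have "N \<le> 3 ^ Suc N" using power_gt_expt[of 3 "Suc N"] by simp
      then have 1: "N \<le> 3 ^ Suc k" unfolding k_def by (rule LeastI)
      have "\<not> N \<le> 3 ^ k" if "k \<noteq> 0"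
      proof -
        from that obtain m where m: "k = Suc m" by (cases k) auto
        then show ?thesis using not_less_Least[of m "\<lambda>k. N \<le> 3 ^ Suc k"] by (simp add: k_def)
      qed
      then show ?thesis using 1 by (meson not_le)
    qed
    then obtain k where k: "k = 0 \<or> 3 ^ k < N" "N \<le> 3 ^ Suc k" by blast
    have "\<theta> ^ k = 3 powr (log 3 \<theta> * real k)" using \<theta> by (simp add: powr_mult_base powr_powr[symmetric] powr_realpow)
    also have "\<dots> \<le> 3 powr (- \<alpha> * real k)" using \<alpha>(3) mult_right_mono[of "log 3 \<theta>" "- \<alpha>" "real k"] by simp
    also have "\<dots> = 3 powr \<alpha> * (3 powr real (Suc k)) powr (- \<alpha>)"
      by (simp add: powr_powr powr_add[symmetric] algebra_simps)
    also have "\<dots> \<le> 3 powr \<alpha> * real N powr (- \<alpha>)"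
    proof -
      have "real N \<le> 3 powr real (Suc k)" using k(2) by (simp only: powr_realpow of_nat_le_iff[symmetric, where 'a=real]) simp
      then show ?thesis using N \<alpha> by (intro mult_left_mono powr_mono2') auto
    qed
    finally have le: "\<theta> ^ k \<le> 3 powr \<alpha> * real N powr (- \<alpha>)" .
    have "(wfield l \<xi> v i x)\<^sup>2 \<le> \<theta> ^ k * (c\<^sup>2 * real (card T) * (v \<bullet> v))"
      by (rule wfield_bound_hole[OF \<theta>(1) hole k(1)])
    also have "\<dots> \<le> 3 powr \<alpha> * real N powr (- \<alpha>) * (c\<^sup>2 * real (card T) * (v \<bullet> v))"
      by (intro mult_right_mono le) auto
    finally show "(wfield l \<xi> v i x)\<^sup>2 \<le> 3 powr \<alpha> * c\<^sup>2 * real N powr (- \<alpha>) * (real (card (torus N :: 'd site set)) * (v \<bullet> v))"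
      by (simp add: mult_ac)
  qed (use \<alpha> c in auto)
qed

section \<open>Cutoffs and trial functions on large tori\<close>

section \<open>Gluing correctors of independent blocks\<close>

lemma torus_rep_multiple:
  assumes "M = m * N" shows "torus_rep N (torus_rep M x) = torus_rep N x"
proof -
  have "((x $ k + int M) mod (2 * int M) - int M + int N) mod (2 * int N) = (x $ k + int N) mod (2 * int N)" for k
  proof -
    have d: "2 * int N dvd 2 * int M" using assms by simp
    have "((x $ k + int M) mod (2 * int M) + (int N - int M)) mod (2 * int N)
      = ((x $ k + int M) mod (2 * int M) mod (2 * int N) + (int N - int M)) mod (2 * int N)"
      by (simp only: mod_add_left_eq)
    also have "\<dots> = ((x $ k + int M) + (int N - int M)) mod (2 * int N)"
      by (simp only: mod_mod_cancel[OF d] mod_add_left_eq)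
    finally show ?thesis by (simp add: algebra_simps)
  qed
  then show ?thesis by (simp add: torus_rep_def vec_eq_iff)
qed

text \<open>The double sum of \<open>h (x + y)\<close> over both tori is evaluated in two ways;
  shift invariance of each inner sum avoids an explicit decomposition into blocks.\<close>

lemma torus_sum_multiple:
  fixes h :: "'d::finite site \<Rightarrow> real"
  assumes "N > 0" "M > 0" "M = m * N" "periodic N h"
  shows "real (card (torus N :: 'd site set)) * (\<Sum>x\<in>torus M. h x) = real (card (torus M :: 'd site set)) * (\<Sum>y\<in>torus N. h y)"
proof -
  have pM: "periodic M h"
    using assms(4) torus_rep_multiple[OF assms(3)] unfolding periodic_def by metis
  have "real (card (torus N :: 'd site set)) * (\<Sum>x\<in>torus M. h x) = (\<Sum>y\<in>(torus N :: 'd site set). \<Sum>x\<in>torus M. h (x + y))"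
    by (simp add: torus_sum_shift[OF assms(2) pM])
  also have "\<dots> = (\<Sum>x\<in>torus M. \<Sum>y\<in>torus N. h (y + x))"
    by (subst sum.swap) (simp add: add.commute)
  also have "\<dots> = real (card (torus M :: 'd site set)) * (\<Sum>y\<in>torus N. h y)"
    by (simp add: torus_sum_shift[OF assms(1,4)])
  finally show ?thesis .
qed

text \<open>Distance to the outermost layer of sites, where it is 0. The two faces look different
  because coordinates run from -N to N - 1.\<close>

definition edge_dist :: "nat \<Rightarrow> 'd::finite site \<Rightarrow> int" where
  "edge_dist N y = Min (range (\<lambda>k. min (y $ k + int N) (int N - 1 - y $ k)))"

definition ecut :: "nat \<Rightarrow> nat \<Rightarrow> 'd::finite site \<Rightarrow> real" where
  "ecut N L y = min 1 (real_of_int (edge_dist N (torus_rep N y)) / real L)"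

lemma le_edge_dist_iff: "r \<le> edge_dist N y \<longleftrightarrow> (\<forall>k. r \<le> y $ k + int N \<and> r \<le> int N - 1 - y $ k)"
  by (auto simp: edge_dist_def)

lemma edge_dist_nonneg: "y \<in> torus N \<Longrightarrow> edge_dist N y \<ge> 0"
proof -
  assume "y \<in> torus N"
  then have "- int N \<le> y $ k" "y $ k < int N" for k by (auto simp: torus_def)
  then show "edge_dist N y \<ge> 0" unfolding le_edge_dist_iff by (smt (verit))
qed

lemma edge_dist_step:
  "edge_dist N (y + unit_site i) \<le> edge_dist N y + 1" "edge_dist N y \<le> edge_dist N (y + unit_site i) + 1"
proof -
  have e: "\<bar>unit_site i $ k\<bar> \<le> 1" for k by (simp add: unit_site_def axis_def)
  have "edge_dist N (y + unit_site i) - 1 \<le> edge_dist N y"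
    unfolding le_edge_dist_iff
  proof
    fix k
    have "edge_dist N (y + unit_site i) \<le> (y + unit_site i) $ k + int N"
      "edge_dist N (y + unit_site i) \<le> int N - 1 - (y + unit_site i) $ k"
      using le_edge_dist_iff[of "edge_dist N (y + unit_site i)" N "y + unit_site i"] by auto
    then show "edge_dist N (y + unit_site i) - 1 \<le> y $ k + int N \<and> edge_dist N (y + unit_site i) - 1 \<le> int N - 1 - y $ k"
      using e[of k] unfolding vector_add_component by linarith
  qed
  then show "edge_dist N (y + unit_site i) \<le> edge_dist N y + 1" by simp
  have "edge_dist N y - 1 \<le> edge_dist N (y + unit_site i)"
    unfolding le_edge_dist_iff
  proof
    fix k
    have "edge_dist N y \<le> y $ k + int N" "edge_dist N y \<le> int N - 1 - y $ k"
      using le_edge_dist_iff[of "edge_dist N y" N y] by auto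
    then show "edge_dist N y - 1 \<le> (y + unit_site i) $ k + int N \<and> edge_dist N y - 1 \<le> int N - 1 - (y + unit_site i) $ k"
      using e[of k] unfolding vector_add_component by linarith
  qed
  then show "edge_dist N y \<le> edge_dist N (y + unit_site i) + 1" by simp
qed

lemma periodic_ecut: "periodic N (ecut N L)"
  by (simp add: periodic_def ecut_def)

lemma ecut_bounds:
  assumes "N > 0" shows "0 \<le> ecut N L y" "ecut N L y \<le> 1"
  using edge_dist_nonneg[OF torus_rep_in[OF assms], of y] by (auto simp: ecut_def)

text \<open>Both ends of a bond leaving the period lie in the outermost layer, the far one after
  reduction modulo 2 N. Unrelated correctors of neighbouring blocks therefore meet at the value
  0.\<close>

lemma ecut_boundary:
  assumes "y \<in> torus N" "y + unit_site i \<notin> torus N"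
  shows "ecut N L y = 0" "ecut N L (y + unit_site i) = 0"
proof -
  have N: "N > 0" using assms(1) by (auto simp: torus_def intro!: Nat.gr0I dest: spec)
  obtain k where k: "\<not> (- int N \<le> (y + unit_site i) $ k \<and> (y + unit_site i) $ k < int N)"
    using assms(2) by (auto simp: torus_def)
  have yk: "- int N \<le> y $ k" "y $ k < int N" using assms(1) by (auto simp: torus_def)
  have ik: "k = i" using k yk by (auto simp: unit_site_def axis_def split: if_splits)
  then have yi: "y $ i = int N - 1" using k yk by (auto simp: unit_site_def axis_def)
  have "edge_dist N y \<le> int N - 1 - y $ i" using le_edge_dist_iff[of "edge_dist N y" N y] by auto
  then have "edge_dist N y = 0" using yi edge_dist_nonneg[OF assms(1)] by simp
  then show "ecut N L y = 0" by (simp add: ecut_def torus_rep_id[OF assms(1)])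
  let ?z = "torus_rep N (y + unit_site i)"
  have "?z $ i = - int N" using yi by (simp add: torus_rep_def unit_site_def)
  moreover have "edge_dist N ?z \<le> ?z $ i + int N" using le_edge_dist_iff[of "edge_dist N ?z" N ?z] by auto
  ultimately have "edge_dist N ?z = 0" using edge_dist_nonneg[OF torus_rep_in[OF N], of "y + unit_site i"] by simp
  then show "ecut N L (y + unit_site i) = 0" by (simp add: ecut_def)
qed

lemma nab_ecut:
  fixes y :: "'d::finite site"
  assumes "N > 0" "L > 0" shows "(nab (ecut N L) i y)\<^sup>2 \<le> 1 / (real L)\<^sup>2"
proof -
  have *: "(nab (ecut N L) i y)\<^sup>2 \<le> 1 / (real L)\<^sup>2" if y: "y \<in> torus N" for y :: "'d site"
  proof (cases "y + unit_site i \<in> torus N")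
    case False
    then show ?thesis using ecut_boundary[OF y False] by (simp add: nab_def)
  next
    case True
    have "\<bar>min 1 a - min 1 b\<bar> \<le> \<bar>a - b\<bar>" for a b :: real by (auto simp: min_def abs_if)
    then have "\<bar>nab (ecut N L) i y\<bar> \<le> \<bar>real_of_int (edge_dist N (y + unit_site i)) / real L - real_of_int (edge_dist N y) / real L\<bar>"
      by (simp add: nab_def ecut_def torus_rep_id[OF y] torus_rep_id[OF True])
    also have "\<dots> = \<bar>real_of_int (edge_dist N (y + unit_site i) - edge_dist N y)\<bar> / real L"
      by (simp add: diff_divide_distrib[symmetric])
    also have "\<dots> \<le> 1 / real L"
      using edge_dist_step[of N y i] by (intro divide_right_mono) (auto simp: abs_le_iff)
    finally have "\<bar>nab (ecut N L) i y\<bar>\<^sup>2 \<le> (1 / real L)\<^sup>2" by (intro power_mono) auto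
    then show ?thesis by (simp add: power_divide)
  qed
  show ?thesis by (rule periodic_ext[OF assms(1) periodic_nab[OF periodic_ecut], where P = "\<lambda>t. t\<^sup>2 \<le> _"]) (rule *)
qed

text \<open>The 2 d faces have layers of width \<open>L\<close>, each a fraction
  \<open>L / (2 * N)\<close> of the torus; outside of them the cutoff is 1.\<close>

lemma sum_ecut_le:
  assumes N: "N > 0" and L: "0 < L" "L \<le> N"
  shows "(\<Sum>y\<in>(torus N :: 'd::finite site set). 1 - ecut N L y) \<le> real CARD('d) * real L / real N * real (card (torus N :: 'd site set))"
proof -
  let ?T = "torus N :: 'd site set"
  define lo where "lo k = {y \<in> ?T. y $ k + int N < int L}" for k
  define hi where "hi k = {y \<in> ?T. int N - 1 - y $ k < int L}" for k
  have cnt: "real (card A) = real L / (2 * real N) * real (card ?T)"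
    if A: "A = sbox (\<chi> j. if j = k then a else - int N) (\<chi> j. if j = k then a + int L - 1 else int N - 1)" for A :: "'d site set" and a k
  proof -
    have "card A = (\<Prod>j\<in>UNIV. if j = k then L else 2 * N)"
      unfolding A card_sbox by (intro prod.cong) auto
    also have "\<dots> = L * (2 * N) ^ (CARD('d) - 1)"
      by (subst prod.remove[of _ k]) (auto simp: card_Diff_singleton)
    finally have "real (card A) = real L * (2 * real N) ^ (CARD('d) - 1)" by simp
    moreover have "(2 * real N) ^ CARD('d) = 2 * real N * (2 * real N) ^ (CARD('d) - 1)"
      by (metis One_nat_def Suc_pred power_Suc zero_less_card_finite)
    ultimately show ?thesis using N by (simp add: card_torus)
  qed
  have lo: "lo k = sbox (\<chi> j. if j = k then - int N else - int N) (\<chi> j. if j = k then - int N + int L - 1 else int N - 1)" for k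
  proof -
    have "y $ k + int N < int L \<longleftrightarrow> y $ k \<le> - int N + int L - 1" for y :: "'d site" by linarith
    moreover have "y $ j \<le> int N - 1 \<longleftrightarrow> y $ j < int N" for y :: "'d site" and j by linarith
    moreover have "int L \<le> int N" using L by simp
    ultimately show ?thesis by (auto simp: lo_def torus_def sbox_def split: if_splits)
  qed
  have hi: "hi k = sbox (\<chi> j. if j = k then int N - int L else - int N) (\<chi> j. if j = k then int N - int L + int L - 1 else int N - 1)" for k
  proof -
    have "int N - 1 - y $ k < int L \<longleftrightarrow> int N - int L \<le> y $ k" for y :: "'d site" by linarith
    moreover have "y $ j \<le> int N - 1 \<longleftrightarrow> y $ j < int N" for y :: "'d site" and j by linarith
    moreover have "int L \<le> int N" using L by simp
    ultimately show ?thesis by (auto simp: hi_def torus_def sbox_def split: if_splits)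
  qed
  have "(\<Sum>y\<in>?T. 1 - ecut N L y) \<le> (\<Sum>y\<in>?T. \<Sum>k\<in>UNIV. (if y \<in> lo k then 1 else 0) + (if y \<in> hi k then 1 else 0))"
  proof (rule sum_mono)
    fix y assume y: "y \<in> ?T"
    show "1 - ecut N L y \<le> (\<Sum>k\<in>UNIV. (if y \<in> lo k then 1 else 0) + (if y \<in> hi k then 1 else 0))"
    proof (cases "\<exists>k. y \<in> lo k \<or> y \<in> hi k")
      case True
      then obtain k where k: "y \<in> lo k \<or> y \<in> hi k" by blast
      have "1 - ecut N L y \<le> 1" using ecut_bounds[OF N] by simp
      also have "\<dots> \<le> (if y \<in> lo k then 1 else 0) + (if y \<in> hi k then 1 else 0 :: real)" using k by auto
      also have "\<dots> \<le> (\<Sum>k\<in>UNIV. (if y \<in> lo k then 1 else 0) + (if y \<in> hi k then 1 else 0))"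
        by (rule member_le_sum[where f = "\<lambda>k. (if y \<in> lo k then 1 else 0) + (if y \<in> hi k then 1 else 0 :: real)"]) auto
      finally show ?thesis .
    next
      case False
      then have "int L \<le> edge_dist N y" using y unfolding le_edge_dist_iff by (auto simp: lo_def hi_def not_less)
      then have "real L \<le> real_of_int (edge_dist N y)" by linarith
      then have "ecut N L y = 1"
        using L(1) by (simp add: ecut_def torus_rep_id[OF y] min_def divide_simps)
      then show ?thesis by (auto intro!: sum_nonneg)
    qed
  qed
  also have "\<dots> = (\<Sum>k\<in>UNIV. real (card (lo k)) + real (card (hi k)))"
  proof -
    have "(\<Sum>y\<in>?T. if y \<in> A then 1 else 0 :: real) = real (card A)" if "A \<subseteq> ?T" for A
      using that by (simp add: sum.If_cases Int_absorb1)
    moreover have "lo k \<subseteq> ?T" "hi k \<subseteq> ?T" for k by (auto simp: lo_def hi_def)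
    ultimately show ?thesis by (subst sum.swap) (simp add: sum.distrib)
  qed
  also have "\<dots> = (\<Sum>k\<in>(UNIV :: 'd set). real L / real N * real (card ?T))"
    using cnt[OF lo] cnt[OF hi] by (simp add: field_simps)
  finally show ?thesis by simp
qed

context torus_env
begin

text \<open>The new field is a convex combination of \<open>wfield\<close> and of the constant field
  \<open>v\<close>, plus the corrector times the gradient of the cutoff. Convexity keeps the
  coefficient of the main energy at 1 before Young's inequality with \<kappa> separates the last
  term.\<close>

lemma cutoff_energy:
  assumes \<eta>: "periodic N \<eta>" "\<And>x. 0 \<le> \<eta> x" "\<And>x. \<eta> x \<le> 1" and lip: "\<And>i x. (nab \<eta> i x)\<^sup>2 \<le> q" and \<kappa>: "\<kappa> > 0"
  shows "(\<Sum>x\<in>T. \<Sum>i\<in>UNIV. \<xi> (x, i) * (v $ i + nab (\<lambda>u. \<eta> u * corr l \<xi> v u) i x)\<^sup>2)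
    \<le> (1 + \<kappa>) * ((\<Sum>x\<in>T. \<Sum>i\<in>UNIV. \<xi> (x, i) * (wfield l \<xi> v i x)\<^sup>2) + c * (v \<bullet> v) * (\<Sum>x\<in>T. 1 - \<eta> x))
      + (1 + 1 / \<kappa>) * (c * real CARD('d) * q * (\<Sum>x\<in>T. (corr l \<xi> v x)\<^sup>2))"
proof -
  let ?\<phi> = "corr l \<xi> v" and ?w = "wfield l \<xi> v"
  have pt: "\<xi> (x, i) * (v $ i + nab (\<lambda>u. \<eta> u * ?\<phi> u) i x)\<^sup>2
    \<le> (1 + \<kappa>) * (\<xi> (x, i) * (?w i x)\<^sup>2 + c * ((1 - \<eta> (x + unit_site i)) * (v $ i)\<^sup>2)) + (1 + 1 / \<kappa>) * (c * q * (?\<phi> x)\<^sup>2)" for x i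
  proof -
    define e where "e = \<eta> (x + unit_site i)"
    have e: "0 \<le> e" "e \<le> 1" using \<eta> by (auto simp: e_def)
    define A where "A = e * ?w i x + (1 - e) * v $ i"
    define B where "B = ?\<phi> x * nab \<eta> i x"
    have AB: "v $ i + nab (\<lambda>u. \<eta> u * ?\<phi> u) i x = A + B"
      by (simp add: A_def B_def e_def nab_def wfield_def algebra_simps)
    have young: "(A + B)\<^sup>2 \<le> (1 + \<kappa>) * A\<^sup>2 + (1 + 1 / \<kappa>) * B\<^sup>2"
    proof -
      have "0 \<le> (\<kappa> * A - B)\<^sup>2 / \<kappa>" using \<kappa> by simp
      then have "2 * A * B \<le> \<kappa> * A\<^sup>2 + B\<^sup>2 / \<kappa>" using \<kappa> by (simp add: power2_eq_square field_simps)
      then show ?thesis by (simp add: power2_eq_square algebra_simps)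
    qed
    have "A\<^sup>2 \<le> e * (?w i x)\<^sup>2 + (1 - e) * (v $ i)\<^sup>2"
    proof -
      have "0 \<le> e * (1 - e) * (?w i x - v $ i)\<^sup>2" using e by simp
      then show ?thesis by (simp add: A_def power2_eq_square algebra_simps)
    qed
    also have "\<dots> \<le> (?w i x)\<^sup>2 + (1 - e) * (v $ i)\<^sup>2" using e mult_right_mono[of e 1 "(?w i x)\<^sup>2"] by simp
    finally have "\<xi> (x, i) * A\<^sup>2 \<le> \<xi> (x, i) * (?w i x)\<^sup>2 + \<xi> (x, i) * ((1 - e) * (v $ i)\<^sup>2)"
      using less_imp_le[OF pos[of "(x, i)"]] unfolding distrib_left[symmetric] by (intro mult_left_mono)
    also have "\<xi> (x, i) * ((1 - e) * (v $ i)\<^sup>2) \<le> c * ((1 - e) * (v $ i)\<^sup>2)"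
      using e ellipticD(2)[OF ell] by (intro mult_right_mono) auto
    finally have hA: "\<xi> (x, i) * A\<^sup>2 \<le> \<xi> (x, i) * (?w i x)\<^sup>2 + c * ((1 - e) * (v $ i)\<^sup>2)" by simp
    have "B\<^sup>2 \<le> q * (?\<phi> x)\<^sup>2" using mult_right_mono[OF lip[of i x], of "(?\<phi> x)\<^sup>2"] by (simp add: B_def power_mult_distrib mult.commute)
    then have hB: "\<xi> (x, i) * B\<^sup>2 \<le> c * (q * (?\<phi> x)\<^sup>2)"
      using ellipticD(2)[OF ell] c by (intro mult_mono) auto
    have "\<xi> (x, i) * (A + B)\<^sup>2 \<le> (1 + \<kappa>) * (\<xi> (x, i) * A\<^sup>2) + (1 + 1 / \<kappa>) * (\<xi> (x, i) * B\<^sup>2)"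
      using mult_left_mono[OF young less_imp_le[OF pos[of "(x, i)"]]] by (simp add: algebra_simps)
    also have "\<dots> \<le> (1 + \<kappa>) * (\<xi> (x, i) * (?w i x)\<^sup>2 + c * ((1 - e) * (v $ i)\<^sup>2)) + (1 + 1 / \<kappa>) * (c * (q * (?\<phi> x)\<^sup>2))"
      using \<kappa> by (intro add_mono mult_left_mono hA hB) auto
    finally show ?thesis unfolding AB by (simp add: e_def mult.assoc)
  qed
  have shift: "(\<Sum>x\<in>T. \<Sum>i\<in>UNIV. (1 - \<eta> (x + unit_site i)) * (v $ i)\<^sup>2) = (v \<bullet> v) * (\<Sum>x\<in>T. 1 - \<eta> x)"
  proof -
    have "(\<Sum>x\<in>T. 1 - \<eta> (x + unit_site i)) = (\<Sum>x\<in>T. 1 - \<eta> x)" for i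
      by (rule torus_sum_shift[OF N periodic_diff[OF periodic_const \<eta>(1)]])
    then have "(\<Sum>i\<in>UNIV. (\<Sum>x\<in>T. 1 - \<eta> (x + unit_site i)) * (v $ i)\<^sup>2) = (\<Sum>x\<in>T. 1 - \<eta> x) * (\<Sum>i\<in>UNIV. (v $ i)\<^sup>2)"
      by (simp add: sum_distrib_left)
    moreover have "(\<Sum>i\<in>UNIV. (v $ i)\<^sup>2) = v \<bullet> v" by (simp add: inner_vec_def power2_eq_square)
    ultimately show ?thesis
      by (subst sum.swap) (simp only: sum_distrib_right[symmetric] mult.commute)
  qed
  have "(\<Sum>x\<in>T. \<Sum>i\<in>UNIV. \<xi> (x, i) * (v $ i + nab (\<lambda>u. \<eta> u * ?\<phi> u) i x)\<^sup>2)
    \<le> (\<Sum>x\<in>T. \<Sum>i\<in>UNIV. (1 + \<kappa>) * (\<xi> (x, i) * (?w i x)\<^sup>2 + c * ((1 - \<eta> (x + unit_site i)) * (v $ i)\<^sup>2)) + (1 + 1 / \<kappa>) * (c * q * (?\<phi> x)\<^sup>2))"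
    by (intro sum_mono pt)
  also have "\<dots> = (1 + \<kappa>) * ((\<Sum>x\<in>T. \<Sum>i\<in>UNIV. \<xi> (x, i) * (?w i x)\<^sup>2) + c * (\<Sum>x\<in>T. \<Sum>i\<in>UNIV. (1 - \<eta> (x + unit_site i)) * (v $ i)\<^sup>2))
     + (1 + 1 / \<kappa>) * (c * real CARD('d) * q * (\<Sum>x\<in>T. (?\<phi> x)\<^sup>2))"
    by (simp add: sum.distrib sum_distrib_left[symmetric] mult_ac)
  finally show ?thesis by (simp only: shift mult.assoc)
qed

lemma corr_square_le: "(corr l \<xi> v x)\<^sup>2 \<le> (real CARD('d) * real N)\<^sup>2 * (4 * c\<^sup>2 * real (card T) * (v \<bullet> v))"
proof -
  have "(\<Sum>x\<in>T. (corr l \<xi> v x)\<^sup>2) \<le> (real CARD('d) * real N)\<^sup>2 * (4 * c\<^sup>2 * real (card T) * (v \<bullet> v))"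
    using poincare_torus[OF N periodic_corr sum_corr] mult_left_mono[OF grad_energy_corr]
    by (meson order_trans zero_le_power2)
  moreover have "(corr l \<xi> v y)\<^sup>2 \<le> (\<Sum>x\<in>T. (corr l \<xi> v x)\<^sup>2)" if "y \<in> T" for y
    using that by (intro member_le_sum) auto
  ultimately have "(corr l \<xi> v y)\<^sup>2 \<le> (real CARD('d) * real N)\<^sup>2 * (4 * c\<^sup>2 * real (card T) * (v \<bullet> v))" if "y \<in> T" for y
    using that by (meson order_trans)
  then show ?thesis by (rule periodic_ext[OF N periodic_corr, where P = "\<lambda>t. t\<^sup>2 \<le> _"])
qed

lemma dform_lin_add: "dform (\<lambda>x. lin v x + f x) (\<lambda>x. lin v x + f x) = (\<Sum>x\<in>T. \<Sum>i\<in>UNIV. \<xi> (x, i) * (v $ i + nab f i x)\<^sup>2)"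
proof -
  have "nab (\<lambda>x. lin v x + f x) i x = v $ i + nab f i x" for i x
    by (simp add: nab_def lin_add lin_unit)
  then show ?thesis by (simp add: dform_def power2_eq_square mult.assoc)
qed

lemma sum_msq_lin_ge: "real n * (real (card T) * Fq N l \<xi> v / l) \<le> (\<Sum>x\<in>T. msq n (lin v) x)"
proof -
  have "2 * dform (U v) (U v) = real (card T) * Fq N l \<xi> v"
    using card_torus_pos[OF N, where 'd='d] by (auto simp: Fq_dform)
  then show ?thesis using sum_msq_ge[OF periodic_nab_U gen_U periodic_corr, of n v v] by simp
qed

text \<open>\<open>lin v\<close> is the trial coordinate minus the periodic \<open>f\<close>. The
  first grows at most by its energy, the second contributes an amount bounded independently of
  \<open>n\<close>, which disappears against linear growth.\<close>

lemma sum_msq_lin_le: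
  assumes f: "periodic N f" and \<epsilon>: "\<epsilon> > 0"
  shows "(\<Sum>x\<in>T. msq n (lin v) x) \<le> (1 + \<epsilon>) * (real n * (2 * (\<Sum>x\<in>T. \<Sum>i\<in>UNIV. \<xi> (x, i) * (v $ i + nab f i x)\<^sup>2) / l))
     + (1 + 1 / \<epsilon>) * (4 * (\<Sum>x\<in>T. (f x)\<^sup>2))"
proof -
  let ?W = "\<lambda>x. lin v x + f x"
  have W: "periodic N (nab ?W i)" for i
  proof -
    have "nab ?W i = (\<lambda>x. v $ i + nab f i x)" by (auto simp: nab_def lin_add lin_unit)
    then show ?thesis using periodic_add[OF periodic_const periodic_nab[OF f]] by simp
  qed
  have "(\<Sum>x\<in>T. msq n (lin v) x) \<le> (\<Sum>x\<in>T. (1 + \<epsilon>) * msq n ?W x + (1 + 1 / \<epsilon>) * msq n f x)"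
    using msq_split[OF \<epsilon>, of n ?W f] by (intro sum_mono) simp
  also have "\<dots> = (1 + \<epsilon>) * (\<Sum>x\<in>T. msq n ?W x) + (1 + 1 / \<epsilon>) * (\<Sum>x\<in>T. msq n f x)"
    by (simp add: sum.distrib sum_distrib_left)
  also have "\<dots> \<le> (1 + \<epsilon>) * (real n * (2 * dform ?W ?W / l)) + (1 + 1 / \<epsilon>) * (4 * (\<Sum>x\<in>T. (f x)\<^sup>2))"
    using \<epsilon> by (intro add_mono mult_left_mono sum_msq_le[OF W] sum_msq_periodic_le f) auto
  finally show ?thesis by (simp only: dform_lin_add)
qed

end

text \<open>\<open>x - torus_rep N x\<close> is the base point of the block containing
  \<open>x\<close>: the environment there is moved to the origin and periodised.\<close>

definition block_env :: "nat \<Rightarrow> 'd::finite env \<Rightarrow> 'd site \<Rightarrow> 'd env" where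
  "block_env N \<xi> x = periodize N (env_shift (x - torus_rep N x) \<xi>)"

definition glued :: "real \<Rightarrow> nat \<Rightarrow> nat \<Rightarrow> 'd::finite env \<Rightarrow> real ^ 'd \<Rightarrow> 'd site \<Rightarrow> real" where
  "glued l N L \<xi> v x = ecut N L x * corr l (block_env N \<xi> x) v (torus_rep N x)"

locale torus_env_blocks = torus_env M c l \<xi> for M c l and \<xi> :: "'d::finite env" +
  fixes N m :: nat
  assumes N0: "N > 0" and M: "M = m * N"
begin

lemma block_env_torus: "torus_env N c l (block_env N \<xi> x)"
  by unfold_locales (auto simp: N0 c l block_env_def intro!: periodic_periodize elliptic_periodize elliptic_env_shift ell)

lemma periodic_glued: "periodic M (glued l N L \<xi> v)"
  unfolding periodic_def
proof
  fix x
  have "\<xi> (u + (torus_rep M x - torus_rep N x), i) = \<xi> (u + (x - torus_rep N x), i)" for u i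
  proof -
    have "\<xi> (torus_rep M (torus_rep M x + (u - torus_rep N x)), i) = \<xi> (torus_rep M (x + (u - torus_rep N x)), i)"
      by (simp only: torus_rep_add)
    then show ?thesis using per[of i] by (simp add: periodic_def algebra_simps)
  qed
  then have "block_env N \<xi> (torus_rep M x) = block_env N \<xi> x"
    by (simp add: block_env_def torus_rep_multiple[OF M] env_shift_def)
  moreover have "ecut N L (torus_rep M x) = ecut N L x"
    by (simp add: ecut_def torus_rep_multiple[OF M])
  ultimately show "glued l N L \<xi> v (torus_rep M x) = glued l N L \<xi> v x"
    by (simp add: glued_def torus_rep_multiple[OF M])
qed

lemma block_conductance: "\<xi> (x, i) = block_env N \<xi> x (torus_rep N x, i)"
  by (simp add: block_env_def periodize_def env_shift_def)

text \<open>A bond inside a block sees a single corrector; at a bond between blocks the cutoff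
  vanishes at both ends, so either description of its gradient gives 0.\<close>

lemma nab_glued:
  "nab (glued l N L \<xi> v) i x = nab (\<lambda>u. ecut N L u * corr l (block_env N \<xi> x) v u) i (torus_rep N x)"
proof -
  let ?y = "torus_rep N x" and ?e = "unit_site i"
  have cut: "ecut N L (x + ?e) = ecut N L (?y + ?e)" "ecut N L x = ecut N L ?y"
    by (simp_all add: ecut_def torus_rep_add)
  show ?thesis
  proof (cases "?y + ?e \<in> torus N")
    case True
    then have r: "torus_rep N (x + ?e) = ?y + ?e" using torus_rep_id[OF True] by (simp add: torus_rep_add)
    then have "block_env N \<xi> (x + ?e) = block_env N \<xi> x" by (simp add: block_env_def)
    then show ?thesis using r by (simp add: nab_def glued_def cut)
  next
    case False
    have "ecut N L ?y = 0" "ecut N L (?y + ?e) = 0"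
      using ecut_boundary[OF torus_rep_in[OF N0] False] by auto
    then show ?thesis by (simp add: nab_def glued_def cut)
  qed
qed

lemma glued_square_le:
  "(glued l N L \<xi> v x)\<^sup>2 \<le> (real CARD('d) * real N)\<^sup>2 * (4 * c\<^sup>2 * real (card (torus N :: 'd site set)) * (v \<bullet> v))"
proof -
  interpret B: torus_env N c l "block_env N \<xi> x" by (rule block_env_torus)
  have "(ecut N L x)\<^sup>2 \<le> 1" using ecut_bounds[OF N0, of L x] by (simp add: power_le_one)
  then have "(glued l N L \<xi> v x)\<^sup>2 \<le> 1 * (corr l (block_env N \<xi> x) v (torus_rep N x))\<^sup>2"
    unfolding glued_def power_mult_distrib by (intro mult_right_mono) auto
  then show ?thesis using B.corr_square_le[of v "torus_rep N x"] by linarith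
qed

end

section \<open>Identification of the effective matrices\<close>

section \<open>Effective matrices from uniformised mean squares\<close>

lemma poisson_sums: "(\<lambda>k. x ^ k / fact k) sums exp (x :: real)"
  using exp_converges[of x] by (simp add: divide_inverse mult.commute)

lemma poisson_mean_sums: "(\<lambda>k. x ^ k / fact k * real k) sums (x * exp (x :: real))"
proof (rule sums_Suc_imp)
  have "x ^ Suc k / fact (Suc k) * real (Suc k) = x * (x ^ k / fact k)" for k
    by (simp add: field_simps del: of_nat_Suc)
  then show "(\<lambda>k. x ^ Suc k / fact (Suc k) * real (Suc k)) sums (x * exp x)"
    using sums_mult[OF poisson_sums[of x], of x] by simp
qed simp

text \<open>Sublinear errors survive Poisson averaging: \<open>\<epsilon> * k + C\<close> has mean
  \<open>\<epsilon> * l * t + C\<close>, and division by \<open>t\<close> leaves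
  \<open>\<epsilon> * l\<close> in the limit.\<close>

lemma poisson_average_limit:
  fixes a :: "nat \<Rightarrow> real"
  assumes l: "l > 0" and a: "\<And>\<epsilon>. \<epsilon> > 0 \<Longrightarrow> \<exists>C. \<forall>n. \<bar>a n - real n * \<beta>\<bar> \<le> \<epsilon> * real n + C"
  shows "((\<lambda>t. 1 / t * (exp (- (l * t)) * (\<Sum>k. (l * t) ^ k / fact k * a k))) \<longlongrightarrow> l * \<beta>) at_top"
proof (rule tendstoI)
  fix e :: real assume e: "e > 0"
  define \<epsilon> where "\<epsilon> = e / (2 * l)"
  have \<epsilon>: "\<epsilon> > 0" using e l by (simp add: \<epsilon>_def)
  obtain C where C: "\<And>n. \<bar>a n - real n * \<beta>\<bar> \<le> \<epsilon> * real n + C" using a[OF \<epsilon>] by blast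
  show "\<forall>\<^sub>F t in at_top. dist (1 / t * (exp (- (l * t)) * (\<Sum>k. (l * t) ^ k / fact k * a k))) (l * \<beta>) < e"
    using eventually_gt_at_top[of "max 0 (2 * C / e)"]
  proof eventually_elim
    case (elim t)
    then have t: "t > 0" "2 * C / e < t" by auto
    define x where "x = l * t"
    have x: "x > 0" using l t by (simp add: x_def)
    let ?p = "\<lambda>k. x ^ k / fact k"
    have maj: "(\<lambda>k. ?p k * (\<epsilon> * real k + C)) sums (\<epsilon> * (x * exp x) + C * exp x)"
      using sums_add[OF sums_mult[OF poisson_mean_sums[of x], of \<epsilon>] sums_mult[OF poisson_sums[of x], of C]]
      by (simp add: algebra_simps add_divide_distrib)
    have bd: "norm (?p k * (a k - real k * \<beta>)) \<le> ?p k * (\<epsilon> * real k + C)" for k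
    proof -
      have "norm (?p k * (a k - real k * \<beta>)) = ?p k * \<bar>a k - real k * \<beta>\<bar>" using x by (simp add: abs_mult)
      also have "\<dots> \<le> ?p k * (\<epsilon> * real k + C)" using x by (intro mult_left_mono C) auto
      finally show ?thesis .
    qed
    have sm: "summable (\<lambda>k. ?p k * (a k - real k * \<beta>))"
      by (rule summable_comparison_test'[OF sums_summable[OF maj]]) (rule bd)
    have "(\<lambda>k. ?p k * a k) sums ((\<Sum>k. ?p k * (a k - real k * \<beta>)) + \<beta> * (x * exp x))"
      using sums_add[OF summable_sums[OF sm] sums_mult[OF poisson_mean_sums[of x], of \<beta>]] by (simp add: algebra_simps)
    then have "(\<Sum>k. ?p k * a k) - \<beta> * (x * exp x) = (\<Sum>k. ?p k * (a k - real k * \<beta>))"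
      by (simp add: sums_iff)
    moreover have "norm (\<Sum>k. ?p k * (a k - real k * \<beta>)) \<le> \<epsilon> * (x * exp x) + C * exp x"
      using norm_suminf_le[OF bd sums_summable[OF maj]] maj by (simp add: sums_iff)
    ultimately have main: "\<bar>(\<Sum>k. ?p k * a k) - \<beta> * (x * exp x)\<bar> \<le> \<epsilon> * (x * exp x) + C * exp x" by simp
    have "1 / t * (exp (- x) * (\<Sum>k. ?p k * a k)) - l * \<beta> = exp (- x) / t * ((\<Sum>k. ?p k * a k) - \<beta> * (x * exp x))"
      using t by (simp add: field_simps exp_minus x_def)
    then have "\<bar>1 / t * (exp (- x) * (\<Sum>k. ?p k * a k)) - l * \<beta>\<bar> = exp (- x) / t * \<bar>(\<Sum>k. ?p k * a k) - \<beta> * (x * exp x)\<bar>"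
      using t by (simp add: abs_mult)
    also have "\<dots> \<le> exp (- x) / t * (\<epsilon> * (x * exp x) + C * exp x)"
      using t by (intro mult_left_mono main) auto
    also have "\<dots> = \<epsilon> * l + C / t" using t by (simp add: field_simps exp_minus x_def)
    also have "\<dots> < e"
    proof -
      have "C / t < e / 2" using t e by (simp add: field_simps)
      moreover have "\<epsilon> * l = e / 2" using l by (simp add: \<epsilon>_def)
      ultimately show ?thesis by linarith
    qed
    finally show ?case by (simp add: dist_real_def x_def)
  qed
qed

text \<open>Polarisation, by which all statements about quadratic forms are carried over to
  entries.\<close>

lemma symmetric_matrix_entry:
  fixes A :: "real ^ 'd ^ 'd::finite"
  assumes "transpose A = A"
  shows "A $ i $ j = ((A *v (axis i 1 + axis j 1)) \<bullet> (axis i 1 + axis j 1)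
    - (A *v (axis i 1 - axis j 1)) \<bullet> (axis i 1 - axis j 1)) / 4"
proof -
  have e: "(A *v axis j 1) \<bullet> axis i 1 = A $ i $ j" for i j
    by (simp add: matrix_vector_mult_basis inner_axis column_def)
  have "A $ j $ i = A $ i $ j" using assms by (metis transpose_def vec_lambda_beta)
  then show ?thesis
    by (simp add: matrix_vector_right_distrib matrix_vector_mult_diff_distrib inner_add_left inner_add_right
        inner_diff_left inner_diff_right e)
qed

lemma diffusion_matrix_eqI:
  assumes "transpose A = A" "\<And>v. ((\<lambda>t. 1 / t * q t v) \<longlongrightarrow> (A *v v) \<bullet> v) at_top"
  shows "diffusion_matrix q = A"
  unfolding diffusion_matrix_def
proof (rule the_equality)
  fix B assume B: "transpose B = B \<and> (\<forall>v. ((\<lambda>t. 1 / t * q t v) \<longlongrightarrow> (B *v v) \<bullet> v) at_top)"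
  then have "(B *v v) \<bullet> v = (A *v v) \<bullet> v" for v
    using assms(2)[of v] tendsto_unique[OF trivial_limit_at_top_linorder] by blast
  then have "B $ i $ j = A $ i $ j" for i j
    using symmetric_matrix_entry[OF assms(1), of i j] symmetric_matrix_entry[of B i j] B by simp
  then show "B = A" by (simp add: vec_eq_iff)
qed (use assms in auto)

text \<open>The bilinear form belonging to \<open>Fq\<close> on coordinate vectors: the explicit
  witness for the definite description \<open>diffusion_matrix\<close>.\<close>

definition dmat :: "nat \<Rightarrow> real \<Rightarrow> 'd::finite env \<Rightarrow> real ^ 'd ^ 'd" where
  "dmat N l \<xi> = (\<chi> i j. 2 / real (card (torus N :: 'd site set))
     * (\<Sum>x\<in>torus N. \<Sum>k\<in>UNIV. \<xi> (x, k) * (wfield l \<xi> (axis i 1) k x * wfield l \<xi> (axis j 1) k x)))"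

lemma transpose_dmat: "transpose (dmat N l \<xi>) = dmat N l \<xi>"
  by (simp add: transpose_def dmat_def mult.commute)

context torus_env
begin

lemma wfield_expand: "wfield l \<xi> v k x = (\<Sum>i\<in>UNIV. v $ i * wfield l \<xi> (axis i 1) k x)"
proof -
  have "wfield l \<xi> (\<Sum>i\<in>I. f i) k x = (\<Sum>i\<in>I. wfield l \<xi> (f i) k x)" if "finite I" for I and f :: "'d \<Rightarrow> real ^ 'd"
    using that
  proof (induction I rule: finite_induct)
    case empty
    then show ?case using wfield_scale[of 0 0 k x] by simp
  qed (simp add: wfield_add)
  from this[OF finite_class.finite_UNIV, of "\<lambda>i. v $ i *\<^sub>R axis i 1"] show ?thesis
    by (simp add: basis_expansion[of v, unfolded scalar_mult_eq_scaleR] wfield_scale)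
qed

lemma dmat_form: "(dmat N l \<xi> *v v) \<bullet> v = Fq N l \<xi> v"
proof -
  let ?w = "\<lambda>i k x. wfield l \<xi> (axis i 1) k x"
  have "\<xi> (x, k) * (wfield l \<xi> v k x)\<^sup>2 = (\<Sum>i\<in>UNIV. \<Sum>j\<in>UNIV. v $ i * v $ j * (\<xi> (x, k) * (?w i k x * ?w j k x)))" for x k
    unfolding wfield_expand[of v] power2_eq_square sum_product by (simp add: sum_distrib_left mult_ac)
  then have "(\<Sum>x\<in>T. \<Sum>k\<in>UNIV. \<xi> (x, k) * (wfield l \<xi> v k x)\<^sup>2)
    = (\<Sum>x\<in>T. \<Sum>k\<in>UNIV. \<Sum>i\<in>UNIV. \<Sum>j\<in>UNIV. v $ i * v $ j * (\<xi> (x, k) * (?w i k x * ?w j k x)))" by simp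
  also have "\<dots> = (\<Sum>i\<in>UNIV. \<Sum>j\<in>UNIV. \<Sum>x\<in>T. \<Sum>k\<in>UNIV. v $ i * v $ j * (\<xi> (x, k) * (?w i k x * ?w j k x)))"
  proof -
    have swap4: "(\<Sum>x\<in>T. \<Sum>k\<in>UNIV. \<Sum>i\<in>UNIV. \<Sum>j\<in>UNIV. g x k i j) = (\<Sum>i\<in>UNIV. \<Sum>j\<in>UNIV. \<Sum>x\<in>T. \<Sum>k\<in>UNIV. g x k i j)"
      for g :: "'d site \<Rightarrow> 'd \<Rightarrow> 'd \<Rightarrow> 'd \<Rightarrow> real"
      using sum.swap[of "\<lambda>p q. g (fst p) (snd p) (fst q) (snd q)" "UNIV \<times> UNIV" "T \<times> UNIV"]
      by (simp add: sum.cartesian_product' del: UNIV_Times_UNIV)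
    show ?thesis by (rule swap4)
  qed
  finally show ?thesis
    by (simp add: Fq_def dmat_def matrix_vector_mult_def inner_vec_def sum_distrib_left sum_distrib_right mult_ac)
qed

lemma mean_square_limit: "((\<lambda>t. 1 / t * mean_square \<xi> t v) \<longlongrightarrow> Fq N l \<xi> v) at_top"
proof -
  have "((\<lambda>t. 1 / t * (exp (- (l * t)) * (\<Sum>k. (l * t) ^ k / fact k * (K ^^ k) (\<lambda>y. (lin v y)\<^sup>2) 0)))
    \<longlongrightarrow> l * (Fq N l \<xi> v / l)) at_top"
  proof (rule poisson_average_limit[OF l_pos])
    fix \<epsilon> :: real assume "\<epsilon> > 0"
    from Kn_square[OF this, of v] show "\<exists>C. \<forall>n. \<bar>(K ^^ n) (\<lambda>y. (lin v y)\<^sup>2) 0 - real n * (Fq N l \<xi> v / l)\<bar> \<le> \<epsilon> * real n + C"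
      by blast
  qed
  moreover have "\<forall>\<^sub>F t in at_top. 1 / t * (exp (- (l * t)) * (\<Sum>k. (l * t) ^ k / fact k * (K ^^ k) (\<lambda>y. (lin v y)\<^sup>2) 0)) = 1 / t * mean_square \<xi> t v"
    using eventually_ge_at_top[of 0]
    by eventually_elim (simp add: mean_square_eq_semi[OF ell c l2] semi_def lin_def)
  ultimately show ?thesis using l_pos by (auto elim: Lim_transform_eventually)
qed

lemma diffusion_matrix_eq: "diffusion_matrix (mean_square \<xi>) = dmat N l \<xi>"
  by (rule diffusion_matrix_eqI[OF transpose_dmat], unfold dmat_form, rule mean_square_limit)

end

lemma torus_env_periodize:
  "N > 0 \<Longrightarrow> c \<ge> 1 \<Longrightarrow> elliptic c \<xi> \<Longrightarrow> 4 * real CARD('d) * c \<le> l \<Longrightarrow> torus_env N c l (periodize N \<xi>)"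
  for \<xi> :: "'d::finite env"
  by unfold_locales (auto intro: elliptic_periodize periodic_periodize)

lemma eff_diffusion_fin_entry:
  fixes \<xi> :: "'d::finite env"
  assumes "N > 0" "c \<ge> 1" "elliptic c \<xi>" "4 * real CARD('d) * c \<le> l"
  shows "eff_diffusion_fin N \<xi> $ i $ j = (Fq N l (periodize N \<xi>) (axis i 1 + axis j 1)
    - Fq N l (periodize N \<xi>) (axis i 1 - axis j 1)) / 4"
proof -
  interpret torus_env N c l "periodize N \<xi>" by (rule torus_env_periodize[OF assms])
  show ?thesis
    unfolding eff_diffusion_fin_def diffusion_matrix_eq
    by (subst symmetric_matrix_entry[OF transpose_dmat]) (simp only: dmat_form)
qed

section \<open>Random environments and concentration of the entries\<close>

section \<open>Random environments\<close>

lemma gen_measurable: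
  assumes "\<And>b. (\<lambda>\<omega>. \<Xi> \<omega> b) \<in> borel_measurable A" "\<And>x. (\<lambda>\<omega>. f \<omega> x) \<in> borel_measurable A"
  shows "(\<lambda>\<omega>. gen (\<Xi> \<omega>) (f \<omega>) x) \<in> borel_measurable A"
  unfolding gen_eq_sum
  by (intro borel_measurable_sum borel_measurable_add borel_measurable_times borel_measurable_diff assms)

lemma lazyn_measurable:
  assumes "\<And>b. (\<lambda>\<omega>. \<Xi> \<omega> b) \<in> borel_measurable A" "\<And>x. (\<lambda>\<omega>. f \<omega> x) \<in> borel_measurable A"
  shows "(\<lambda>\<omega>. lazyn l (\<Xi> \<omega>) n (f \<omega>) x) \<in> borel_measurable A"
proof (induction n arbitrary: x)
  case (Suc n)
  have "(\<lambda>\<omega>. gen (\<Xi> \<omega>) (lazyn l (\<Xi> \<omega>) n (f \<omega>)) x) \<in> borel_measurable A"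
    by (intro gen_measurable assms(1) Suc.IH)
  moreover have "lazyn l (\<Xi> \<omega>) (Suc n) (f \<omega>) x = lazyn l (\<Xi> \<omega>) n (f \<omega>) x + gen (\<Xi> \<omega>) (lazyn l (\<Xi> \<omega>) n (f \<omega>)) x / l" for \<omega>
    by (simp add: lazy_def[of l "\<Xi> \<omega>" "lazyn l (\<Xi> \<omega>) n (f \<omega>)" x])
  ultimately show ?case by (simp only:) (intro borel_measurable_add borel_measurable_divide Suc.IH borel_measurable_const)
qed (simp add: assms)

lemma corr_measurable:
  assumes "\<And>b. (\<lambda>\<omega>. \<Xi> \<omega> b) \<in> borel_measurable A"
  shows "(\<lambda>\<omega>. corr l (\<Xi> \<omega>) v x) \<in> borel_measurable A"
  unfolding corr_def green_def
  by (intro borel_measurable_divide borel_measurable_suminf lazyn_measurable gen_measurable assms borel_measurable_const)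

lemma wfield_measurable:
  assumes "\<And>b. (\<lambda>\<omega>. \<Xi> \<omega> b) \<in> borel_measurable A"
  shows "(\<lambda>\<omega>. wfield l (\<Xi> \<omega>) v i x) \<in> borel_measurable A"
  unfolding wfield_def nab_def
  by (intro borel_measurable_add borel_measurable_diff corr_measurable assms borel_measurable_const)

lemma Fq_measurable:
  fixes \<Xi> :: "'a \<Rightarrow> 'd::finite env"
  assumes "\<And>b. (\<lambda>\<omega>. \<Xi> \<omega> b) \<in> borel_measurable A"
  shows "(\<lambda>\<omega>. Fq N l (\<Xi> \<omega>) v) \<in> borel_measurable A"
  unfolding Fq_def
  by (intro borel_measurable_times borel_measurable_sum borel_measurable_power wfield_measurable assms borel_measurable_const)

locale random_env = iid M for M :: "real measure" +
  fixes c l :: real and ty :: "'d::finite itself"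
  assumes c: "c \<ge> 1" and sets_M: "sets M = sets (restrict_space borel {1/c..c})"
    and l: "4 * real CARD('d) * c \<le> l"
begin

abbreviation "E \<equiv> (PM :: 'd env measure)"
abbreviation J :: "nat \<Rightarrow> ('d site \<times> 'd) set" where "J N \<equiv> torus N \<times> UNIV"

lemma space_M: "space M = {1/c..c}"
  using sets_eq_imp_space_eq[OF sets_M] by (simp add: space_restrict_space)

lemma prob_space_E: "prob_space E"
  by (rule prob_space_PM)

lemma elliptic_E: "\<xi> \<in> space E \<Longrightarrow> elliptic c \<xi>"
  by (auto simp: elliptic_def space_PiM PiE_def Pi_def space_M)

lemma id_measurable: "(\<lambda>r. r) \<in> borel_measurable M"
  unfolding measurable_cong_sets[OF sets_M refl] by (rule measurable_restrict_space1) simp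

lemma component_measurable: "b \<in> I \<Longrightarrow> (\<lambda>\<xi>. \<xi> b) \<in> borel_measurable (\<Pi>\<^sub>M b\<in>I. M)"
  by (rule measurable_compose[OF measurable_component_singleton[of b I "\<lambda>_. M"] id_measurable])

lemma periodize_measurable:
  assumes "N > 0" "J N \<subseteq> I"
  shows "(\<lambda>\<xi>. periodize N \<xi> b) \<in> borel_measurable (\<Pi>\<^sub>M b\<in>I. M)"
  using assms torus_rep_in[OF assms(1), of "fst b"]
  by (cases b) (auto simp: periodize_def intro!: component_measurable)

lemma torus_env_E: "N > 0 \<Longrightarrow> \<xi> \<in> space E \<Longrightarrow> torus_env N c l (periodize N \<xi>)"
  using torus_env_periodize c elliptic_E l by blast

text \<open>The conductances are independent and identically distributed, so reading them through an
  injective relabelling of the sites of one period preserves the law. Stationarity on the torus and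
  the law of a block in a larger torus are both instances.\<close>

lemma integral_reindex:
  fixes h :: "'d env \<Rightarrow> real"
  assumes N: "N > 0" and \<kappa>: "inj_on \<kappa> (torus N)"
    and h: "(\<lambda>\<xi>. h (periodize N \<xi>)) \<in> borel_measurable (\<Pi>\<^sub>M b\<in>J N. M)"
  shows "(\<integral>\<xi>. h (\<lambda>(x, i). \<xi> (\<kappa> (torus_rep N x), i)) \<partial>E) = (\<integral>\<xi>. h (periodize N \<xi>) \<partial>E)"
proof -
  have main: "(\<integral>\<xi>. h (\<lambda>(x, i). \<xi> (\<kappa> (torus_rep N x), i)) \<partial>E) = (\<integral>\<xi>. h (periodize N \<xi>) \<partial>(\<Pi>\<^sub>M b\<in>J N. M))"
    if \<kappa>: "inj_on \<kappa> (torus N)" for \<kappa> :: "'d site \<Rightarrow> 'd site"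
  proof -
    let ?R = "\<lambda>\<xi>. \<lambda>b\<in>J N. \<xi> (\<kappa> (fst b), snd b)"
    have "inj_on (\<lambda>b. (\<kappa> (fst b), snd b)) (J N)" using \<kappa> by (auto simp: inj_on_def)
    then have d: "distr E (\<Pi>\<^sub>M b\<in>J N. M) ?R = (\<Pi>\<^sub>M b\<in>J N. M)"
      using distr_PiM_reindex[of UNIV "\<lambda>_. M" "\<lambda>b. (\<kappa> (fst b), snd b)" "J N"] prob_space_axioms by simp
    have R: "?R \<in> measurable E (\<Pi>\<^sub>M b\<in>J N. M)"
      by (intro measurable_restrict measurable_component_singleton) auto
    have per: "periodize N (?R \<xi>) = (\<lambda>(x, i). \<xi> (\<kappa> (torus_rep N x), i))" for \<xi> :: "'d env"
      by (auto simp: periodize_def N fun_eq_iff)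
    have "(\<integral>\<xi>. h (periodize N \<xi>) \<partial>(\<Pi>\<^sub>M b\<in>J N. M)) = (\<integral>\<xi>. h (periodize N \<xi>) \<partial>distr E (\<Pi>\<^sub>M b\<in>J N. M) ?R)"
      by (simp only: d)
    also have "\<dots> = (\<integral>\<xi>. h (periodize N (?R \<xi>)) \<partial>E)"
      by (rule integral_distr[OF R h])
    finally show ?thesis by (simp only: per)
  qed
  have "(\<lambda>(x, i). \<xi> (torus_rep N x, i)) = periodize N \<xi>" for \<xi> :: "'d env"
    by (simp add: periodize_def)
  with main[OF \<kappa>] main[of "\<lambda>x. x"] show ?thesis by (simp add: inj_on_def)
qed

lemma Fq_bdd: assumes "N > 0" shows "bdd (\<lambda>\<xi>. Fq N l (periodize N \<xi> :: 'd env) v)"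
proof -
  have "\<bar>Fq N l (periodize N \<xi>) v\<bar> \<le> 2 * c * (v \<bullet> v)" if "\<xi> \<in> space E" for \<xi>
    using torus_env.Fq_bounds[OF torus_env_E[OF assms that], of v] by simp
  then show ?thesis unfolding bdd_def
    using Fq_measurable[where \<Xi> = "periodize N", OF periodize_measurable[OF assms subset_UNIV]] by blast
qed

lemma corr_bdd: assumes "N > 0" shows "bdd (\<lambda>\<xi>. corr l (periodize N \<xi> :: 'd env) v x)"
proof -
  let ?B = "(real CARD('d) * real N)\<^sup>2 * (4 * c\<^sup>2 * real (card (torus N :: 'd site set)) * (v \<bullet> v))"
  have "\<bar>corr l (periodize N \<xi>) v x\<bar> \<le> sqrt ?B" if "\<xi> \<in> space E" for \<xi>
    using torus_env.corr_square_le[OF torus_env_E[OF assms that], of v x] real_le_rsqrt[of "\<bar>corr l (periodize N \<xi>) v x\<bar>"] by simp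
  then show ?thesis unfolding bdd_def
    using corr_measurable[where \<Xi> = "periodize N", OF periodize_measurable[OF assms subset_UNIV]] by blast
qed

lemma torus_env_pair_E:
  assumes "N > 0" "\<xi> \<in> space E" "t \<in> space M" "z \<in> torus N"
  shows "torus_env_pair N c l (periodize N \<xi>) (periodize N (\<xi>((z, k) := t))) z k"
proof -
  interpret a: torus_env N c l "periodize N \<xi>" by (rule torus_env_E[OF assms(1,2)])
  interpret b: torus_env N c l "periodize N (\<xi>((z, k) := t))"
    by (rule torus_env_E[OF assms(1) upd_space[OF assms(2,3)]])
  show ?thesis
    by unfold_locales (use assms(4) in \<open>auto simp: periodize_def torus_rep_id\<close>)
qed

lemma depends_periodize: "N > 0 \<Longrightarrow> depends (J N) (\<lambda>\<xi>. h (periodize N \<xi>))"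
  unfolding depends_def
proof (intro ballI impI)
  fix \<xi> \<xi>' :: "'d env" assume N: "N > 0" and e: "\<forall>b\<in>J N. \<xi> b = \<xi>' b"
  have "periodize N \<xi> b = periodize N \<xi>' b" for b
    using e torus_rep_in[OF N, of "fst b"] by (cases b) (auto simp: periodize_def)
  then show "h (periodize N \<xi>) = h (periodize N \<xi>')" by presburger
qed

section \<open>Concentration\<close>

lemma quarter_diff:
  fixes a b a' b' t :: real
  assumes "\<bar>(a - b) / 4 - (a' - b') / 4\<bar> > t" shows "\<bar>a - a'\<bar> > 2 * t \<or> \<bar>b - b'\<bar> > 2 * t"
  using assms by argo

text \<open>\<open>concentration\<close> is applied with the oscillation bounds of
  \<open>Fq_diff_le\<close>: their maximum is of order \<open>N powr (- \<alpha>)\<close> by the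
  decay of the field, while their sum is bounded through the total energy. This allows
  \<open>s\<close> of order \<open>N powr (\<alpha> / 2)\<close>.\<close>

lemma Fq_tail:
  assumes N: "N > 0" and C: "C > 0"
    and decay: "\<And>(\<xi> :: 'd env) i x. torus_env N c l \<xi> \<Longrightarrow> (wfield l \<xi> v i x)\<^sup>2 \<le> C * real N powr (- \<alpha>) * (real (card (torus N :: 'd site set)) * (v \<bullet> v))"
    and v: "v \<bullet> v \<le> 4" and \<sigma>: "\<sigma> > 0" "\<sigma> \<le> 1 / (2 * (1 + 8 * c * (1 + c\<^sup>2) * C) * (1 + 8 * c ^ 3 * (1 + c\<^sup>2)))"
    and \<alpha>: "\<alpha> > 0"
  shows "measure E {\<xi> \<in> space E. \<bar>Fq N l (periodize N \<xi>) v - (\<integral>\<xi>. Fq N l (periodize N \<xi>) v \<partial>E)\<bar> > t}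
    \<le> 2 * exp (1 - \<sigma> * real N powr (\<alpha> / 2) * t)"
proof -
  let ?T = "torus N :: 'd site set"
  have cT: "real (card ?T) > 0" using card_torus_pos[OF N, where 'd='d] by simp
  define A where "A = 8 * c * (1 + c\<^sup>2) * C"
  define S where "S = 8 * c ^ 3 * (1 + c\<^sup>2)"
  define Mx where "Mx = A * real N powr (- \<alpha>)"
  define s where "s = \<sigma> * real N powr (\<alpha> / 2)"
  define m where "m b \<xi> = 2 * c * (1 + c\<^sup>2) / real (card ?T) * (wfield l (periodize N \<xi>) v (snd b) (fst b))\<^sup>2" for b and \<xi> :: "'d env"
  have k0: "0 < 2 * c * (1 + c\<^sup>2)" using c by (intro mult_pos_pos) (auto intro: add_pos_nonneg)
  have A: "A > 0" using k0 C unfolding A_def by (simp add: mult_pos_pos)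
  have S: "S > 0" using c unfolding S_def by (intro mult_pos_pos) (auto intro: add_pos_nonneg)
  have m1: "m b \<xi> \<le> Mx" if "\<xi> \<in> space E" for b \<xi>
  proof -
    have "(wfield l (periodize N \<xi>) v (snd b) (fst b))\<^sup>2 \<le> C * real N powr (- \<alpha>) * (real (card ?T) * (v \<bullet> v))"
      by (rule decay[OF torus_env_E[OF N that]])
    also have "\<dots> \<le> C * real N powr (- \<alpha>) * (real (card ?T) * 4)"
      using C v by (intro mult_left_mono) auto
    finally have "m b \<xi> \<le> 2 * c * (1 + c\<^sup>2) / real (card ?T) * (C * real N powr (- \<alpha>) * (real (card ?T) * 4))"
      unfolding m_def using k0 cT by (intro mult_left_mono) auto
    also have "\<dots> = Mx"
    proof -
      have "2 * c * (1 + c\<^sup>2) / t * (C * P * (t * 4)) = 8 * c * (1 + c\<^sup>2) * C * P" if "t > 0" for t P :: real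
        using that by (simp add: field_simps)
      then show ?thesis using cT by (simp only: Mx_def A_def)
    qed
    finally show ?thesis .
  qed
  have m2: "(\<Sum>b\<in>J N. m b \<xi>) \<le> S" if "\<xi> \<in> space E" for \<xi>
  proof -
    interpret torus_env N c l "periodize N \<xi>" by (rule torus_env_E[OF N that])
    have "(\<Sum>b\<in>J N. m b \<xi>) = 2 * c * (1 + c\<^sup>2) / real (card ?T) * (\<Sum>x\<in>?T. \<Sum>i\<in>UNIV. (wfield l (periodize N \<xi>) v i x)\<^sup>2)"
      by (simp add: m_def sum.cartesian_product' sum_distrib_left)
    also have "\<dots> \<le> 2 * c * (1 + c\<^sup>2) / real (card ?T) * (c\<^sup>2 * real (card ?T) * (v \<bullet> v))"
      using k0 cT by (intro mult_left_mono sum_wfield_le) auto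
    also have "\<dots> \<le> 2 * c * (1 + c\<^sup>2) / real (card ?T) * (c\<^sup>2 * real (card ?T) * 4)"
      using k0 cT v by (intro mult_left_mono) auto
    also have "\<dots> = S" using cT by (auto simp: S_def power3_eq_cube power2_eq_square)
    finally show ?thesis .
  qed
  have osc: "\<bar>Fq N l (periodize N \<xi>) v - Fq N l (periodize N (\<xi>(b := t))) v\<bar> \<le> m b \<xi>"
    if b: "b \<in> J N" and *: "\<xi> \<in> space E" "t \<in> space M" for b \<xi> t
  proof -
    obtain z k where zk: "b = (z, k)" "z \<in> torus N" using b by auto
    interpret torus_env_pair N c l "periodize N \<xi>" "periodize N (\<xi>(b := t))" z k
      unfolding zk(1) by (rule torus_env_pair_E[OF N * zk(2)])
    show ?thesis using Fq_diff_le[of v] by (simp add: m_def zk(1) abs_minus_commute)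
  qed
  \<comment> \<open>A single bound on \<sigma> yields both side conditions of
    \<open>concentration\<close>: \<open>2 * (1 + A) * (1 + S)\<close> dominates \<open>A\<close>,
    and its square dominates \<open>4 * A * S\<close>.\<close>
  have AS: "\<sigma> * A \<le> 1" "A * S * \<sigma>\<^sup>2 \<le> 1 / 4"
  proof -
    have D: "0 < 2 * (1 + A) * (1 + S)" using A S by simp
    have \<sigma>1: "\<sigma> * (2 * (1 + A) * (1 + S)) \<le> 1" using \<sigma>(2) D unfolding A_def[symmetric] S_def[symmetric] by (simp add: pos_le_divide_eq)
    have "A * 1 \<le> (2 * (1 + A)) * (1 + S)" using A S by (intro mult_mono) auto
    then have "\<sigma> * A \<le> \<sigma> * (2 * (1 + A) * (1 + S))" using \<sigma>(1) by (intro mult_left_mono) auto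
    then show "\<sigma> * A \<le> 1" using \<sigma>1 by linarith
    have "A \<le> (1 + A)\<^sup>2" "S \<le> (1 + S)\<^sup>2" using A S by (auto simp: power2_eq_square algebra_simps)
    then have "A * S \<le> (1 + A)\<^sup>2 * (1 + S)\<^sup>2" using A S by (intro mult_mono) auto
    then have "4 * \<sigma>\<^sup>2 * (A * S) \<le> 4 * \<sigma>\<^sup>2 * ((1 + A)\<^sup>2 * (1 + S)\<^sup>2)" by (intro mult_left_mono) auto
    also have "\<dots> = (\<sigma> * (2 * (1 + A) * (1 + S)))\<^sup>2" by (simp only: power_mult_distrib) simp
    also have "\<dots> \<le> 1" using \<sigma>1 \<sigma>(1) D by (intro power_le_one) auto
    finally have "4 * (A * S * \<sigma>\<^sup>2) \<le> 1" by (simp only: mult_ac)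
    then show "A * S * \<sigma>\<^sup>2 \<le> 1 / 4" by linarith
  qed
  have pw: "real N powr (\<alpha> / 2) * real N powr (- \<alpha>) \<le> 1" "real N powr (- \<alpha>) * (real N powr (\<alpha> / 2))\<^sup>2 = 1"
  proof -
    have "real N powr (\<alpha> / 2) * real N powr (- \<alpha>) = real N powr (- (\<alpha> / 2))" by (simp add: powr_add[symmetric])
    also have "\<dots> \<le> real N powr 0" using N \<alpha> by (intro powr_mono) auto
    finally show "real N powr (\<alpha> / 2) * real N powr (- \<alpha>) \<le> 1" using N by simp
    have "(real N powr (\<alpha> / 2))\<^sup>2 = real N powr \<alpha>" by (simp add: power2_eq_square powr_add[symmetric])
    then show "real N powr (- \<alpha>) * (real N powr (\<alpha> / 2))\<^sup>2 = 1" using N by (simp add: powr_add[symmetric])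
  qed
  have "s * Mx = (\<sigma> * A) * (real N powr (\<alpha> / 2) * real N powr (- \<alpha>))" by (simp add: s_def Mx_def)
  also have "\<dots> \<le> 1 * 1" using AS pw A \<sigma> by (intro mult_mono) auto
  finally have s1: "s * Mx \<le> 1" by simp
  have "Mx * S * s\<^sup>2 = A * S * \<sigma>\<^sup>2 * (real N powr (- \<alpha>) * (real N powr (\<alpha> / 2))\<^sup>2)"
    by (simp add: s_def Mx_def power_mult_distrib)
  then have s2: "Mx * S * s\<^sup>2 \<le> 1 / 4" using AS(2) by (simp only: pw(2))
  have "measure E {\<xi> \<in> space E. \<bar>Fq N l (periodize N \<xi>) v - (\<integral>\<xi>. Fq N l (periodize N \<xi>) v \<partial>E)\<bar> > t} \<le> 2 * exp (1 - s * t)"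
  proof (rule concentration[where I = "J N" and m = m and Mx = Mx and S = S])
    show "bdd (\<lambda>\<xi>. Fq N l (periodize N \<xi>) v)" by (rule Fq_bdd[OF N])
    show "depends (J N) (\<lambda>\<xi>. Fq N l (periodize N \<xi>) v)" by (rule depends_periodize[OF N])
    show "s > 0" using \<sigma>(1) N by (simp add: s_def)
    show "Mx \<ge> 0" using A by (simp add: Mx_def)
  qed (use s1 s2 osc m1 m2 in auto)
  then show ?thesis by (simp add: s_def)
qed

text \<open>An entry is a quarter of the difference of two forms, so a deviation \<open>t\<close> of
  the entry forces a deviation \<open>2 * t\<close> of one of them. The two vectors have squared
  norm at most 4.\<close>

lemma entry_tail:
  assumes N: "N > 0" and C: "C > 0"
    and decay: "\<And>(\<xi> :: 'd env) v i x. torus_env N c l \<xi> \<Longrightarrow> (wfield l \<xi> v i x)\<^sup>2 \<le> C * real N powr (- \<alpha>) * (real (card (torus N :: 'd site set)) * (v \<bullet> v))"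
    and \<sigma>: "\<sigma> > 0" "\<sigma> \<le> 1 / (2 * (1 + 8 * c * (1 + c\<^sup>2) * C) * (1 + 8 * c ^ 3 * (1 + c\<^sup>2)))"
    and \<alpha>: "\<alpha> > 0"
  shows "measure E {\<xi> \<in> space E. \<bar>eff_diffusion_fin N \<xi> $ i $ j - (\<integral>\<xi>'. eff_diffusion_fin N \<xi>' $ i $ j \<partial>E)\<bar> > t}
    \<le> 4 * exp (1 - 2 * \<sigma> * real N powr (\<alpha> / 2) * t)"
proof -
  interpret P: prob_space E by (rule prob_space_E)
  let ?F = "\<lambda>v \<xi>. Fq N l (periodize N \<xi>) v"
  let ?p = "axis i 1 + axis j 1 :: real ^ 'd" and ?m = "axis i 1 - axis j 1 :: real ^ 'd"
  define X where "X v = {\<xi> \<in> space E. \<bar>?F v \<xi> - (\<integral>\<xi>. ?F v \<xi> \<partial>E)\<bar> > 2 * t}" for v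
  have [measurable]: "?F v \<in> borel_measurable E" for v by (rule bddD[OF Fq_bdd[OF N]])
  have X[measurable]: "X v \<in> sets E" for v unfolding X_def by measurable
  have e: "eff_diffusion_fin N \<xi> $ i $ j = (?F ?p \<xi> - ?F ?m \<xi>) / 4" if "\<xi> \<in> space E" for \<xi>
    by (rule eff_diffusion_fin_entry[OF N c elliptic_E[OF that] l])
  have "(\<integral>\<xi>. eff_diffusion_fin N \<xi> $ i $ j \<partial>E) = (\<integral>\<xi>. (?F ?p \<xi> - ?F ?m \<xi>) / 4 \<partial>E)"
    by (intro Bochner_Integration.integral_cong refl e)
  also have "\<dots> = ((\<integral>\<xi>. ?F ?p \<xi> \<partial>E) - (\<integral>\<xi>. ?F ?m \<xi> \<partial>E)) / 4"
    using bdd_integrable[OF Fq_bdd[OF N]] by simp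
  finally have ee: "(\<integral>\<xi>. eff_diffusion_fin N \<xi> $ i $ j \<partial>E) = ((\<integral>\<xi>. ?F ?p \<xi> \<partial>E) - (\<integral>\<xi>. ?F ?m \<xi> \<partial>E)) / 4" .
  have "measure E {\<xi> \<in> space E. \<bar>eff_diffusion_fin N \<xi> $ i $ j - (\<integral>\<xi>'. eff_diffusion_fin N \<xi>' $ i $ j \<partial>E)\<bar> > t}
    \<le> measure E (X ?p \<union> X ?m)"
  proof (rule P.finite_measure_mono)
    show "{\<xi> \<in> space E. \<bar>eff_diffusion_fin N \<xi> $ i $ j - (\<integral>\<xi>'. eff_diffusion_fin N \<xi>' $ i $ j \<partial>E)\<bar> > t} \<subseteq> X ?p \<union> X ?m"
    proof
      fix x assume x: "x \<in> {\<xi> \<in> space E. \<bar>eff_diffusion_fin N \<xi> $ i $ j - (\<integral>\<xi>'. eff_diffusion_fin N \<xi>' $ i $ j \<partial>E)\<bar> > t}"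
      then have s: "x \<in> space E" by simp
      have "t < \<bar>(?F ?p x - ?F ?m x) / 4 - ((\<integral>\<xi>. ?F ?p \<xi> \<partial>E) - (\<integral>\<xi>. ?F ?m \<xi> \<partial>E)) / 4\<bar>"
        using x unfolding mem_Collect_eq ee e[OF s] by (rule conjunct2)
      from quarter_diff[OF this] s show "x \<in> X ?p \<union> X ?m" unfolding X_def Un_iff mem_Collect_eq by blast
    qed
  qed simp
  also have "\<dots> \<le> measure E (X ?p) + measure E (X ?m)" by (intro measure_Un_le X)
  also have "\<dots> \<le> 2 * exp (1 - \<sigma> * real N powr (\<alpha> / 2) * (2 * t)) + 2 * exp (1 - \<sigma> * real N powr (\<alpha> / 2) * (2 * t))"
  proof (intro add_mono)
    have "axis i 1 \<bullet> (axis j 1 :: real ^ 'd) \<in> {0, 1}" by (auto simp: inner_axis_axis)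
    moreover have "axis i 1 \<bullet> (axis i 1 :: real ^ 'd) = 1" for i by (simp add: inner_axis_axis)
    ultimately have v: "?p \<bullet> ?p \<le> 4" "?m \<bullet> ?m \<le> 4"
      by (auto simp: inner_add_left inner_add_right inner_diff_left inner_diff_right inner_commute)
    have "measure E (X v) \<le> 2 * exp (1 - \<sigma> * real N powr (\<alpha> / 2) * (2 * t))" if "v \<bullet> v \<le> 4" for v
      unfolding X_def
    proof (rule Fq_tail[OF N C])
      fix \<xi> :: "'d env" and i x assume "torus_env N c l \<xi>"
      then show "(wfield l \<xi> v i x)\<^sup>2 \<le> C * real N powr (- \<alpha>) * (real (card (torus N :: 'd site set)) * (v \<bullet> v))" by (rule decay)
    qed (rule that \<sigma> \<alpha>)+
    then show "measure E (X ?p) \<le> 2 * exp (1 - \<sigma> * real N powr (\<alpha> / 2) * (2 * t))"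
      "measure E (X ?m) \<le> 2 * exp (1 - \<sigma> * real N powr (\<alpha> / 2) * (2 * t))" using v by blast+
  qed
  finally show ?thesis by (simp add: mult_ac)
qed

end

text \<open>With \<open>y = N powr \<nu>\<close> the exponent is a multiple of \<open>y ^ 3\<close>
  against the target \<open>y\<close>; the prefactor 4 is absorbed by \<open>exp 2\<close>.\<close>

lemma tail_beats_target:
  fixes \<sigma> \<nu> :: real
  assumes \<sigma>: "\<sigma> > 0" and \<nu>: "\<nu> > 0"
  shows "\<forall>\<^sub>F N in sequentially. 4 * exp (1 - 2 * \<sigma> * real N powr (8 * \<nu> / 2) * real N powr (- \<nu>)) < exp (- (real N powr \<nu>))"
proof -
  define K where "K = max 2 (2 / \<sigma>)"
  have "\<forall>\<^sub>F N in sequentially. max 2 (2 / \<sigma>) \<le> real N powr \<nu>"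
    using eventually_ge_at_top[of "nat \<lceil>K powr (1 / \<nu>)\<rceil>"]
  proof eventually_elim
    case (elim N)
    have "K > 0" by (simp add: K_def)
    then have "K = (K powr (1 / \<nu>)) powr \<nu>" using \<nu> by (simp add: powr_powr)
    also have "\<dots> \<le> real N powr \<nu>" using elim \<nu> by (intro powr_mono2) (auto simp: nat_ceiling_le_eq)
    finally show ?case by (simp only: K_def)
  qed
  with eventually_gt_at_top[of 0] show ?thesis
  proof eventually_elim
    case (elim N)
    define y where "y = real N powr \<nu>"
    have y: "y \<ge> 2" "\<sigma> * y \<ge> 2" using elim \<sigma> by (auto simp: y_def field_simps)
    have "real N powr (8 * \<nu> / 2) * real N powr (- \<nu>) = real N powr (\<nu> + \<nu> + \<nu>)"
      by (simp add: powr_add[symmetric])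
    also have "\<dots> = y * y * y" by (simp only: powr_add y_def)
    finally have e: "2 * \<sigma> * real N powr (8 * \<nu> / 2) * real N powr (- \<nu>) = 2 * (\<sigma> * y) * (y * y)" by simp
    have "2 * 2 * (2 * y) \<le> 2 * (\<sigma> * y) * (y * y)" using y by (intro mult_mono) auto
    then have big: "1 - 2 * (\<sigma> * y) * (y * y) < - y - 2" using y by linarith
    have "(4 :: real) \<le> exp 1 * exp 1" using mult_mono[of 2 "exp 1" 2 "exp (1 :: real)"] exp_ge_add_one_self[of 1] by simp
    then have "4 * exp (1 - 2 * (\<sigma> * y) * (y * y)) \<le> exp 2 * exp (1 - 2 * (\<sigma> * y) * (y * y))"
      by (intro mult_right_mono) (auto simp flip: exp_add)
    also have "\<dots> < exp (- y)" unfolding exp_add[symmetric] using big by simp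
    finally show ?case by (simp only: e y_def)
  qed
qed

section \<open>The size of the corrector\<close>

section \<open>Sublinearity of the corrector\<close>

context random_env
begin

lemma bdd_divide: "bdd f \<Longrightarrow> bdd (\<lambda>w. f w / a)"
  using bdd_mult[OF _ bdd_const[of "1 / a"]] by simp

lemma integral_shift:
  fixes h :: "'d env \<Rightarrow> real"
  assumes N: "N > 0" and h: "(\<lambda>\<xi>. h (periodize N \<xi>)) \<in> borel_measurable (\<Pi>\<^sub>M b\<in>J N. M)"
  shows "(\<integral>\<xi>. h (env_shift y (periodize N \<xi>)) \<partial>E) = (\<integral>\<xi>. h (periodize N \<xi>) \<partial>E)"
proof -
  have "env_shift y (periodize N \<xi>) = (\<lambda>(x, i). \<xi> (torus_rep N (torus_rep N x + y), i))" for \<xi> :: "'d env"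
    by (simp add: env_shift_def periodize_def torus_rep_add)
  moreover have "inj_on (\<lambda>x. torus_rep N (x + y)) (torus N)"
    using bij_torus_shift[OF N] by (rule bij_betw_imp_inj_on)
  ultimately show ?thesis using integral_reindex[OF N _ h, of "\<lambda>x. torus_rep N (x + y)"] by simp
qed

abbreviation phi :: "nat \<Rightarrow> real ^ 'd \<Rightarrow> 'd env \<Rightarrow> 'd site \<Rightarrow> real" where
  "phi N v \<xi> \<equiv> corr l (periodize N \<xi>) v"

lemma phi_measurable: "N > 0 \<Longrightarrow> (\<lambda>\<xi>. phi N v \<xi> x) \<in> borel_measurable (\<Pi>\<^sub>M b\<in>J N. M)"
  by (intro corr_measurable periodize_measurable) auto

lemma integral_phi_shift:
  fixes g :: "real \<Rightarrow> real \<Rightarrow> real"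
  assumes N: "N > 0" and g: "case_prod g \<in> borel_measurable (borel \<Otimes>\<^sub>M borel)"
  shows "(\<integral>\<xi>. g (phi N v \<xi> x) (phi N v \<xi> (x + y)) \<partial>E) = (\<integral>\<xi>. g (phi N v \<xi> 0) (phi N v \<xi> y) \<partial>E)"
proof -
  have "(\<lambda>\<xi>. g (phi N v \<xi> 0) (phi N v \<xi> y)) \<in> borel_measurable (\<Pi>\<^sub>M b\<in>J N. M)"
    using measurable_compose[OF measurable_Pair[OF phi_measurable[OF N, of v 0] phi_measurable[OF N, of v y]] g] by simp
  from integral_shift[OF N, of "\<lambda>\<xi>. g (corr l \<xi> v 0) (corr l \<xi> v y)", OF this, of x]
  show ?thesis by (simp add: corr_env_shift add.commute)
qed

text \<open>By stationarity the mean is the same at every site, and the corrector sums to zero over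
  the torus.\<close>

lemma integral_phi:
  assumes N: "N > 0" shows "(\<integral>\<xi>. phi N v \<xi> x \<partial>E) = 0"
proof -
  let ?T = "torus N :: 'd site set"
  have s: "(\<integral>\<xi>. phi N v \<xi> x \<partial>E) = (\<integral>\<xi>. phi N v \<xi> 0 \<partial>E)" for x
    using integral_phi_shift[OF N, of "\<lambda>a b. a" v x 0] by simp
  have "0 = (\<integral>\<xi>. (\<Sum>x\<in>?T. phi N v \<xi> x) \<partial>E)"
  proof -
    have "(\<integral>\<xi>. (\<Sum>x\<in>?T. phi N v \<xi> x) \<partial>E) = (\<integral>\<xi>. 0 \<partial>E)"
      by (intro Bochner_Integration.integral_cong refl torus_env.sum_corr[OF torus_env_E[OF N]])
    then show ?thesis by simp
  qed
  also have "\<dots> = (\<Sum>x\<in>?T. \<integral>\<xi>. phi N v \<xi> x \<partial>E)"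
    by (intro Bochner_Integration.integral_sum bdd_integrable corr_bdd N)
  also have "\<dots> = (\<Sum>x\<in>?T. \<integral>\<xi>. phi N v \<xi> 0 \<partial>E)" by (intro sum.cong refl s)
  also have "\<dots> = real (card ?T) * (\<integral>\<xi>. phi N v \<xi> 0 \<partial>E)" by simp
  finally show ?thesis using card_torus_pos[OF N, where 'd='d] by (auto simp: s[of x])
qed

text \<open>Stationarity replaces the expectation at one site by an average over the torus, where
  \<open>shift_diff_le\<close> and the energy bound hold for every environment.\<close>

lemma integral_phi_diff_le:
  assumes N: "N > 0"
  shows "(\<integral>\<xi>. (phi N v \<xi> y - phi N v \<xi> 0)\<^sup>2 \<partial>E) \<le> (real_of_int (\<Sum>k\<in>UNIV. \<bar>y $ k\<bar>))\<^sup>2 * (4 * c\<^sup>2 * (v \<bullet> v))"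
proof -
  interpret P: prob_space E by (rule prob_space_E)
  let ?T = "torus N :: 'd site set" and ?r = "(real_of_int (\<Sum>k\<in>UNIV. \<bar>y $ k\<bar>))\<^sup>2"
  have cT: "real (card ?T) > 0" using card_torus_pos[OF N, where 'd='d] by simp
  have b: "bdd (\<lambda>\<xi>. (phi N v \<xi> (x + y) - phi N v \<xi> x)\<^sup>2)" for x
    by (intro bdd_power bdd_diff corr_bdd N)
  have g: "(\<lambda>(a, b). (b - a)\<^sup>2 :: real) \<in> borel_measurable (borel \<Otimes>\<^sub>M borel)" by measurable
  have s: "(\<integral>\<xi>. (phi N v \<xi> (x + y) - phi N v \<xi> x)\<^sup>2 \<partial>E) = (\<integral>\<xi>. (phi N v \<xi> y - phi N v \<xi> 0)\<^sup>2 \<partial>E)" for x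
    using integral_phi_shift[OF N g, of v x y] by simp
  have "real (card ?T) * (\<integral>\<xi>. (phi N v \<xi> y - phi N v \<xi> 0)\<^sup>2 \<partial>E) = (\<Sum>x\<in>?T. \<integral>\<xi>. (phi N v \<xi> (x + y) - phi N v \<xi> x)\<^sup>2 \<partial>E)"
    by (simp add: s)
  also have "\<dots> = (\<integral>\<xi>. (\<Sum>x\<in>?T. (phi N v \<xi> (x + y) - phi N v \<xi> x)\<^sup>2) \<partial>E)"
    by (intro Bochner_Integration.integral_sum[symmetric] bdd_integrable b)
  also have "\<dots> \<le> (\<integral>\<xi>. ?r * (4 * c\<^sup>2 * real (card ?T) * (v \<bullet> v)) \<partial>E)"
  proof (intro integral_mono)
    show "integrable E (\<lambda>\<xi>. \<Sum>x\<in>?T. (phi N v \<xi> (x + y) - phi N v \<xi> x)\<^sup>2)" by (intro bdd_integrable bdd_sum b)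
    fix \<xi> :: "'d env" assume "\<xi> \<in> space E"
    then interpret torus_env N c l "periodize N \<xi>" by (rule torus_env_E[OF N])
    have "(\<Sum>x\<in>?T. (phi N v \<xi> (x + y) - phi N v \<xi> x)\<^sup>2) \<le> ?r * grad_energy N (phi N v \<xi>)"
      by (rule shift_diff_le[OF N periodic_corr])
    also have "\<dots> \<le> ?r * (4 * c\<^sup>2 * real (card ?T) * (v \<bullet> v))" by (intro mult_left_mono grad_energy_corr) auto
    finally show "(\<Sum>x\<in>?T. (phi N v \<xi> (x + y) - phi N v \<xi> x)\<^sup>2) \<le> ?r * (4 * c\<^sup>2 * real (card ?T) * (v \<bullet> v))" .
  qed simp
  also have "\<dots> = real (card ?T) * (?r * (4 * c\<^sup>2 * (v \<bullet> v)))" by (simp add: P.prob_space)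
  finally show ?thesis using cT by simp
qed

definition block :: "nat \<Rightarrow> 'd site set" where
  "block m = sbox 0 (\<chi> k. int m - 1)"

lemma card_block: "card (block m) = m ^ CARD('d)"
  by (simp add: block_def card_sbox)

lemma block_subset: "m \<le> N \<Longrightarrow> block m \<subseteq> torus N"
proof
  fix x assume "m \<le> N" "x \<in> block m"
  then have "0 \<le> x $ k" "x $ k \<le> int m - 1" "int m \<le> int N" for k by (auto simp: block_def sbox_def)
  then show "x \<in> torus N" unfolding torus_def by (smt (verit) mem_Collect_eq of_nat_0_le_iff)
qed

text \<open>
  The spatial average of the corrector over a block is a linear functional of the corrector, with
  a density \<open>q\<close> of mean zero; a single conductance changes it by the product of the field and of the
  gradient of the Green potential of \<open>q\<close> at that bond.
\<close>

lemma variance_block_average: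
  assumes N: "N > 0" and m: "0 < m" "m \<le> N" and B: "B \<ge> 0"
    and decay: "\<And>(\<xi> :: 'd env) i x. torus_env N c l \<xi> \<Longrightarrow> (wfield l \<xi> v i x)\<^sup>2 \<le> B * real (card (torus N :: 'd site set))"
  shows "(\<integral>\<xi>. ((\<Sum>y\<in>block m. phi N v \<xi> y) / real (card (block m)))\<^sup>2 \<partial>E)
    \<le> c\<^sup>2 * B * (c * real CARD('d) * real N)\<^sup>2 * (real (card (torus N :: 'd site set)) / real (card (block m)))"
proof -
  interpret P: prob_space E by (rule prob_space_E)
  let ?T = "torus N :: 'd site set" and ?Q = "block m"
  define t where "t = real (card ?T)"
  define s where "s = real (card ?Q)"
  have t: "t > 0" using card_torus_pos[OF N, where 'd='d] by (simp add: t_def)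
  have s: "s > 0" using m by (simp add: s_def card_block)
  have Q: "?Q \<subseteq> ?T" by (rule block_subset[OF m(2)])
  have finQ: "finite ?Q" using Q by (rule finite_subset) simp
  define f where "f \<xi> = (\<Sum>y\<in>?Q. phi N v \<xi> y) / s" for \<xi> :: "'d env"
  \<comment> \<open>Subtracting 1 makes the mean zero and leaves the functional unchanged, because
    correctors sum to zero over the torus.\<close>
  define q where "q x = t / s * (if torus_rep N x \<in> ?Q then 1 else 0) - 1" for x
  have q_per: "periodic N q" by (simp add: periodic_def q_def)
  have q_sum: "(\<Sum>x\<in>?T. q x * g x) = t / s * (\<Sum>x\<in>?Q. g x) - (\<Sum>x\<in>?T. g x)" for g :: "'d site \<Rightarrow> real"
  proof -
    have "(\<Sum>x\<in>?T. q x * g x) = (\<Sum>x\<in>?T. t / s * (if x \<in> ?Q then g x else 0) - g x)"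
      by (intro sum.cong refl) (auto simp: q_def torus_rep_id algebra_simps)
    also have "\<dots> = t / s * (\<Sum>x\<in>?T. if x \<in> ?Q then g x else 0) - (\<Sum>x\<in>?T. g x)"
      by (simp only: sum_subtractf sum_distrib_left)
    also have "(\<Sum>x\<in>?T. if x \<in> ?Q then g x else 0) = (\<Sum>x\<in>?Q. g x)"
      using Q by (simp add: sum.If_cases Int_absorb1)
    finally show ?thesis .
  qed
  have q0: "(\<Sum>x\<in>?T. q x) = 0" using q_sum[of "\<lambda>x. 1"] s by (simp add: t_def s_def)
  have q2: "(\<Sum>x\<in>?T. (q x)\<^sup>2) \<le> t * (t / s)"
  proof -
    have "(\<Sum>x\<in>?T. (q x)\<^sup>2) = t / s * (\<Sum>x\<in>?Q. q x) - (\<Sum>x\<in>?T. q x)"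
      using q_sum[of q] by (simp add: power2_eq_square)
    also have "(\<Sum>x\<in>?Q. q x) = (\<Sum>x\<in>?Q. t / s - 1)"
      using Q by (intro sum.cong refl) (auto simp: q_def torus_rep_id)
    also have "\<dots> = t - s" using s by (simp add: s_def right_diff_distrib)
    also have "t / s * (t - s) - (\<Sum>x\<in>?T. q x) \<le> t / s * t" using q0 s t by (simp add: right_diff_distrib)
    finally show ?thesis by (simp add: mult.commute)
  qed
  have f_bdd: "bdd f" unfolding f_def by (intro bdd_divide bdd_sum corr_bdd N)
  have Ef: "(\<integral>\<xi>. f \<xi> \<partial>E) = 0"
    unfolding f_def using bdd_integrable[OF corr_bdd[OF N]] by (simp add: integral_phi[OF N])
  have fdiff: "(f \<xi> - f (\<xi>(b := r)))\<^sup>2 \<le> c\<^sup>2 * B / t * (nab (green l (periodize N \<xi>) q) (snd b) (fst b))\<^sup>2"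
    if \<xi>: "\<xi> \<in> space E" and r: "r \<in> space M" and b: "b \<in> J N" for \<xi> r b
  proof -
    obtain z k where zk: "b = (z, k)" "z \<in> ?T" using b by auto
    \<comment> \<open>The roles are exchanged: \<xi> is regarded as a modification of \<xi>'. The
      Green potential then belongs to \<xi>, which is fixed while \<open>b\<close> varies, so that
      its gradient can be summed over all bonds.\<close>
    define \<xi>' where "\<xi>' = \<xi>(b := r)"
    have \<xi>': "\<xi>' \<in> space E" "\<xi> b \<in> space M" "\<xi>'(b := \<xi> b) = \<xi>"
      using upd_space[OF \<xi> r] \<xi> by (auto simp: \<xi>'_def space_PiM)
    have "torus_env_pair N c l (periodize N \<xi>') (periodize N (\<xi>'((z, k) := \<xi> b))) z k"
      by (rule torus_env_pair_E[OF N \<xi>'(1,2) zk(2)])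
    then interpret torus_env_pair N c l "periodize N \<xi>'" "periodize N \<xi>" z k
      using \<xi>'(3) by (simp add: zk(1))
    let ?w = "wfield l (periodize N \<xi>') v k z" and ?G = "nab (green l (periodize N \<xi>) q) k z"
    have eq: "t * f \<zeta> = (\<Sum>x\<in>?T. q x * phi N v \<zeta> x)" if "\<zeta> \<in> space E" for \<zeta>
      using q_sum[of "phi N v \<zeta>"] torus_env.sum_corr[OF torus_env_E[OF N that], of v] by (simp add: f_def)
    have "t * (f \<xi> - f \<xi>') = (\<Sum>x\<in>?T. q x * (phi N v \<xi> x - phi N v \<xi>' x))"
      using eq[OF \<xi>] eq[OF \<xi>'(1)] by (simp add: right_diff_distrib sum_subtractf)
    also have "\<dots> = - ((periodize N \<xi> (z, k) - periodize N \<xi>' (z, k)) * (?w * ?G))"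
      by (rule corr_functional_diff[OF q_per q0])
    finally have "(t * (f \<xi> - f \<xi>'))\<^sup>2 = (periodize N \<xi> (z, k) - periodize N \<xi>' (z, k))\<^sup>2 * (?w\<^sup>2 * ?G\<^sup>2)"
      by (simp add: power_mult_distrib)
    also have "\<dots> \<le> c\<^sup>2 * ((B * t) * ?G\<^sup>2)"
    proof (intro mult_mono mult_right_mono)
      show "(periodize N \<xi> (z, k) - periodize N \<xi>' (z, k))\<^sup>2 \<le> c\<^sup>2"
        using abs_bond_diff c by (simp add: abs_le_square_iff[symmetric])
      show "?w\<^sup>2 \<le> B * t" unfolding t_def by (rule decay[OF torus_env_E[OF N \<xi>'(1)]])
    qed (use B t in auto)
    finally have "t\<^sup>2 * (f \<xi> - f \<xi>')\<^sup>2 \<le> t\<^sup>2 * (c\<^sup>2 * B / t * ?G\<^sup>2)"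
      using t by (simp add: power_mult_distrib power2_eq_square mult_ac)
    then have "(f \<xi> - f \<xi>')\<^sup>2 \<le> c\<^sup>2 * B / t * ?G\<^sup>2"
      using t by (simp only: mult_le_cancel_left_pos zero_less_power)
    then show ?thesis by (simp add: \<xi>'_def zk(1))
  qed
  have "(\<integral>\<xi>. (f \<xi>)\<^sup>2 \<partial>E) - (\<integral>\<xi>. f \<xi> \<partial>E)\<^sup>2 \<le> (\<integral>\<xi>. c\<^sup>2 * B / t * ((c * real CARD('d) * real N)\<^sup>2 * (t * (t / s))) \<partial>E) / 2"
  proof (rule efron_stein_le[where I = "J N"])
    show "depends (J N) f"
      using depends_periodize[OF N, of "\<lambda>\<xi>. (\<Sum>y\<in>?Q. corr l \<xi> v y) / s"] by (simp add: f_def[abs_def])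
    fix \<xi> :: "'d env" assume \<xi>: "\<xi> \<in> space E"
    interpret torus_env N c l "periodize N \<xi>" by (rule torus_env_E[OF N \<xi>])
    let ?G = "\<lambda>b. (nab (green l (periodize N \<xi>) q) (snd b) (fst b))\<^sup>2"
    have "(\<integral>r. (f \<xi> - f (\<xi>(b := r)))\<^sup>2 \<partial>M) \<le> c\<^sup>2 * B / t * ?G b" if b: "b \<in> J N" for b
    proof -
      have "(\<integral>r. (f \<xi> - f (\<xi>(b := r)))\<^sup>2 \<partial>M) \<le> (\<integral>r. c\<^sup>2 * B / t * ?G b \<partial>M)"
      proof (rule integral_mono_AE')
        show "AE r in M. (f \<xi> - f (\<xi>(b := r)))\<^sup>2 \<le> c\<^sup>2 * B / t * ?G b"
          using fdiff[OF \<xi> _ b] by (intro AE_I2)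
        show "AE r in M. 0 \<le> c\<^sup>2 * B / t * ?G b" using B t by (intro AE_I2) simp
      qed simp
      then show ?thesis by (simp add: prob_space)
    qed
    then have "(\<Sum>b\<in>J N. \<integral>r. (f \<xi> - f (\<xi>(b := r)))\<^sup>2 \<partial>M) \<le> c\<^sup>2 * B / t * (\<Sum>b\<in>J N. ?G b)"
      unfolding sum_distrib_left by (intro sum_mono)
    also have "(\<Sum>b\<in>J N. ?G b) = grad_energy N (green l (periodize N \<xi>) q)"
      by (simp add: grad_energy_def sum.cartesian_product')
    also have "c\<^sup>2 * B / t * \<dots> \<le> c\<^sup>2 * B / t * ((c * real CARD('d) * real N)\<^sup>2 * (t * (t / s)))"
      using B t by (intro mult_left_mono order_trans[OF green_grad_energy[OF q_per q0]] q2) auto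
    finally show "(\<Sum>b\<in>J N. \<integral>r. (f \<xi> - f (\<xi>(b := r)))\<^sup>2 \<partial>M) \<le> c\<^sup>2 * B / t * ((c * real CARD('d) * real N)\<^sup>2 * (t * (t / s)))" .
  qed (auto intro: f_bdd bdd_const)
  also have "\<dots> = c\<^sup>2 * B * (c * real CARD('d) * real N)\<^sup>2 * (t / s) / 2" using t by (simp add: P.prob_space)
  also have "\<dots> \<le> c\<^sup>2 * B * (c * real CARD('d) * real N)\<^sup>2 * (t / s)"
  proof -
    have "0 \<le> c\<^sup>2 * B * (c * real CARD('d) * real N)\<^sup>2 * (t / s)" using B s t by (intro mult_nonneg_nonneg) auto
    moreover have "r / 2 \<le> r" if "0 \<le> r" for r :: real using that by simp
    ultimately show ?thesis by blast
  qed
  finally show ?thesis unfolding Ef by (simp add: f_def t_def s_def)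
qed

definition cmean :: "nat \<Rightarrow> real ^ 'd \<Rightarrow> real" where
  "cmean N v = (\<integral>\<xi>. (phi N v \<xi> 0)\<^sup>2 \<partial>E)"

lemma cmean_eq: "N > 0 \<Longrightarrow> (\<integral>\<xi>. (phi N v \<xi> x)\<^sup>2 \<partial>E) = cmean N v"
  unfolding cmean_def by (rule integral_phi_shift[where g = "\<lambda>a b. a\<^sup>2" and y = 0]) measurable

text \<open>The value at 0 is a block average plus a fluctuation inside the block. The average has
  small variance because the field decays; the fluctuation is at most of order
  \<open>m\<^sup>2\<close> by the gradient bound. The block size \<open>m\<close> is left
  free.\<close>

lemma cmean_le:
  assumes N: "N > 0" and m: "0 < m" "m \<le> N" and B: "B \<ge> 0"
    and decay: "\<And>(\<xi> :: 'd env) i x. torus_env N c l \<xi> \<Longrightarrow> (wfield l \<xi> v i x)\<^sup>2 \<le> B * real (card (torus N :: 'd site set))"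
  shows "cmean N v \<le> 2 * (c\<^sup>2 * B * (c * real CARD('d) * real N)\<^sup>2 * (2 * real N / real m) ^ CARD('d))
    + 2 * ((real CARD('d) * real m)\<^sup>2 * (4 * c\<^sup>2 * (v \<bullet> v)))"
proof -
  interpret P: prob_space E by (rule prob_space_E)
  let ?Q = "block m"
  define s where "s = real (card ?Q)"
  have s: "s > 0" using m by (simp add: s_def card_block)
  let ?f = "\<lambda>\<xi>. (\<Sum>y\<in>?Q. phi N v \<xi> y) / s"
  let ?g = "\<lambda>\<xi>. (\<Sum>y\<in>?Q. (phi N v \<xi> y - phi N v \<xi> 0)\<^sup>2) / s"
  have b1: "bdd (\<lambda>\<xi>. (?f \<xi>)\<^sup>2)" by (intro bdd_power bdd_divide bdd_sum corr_bdd N)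
  have b2: "bdd (\<lambda>\<xi>. (phi N v \<xi> y - phi N v \<xi> 0)\<^sup>2)" for y by (intro bdd_power bdd_diff corr_bdd N)
  have b3: "bdd ?g" by (intro bdd_divide bdd_sum b2)
  have "cmean N v \<le> (\<integral>\<xi>. 2 * (?f \<xi>)\<^sup>2 + 2 * ?g \<xi> \<partial>E)"
    unfolding cmean_def
  proof (intro integral_mono bdd_integrable bdd_power corr_bdd N bdd_add bdd_mult bdd_const bdd_sum bdd_divide bdd_diff)
    fix \<xi> :: "'d env" assume "\<xi> \<in> space E"
    let ?a = "phi N v \<xi> 0"
    have "(?f \<xi> - ?a)\<^sup>2 \<le> ?g \<xi>"
    proof -
      have "?f \<xi> - ?a = (\<Sum>y\<in>?Q. phi N v \<xi> y - ?a) / s"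
        using s by (simp add: sum_subtractf diff_divide_distrib s_def)
      then have "(?f \<xi> - ?a)\<^sup>2 = (\<Sum>y\<in>?Q. phi N v \<xi> y - ?a)\<^sup>2 / s\<^sup>2" by (simp add: power_divide)
      also have "\<dots> \<le> (s * (\<Sum>y\<in>?Q. (phi N v \<xi> y - ?a)\<^sup>2)) / s\<^sup>2"
        using sum_squared_le_sum_of_squares[of "\<lambda>y. phi N v \<xi> y - ?a" ?Q]
        by (intro divide_right_mono) (simp_all add: s_def mult.commute)
      also have "\<dots> = ?g \<xi>" using s by (simp add: power2_eq_square)
      finally show ?thesis .
    qed
    moreover have "?a\<^sup>2 \<le> 2 * (?f \<xi>)\<^sup>2 + 2 * (?f \<xi> - ?a)\<^sup>2"
    proof -
      have "0 \<le> (2 * ?f \<xi> - ?a)\<^sup>2" by simp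
      then show ?thesis by (simp add: power2_eq_square algebra_simps)
    qed
    ultimately show "?a\<^sup>2 \<le> 2 * (?f \<xi>)\<^sup>2 + 2 * ?g \<xi>" by linarith
  qed
  also have "\<dots> = 2 * (\<integral>\<xi>. (?f \<xi>)\<^sup>2 \<partial>E) + 2 * (\<integral>\<xi>. ?g \<xi> \<partial>E)"
  proof -
    have "(\<integral>\<xi>. 2 * (?f \<xi>)\<^sup>2 + 2 * ?g \<xi> \<partial>E) = (\<integral>\<xi>. 2 * (?f \<xi>)\<^sup>2 \<partial>E) + (\<integral>\<xi>. 2 * ?g \<xi> \<partial>E)"
      by (intro Bochner_Integration.integral_add bdd_integrable bdd_mult bdd_const b1 b3)
    then show ?thesis by (simp only: integral_mult_right_zero)
  qed
  also have "\<dots> \<le> 2 * (c\<^sup>2 * B * (c * real CARD('d) * real N)\<^sup>2 * (2 * real N / real m) ^ CARD('d))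
    + 2 * ((real CARD('d) * real m)\<^sup>2 * (4 * c\<^sup>2 * (v \<bullet> v)))"
  proof (intro add_mono mult_left_mono)
    have "real (card (torus N :: 'd site set)) / s = (2 * real N / real m) ^ CARD('d)"
      by (simp add: s_def card_torus card_block power_divide)
    then show "(\<integral>\<xi>. (?f \<xi>)\<^sup>2 \<partial>E) \<le> c\<^sup>2 * B * (c * real CARD('d) * real N)\<^sup>2 * (2 * real N / real m) ^ CARD('d)"
      using variance_block_average[OF N m B decay] by (simp add: s_def)
    have "(\<integral>\<xi>. (phi N v \<xi> y - phi N v \<xi> 0)\<^sup>2 \<partial>E) \<le> (real CARD('d) * real m)\<^sup>2 * (4 * c\<^sup>2 * (v \<bullet> v))" if y: "y \<in> ?Q" for y
    proof -
      have "\<bar>y $ k\<bar> \<le> int m" for k using y by (auto simp: block_def sbox_def abs_le_iff dest!: spec[of _ k])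
      then have "(\<Sum>k\<in>UNIV. \<bar>y $ k\<bar>) \<le> (\<Sum>k\<in>(UNIV :: 'd set). int m)" by (intro sum_mono)
      then have "real_of_int (\<Sum>k\<in>UNIV. \<bar>y $ k\<bar>) \<le> real_of_int (int CARD('d) * int m)"
        unfolding of_int_le_iff by simp
      then have "(real_of_int (\<Sum>k\<in>UNIV. \<bar>y $ k\<bar>))\<^sup>2 \<le> (real CARD('d) * real m)\<^sup>2"
        by (intro power_mono) (auto intro: sum_nonneg)
      then have "(real_of_int (\<Sum>k\<in>UNIV. \<bar>y $ k\<bar>))\<^sup>2 * (4 * c\<^sup>2 * (v \<bullet> v)) \<le> (real CARD('d) * real m)\<^sup>2 * (4 * c\<^sup>2 * (v \<bullet> v))"
        by (intro mult_right_mono) auto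
      then show ?thesis using integral_phi_diff_le[OF N, of v y] by linarith
    qed
    then have "(\<Sum>y\<in>?Q. \<integral>\<xi>. (phi N v \<xi> y - phi N v \<xi> 0)\<^sup>2 \<partial>E) \<le> (\<Sum>y\<in>?Q. (real CARD('d) * real m)\<^sup>2 * (4 * c\<^sup>2 * (v \<bullet> v)))"
      by (intro sum_mono)
    then have "(\<Sum>y\<in>?Q. \<integral>\<xi>. (phi N v \<xi> y - phi N v \<xi> 0)\<^sup>2 \<partial>E) / s \<le> (real CARD('d) * real m)\<^sup>2 * (4 * c\<^sup>2 * (v \<bullet> v))"
      using s by (simp add: s_def pos_divide_le_eq mult.commute)
    moreover have "(\<integral>\<xi>. ?g \<xi> \<partial>E) = (\<Sum>y\<in>?Q. \<integral>\<xi>. (phi N v \<xi> y - phi N v \<xi> 0)\<^sup>2 \<partial>E) / s"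
      by (simp only: integral_divide_zero Bochner_Integration.integral_sum[OF bdd_integrable[OF b2]])
    ultimately show "(\<integral>\<xi>. ?g \<xi> \<partial>E) \<le> (real CARD('d) * real m)\<^sup>2 * (4 * c\<^sup>2 * (v \<bullet> v))" by (simp only:)
  qed auto
  finally show ?thesis .
qed

lemma nat_div_ge: "real N / (2 * real p) \<le> real (N div p)" if "p > 0" "2 * p \<le> N" for N p :: nat
proof -
  have "real N \<le> real p * real (N div p) + real p"
  proof -
    have "N \<le> p * (N div p) + p"
      using mod_less_divisor[OF that(1), of N] mult_div_mod_eq[of p N] by linarith
    then have "real N \<le> real (p * (N div p) + p)" by (simp only: of_nat_le_iff)
    then show ?thesis by simp
  qed
  moreover have "2 * real p \<le> real N" using that(2) by linarith
  ultimately have "real N \<le> 2 * real p * real (N div p)" by linarith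
  then show ?thesis using that by (simp add: pos_divide_le_eq mult_ac)
qed

text \<open>The block size is N divided by a large constant \<open>p\<close>. Then the fluctuation
  term is a small multiple of the square of N, and for fixed \<open>p\<close> the variance term
  carries the vanishing factor \<open>N powr (- \<alpha>)\<close>.\<close>

theorem corrector_sublinear:
  assumes \<alpha>: "\<alpha> > 0" and C: "C > 0"
    and decay: "\<And>N (\<xi> :: 'd env) i x. torus_env N c l \<xi> \<Longrightarrow> (wfield l \<xi> v i x)\<^sup>2 \<le> C * real N powr (- \<alpha>) * (real (card (torus N :: 'd site set)) * (v \<bullet> v))"
    and \<epsilon>: "\<epsilon> > 0"
  shows "\<forall>\<^sub>F N in sequentially. cmean N v \<le> \<epsilon> * (real N)\<^sup>2"
proof -
  define K1 where "K1 = 2 * (c\<^sup>2 * (C * (v \<bullet> v)) * (c * real CARD('d))\<^sup>2)"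
  define K2 where "K2 = 8 * c\<^sup>2 * (real CARD('d))\<^sup>2 * (v \<bullet> v)"
  have K: "K1 \<ge> 0" "K2 \<ge> 0" using C by (auto simp: K1_def K2_def)
  obtain p :: nat where p: "real p > max 1 (2 * K2 / \<epsilon>)" using reals_Archimedean2 by blast
  have p0: "p > 0" "real p \<ge> 1" using p by auto
  have "K2 * 2 < \<epsilon> * real p" using p \<epsilon> by (simp add: pos_divide_less_eq mult.commute)
  also have "\<dots> \<le> \<epsilon> * (real p)\<^sup>2" using p0 \<epsilon> mult_left_mono[of 1 "real p" "real p"] by (simp add: power2_eq_square)
  finally have K2p: "K2 / (real p)\<^sup>2 \<le> \<epsilon> / 2" using p0 by (simp add: pos_divide_le_eq)
  have "(\<lambda>N. K1 * (4 * real p) ^ CARD('d) * real N powr (- \<alpha>)) \<longlonglongrightarrow> K1 * (4 * real p) ^ CARD('d) * 0"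
    by (intro tendsto_intros tendsto_neg_powr filterlim_real_sequentially) (use \<alpha> in auto)
  then have "\<forall>\<^sub>F N in sequentially. K1 * (4 * real p) ^ CARD('d) * real N powr (- \<alpha>) < \<epsilon> / 2"
    using \<epsilon> by (intro order_tendstoD(2)) auto
  then show ?thesis using eventually_ge_at_top[of "2 * p"]
  proof eventually_elim
    case (elim N)
    define m where "m = N div p"
    have N: "N > 0" using elim p0 by simp
    have m: "0 < m" "m \<le> N" using elim p0 by (auto simp: m_def div_greater_zero_iff)
    have mN: "real m \<le> real N / real p" by (simp add: m_def of_nat_div_le_of_nat)
    have Nm: "2 * real N / real m \<le> 4 * real p"
      using nat_div_ge[OF p0(1) elim(2)] m p0 by (simp add: m_def[symmetric] divide_simps mult_ac)
    define B where "B = C * real N powr (- \<alpha>) * (v \<bullet> v)"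
    have "cmean N v \<le> 2 * (c\<^sup>2 * B * (c * real CARD('d) * real N)\<^sup>2 * (2 * real N / real m) ^ CARD('d))
      + 2 * ((real CARD('d) * real m)\<^sup>2 * (4 * c\<^sup>2 * (v \<bullet> v)))"
      by (rule cmean_le[OF N m]) (use C decay in \<open>auto simp: B_def mult_ac\<close>)
    also have "2 * (c\<^sup>2 * B * (c * real CARD('d) * real N)\<^sup>2 * (2 * real N / real m) ^ CARD('d))
      \<le> 2 * (c\<^sup>2 * B * (c * real CARD('d) * real N)\<^sup>2 * (4 * real p) ^ CARD('d))"
      using C by (intro mult_left_mono power_mono Nm) (auto simp: B_def)
    also have "\<dots> = K1 * (4 * real p) ^ CARD('d) * real N powr (- \<alpha>) * (real N)\<^sup>2"
      by (simp add: K1_def B_def power_mult_distrib mult_ac)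
    also have "\<dots> \<le> \<epsilon> / 2 * (real N)\<^sup>2" using elim(1) by (intro mult_right_mono) auto
    also have "2 * ((real CARD('d) * real m)\<^sup>2 * (4 * c\<^sup>2 * (v \<bullet> v))) = K2 * (real m)\<^sup>2"
      by (simp add: K2_def power_mult_distrib mult_ac)
    also have "\<dots> \<le> K2 * (real N / real p)\<^sup>2" by (intro mult_left_mono power_mono mN K) auto
    also have "\<dots> = K2 / (real p)\<^sup>2 * (real N)\<^sup>2" by (simp add: power_divide)
    also have "\<dots> \<le> \<epsilon> / 2 * (real N)\<^sup>2" by (intro mult_right_mono K2p) auto
    finally show ?case by (simp add: field_simps)
  qed
qed

end

section \<open>Squeezing finite volume means against annealed mean squares\<close>

section \<open>Convergence of the mean finite volume coefficients\<close>

text \<open>Without monotonicity, the two relations still make \<delta> a Cauchy sequence: a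
  near-infimum \<open>\<delta> N1\<close> bounds a suitable \<open>\<beta> n\<close>, and this one
  bounds \<open>\<delta> N\<close> for all \<open>N\<close> beyond \<open>n\<close>.\<close>

lemma common_limit:
  fixes \<beta> \<delta> :: "nat \<Rightarrow> real"
  assumes nn: "\<And>N. 0 \<le> \<delta> N" and le: "\<And>n N. 0 < n \<Longrightarrow> n < N \<Longrightarrow> \<delta> N \<le> \<beta> n"
    and ge: "\<And>e. e > 0 \<Longrightarrow> \<forall>\<^sub>F N in sequentially. \<forall>\<^sub>F n in sequentially. \<beta> n \<le> \<delta> N + e"
  obtains \<Lambda> where "\<delta> \<longlonglongrightarrow> \<Lambda>" "\<beta> \<longlonglongrightarrow> \<Lambda>"
proof -
  have near: "\<exists>s n0. \<forall>N\<ge>n0. s \<le> \<delta> N \<and> \<delta> N < s + e" if e: "e > 0" for e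
  proof -
    obtain N0 where N0: "\<And>N. N \<ge> N0 \<Longrightarrow> \<forall>\<^sub>F n in sequentially. \<beta> n \<le> \<delta> N + e / 3"
      using ge[of "e / 3"] e by (auto simp: eventually_sequentially)
    define s where "s = Inf (\<delta> ` {N0..})"
    have lower: "s \<le> \<delta> N" if "N \<ge> N0" for N
      unfolding s_def using that nn by (intro cInf_lower bdd_belowI2[of _ 0]) auto
    have "Inf (\<delta> ` {N0..}) < s + e / 3" using e by (simp add: s_def)
    then obtain N1 where N1: "N1 \<ge> N0" "\<delta> N1 < s + e / 3"
      by (subst (asm) cInf_less_iff) (use nn in \<open>auto intro: bdd_belowI2[of _ 0]\<close>)
    obtain n1 where n1: "\<And>n. n \<ge> n1 \<Longrightarrow> \<beta> n \<le> \<delta> N1 + e / 3"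
      using N0[OF N1(1)] by (auto simp: eventually_sequentially)
    define n where "n = Suc n1"
    have "s \<le> \<delta> N \<and> \<delta> N < s + e" if "N \<ge> max N0 (Suc n)" for N
    proof -
      have "\<delta> N \<le> \<beta> n" using that by (intro le) (auto simp: n_def)
      also have "\<dots> \<le> \<delta> N1 + e / 3" by (intro n1) (simp add: n_def)
      finally show ?thesis using lower[of N] that N1(2) e by auto
    qed
    then show ?thesis by blast
  qed
  have "Cauchy \<delta>"
  proof (rule metric_CauchyI)
    fix e :: real assume "e > 0"
    from near[OF this] obtain s n0 where *: "\<And>N. N \<ge> n0 \<Longrightarrow> s \<le> \<delta> N \<and> \<delta> N < s + e" by blast
    have "dist (\<delta> m) (\<delta> n) < e" if "m \<ge> n0" "n \<ge> n0" for m n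
    proof -
      have "s \<le> \<delta> m" "\<delta> m < s + e" "s \<le> \<delta> n" "\<delta> n < s + e" using * that by blast+
      then show ?thesis by (simp add: dist_real_def abs_less_iff)
    qed
    then show "\<exists>n0. \<forall>m\<ge>n0. \<forall>n\<ge>n0. dist (\<delta> m) (\<delta> n) < e" by blast
  qed
  then obtain \<Lambda> where \<Lambda>: "\<delta> \<longlonglongrightarrow> \<Lambda>" using real_Cauchy_convergent by (auto simp: convergent_def)
  have lower: "\<Lambda> \<le> \<beta> n" if "n > 0" for n
    by (rule LIMSEQ_le_const2[OF \<Lambda>]) (use le[OF that] in \<open>auto intro!: exI[of _ "Suc n"]\<close>)
  have "\<beta> \<longlonglongrightarrow> \<Lambda>"
  proof (rule tendstoI)
    fix e :: real assume e: "e > 0"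
    have "\<forall>\<^sub>F N in sequentially. \<delta> N < \<Lambda> + e / 2" using \<Lambda> e by (intro order_tendstoD(2)) auto
    moreover have "\<forall>\<^sub>F N in sequentially. \<forall>\<^sub>F n in sequentially. \<beta> n \<le> \<delta> N + e / 2" using ge[of "e / 2"] e by simp
    ultimately have "\<forall>\<^sub>F N in sequentially. \<delta> N < \<Lambda> + e / 2 \<and> (\<forall>\<^sub>F n in sequentially. \<beta> n \<le> \<delta> N + e / 2)"
      by (rule eventually_conj)
    then obtain N where N: "\<delta> N < \<Lambda> + e / 2" "\<forall>\<^sub>F n in sequentially. \<beta> n \<le> \<delta> N + e / 2"
      using eventually_happens'[OF sequentially_bot] by blast
    show "\<forall>\<^sub>F n in sequentially. dist (\<beta> n) \<Lambda> < e"
      using N(2) eventually_gt_at_top[of 0]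
    proof eventually_elim
      case (elim n)
      then show ?case using lower[of n] N(1) by (simp add: dist_real_def)
    qed
  qed
  with \<Lambda> show ?thesis by (rule that)
qed

text \<open>The additive constant collects the finitely many indices before the limit takes
  hold.\<close>

lemma linear_growth_bound:
  fixes b :: "nat \<Rightarrow> real"
  assumes l: "l > 0" and lim: "(\<lambda>n. l * b n / real n) \<longlonglongrightarrow> \<Lambda>" and \<epsilon>: "\<epsilon> > 0"
  shows "\<exists>C. \<forall>n. \<bar>b n - real n * (\<Lambda> / l)\<bar> \<le> \<epsilon> * real n + C"
proof -
  have "\<forall>\<^sub>F n in sequentially. dist (l * b n / real n) \<Lambda> < \<epsilon> * l" using lim \<epsilon> l by (intro tendstoD) auto
  then obtain n0 where n0: "\<And>n. n \<ge> n0 \<Longrightarrow> \<bar>l * b n / real n - \<Lambda>\<bar> < \<epsilon> * l"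
    by (auto simp: eventually_sequentially dist_real_def)
  define C where "C = (\<Sum>n\<le>n0. \<bar>b n - real n * (\<Lambda> / l)\<bar>)"
  have C0: "C \<ge> 0" unfolding C_def by (intro sum_nonneg) simp
  have "\<bar>b n - real n * (\<Lambda> / l)\<bar> \<le> \<epsilon> * real n + C" for n
  proof (cases "n \<le> n0")
    case True
    then have "\<bar>b n - real n * (\<Lambda> / l)\<bar> \<le> C" unfolding C_def by (intro member_le_sum) auto
    moreover have "0 \<le> \<epsilon> * real n" using \<epsilon> by simp
    ultimately show ?thesis by linarith
  next
    case False
    then have n: "n > 0" by simp
    have "b n - real n * (\<Lambda> / l) = real n / l * (l * b n / real n - \<Lambda>)" using n l by (simp add: field_simps)
    then have "\<bar>b n - real n * (\<Lambda> / l)\<bar> = real n / l * \<bar>l * b n / real n - \<Lambda>\<bar>" using l by (simp add: abs_mult)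
    also have "\<dots> \<le> real n / l * (\<epsilon> * l)" using n0[of n] False l by (intro mult_left_mono) auto
    also have "\<dots> = \<epsilon> * real n" using l by simp
    finally show ?thesis using C0 by linarith
  qed
  then show ?thesis by blast
qed

lemma lazyn_square_bounds:
  fixes \<zeta> :: "'d::finite env"
  assumes "elliptic c \<zeta>" "c \<ge> 1" "2 * real CARD('d) * c \<le> l"
  shows "0 \<le> lazyn l \<zeta> n (\<lambda>y. (lin v y)\<^sup>2) 0" "lazyn l \<zeta> n (\<lambda>y. (lin v y)\<^sup>2) 0 \<le> 2 * (norm v)\<^sup>2 * exp 1 ^ n"
proof -
  interpret growth \<zeta> c l "\<lambda>y. (lin v y)\<^sup>2" "2 * (norm v)\<^sup>2"
    by unfold_locales (use assms square_growth in \<open>auto simp: lin_def\<close>)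
  show "0 \<le> lazyn l \<zeta> n (\<lambda>y. (lin v y)\<^sup>2) 0" by (rule Kn_nonneg)
  show "lazyn l \<zeta> n (\<lambda>y. (lin v y)\<^sup>2) 0 \<le> 2 * (norm v)\<^sup>2 * exp 1 ^ n"
    using Kn_le[of n 0] by (simp add: weight_def)
qed

lemma lazyn_recentre:
  "lazyn l \<zeta> n (\<lambda>y. (lin v y - lin v x)\<^sup>2) x = lazyn l (env_shift x \<zeta>) n (\<lambda>y. (lin v y)\<^sup>2) 0"
  using fun_cong[OF lazyn_env_shift[where l = l and z = x and \<xi> = \<zeta> and n = n and f = "\<lambda>y. (lin v y - lin v x)\<^sup>2"], of 0]
  by (simp add: lin_add)

context random_env
begin

lemma l_facts: "2 * real CARD('d) * c \<le> l" "l > 0"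
proof -
  have "0 < real CARD('d) * c" using c by simp
  then show "2 * real CARD('d) * c \<le> l" "l > 0" using l by linarith+
qed

definition bn :: "nat \<Rightarrow> real ^ 'd \<Rightarrow> real" where
  "bn n v = (\<integral>\<xi>. lazyn l \<xi> n (\<lambda>y. (lin v y)\<^sup>2) 0 \<partial>E)"

definition dn :: "nat \<Rightarrow> real ^ 'd \<Rightarrow> real" where
  "dn N v = (\<integral>\<xi>. Fq N l (periodize N \<xi>) v \<partial>E)"

lemma bdd_lazyn_square:
  fixes \<Xi> :: "'d env \<Rightarrow> 'd env"
  assumes "\<And>b. (\<lambda>\<xi>. \<Xi> \<xi> b) \<in> borel_measurable E" "\<And>\<xi>. \<xi> \<in> space E \<Longrightarrow> elliptic c (\<Xi> \<xi>)"
  shows "bdd (\<lambda>\<xi>. lazyn l (\<Xi> \<xi>) n (\<lambda>y. (lin v y)\<^sup>2) 0)"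
proof -
  have "\<bar>lazyn l (\<Xi> \<xi>) n (\<lambda>y. (lin v y)\<^sup>2) 0\<bar> \<le> 2 * (norm v)\<^sup>2 * exp 1 ^ n" if "\<xi> \<in> space E" for \<xi>
    using lazyn_square_bounds[OF assms(2)[OF that] c l_facts(1), of n v] by simp
  then show ?thesis unfolding bdd_def using lazyn_measurable[where \<Xi> = \<Xi> and f = "\<lambda>\<omega> y. (lin v y)\<^sup>2", OF assms(1) borel_measurable_const] by blast
qed

lemma bdd_msq:
  assumes "N > 0"
  shows "bdd (\<lambda>\<xi> :: 'd env. lazyn l (periodize N \<xi>) n (\<lambda>y. (lin v y - lin v x)\<^sup>2) x)"
  unfolding lazyn_recentre
proof (rule bdd_lazyn_square)
  fix b show "(\<lambda>\<xi> :: 'd env. env_shift x (periodize N \<xi>) b) \<in> borel_measurable E"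
    using periodize_measurable[OF assms subset_UNIV, of "(fst b + x, snd b)"]
    by (cases b) (simp add: env_shift_def)
qed (intro elliptic_env_shift elliptic_periodize elliptic_E)

text \<open>From the origin, \<open>n\<close> steps read only bonds named by sites with coordinates
  between -n and n. As the largest coordinate of a period is N - 1, \<open>n < N\<close> makes
  periodisation invisible; stationarity moves any other starting point to the origin.\<close>

lemma integral_msq:
  assumes n: "n < N"
  shows "(\<integral>\<xi>. lazyn l (periodize N \<xi>) n (\<lambda>y. (lin v y - lin v x)\<^sup>2) x \<partial>E) = bn n v"
proof -
  have N: "N > 0" using n by simp
  have "lazyn l (periodize N \<xi>) n f 0 = lazyn l \<xi> n f 0" for \<xi> :: "'d env" and f
  proof (rule lazyn_local)
    fix y :: "'d site" and i assume *: "\<And>k. \<bar>y $ k - 0 $ k\<bar> \<le> int n"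
    have "- int N \<le> y $ k \<and> y $ k < int N" for k using *[of k] n by simp linarith
    then have "y \<in> torus N" by (simp add: torus_def)
    then show "periodize N \<xi> (y, i) = \<xi> (y, i)" by (simp add: periodize_def torus_rep_id)
  qed
  moreover have "(\<lambda>\<xi>. lazyn l (periodize N \<xi>) n (\<lambda>y. (lin v y)\<^sup>2) 0) \<in> borel_measurable (\<Pi>\<^sub>M b\<in>J N. M)"
    by (rule lazyn_measurable[where f = "\<lambda>\<omega> y. (lin v y)\<^sup>2"]) (auto intro: periodize_measurable N)
  ultimately show ?thesis
    using integral_shift[OF N, of "\<lambda>\<zeta>. lazyn l \<zeta> n (\<lambda>y. (lin v y)\<^sup>2) 0" x] by (simp add: lazyn_recentre bn_def)
qed

lemma dn_bounds: "0 \<le> dn N v" "N > 0 \<Longrightarrow> dn N v \<le> 2 * c * (v \<bullet> v)"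
proof -
  interpret P: prob_space E by (rule prob_space_E)
  show "N > 0 \<Longrightarrow> dn N v \<le> 2 * c * (v \<bullet> v)"
    unfolding dn_def by (rule P.integral_le_const) (auto intro!: AE_I2 bdd_integrable Fq_bdd torus_env.Fq_bounds(2) torus_env_E)
  have "0 \<le> Fq N l (periodize N \<xi>) v" if "\<xi> \<in> space E" for \<xi>
    unfolding Fq_def using elliptic_pos[OF elliptic_periodize[OF elliptic_E[OF that]] c]
    by (intro mult_nonneg_nonneg sum_nonneg) (auto intro: less_imp_le)
  then show "0 \<le> dn N v" unfolding dn_def by (intro integral_nonneg_AE AE_I2)
qed

lemma dn_le_bn:
  assumes n: "0 < n" "n < N"
  shows "dn N v \<le> l * bn n v / real n"
proof -
  let ?T = "torus N :: 'd site set"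
  have N: "N > 0" using n by simp
  have cT: "real (card ?T) > 0" using card_torus_pos[OF N, where 'd='d] by simp
  let ?m = "\<lambda>x \<xi>. lazyn l (periodize N \<xi>) n (\<lambda>y. (lin v y - lin v x)\<^sup>2) x"
  have "real n * real (card ?T) / l * dn N v = (\<integral>\<xi>. real n * real (card ?T) / l * Fq N l (periodize N \<xi>) v \<partial>E)"
    by (simp add: dn_def)
  also have "\<dots> \<le> (\<integral>\<xi>. (\<Sum>x\<in>?T. ?m x \<xi>) \<partial>E)"
  proof (intro integral_mono bdd_integrable bdd_mult bdd_const bdd_sum Fq_bdd bdd_msq N)
    fix \<xi> :: "'d env" assume "\<xi> \<in> space E"
    then interpret torus_env N c l "periodize N \<xi>" by (rule torus_env_E[OF N])
    show "real n * real (card ?T) / l * Fq N l (periodize N \<xi>) v \<le> (\<Sum>x\<in>?T. ?m x \<xi>)"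
      using sum_msq_lin_ge[of n v] by (simp add: msq_def)
  qed
  also have "\<dots> = (\<Sum>x\<in>?T. \<integral>\<xi>. ?m x \<xi> \<partial>E)"
    by (intro Bochner_Integration.integral_sum bdd_integrable bdd_msq N)
  also have "\<dots> = real (card ?T) * bn n v" by (simp add: integral_msq[OF n(2)])
  finally have "real (card ?T) * (real n * dn N v / l) \<le> real (card ?T) * bn n v" by (simp add: mult_ac)
  then have "real n * dn N v / l \<le> bn n v" using cT by (simp only: mult_le_cancel_left_pos)
  then show ?thesis using l_facts(2) n by (simp add: field_simps)
qed

subsection \<open>The upper bound by glued correctors\<close>

lemma integral_block:
  fixes h :: "'d env \<Rightarrow> real"
  assumes N: "N > 0" and M: "M' > 0" "M' = m * N"
    and h: "(\<lambda>\<xi>. h (periodize N \<xi>)) \<in> borel_measurable (\<Pi>\<^sub>M b\<in>J N. M)"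
  shows "(\<integral>\<xi>. h (block_env N (periodize M' \<xi>) x) \<partial>E) = (\<integral>\<xi>. h (periodize N \<xi>) \<partial>E)"
proof -
  define z where "z = x - torus_rep N x"
  have "block_env N (periodize M' \<xi>) x = (\<lambda>(u, i). \<xi> (torus_rep M' (torus_rep N u + z), i))" for \<xi> :: "'d env"
    by (simp add: block_env_def env_shift_def periodize_def z_def)
  moreover have "inj_on (\<lambda>u. torus_rep M' (u + z)) (torus N)"
  proof (rule inj_onI)
    fix u u' :: "'d site" assume u: "u \<in> torus N" "u' \<in> torus N" and "torus_rep M' (u + z) = torus_rep M' (u' + z)"
    then have "torus_rep M' (torus_rep M' (u + z) - z) = torus_rep M' (torus_rep M' (u' + z) - z)" by simp
    then have "torus_rep M' u = torus_rep M' u'" by (simp add: torus_rep_diff)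
    moreover have "torus N \<subseteq> (torus M' :: 'd site set)"
    proof -
      have "N \<le> M'" using M by (cases m) auto
      then have *: "int N \<le> int M'" by simp
      show ?thesis
      proof
        fix x :: "'d site" assume "x \<in> torus N"
        then have "- int N \<le> x $ k" "x $ k < int N" for k by (auto simp: torus_def)
        with * have "- int M' \<le> x $ k \<and> x $ k < int M'" for k by (meson le_minus_iff less_le_trans neg_le_iff_le order_trans)
        then show "x \<in> torus M'" by (simp add: torus_def)
      qed
    qed
    ultimately show "u = u'" using u torus_rep_id[of u M'] torus_rep_id[of u' M'] by auto
  qed
  ultimately show ?thesis using integral_reindex[OF N _ h, of "\<lambda>u. torus_rep M' (u + z)"] by simp
qed

definition Psi :: "nat \<Rightarrow> nat \<Rightarrow> real ^ 'd \<Rightarrow> 'd env \<Rightarrow> 'd site \<Rightarrow> real" where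
  "Psi N L v \<zeta> y = (\<Sum>i\<in>UNIV. \<zeta> (y, i) * (v $ i + nab (\<lambda>u. ecut N L u * corr l \<zeta> v u) i y)\<^sup>2)"

definition cell_energy :: "nat \<Rightarrow> nat \<Rightarrow> real ^ 'd \<Rightarrow> real" where
  "cell_energy N L v = 2 / real (card (torus N :: 'd site set)) * (\<Sum>y\<in>torus N. \<integral>\<xi>. Psi N L v (periodize N \<xi>) y \<partial>E)"

lemma Psi_measurable:
  assumes "\<And>b. (\<lambda>\<omega>. \<Xi> \<omega> b) \<in> borel_measurable A"
  shows "(\<lambda>\<omega>. Psi N L v (\<Xi> \<omega>) y) \<in> borel_measurable A"
  unfolding Psi_def nab_def
  by (intro borel_measurable_sum borel_measurable_times borel_measurable_power borel_measurable_add
      borel_measurable_diff corr_measurable assms borel_measurable_const)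

lemma Psi_bdd:
  fixes \<Xi> :: "'d env \<Rightarrow> 'd env"
  assumes m: "\<And>b. (\<lambda>\<xi>. \<Xi> \<xi> b) \<in> borel_measurable E" and t: "\<And>\<xi>. \<xi> \<in> space E \<Longrightarrow> torus_env N c l (\<Xi> \<xi>)"
  shows "bdd (\<lambda>\<xi>. Psi N L v (\<Xi> \<xi>) y)"
proof -
  let ?B = "(real CARD('d) * real N)\<^sup>2 * (4 * c\<^sup>2 * real (card (torus N :: 'd site set)) * (v \<bullet> v))"
  have "\<bar>corr l (\<Xi> \<xi>) v x\<bar> \<le> sqrt ?B" if "\<xi> \<in> space E" for \<xi> x
    using torus_env.corr_square_le[OF t[OF that], of v x] real_le_rsqrt[of "\<bar>corr l (\<Xi> \<xi>) v x\<bar>"] by simp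
  then have b1: "bdd (\<lambda>\<xi>. corr l (\<Xi> \<xi>) v x)" for x unfolding bdd_def using corr_measurable[where \<Xi> = \<Xi>, OF m] by blast
  have "\<bar>\<Xi> \<xi> b\<bar> \<le> c" if "\<xi> \<in> space E" for \<xi> b
    using elliptic_pos[OF torus_env.ell[OF t[OF that]] c, of b] ellipticD(2)[OF torus_env.ell[OF t[OF that]], of b] by simp
  then have b2: "bdd (\<lambda>\<xi>. \<Xi> \<xi> b)" for b unfolding bdd_def using m by blast
  show ?thesis unfolding Psi_def nab_def
    by (intro bdd_sum bdd_mult bdd_power bdd_add bdd_diff bdd_const b1 b2)
qed

text \<open>Every block has the law of one periodised environment, so the expected energy of the
  glued trial function is \<open>cell_energy\<close>. Its square is bounded by a quantity free of
  \<open>n\<close>, which permits \<open>n\<close> to tend to infinity while \<open>N\<close> is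
  fixed.\<close>

lemma bn_le_cell_energy:
  assumes N: "N > 0" and \<epsilon>: "\<epsilon> > 0"
  shows "bn n v \<le> (1 + \<epsilon>) * (real n * (cell_energy N L v / l))
    + (1 + 1 / \<epsilon>) * (4 * ((real CARD('d) * real N)\<^sup>2 * (4 * c\<^sup>2 * real (card (torus N :: 'd site set)) * (v \<bullet> v))))"
proof -
  interpret P: prob_space E by (rule prob_space_E)
  \<comment> \<open>A multiple of \<open>N\<close>, so that blocks tile the large torus, and larger
    than \<open>n\<close>, so that \<open>n\<close> steps do not notice its period.\<close>
  define M' where "M' = Suc n * N"
  have M': "M' > 0" "n < M'"
    unfolding M'_def by (use N in simp) (rule less_le_trans[OF lessI], use N in \<open>cases N; simp\<close>)
  let ?T = "torus N :: 'd site set" and ?T' = "torus M' :: 'd site set"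
  have cT: "real (card ?T) > 0" "real (card ?T') > 0"
    using card_torus_pos[OF N, where 'd='d] card_torus_pos[OF M'(1), where 'd='d] by auto
  let ?D = "(real CARD('d) * real N)\<^sup>2 * (4 * c\<^sup>2 * real (card ?T) * (v \<bullet> v))"
  let ?m = "\<lambda>x \<xi>. lazyn l (periodize M' \<xi>) n (\<lambda>y. (lin v y - lin v x)\<^sup>2) x"
  let ?P = "\<lambda>x \<xi>. Psi N L v (block_env N (periodize M' \<xi>) x) (torus_rep N x)"
  have blocks: "torus_env_blocks M' c l (periodize M' \<xi>) N (Suc n)" if "\<xi> \<in> space E" for \<xi>
    using torus_env_E[OF M'(1) that] N by (simp add: torus_env_blocks_def torus_env_blocks_axioms_def M'_def)
  have bP: "bdd (?P x)" for x
  proof (rule Psi_bdd)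
    fix b show "(\<lambda>\<xi>. block_env N (periodize M' \<xi>) x b) \<in> borel_measurable E"
      using periodize_measurable[OF M'(1) subset_UNIV, of "(torus_rep N (fst b) + (x - torus_rep N x), snd b)"]
      by (cases b) (simp add: block_env_def periodize_def[of N] env_shift_def)
  qed (rule torus_env_blocks.block_env_torus[OF blocks])
  have "real (card ?T') * bn n v = (\<Sum>x\<in>?T'. \<integral>\<xi>. ?m x \<xi> \<partial>E)" by (simp add: integral_msq[OF M'(2)])
  also have "\<dots> = (\<integral>\<xi>. (\<Sum>x\<in>?T'. ?m x \<xi>) \<partial>E)"
    by (intro Bochner_Integration.integral_sum[symmetric] bdd_integrable bdd_msq M')
  also have "\<dots> \<le> (\<integral>\<xi>. (1 + \<epsilon>) * real n * 2 / l * (\<Sum>x\<in>?T'. ?P x \<xi>) + (1 + 1 / \<epsilon>) * (4 * (real (card ?T') * ?D)) \<partial>E)"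
  proof (intro integral_mono bdd_integrable bdd_add bdd_mult bdd_const bdd_sum bdd_msq M' bP)
    fix \<xi> :: "'d env" assume "\<xi> \<in> space E"
    then interpret torus_env_blocks M' c l "periodize M' \<xi>" N "Suc n" by (rule blocks)
    let ?f = "glued l N L (periodize M' \<xi>) v"
    have e: "(\<Sum>x\<in>?T'. \<Sum>i\<in>UNIV. periodize M' \<xi> (x, i) * (v $ i + nab ?f i x)\<^sup>2) = (\<Sum>x\<in>?T'. ?P x \<xi>)"
      by (simp only: Psi_def nab_glued block_conductance[symmetric])
    have first: "(\<Sum>x\<in>?T'. ?m x \<xi>) \<le> (1 + \<epsilon>) * (real n * (2 * (\<Sum>x\<in>?T'. ?P x \<xi>) / l)) + (1 + 1 / \<epsilon>) * (4 * (\<Sum>x\<in>?T'. (?f x)\<^sup>2))"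
      using sum_msq_lin_le[OF periodic_glued \<epsilon>, of n v L v] unfolding msq_def e .
    have "(\<Sum>x\<in>?T'. (?f x)\<^sup>2) \<le> (\<Sum>x\<in>?T'. ?D)" by (intro sum_mono glued_square_le)
    also have "\<dots> = real (card ?T') * ?D" by simp
    finally have le: "(1 + 1 / \<epsilon>) * (4 * (\<Sum>x\<in>?T'. (?f x)\<^sup>2)) \<le> (1 + 1 / \<epsilon>) * (4 * (real (card ?T') * ?D))"
      using \<epsilon> by (intro mult_left_mono) auto
    have eq: "(1 + \<epsilon>) * (real n * (2 * r / l)) = (1 + \<epsilon>) * real n * 2 / l * r" for r by simp
    show "(\<Sum>x\<in>?T'. ?m x \<xi>) \<le> (1 + \<epsilon>) * real n * 2 / l * (\<Sum>x\<in>?T'. ?P x \<xi>) + (1 + 1 / \<epsilon>) * (4 * (real (card ?T') * ?D))"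
      by (rule order_trans[OF first[unfolded eq] add_left_mono[OF le]])
  qed
  also have "\<dots> = (1 + \<epsilon>) * real n * 2 / l * (\<Sum>x\<in>?T'. \<integral>\<xi>. ?P x \<xi> \<partial>E) + (1 + 1 / \<epsilon>) * (4 * (real (card ?T') * ?D))"
  proof -
    have "(\<integral>\<xi>. (1 + \<epsilon>) * real n * 2 / l * (\<Sum>x\<in>?T'. ?P x \<xi>) + (1 + 1 / \<epsilon>) * (4 * (real (card ?T') * ?D)) \<partial>E)
      = (\<integral>\<xi>. (1 + \<epsilon>) * real n * 2 / l * (\<Sum>x\<in>?T'. ?P x \<xi>) \<partial>E) + (\<integral>\<xi>. (1 + 1 / \<epsilon>) * (4 * (real (card ?T') * ?D)) \<partial>E)"
      by (intro Bochner_Integration.integral_add bdd_integrable bdd_mult bdd_const bdd_sum bP)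
    then show ?thesis
      by (simp only: integral_mult_right_zero Bochner_Integration.integral_sum[OF bdd_integrable[OF bP]]) (simp add: P.prob_space)
  qed
  also have "(\<Sum>x\<in>?T'. \<integral>\<xi>. ?P x \<xi> \<partial>E) = real (card ?T') / 2 * cell_energy N L v"
  proof -
    define H where "H y = (\<integral>\<xi>. Psi N L v (periodize N \<xi>) y \<partial>E)" for y
    have mh: "(\<lambda>\<xi>. Psi N L v (periodize N \<xi>) y) \<in> borel_measurable (\<Pi>\<^sub>M b\<in>J N. M)" for y
      by (intro Psi_measurable periodize_measurable N) auto
    have PH: "(\<Sum>x\<in>?T'. \<integral>\<xi>. ?P x \<xi> \<partial>E) = (\<Sum>x\<in>?T'. H (torus_rep N x))"
      unfolding H_def
      by (intro sum.cong refl integral_block[OF N M'(1) M'_def, of "\<lambda>\<zeta>. Psi N L v \<zeta> y" for y, OF mh])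
    have "periodic N (\<lambda>x. H (torus_rep N x))" by (simp add: periodic_def)
    from torus_sum_multiple[OF N M'(1) M'_def this]
    have A: "real (card ?T) * (\<Sum>x\<in>?T'. \<integral>\<xi>. ?P x \<xi> \<partial>E) = real (card ?T') * (\<Sum>y\<in>?T. H y)"
      unfolding PH by (simp add: torus_rep_id)
    have aux: "r = C / 2 * (2 / t * B)" if "t * r = C * B" "t > 0" for r B C t :: real
    proof -
      have "r = C * B / t" using that by (simp add: eq_divide_eq mult.commute)
      then show ?thesis by simp
    qed
    from aux[OF A cT(1)] show ?thesis by (simp only: cell_energy_def H_def)
  qed
  finally have fin: "real (card ?T') * bn n v \<le> (1 + \<epsilon>) * real n * 2 / l * (real (card ?T') / 2 * cell_energy N L v) + (1 + 1 / \<epsilon>) * (4 * (real (card ?T') * ?D))" .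
  have aux: "a * k * 2 / l * (t / 2 * g) + h * (4 * (t * D)) = t * (a * (k * (g / l)) + h * (4 * D))" for a k t g h D :: real
    by (simp add: distrib_left)
  from fin have "real (card ?T') * bn n v \<le> real (card ?T') * ((1 + \<epsilon>) * (real n * (cell_energy N L v / l)) + (1 + 1 / \<epsilon>) * (4 * ?D))"
    by (rule ord_le_eq_trans[OF _ aux])
  then show ?thesis using cT(2) by (simp only: mult_le_cancel_left_pos)
qed

text \<open>Two errors compete: the boundary layer, a fraction of order \<open>L / N\<close>, and
  the gradient of the cutoff, of order \<open>cmean N v\<close> divided by the square of
  \<open>L\<close>. The width \<open>L\<close> has to be small against \<open>N\<close> but large
  against the corrector.\<close>

lemma cell_energy_le:
  assumes N: "N > 0" and L: "0 < L" "L \<le> N" and \<kappa>: "\<kappa> > 0"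
  shows "cell_energy N L v \<le> (1 + \<kappa>) * (dn N v + 2 * c * (v \<bullet> v) * (real CARD('d) * real L / real N))
    + (1 + 1 / \<kappa>) * (2 * c * real CARD('d) * cmean N v / (real L)\<^sup>2)"
proof -
  interpret P: prob_space E by (rule prob_space_E)
  let ?T = "torus N :: 'd site set"
  define t where "t = real (card ?T)"
  have t: "t > 0" using card_torus_pos[OF N, where 'd='d] by (simp add: t_def)
  let ?e = "real CARD('d) * real L / real N * t"
  have bP: "bdd (\<lambda>\<xi>. Psi N L v (periodize N \<xi>) y)" for y
    by (rule Psi_bdd[OF periodize_measurable[OF N subset_UNIV] torus_env_E[OF N]])
  have bphi: "bdd (\<lambda>\<xi>. (phi N v \<xi> x)\<^sup>2)" for x by (intro bdd_power corr_bdd N)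
  let ?R = "\<lambda>\<xi>. (1 + \<kappa>) * (t / 2 * Fq N l (periodize N \<xi>) v + c * (v \<bullet> v) * ?e)
      + (1 + 1 / \<kappa>) * (c * real CARD('d) * (1 / (real L)\<^sup>2) * (\<Sum>x\<in>?T. (phi N v \<xi> x)\<^sup>2))"
  have "(\<Sum>y\<in>?T. \<integral>\<xi>. Psi N L v (periodize N \<xi>) y \<partial>E) = (\<integral>\<xi>. (\<Sum>y\<in>?T. Psi N L v (periodize N \<xi>) y) \<partial>E)"
    by (intro Bochner_Integration.integral_sum[symmetric] bdd_integrable bP)
  also have "\<dots> \<le> (\<integral>\<xi>. ?R \<xi> \<partial>E)"
  proof (intro integral_mono bdd_integrable bdd_add bdd_mult bdd_const bdd_sum bP bphi Fq_bdd N)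
    fix \<xi> :: "'d env" assume "\<xi> \<in> space E"
    then interpret torus_env N c l "periodize N \<xi>" by (rule torus_env_E[OF N])
    have "(\<Sum>y\<in>?T. Psi N L v (periodize N \<xi>) y)
      \<le> (1 + \<kappa>) * ((\<Sum>x\<in>?T. \<Sum>i\<in>UNIV. periodize N \<xi> (x, i) * (wfield l (periodize N \<xi>) v i x)\<^sup>2) + c * (v \<bullet> v) * (\<Sum>x\<in>?T. 1 - ecut N L x))
      + (1 + 1 / \<kappa>) * (c * real CARD('d) * (1 / (real L)\<^sup>2) * (\<Sum>x\<in>?T. (phi N v \<xi> x)\<^sup>2))"
      unfolding Psi_def
      by (rule cutoff_energy) (use periodic_ecut ecut_bounds[OF N] nab_ecut[OF N L(1)] \<kappa> in auto)
    also have "(\<Sum>x\<in>?T. \<Sum>i\<in>UNIV. periodize N \<xi> (x, i) * (wfield l (periodize N \<xi>) v i x)\<^sup>2) = t / 2 * Fq N l (periodize N \<xi>) v"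
      using t by (simp add: Fq_def t_def)
    also have "(1 + \<kappa>) * (t / 2 * Fq N l (periodize N \<xi>) v + c * (v \<bullet> v) * (\<Sum>x\<in>?T. 1 - ecut N L x))
      \<le> (1 + \<kappa>) * (t / 2 * Fq N l (periodize N \<xi>) v + c * (v \<bullet> v) * ?e)"
      using sum_ecut_le[OF N L, where 'd='d] \<kappa> c unfolding t_def
      by (intro mult_left_mono add_left_mono) auto
    finally show "(\<Sum>y\<in>?T. Psi N L v (periodize N \<xi>) y) \<le> ?R \<xi>" by simp
  qed
  also have "\<dots> = (1 + \<kappa>) * (t / 2 * dn N v + c * (v \<bullet> v) * ?e)
      + (1 + 1 / \<kappa>) * (c * real CARD('d) * (1 / (real L)\<^sup>2) * (t * cmean N v))"
  proof -
    let ?K = "c * (v \<bullet> v) * ?e"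
    have 1: "(\<integral>\<xi>. ?R \<xi> \<partial>E) = (\<integral>\<xi>. (1 + \<kappa>) * (t / 2 * Fq N l (periodize N \<xi>) v + ?K) \<partial>E)
      + (\<integral>\<xi>. (1 + 1 / \<kappa>) * (c * real CARD('d) * (1 / (real L)\<^sup>2) * (\<Sum>x\<in>?T. (phi N v \<xi> x)\<^sup>2)) \<partial>E)"
      by (intro Bochner_Integration.integral_add bdd_integrable bdd_add bdd_mult bdd_const bdd_sum bphi Fq_bdd N)
    have 2: "(\<integral>\<xi>. t / 2 * Fq N l (periodize N \<xi>) v + ?K \<partial>E) = (\<integral>\<xi>. t / 2 * Fq N l (periodize N \<xi>) v \<partial>E) + (\<integral>\<xi>. ?K \<partial>E)"
      by (intro Bochner_Integration.integral_add bdd_integrable bdd_mult bdd_const Fq_bdd N)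
    have 3: "(\<integral>\<xi>. ?K \<partial>E) = ?K" by (simp add: P.prob_space)
    have 4: "(\<integral>\<xi>. (\<Sum>x\<in>?T. (phi N v \<xi> x)\<^sup>2) \<partial>E) = t * cmean N v"
      by (simp only: Bochner_Integration.integral_sum[OF bdd_integrable[OF bphi]] cmean_eq[OF N]) (simp add: t_def)
    show ?thesis by (simp only: 1 integral_mult_right_zero 2 4 dn_def) (simp add: P.prob_space)
  qed
  finally have "cell_energy N L v \<le> 2 / t * ((1 + \<kappa>) * (t / 2 * dn N v + c * (v \<bullet> v) * ?e)
      + (1 + 1 / \<kappa>) * (c * real CARD('d) * (1 / (real L)\<^sup>2) * (t * cmean N v)))"
    unfolding cell_energy_def t_def[symmetric] using t by (intro mult_left_mono) auto
  also have "\<dots> = (1 + \<kappa>) * (dn N v + 2 * c * (v \<bullet> v) * (real CARD('d) * real L / real N))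
    + (1 + 1 / \<kappa>) * (2 * c * real CARD('d) * cmean N v / (real L)\<^sup>2)"
    using t by (simp add: distrib_left add_divide_distrib mult_ac)
  finally show ?thesis .
qed

end

text \<open>The expectation of a matrix is a Bochner integral, which is 0 by convention for a
  non-integrable function; once integrability is known, entries and forms may be taken
  inside.\<close>

lemma integrable_matrix:
  fixes F :: "'x \<Rightarrow> real ^ 'd ^ 'd::finite"
  assumes "\<And>i j. integrable M (\<lambda>x. F x $ i $ j)"
  shows "integrable M F"
proof -
  have "F x = (\<Sum>i\<in>UNIV. \<Sum>j\<in>UNIV. (F x $ i $ j) *\<^sub>R axis i (axis j 1))" for x
  proof -
    have row: "(\<Sum>j\<in>UNIV. (F x $ i $ j) *\<^sub>R axis i (axis j 1 :: real ^ 'd)) $ a = (if a = i then F x $ a else 0)" for i a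
    proof -
      have "(\<Sum>j\<in>UNIV. (F x $ i $ j) *\<^sub>R axis i (axis j 1 :: real ^ 'd)) $ a
        = (\<Sum>j\<in>UNIV. (F x $ i $ j) *\<^sub>R (axis i (axis j 1 :: real ^ 'd) $ a))"
        by (simp only: sum_component vector_scaleR_component)
      also have "\<dots> = (if a = i then (\<Sum>j\<in>UNIV. (F x $ i $ j) *\<^sub>R axis j 1) else 0)"
        by (simp add: axis_def)
      finally show ?thesis by (simp add: basis_expansion[of "F x $ i", unfolded scalar_mult_eq_scaleR])
    qed
    have col: "(\<Sum>i\<in>UNIV. \<Sum>j\<in>UNIV. (F x $ i $ j) *\<^sub>R axis i (axis j 1 :: real ^ 'd)) $ a = F x $ a" for a
      by (subst sum_component) (simp only: row, simp)
    show ?thesis by (rule vec_eq_iff[THEN iffD2], rule allI, rule sym, rule col)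
  qed
  then have "F = (\<lambda>x. \<Sum>i\<in>UNIV. \<Sum>j\<in>UNIV. (F x $ i $ j) *\<^sub>R axis i (axis j 1))" by blast
  moreover have "integrable M (\<lambda>x. \<Sum>i\<in>UNIV. \<Sum>j\<in>UNIV. (F x $ i $ j) *\<^sub>R axis i (axis j (1 :: real)))"
    by (intro Bochner_Integration.integrable_sum integrable_scaleR_left assms)
  ultimately show ?thesis by simp
qed

lemma bounded_linear_form: "bounded_linear (\<lambda>A :: real ^ 'd ^ 'd::finite. (A *v v) \<bullet> v)"
  by (intro linear_conv_bounded_linear[THEN iffD1] linearI)
    (simp_all add: matrix_vector_mult_add_rdistrib inner_add_left scaleR_matrix_vector_assoc[symmetric])

lemma bounded_linear_entry: "bounded_linear (\<lambda>A :: real ^ 'd ^ 'd::finite. A $ i $ j)"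
  by (rule bounded_linear_compose[OF bounded_linear_vec_nth bounded_linear_vec_nth])

context random_env
begin

text \<open>Sublinearity lets \<open>L\<close> be a fixed fraction of \<open>N\<close>: \<kappa> and
  \<open>p\<close> are chosen for the main term and the boundary layer, and then \<open>N\<close>
  large for the gradient of the cutoff, one third of \<open>e\<close> each.\<close>

lemma cell_energy_limit:
  assumes sub: "\<And>\<epsilon>. \<epsilon> > 0 \<Longrightarrow> \<forall>\<^sub>F N in sequentially. cmean N v \<le> \<epsilon> * (real N)\<^sup>2" and e: "e > 0"
  shows "\<forall>\<^sub>F N in sequentially. \<exists>L. cell_energy N L v \<le> dn N v + e"
proof -
  define K where "K = 2 * c * (v \<bullet> v)"
  define D where "D = real CARD('d)"
  have K: "K \<ge> 0" using c by (simp add: K_def)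
  have D: "D > 0" by (simp add: D_def)
  define \<kappa> where "\<kappa> = min 1 (e / (3 * (K + 1)))"
  have \<kappa>: "0 < \<kappa>" "\<kappa> \<le> 1" using e K by (auto simp: \<kappa>_def)
  have \<kappa>K: "\<kappa> * K \<le> e / 3"
  proof -
    have "\<kappa> * K \<le> e / (3 * (K + 1)) * (K + 1)" using e K \<kappa> by (intro mult_mono) (auto simp: \<kappa>_def)
    moreover have "e / (3 * r) * r = e / 3" if "r > 0" for r :: real using that by simp
    ultimately show ?thesis using K by (metis add_nonneg_pos zero_less_one)
  qed
  obtain p :: nat where p: "real p > max 1 (6 * K * D / e)" using reals_Archimedean2 by blast
  have p0: "p > 0" "real p \<ge> 1" using p by auto
  have pK: "2 * (K * (D / real p)) \<le> e / 3" using p e by (simp add: field_simps)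
  define W where "W = (1 + 1 / \<kappa>) * (2 * c * D) * (4 * (real p)\<^sup>2)"
  have W: "W > 0" using \<kappa> c D p0 by (auto simp: W_def intro!: mult_pos_pos add_pos_pos)
  have "e / (3 * W) > 0" using e W by simp
  from sub[OF this] have "\<forall>\<^sub>F N in sequentially. cmean N v \<le> e / (3 * W) * (real N)\<^sup>2" .
  then show ?thesis using eventually_ge_at_top[of "2 * p"]
  proof eventually_elim
    case (elim N)
    define L where "L = N div p"
    have N: "N > 0" using elim p0 by simp
    have L: "0 < L" "L \<le> N" using elim p0 by (auto simp: L_def div_greater_zero_iff)
    have LN: "real L / real N \<le> 1 / real p"
    proof -
      have "real L \<le> real N / real p" by (simp add: L_def of_nat_div_le_of_nat)
      then show ?thesis using N p0 by (simp add: field_simps)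
    qed
    have NL: "(real N)\<^sup>2 / (real L)\<^sup>2 \<le> 4 * (real p)\<^sup>2"
    proof -
      have "real N \<le> 2 * real p * real L"
        using nat_div_ge[OF p0(1) elim(2)] p0 by (simp add: L_def pos_divide_le_eq mult_ac)
      then have "(real N)\<^sup>2 \<le> (2 * real p * real L)\<^sup>2" by (intro power_mono) auto
      then show ?thesis using L by (simp add: pos_divide_le_eq power_mult_distrib)
    qed
    have "cell_energy N L v \<le> (1 + \<kappa>) * (dn N v + K * (D * real L / real N)) + (1 + 1 / \<kappa>) * (2 * c * D * cmean N v / (real L)\<^sup>2)"
      unfolding K_def D_def by (rule cell_energy_le[OF N L \<kappa>(1)])
    also have "(1 + \<kappa>) * (dn N v + K * (D * real L / real N)) \<le> dn N v + e / 3 + e / 3"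
    proof -
      have "\<kappa> * dn N v \<le> \<kappa> * K" using dn_bounds(2)[OF N, of v] \<kappa> unfolding K_def by (intro mult_left_mono) auto
      moreover have "(1 + \<kappa>) * (K * (D * real L / real N)) \<le> 2 * (K * (D / real p))"
        using \<kappa> K D LN mult_left_mono[OF LN, of D] by (intro mult_mono mult_left_mono) auto
      ultimately have 1: "\<kappa> * dn N v \<le> e / 3" "(1 + \<kappa>) * (K * (D * real L / real N)) \<le> e / 3"
        using \<kappa>K pK by linarith+
      have "(1 + a) * (r + x) = r + a * r + (1 + a) * x" for a r x :: real by (simp add: algebra_simps)
      then show ?thesis using 1 by (metis add_mono add.assoc order_refl)
    qed
    also have "(1 + 1 / \<kappa>) * (2 * c * D * cmean N v / (real L)\<^sup>2) \<le> e / 3"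
    proof -
      have "(1 + 1 / \<kappa>) * (2 * c * D * cmean N v / (real L)\<^sup>2) = (1 + 1 / \<kappa>) * (2 * c * D) * (cmean N v / (real L)\<^sup>2)" by simp
      also have "\<dots> \<le> (1 + 1 / \<kappa>) * (2 * c * D) * (e / (3 * W) * (real N)\<^sup>2 / (real L)\<^sup>2)"
        using \<kappa> c D elim(1) by (intro mult_left_mono divide_right_mono) auto
      also have "\<dots> = (1 + 1 / \<kappa>) * (2 * c * D) * (e / (3 * W)) * ((real N)\<^sup>2 / (real L)\<^sup>2)" by simp
      also have "\<dots> \<le> (1 + 1 / \<kappa>) * (2 * c * D) * (e / (3 * W)) * (4 * (real p)\<^sup>2)"
        using \<kappa> c D e W by (intro mult_left_mono NL) auto
      also have "\<dots> = W * (e / (3 * W))" by (simp add: W_def)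
      also have "\<dots> = e / 3" using W by simp
      finally show ?thesis .
    qed
    finally show ?case by (intro exI[of _ L]) simp
  qed
qed

lemma bn_dn_limit:
  assumes sub: "\<And>\<epsilon>. \<epsilon> > 0 \<Longrightarrow> \<forall>\<^sub>F N in sequentially. cmean N v \<le> \<epsilon> * (real N)\<^sup>2"
  obtains \<Lambda> where "(\<lambda>N. dn N v) \<longlonglongrightarrow> \<Lambda>" "(\<lambda>n. l * bn n v / real n) \<longlonglongrightarrow> \<Lambda>"
proof (rule common_limit[of "\<lambda>N. dn N v" "\<lambda>n. l * bn n v / real n"])
  fix e :: real assume e: "e > 0"
  define K where "K = 2 * c * (v \<bullet> v)"
  have K: "K \<ge> 0" using c by (simp add: K_def)
  \<comment> \<open>As \<open>K\<close> bounds \<open>dn N v\<close>, this \<epsilon> costs at most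
    e / 4; the cell energy costs e / 2 and the term of order 1 / n the remaining e / 4.\<close>
  define \<epsilon> where "\<epsilon> = e / (4 * (K + e))"
  have \<epsilon>: "\<epsilon> > 0" using e K by (simp add: \<epsilon>_def)
  have "\<forall>\<^sub>F N in sequentially. \<exists>L. cell_energy N L v \<le> dn N v + e / 2"
    using e by (intro cell_energy_limit sub) auto
  then show "\<forall>\<^sub>F N in sequentially. \<forall>\<^sub>F n in sequentially. l * bn n v / real n \<le> dn N v + e"
    using eventually_gt_at_top[of 0]
  proof eventually_elim
    case (elim N)
    then obtain L where L: "cell_energy N L v \<le> dn N v + e / 2" by blast
    define B where "B = (1 + 1 / \<epsilon>) * (4 * ((real CARD('d) * real N)\<^sup>2 * (4 * c\<^sup>2 * real (card (torus N :: 'd site set)) * (v \<bullet> v))))"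
    have "(\<lambda>n. l * B / real n) \<longlonglongrightarrow> 0" by (rule lim_const_over_n)
    then have "\<forall>\<^sub>F n in sequentially. l * B / real n < e / 4" using e by (intro order_tendstoD(2)) auto
    then show ?case using eventually_gt_at_top[of 0]
    proof eventually_elim
      case n: (elim n)
      have "bn n v \<le> (1 + \<epsilon>) * (real n * (cell_energy N L v / l)) + B"
        unfolding B_def by (rule bn_le_cell_energy[OF elim(2) \<epsilon>])
      then have "l / real n * bn n v \<le> l / real n * ((1 + \<epsilon>) * (real n * (cell_energy N L v / l)) + B)"
        using l_facts(2) by (intro mult_left_mono) auto
      then have "l * bn n v / real n \<le> (1 + \<epsilon>) * cell_energy N L v + l * B / real n"
        using n l_facts(2) by (simp add: distrib_left)
      also have "\<dots> \<le> (1 + \<epsilon>) * (dn N v + e / 2) + e / 4"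
        using \<epsilon> L n by (intro add_mono mult_left_mono) auto
      also have "\<dots> \<le> dn N v + e"
      proof -
        have "\<epsilon> * (dn N v + e / 2) \<le> \<epsilon> * (K + e)"
          using \<epsilon> e dn_bounds(2)[OF elim(2), of v] by (intro mult_left_mono) (auto simp: K_def)
        also have "\<dots> = e / 4"
        proof -
          have "e / (4 * r) * r = e / 4" if "r > 0" for r using that by simp
          from this[of "K + e"] show ?thesis using e K by (simp only: \<epsilon>_def add_nonneg_pos)
        qed
        finally have "\<epsilon> * (dn N v + e / 2) \<le> e / 4" .
        moreover have "(1 + a) * r + q \<le> s" if "a * r \<le> q" "r + 2 * q \<le> s" for a r q s :: real
          using that by (simp add: distrib_right)
        ultimately show ?thesis by simp
      qed
      finally show ?case .
    qed
  qed
qed (auto intro: dn_bounds dn_le_bn that)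

text \<open>Expectation and Poisson series may be exchanged because
  \<open>lazyn_square_bounds\<close> gives a summable majorant uniform in the environment.\<close>

lemma mean_square_mean:
  assumes t: "t \<ge> 0"
  shows "(\<integral>\<xi>. mean_square \<xi> t v \<partial>E) = exp (- (l * t)) * (\<Sum>k. (l * t) ^ k / fact k * bn k v)"
proof -
  interpret P: prob_space E by (rule prob_space_E)
  let ?f = "\<lambda>k \<xi>. (l * t) ^ k / fact k * lazyn l \<xi> k (\<lambda>y. (lin v y)\<^sup>2) 0"
  let ?b = "\<lambda>k. 2 * (norm v)\<^sup>2 * ((l * t * exp 1) ^ k / fact k)"
  have lt: "l * t \<ge> 0" using l_facts(2) t by simp
  have b: "bdd (?f k)" for k
    by (intro bdd_mult bdd_const bdd_lazyn_square elliptic_E component_measurable) auto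
  have le: "norm (?f k \<xi>) \<le> ?b k" if "\<xi> \<in> space E" for k \<xi>
  proof -
    have "norm (?f k \<xi>) \<le> (l * t) ^ k / fact k * (2 * (norm v)\<^sup>2 * exp 1 ^ k)"
      using lazyn_square_bounds[OF elliptic_E[OF that] c l_facts(1), of k v] lt
      by (simp only: real_norm_def abs_mult) (intro mult_mono, auto)
    then show ?thesis by (simp add: power_mult_distrib mult_ac)
  qed
  have sb: "summable ?b" by (intro summable_mult sums_summable[OF poisson_sums])
  have "(\<integral>\<xi>. mean_square \<xi> t v \<partial>E) = (\<integral>\<xi>. exp (- (l * t)) * (\<Sum>k. ?f k \<xi>) \<partial>E)"
    by (intro Bochner_Integration.integral_cong refl)
      (simp add: mean_square_eq_semi[OF elliptic_E c l_facts(1) t] semi_def lin_def)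
  also have "\<dots> = exp (- (l * t)) * (\<integral>\<xi>. (\<Sum>k. ?f k \<xi>) \<partial>E)" by simp
  also have "(\<integral>\<xi>. (\<Sum>k. ?f k \<xi>) \<partial>E) = (\<Sum>k. \<integral>\<xi>. ?f k \<xi> \<partial>E)"
  proof (rule integral_suminf)
    show "integrable E (?f k)" for k by (rule bdd_integrable[OF b])
    show "AE \<xi> in E. summable (\<lambda>k. norm (?f k \<xi>))"
      using le by (intro AE_I2 summable_comparison_test'[OF sb]) auto
    show "summable (\<lambda>k. \<integral>\<xi>. norm (?f k \<xi>) \<partial>E)"
    proof (rule summable_comparison_test'[OF sb])
      fix k
      have "(\<integral>\<xi>. norm (?f k \<xi>) \<partial>E) \<le> ?b k"
        by (rule P.integral_le_const[OF integrable_norm[OF bdd_integrable[OF b]]]) (intro AE_I2 le)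
      moreover have "0 \<le> (\<integral>\<xi>. norm (?f k \<xi>) \<partial>E)" by (intro integral_nonneg_AE) simp
      ultimately show "norm (\<integral>\<xi>. norm (?f k \<xi>) \<partial>E) \<le> ?b k" by (simp only: real_norm_def abs_of_nonneg)
    qed
  qed
  finally show ?thesis by (simp add: bn_def)
qed

lemma mean_square_mean_limit:
  assumes "(\<lambda>n. l * bn n v / real n) \<longlonglongrightarrow> \<Lambda>"
  shows "((\<lambda>t. 1 / t * (\<integral>\<xi>. mean_square \<xi> t v \<partial>E)) \<longlongrightarrow> \<Lambda>) at_top"
proof -
  have "((\<lambda>t. 1 / t * (exp (- (l * t)) * (\<Sum>k. (l * t) ^ k / fact k * bn k v))) \<longlongrightarrow> l * (\<Lambda> / l)) at_top"
    by (intro poisson_average_limit l_facts linear_growth_bound assms)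
  moreover have "\<forall>\<^sub>F t in at_top. 1 / t * (exp (- (l * t)) * (\<Sum>k. (l * t) ^ k / fact k * bn k v)) = 1 / t * (\<integral>\<xi>. mean_square \<xi> t v \<partial>E)"
    using eventually_ge_at_top[of 0] by eventually_elim (simp add: mean_square_mean)
  ultimately show ?thesis using l_facts(2) by (auto elim: Lim_transform_eventually)
qed

lemma eff_diffusion_fin_eq: "N > 0 \<Longrightarrow> \<xi> \<in> space E \<Longrightarrow> eff_diffusion_fin N \<xi> = dmat N l (periodize N \<xi>)"
  unfolding eff_diffusion_fin_def by (rule torus_env.diffusion_matrix_eq[OF torus_env_E])

lemma integrable_eff_diffusion_fin: "N > 0 \<Longrightarrow> integrable E (eff_diffusion_fin N)"
proof (rule integrable_matrix)
  fix i j assume N: "N > 0"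
  have "integrable E (\<lambda>\<xi>. (Fq N l (periodize N \<xi>) (axis i 1 + axis j 1) - Fq N l (periodize N \<xi>) (axis i 1 - axis j 1)) / 4)"
    using bdd_integrable[OF Fq_bdd[OF N]] by simp
  then show "integrable E (\<lambda>\<xi>. eff_diffusion_fin N \<xi> $ i $ j)"
    by (subst Bochner_Integration.integrable_cong[OF refl eff_diffusion_fin_entry[OF N c elliptic_E l]])
qed

text \<open>The forms converge for each \<open>v\<close> separately. That their limit is again the
  form of a symmetric matrix, as the definite description demands, is inherited from the matrices
  \<open>D N\<close>, whose entries converge by polarisation.\<close>

theorem mean_eff_diffusion_limit:
  assumes sub: "\<And>v \<epsilon>. \<epsilon> > 0 \<Longrightarrow> \<forall>\<^sub>F N in sequentially. cmean N v \<le> \<epsilon> * (real N)\<^sup>2"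
  shows "(\<lambda>N. \<integral>\<xi>. eff_diffusion_fin N \<xi> \<partial>E) \<longlonglongrightarrow> eff_diffusion E"
proof -
  define D where "D N = (\<integral>\<xi>. eff_diffusion_fin N \<xi> \<partial>E)" for N
  have "\<exists>\<Lambda>. (\<lambda>N. dn N v) \<longlonglongrightarrow> \<Lambda> \<and> (\<lambda>n. l * bn n v / real n) \<longlonglongrightarrow> \<Lambda>" for v
    using bn_dn_limit[OF sub] by metis
  then obtain \<Lambda> where \<Lambda>: "\<And>v. (\<lambda>N. dn N v) \<longlonglongrightarrow> \<Lambda> v" "\<And>v. (\<lambda>n. l * bn n v / real n) \<longlonglongrightarrow> \<Lambda> v" by metis
  have form: "(D N *v v) \<bullet> v = dn N v" if N: "N > 0" for N v
  proof -
    have "(D N *v v) \<bullet> v = (\<integral>\<xi>. (eff_diffusion_fin N \<xi> *v v) \<bullet> v \<partial>E)"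
      unfolding D_def by (rule integral_bounded_linear[OF bounded_linear_form integrable_eff_diffusion_fin[OF N], symmetric])
    also have "\<dots> = dn N v"
      unfolding dn_def
      by (intro Bochner_Integration.integral_cong refl)
        (simp add: eff_diffusion_fin_eq[OF N] torus_env.dmat_form[OF torus_env_E[OF N]])
    finally show ?thesis .
  qed
  have sym: "transpose (D N) = D N" if N: "N > 0" for N
  proof -
    have e: "D N $ i $ j = (\<integral>\<xi>. eff_diffusion_fin N \<xi> $ i $ j \<partial>E)" for i j
      unfolding D_def by (rule integral_bounded_linear[OF bounded_linear_entry integrable_eff_diffusion_fin[OF N], symmetric])
    have "dmat N l \<xi> $ j $ i = dmat N l \<xi> $ i $ j" for \<xi> :: "'d env" and i j
      by (simp add: dmat_def mult.commute)
    then have "eff_diffusion_fin N \<xi> $ j $ i = eff_diffusion_fin N \<xi> $ i $ j" if "\<xi> \<in> space E" for \<xi> i j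
      by (simp only: eff_diffusion_fin_eq[OF N that])
    then have "D N $ j $ i = D N $ i $ j" for i j
      unfolding e by (intro Bochner_Integration.integral_cong refl)
    then show ?thesis by (simp add: transpose_def vec_eq_iff)
  qed
  define A where "A = (\<chi> i j. (\<Lambda> (axis i 1 + axis j 1) - \<Lambda> (axis i 1 - axis j 1)) / 4)"
  have lim: "D \<longlonglongrightarrow> A"
  proof (intro vec_tendstoI)
    fix i j
    have "(\<lambda>N. (dn N (axis i 1 + axis j 1) - dn N (axis i 1 - axis j 1)) / 4) \<longlonglongrightarrow> A $ i $ j"
      unfolding A_def by (simp, intro tendsto_intros \<Lambda>) simp
    moreover have "\<forall>\<^sub>F N in sequentially. (dn N (axis i 1 + axis j 1) - dn N (axis i 1 - axis j 1)) / 4 = D N $ i $ j"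
      using eventually_gt_at_top[of 0] by eventually_elim (simp add: symmetric_matrix_entry[OF sym] form)
    ultimately show "(\<lambda>N. D N $ i $ j) \<longlonglongrightarrow> A $ i $ j" by (rule Lim_transform_eventually)
  qed
  have "eff_diffusion E = A"
    unfolding eff_diffusion_def
  proof (rule diffusion_matrix_eqI)
    have "D N $ j $ i = D N $ i $ j" if "N > 0" for N i j
      using sym[OF that] by (metis transpose_def vec_lambda_beta)
    then have ev: "\<forall>\<^sub>F N in sequentially. D N $ j $ i = D N $ i $ j" for i j
      by (intro eventually_mono[OF eventually_gt_at_top[of 0]])
    have "A $ j $ i = A $ i $ j" for i j
      using Lim_transform_eventually[OF bounded_linear.tendsto[OF bounded_linear_entry lim] ev]
        bounded_linear.tendsto[OF bounded_linear_entry lim] by (rule LIMSEQ_unique)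
    then show "transpose A = A" by (simp add: transpose_def vec_eq_iff)
    fix v :: "real ^ 'd"
    have "\<forall>\<^sub>F N in sequentially. (D N *v v) \<bullet> v = dn N v"
      using eventually_gt_at_top[of 0] by eventually_elim (rule form)
    from Lim_transform_eventually[OF bounded_linear.tendsto[OF bounded_linear_form lim] this]
    have "(A *v v) \<bullet> v = \<Lambda> v" using \<Lambda>(1) LIMSEQ_unique by blast
    then show "((\<lambda>t. 1 / t * (\<integral>\<xi>. mean_square \<xi> t v \<partial>E)) \<longlongrightarrow> (A *v v) \<bullet> v) at_top"
      using mean_square_mean_limit[OF \<Lambda>(2)] by simp
  qed
  with lim show ?thesis by (simp add: D_def[abs_def])
qed

end

theorem theorem1p1:
  fixes c :: real
  assumes "c \<ge> 1"
  shows "\<exists>\<nu>::real. \<nu> > 0 \<and>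
    (\<forall>\<mu>0 :: real measure.
       prob_space \<mu>0 \<and> sets \<mu>0 = sets (restrict_space borel {1/c..c}) \<longrightarrow>
       (let \<mu> = env_measure \<mu>0 :: ('d::finite) env measure in
         (\<forall>i j :: 'd. \<forall>\<^sub>F N in sequentially.
            measure \<mu> {\<xi> \<in> space \<mu>.
                \<bar>eff_diffusion_fin N \<xi> $ i $ j - (\<integral>\<xi>'. eff_diffusion_fin N \<xi>' $ i $ j \<partial>\<mu>)\<bar> > real N powr (- \<nu>)}
              < exp (- (real N powr \<nu>))) \<and>
         ((\<lambda>N. \<integral>\<xi>. eff_diffusion_fin N \<xi> \<partial>\<mu>) \<longlonglongrightarrow> eff_diffusion \<mu>)))"
proof -
  obtain \<alpha> C where \<alpha>: "0 < \<alpha>" and C: "0 < C"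
    and decay: "\<And>N l (\<xi> :: 'd env) v i x. torus_env N c l \<xi> \<Longrightarrow>
      (wfield l \<xi> v i x)\<^sup>2 \<le> C * real N powr (- \<alpha>) * (real (card (torus N :: 'd site set)) * (v \<bullet> v))"
    using wfield_decay[OF assms, where 'd = 'd] by metis
  \<comment> \<open>Any value below \<alpha> / 4 would serve: the power \<alpha> / 2 - \<nu> in the
    tail bound has to exceed \<nu>. Neither \<alpha> nor \<open>C\<close> depends on the law of the
    conductances.\<close>
  define \<nu> where "\<nu> = \<alpha> / 8"
  have \<nu>: "\<nu> > 0" "\<alpha> = 8 * \<nu>" using \<alpha> by (auto simp: \<nu>_def)
  define \<sigma> where "\<sigma> = 1 / (2 * (1 + 8 * c * (1 + c\<^sup>2) * C) * (1 + 8 * c ^ 3 * (1 + c\<^sup>2)))"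
  have \<sigma>: "\<sigma> > 0" using assms C unfolding \<sigma>_def by (intro divide_pos_pos mult_pos_pos add_pos_nonneg mult_nonneg_nonneg) auto
  show ?thesis
  proof (rule exI[of _ \<nu>], intro conjI allI impI)
    fix \<mu>0 :: "real measure"
    assume \<mu>0: "prob_space \<mu>0 \<and> sets \<mu>0 = sets (restrict_space borel {1/c..c})"
    interpret random_env \<mu>0 c "4 * real CARD('d) * c" "TYPE('d)"
      using \<mu>0 assms by (simp add: random_env_def random_env_axioms_def iid_def)
    have "\<forall>\<^sub>F N in sequentially. measure E {\<xi> \<in> space E.
        \<bar>eff_diffusion_fin N \<xi> $ i $ j - (\<integral>\<xi>'. eff_diffusion_fin N \<xi>' $ i $ j \<partial>E)\<bar> > real N powr (- \<nu>)}
        < exp (- (real N powr \<nu>))" for i j :: 'd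
      using tail_beats_target[OF \<sigma> \<nu>(1)] eventually_gt_at_top[of 0]
    proof eventually_elim
      case (elim N)
      have "measure E {\<xi> \<in> space E. \<bar>eff_diffusion_fin N \<xi> $ i $ j - (\<integral>\<xi>'. eff_diffusion_fin N \<xi>' $ i $ j \<partial>E)\<bar> > real N powr (- \<nu>)}
        \<le> 4 * exp (1 - 2 * \<sigma> * real N powr (\<alpha> / 2) * real N powr (- \<nu>))"
        by (rule entry_tail[OF elim(2) C], erule decay, rule \<sigma>, simp only: \<sigma>_def, rule \<alpha>)
      then show ?case using elim(1) unfolding \<nu>(2) by linarith
    qed
    moreover have "(\<lambda>N. \<integral>\<xi>. eff_diffusion_fin N \<xi> \<partial>E) \<longlonglongrightarrow> eff_diffusion E"
      by (rule mean_eff_diffusion_limit, rule corrector_sublinear[OF \<alpha> C], erule decay)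
    ultimately show "let \<mu> = env_measure \<mu>0 :: 'd env measure in
         (\<forall>i j :: 'd. \<forall>\<^sub>F N in sequentially.
            measure \<mu> {\<xi> \<in> space \<mu>.
                \<bar>eff_diffusion_fin N \<xi> $ i $ j - (\<integral>\<xi>'. eff_diffusion_fin N \<xi>' $ i $ j \<partial>\<mu>)\<bar> > real N powr (- \<nu>)}
              < exp (- (real N powr \<nu>))) \<and>
         ((\<lambda>N. \<integral>\<xi>. eff_diffusion_fin N \<xi> \<partial>\<mu>) \<longlonglongrightarrow> eff_diffusion \<mu>)"
      unfolding Let_def env_measure_def by (intro conjI allI)
  qed (rule \<nu>(1))
qed

end
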